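(* Let $\Lambda$ be a finite-dimensional basic algebra over a field $k$ with Jacobson radical $J$ satisfying $J^n=0$. Let $e_1,\ldots,e_t$ be a complete set of primitive idempotents. For each $i,j$, set $D_i=e_i\Lambda e_i/e_iJe_i$, $D_j=e_j\Lambda e_j/e_jJe_j$, $V_{ij}=e_jJ^{n-1}e_i$, $r_{ij}=\dim_{D_i}V_{ij}$. Assume that $D_j\cong k$ whenever $V_{ij}\neq 0$, and that for every $i$ such that $J^{n-1}P_i\neq 0$ (where $P_i=\Lambda e_i$) there exists at least one $j$ with $r_{ij}\ge 3$. Then the labelled collection of terminal ambiguity fibres $$\left\{\mathcal F^{<n,\mathrm{top},1}_{ij}: V_{ij}\neq 0\right\}_{i,j}$$ (each regarded with its projective geometry) determines the terminal species $$\mathsf{Sp}^{\mathrm{top}}(\Lambda)=\bigl(D_i,{}_{D_j}V_{ij}{}_{D_i}\bigr)_{i,j}$$ up to the standard opposite-division-algebra ambiguity for each recovered residue division algebra $D_i$.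
   Context: Modules are finite-dimensional left $\Lambda$-modules, $n\ge 1$, $J^0=\Lambda$; the $e_h$ are orthogonal, and basic means the modules $\Lambda e_h$ are pairwise non-isomorphic. Each $D_h$ is a division algebra and $V_{ij}$ is a $(D_j,D_i)$-bimodule by multiplication; $r_{ij}$ is its dimension as a right $D_i$-module. Rank-one fibre: for $V_{ij}\ne0$ and a left $D_j$-submodule $U\subseteq V_{ij}$ with $\dim_{D_j}(V_{ij}/U)=1$, put $M_U=P_i/(W_j\oplus U)$ with $W_j=\bigoplus_{h\ne j}e_hJ^{n-1}P_i$; $\mathcal F^{<n,\mathrm{top},1}_{ij}$ is the set of isomorphism classes of the modules $M_U$. Projective geometry on the fibre when $D_j\cong k$: $[\lambda]\mapsto [M_{\ker\lambda}]$ identifies the fibre with $\mathbb P_k(V_{ij}^* )/D_i^\times$, where $V_{ij}^*=\operatorname{Hom}_k(V_{ij},k)$ and $(a\cdot\lambda)(v)=\lambda(va^{-1})$. This is identified with $\mathbb P_{D_i}(\operatorname{Hom}_{D_i}(V_{ij},D_i^* ))$ by sending $\lambda$ to the map $v\mapsto(d\mapsto\lambda(vd))$, where $D_i^*=\operatorname{Hom}_k(D_i,k)$ has bimodule structure $(a\cdot\eta)(x)=\eta(xa)$, $(\eta\cdot a)(x)=\eta(ax)$, $\operatorname{Hom}_{D_i}$ denotes right $D_i$-linear maps, and $\mathbb P_D(W)$ is the set of one-dimensional left $D$-submodules of $W$. The projective linear subspaces of $\mathbb P_D(W)$ are the subsets $\mathbb P_D(U)$, $0\neq U\subseteq W$ a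 submodule; an isomorphism of projective geometries is a bijection preserving projective linear subspaces. "Determines" means that the data can be recovered up to isomorphism from the labelled family (labelled by the pairs $(i,j)$ of the fixed vertex set) of projective geometries taken up to isomorphism. The "standard opposite-division-algebra ambiguity" means that a division algebra is recovered from a projective geometry only up to replacing it by its opposite, according to whether projective spaces are built from left or right modules.
   Formalization: Full isomorphism of species fails (D_1=Q(√x) or Q(x^{1/3}) over k=Q(x)). Here D_i is recovered as a ring, k-linearly if k-isomorphic; V_ij right-semilinearly, with left D_j-action only if that map is k-linear; only for i a source or target of some nonzero V_ij. *)

theory Defs
  imports "HOL-Algebra.Module" "HOL-Algebra.QuotRing" "HOL-Algebra.Ideal_Product"
begin

section \<open>Modules over possibly noncommutative rings\<close>

text \<open>
  The record type \<open>module\<close> of HOL-Algebra is used for left modules over arbitrary rings and for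
  associative algebras; the locales \<open>module\<close> and \<open>algebra\<close> themselves require commutative rings.
  The fields \<open>mult\<close> and \<open>one\<close> carry no meaning when the record stands for a module only.
  A right module over \<open>R\<close> is a left module over \<open>opp R\<close>.
\<close>

definition opp :: "('r, 'z) ring_scheme \<Rightarrow> ('r, 'z) ring_scheme" where
  "opp R = R\<lparr>mult := \<lambda>x y. y \<otimes>\<^bsub>R\<^esub> x\<rparr>"

definition left_mod :: "('r, 'z) ring_scheme \<Rightarrow> 'r set \<Rightarrow> ('r, 'r) module" where
  "left_mod R N = \<lparr>carrier = N, mult = mult R, one = \<one>\<^bsub>R\<^esub>, zero = \<zero>\<^bsub>R\<^esub>, add = add R,
     smult = mult R\<rparr>"

definition quot_module :: "('r, 'm) module \<Rightarrow> 'm set \<Rightarrow> ('r, 'm set) module" where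
  "quot_module M N = ring.extend (M Quot N) (module.fields (\<lambda>r X. \<Union>x\<in>X. N +>\<^bsub>M\<^esub> (r \<odot>\<^bsub>M\<^esub> x)))"

definition semilinear_iso ::
  "('r, 'z) ring_scheme \<Rightarrow> ('r \<Rightarrow> 's) \<Rightarrow> ('r, 'm) module \<Rightarrow> ('s, 'l) module \<Rightarrow> ('m \<Rightarrow> 'l) \<Rightarrow> bool" where
  "semilinear_iso R \<phi> M N f \<longleftrightarrow>
     bij_betw f (carrier M) (carrier N) \<and>
     (\<forall>x\<in>carrier M. \<forall>y\<in>carrier M. f (x \<oplus>\<^bsub>M\<^esub> y) = f x \<oplus>\<^bsub>N\<^esub> f y) \<and>
     (\<forall>r\<in>carrier R. \<forall>x\<in>carrier M. f (r \<odot>\<^bsub>M\<^esub> x) = \<phi> r \<odot>\<^bsub>N\<^esub> f x)"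

definition mod_isomorphic ::
  "('r, 'z) ring_scheme \<Rightarrow> ('r, 'm) module \<Rightarrow> ('r, 'l) module \<Rightarrow> bool" where
  "mod_isomorphic R M N \<longleftrightarrow> (\<exists>f. semilinear_iso R (\<lambda>r. r) M N f)"

definition hom_mod ::
  "('r, 'z) ring_scheme \<Rightarrow> ('r, 'm) module \<Rightarrow> ('r, 'l) module \<Rightarrow> ('m \<Rightarrow> 'l) set" where
  "hom_mod R M N = {f \<in> carrier M \<rightarrow>\<^sub>E carrier N.
     (\<forall>x\<in>carrier M. \<forall>y\<in>carrier M. f (x \<oplus>\<^bsub>M\<^esub> y) = f x \<oplus>\<^bsub>N\<^esub> f y) \<and>
     (\<forall>r\<in>carrier R. \<forall>x\<in>carrier M. f (r \<odot>\<^bsub>M\<^esub> x) = r \<odot>\<^bsub>N\<^esub> f x)}"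

definition is_basis :: "('r, 'z) ring_scheme \<Rightarrow> ('r, 'm) module \<Rightarrow> 'm set \<Rightarrow> bool" where
  "is_basis R M B \<longleftrightarrow> finite B \<and> B \<subseteq> carrier M \<and>
     (\<forall>x\<in>carrier M. \<exists>!a. a \<in> B \<rightarrow>\<^sub>E carrier R \<and> x = (\<Oplus>\<^bsub>M\<^esub>b\<in>B. a b \<odot>\<^bsub>M\<^esub> b))"

text \<open>Only used for finitely generated modules over division rings.\<close>
definition mod_dim :: "('r, 'z) ring_scheme \<Rightarrow> ('r, 'm) module \<Rightarrow> nat" where
  "mod_dim R M = (THE d. \<exists>B. is_basis R M B \<and> card B = d)"

text \<open>\<open>\<P>\<^sub>D(W)\<close>, for \<open>W\<close> a left \<open>D\<close>-module:\<close>
definition proj_space :: "('r, 'z) ring_scheme \<Rightarrow> ('r, 'm) module \<Rightarrow> 'm set set" where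
  "proj_space D W = {L. submodule L D W \<and> mod_dim D (W\<lparr>carrier := L\<rparr>) = 1}"


section \<open>Basic finite-dimensional algebras\<close>

definition k_linear :: "'k ring \<Rightarrow> ('k, 'm) module \<Rightarrow> ('k, 'l) module \<Rightarrow> ('m \<Rightarrow> 'l) \<Rightarrow> bool" where
  "k_linear K M N \<phi> \<longleftrightarrow> (\<forall>c\<in>carrier K. \<forall>x\<in>carrier M. \<phi> (c \<odot>\<^bsub>M\<^esub> x) = c \<odot>\<^bsub>N\<^esub> \<phi> x)"

definition alg_isomorphic :: "'k ring \<Rightarrow> ('k, 'm) module \<Rightarrow> ('k, 'l) module \<Rightarrow> bool" where
  "alg_isomorphic K M N \<longleftrightarrow> (\<exists>\<phi>\<in>ring_iso M N. k_linear K M N \<phi>)"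

definition left_ideal :: "('k, 'a) module \<Rightarrow> 'a set \<Rightarrow> bool" where
  "left_ideal A L \<longleftrightarrow> submodule L A (left_mod A (carrier A))"

definition maximal_left_ideal :: "('k, 'a) module \<Rightarrow> 'a set \<Rightarrow> bool" where
  "maximal_left_ideal A L \<longleftrightarrow> left_ideal A L \<and> L \<noteq> carrier A \<and>
     (\<forall>L'. left_ideal A L' \<and> L \<subseteq> L' \<longrightarrow> L' = L \<or> L' = carrier A)"

definition jacobson_radical :: "('k, 'a) module \<Rightarrow> 'a set" where
  "jacobson_radical A = {x \<in> carrier A. \<forall>L. maximal_left_ideal A L \<longrightarrow> x \<in> L}"

primrec rad_pow :: "('k, 'a) module \<Rightarrow> nat \<Rightarrow> 'a set" where
  "rad_pow A 0 = carrier A"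
| "rad_pow A (Suc m) = ideal_prod A (jacobson_radical A) (rad_pow A m)"

text \<open>\<open>P\<^sub>i = \<Lambda>e\<^sub>i\<close>\<close>
definition proj_ideal :: "('k, 'a) module \<Rightarrow> (nat \<Rightarrow> 'a) \<Rightarrow> nat \<Rightarrow> 'a set" where
  "proj_ideal A e i = {x \<otimes>\<^bsub>A\<^esub> e i |x. x \<in> carrier A}"

definition primitive_idempotent :: "('k, 'a) module \<Rightarrow> 'a \<Rightarrow> bool" where
  "primitive_idempotent A x \<longleftrightarrow> x \<in> carrier A \<and> x \<noteq> \<zero>\<^bsub>A\<^esub> \<and> x \<otimes>\<^bsub>A\<^esub> x = x \<and>
     \<not> (\<exists>y\<in>carrier A. \<exists>z\<in>carrier A. y \<noteq> \<zero>\<^bsub>A\<^esub> \<and> z \<noteq> \<zero>\<^bsub>A\<^esub> \<and> y \<otimes>\<^bsub>A\<^esub> y = y \<and> z \<otimes>\<^bsub>A\<^esub> z = z \<and>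
          y \<otimes>\<^bsub>A\<^esub> z = \<zero>\<^bsub>A\<^esub> \<and> z \<otimes>\<^bsub>A\<^esub> y = \<zero>\<^bsub>A\<^esub> \<and> x = y \<oplus>\<^bsub>A\<^esub> z)"

locale basic_fd_algebra =
  fixes K :: "'k ring" and A :: "('k, 'a) module" and n t :: nat and e :: "nat \<Rightarrow> 'a"
  assumes field: "field K"
    and ring: "ring A"
    and vector_space: "module K A"
    and smult_mult: "\<And>c x y. c \<in> carrier K \<Longrightarrow> x \<in> carrier A \<Longrightarrow> y \<in> carrier A \<Longrightarrow>
          (c \<odot>\<^bsub>A\<^esub> x) \<otimes>\<^bsub>A\<^esub> y = c \<odot>\<^bsub>A\<^esub> (x \<otimes>\<^bsub>A\<^esub> y) \<and> x \<otimes>\<^bsub>A\<^esub> (c \<odot>\<^bsub>A\<^esub> y) = c \<odot>\<^bsub>A\<^esub> (x \<otimes>\<^bsub>A\<^esub> y)"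
    and finite_dimensional: "\<exists>B. is_basis K A B"
    and n_pos: "n \<ge> 1"
    and rad_nilpotent: "rad_pow A n = {\<zero>\<^bsub>A\<^esub>}"
    and primitive: "\<And>i. i \<in> {1..t} \<Longrightarrow> primitive_idempotent A (e i)"
    and orthogonal: "\<And>i j. i \<in> {1..t} \<Longrightarrow> j \<in> {1..t} \<Longrightarrow> i \<noteq> j \<Longrightarrow> e i \<otimes>\<^bsub>A\<^esub> e j = \<zero>\<^bsub>A\<^esub>"
    and complete: "(\<Oplus>\<^bsub>A\<^esub>i\<in>{1..t}. e i) = \<one>\<^bsub>A\<^esub>"
    and basic: "\<And>i j. i \<in> {1..t} \<Longrightarrow> j \<in> {1..t} \<Longrightarrow> i \<noteq> j \<Longrightarrow>
          \<not> mod_isomorphic A (left_mod A (proj_ideal A e i)) (left_mod A (proj_ideal A e j))"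


section \<open>The terminal species\<close>

text \<open>\<open>D\<^sub>i = e\<^sub>i\<Lambda>e\<^sub>i / e\<^sub>iJe\<^sub>i\<close> with its \<open>k\<close>-algebra structure\<close>
definition residue_alg :: "('k, 'a) module \<Rightarrow> (nat \<Rightarrow> 'a) \<Rightarrow> nat \<Rightarrow> ('k, 'a set) module" where
  "residue_alg A e i =
     quot_module (A\<lparr>carrier := {e i \<otimes>\<^bsub>A\<^esub> x \<otimes>\<^bsub>A\<^esub> e i |x. x \<in> carrier A}, one := e i\<rparr>)
       {e i \<otimes>\<^bsub>A\<^esub> x \<otimes>\<^bsub>A\<^esub> e i |x. x \<in> jacobson_radical A}"

text \<open>\<open>J\<^bsup>n-1\<^esup>P\<^sub>i\<close>\<close>
definition last_layer :: "('k, 'a) module \<Rightarrow> nat \<Rightarrow> (nat \<Rightarrow> 'a) \<Rightarrow> nat \<Rightarrow> 'a set" where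
  "last_layer A n e i = ideal_prod A (rad_pow A (n - 1)) (proj_ideal A e i)"

text \<open>\<open>V\<^sub>i\<^sub>j = e\<^sub>jJ\<^bsup>n-1\<^esup>e\<^sub>i\<close>\<close>
definition V_space :: "('k, 'a) module \<Rightarrow> nat \<Rightarrow> (nat \<Rightarrow> 'a) \<Rightarrow> nat \<Rightarrow> nat \<Rightarrow> 'a set" where
  "V_space A n e i j = {e j \<otimes>\<^bsub>A\<^esub> x \<otimes>\<^bsub>A\<^esub> e i |x. x \<in> rad_pow A (n - 1)}"

text \<open>
  A residue class acts on \<open>V\<^sub>i\<^sub>j\<close> through any representative, since \<open>J\<^sup>n = 0\<close>.  The record
  \<open>V_left\<close> is the left \<open>D\<^sub>j\<close>-module and \<open>V_right\<close> the right \<open>D\<^sub>i\<close>-module \<open>V\<^sub>i\<^sub>j\<close>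
  (a left module over \<open>opp D\<^sub>i\<close>).
\<close>
definition V_left ::
  "('k, 'a) module \<Rightarrow> nat \<Rightarrow> (nat \<Rightarrow> 'a) \<Rightarrow> nat \<Rightarrow> nat \<Rightarrow> ('a set, 'a) module" where
  "V_left A n e i j = \<lparr>carrier = V_space A n e i j, mult = mult A, one = \<one>\<^bsub>A\<^esub>, zero = \<zero>\<^bsub>A\<^esub>, add = add A,
     smult = \<lambda>X v. (SOME x. x \<in> X) \<otimes>\<^bsub>A\<^esub> v\<rparr>"

definition V_right ::
  "('k, 'a) module \<Rightarrow> nat \<Rightarrow> (nat \<Rightarrow> 'a) \<Rightarrow> nat \<Rightarrow> nat \<Rightarrow> ('a set, 'a) module" where
  "V_right A n e i j = \<lparr>carrier = V_space A n e i j, mult = mult A, one = \<one>\<^bsub>A\<^esub>, zero = \<zero>\<^bsub>A\<^esub>, add = add A,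
     smult = \<lambda>X v. v \<otimes>\<^bsub>A\<^esub> (SOME x. x \<in> X)\<rparr>"

definition right_rank :: "('k, 'a) module \<Rightarrow> nat \<Rightarrow> (nat \<Rightarrow> 'a) \<Rightarrow> nat \<Rightarrow> nat \<Rightarrow> nat" where
  "right_rank A n e i j = mod_dim (opp (residue_alg A e i)) (V_right A n e i j)"


section \<open>The rank-one fibres\<close>

definition W_compl :: "('k, 'a) module \<Rightarrow> nat \<Rightarrow> nat \<Rightarrow> (nat \<Rightarrow> 'a) \<Rightarrow> nat \<Rightarrow> nat \<Rightarrow> 'a set" where
  "W_compl A n t e i j = {(\<Oplus>\<^bsub>A\<^esub>h\<in>{1..t} - {j}. w h) |w.
     \<forall>h\<in>{1..t} - {j}. w h \<in> {e h \<otimes>\<^bsub>A\<^esub> x |x. x \<in> last_layer A n e i}}"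

text \<open>\<open>M\<^sub>U = P\<^sub>i / (W\<^sub>j \<oplus> U)\<close>\<close>
definition fibre_module ::
  "('k, 'a) module \<Rightarrow> nat \<Rightarrow> nat \<Rightarrow> (nat \<Rightarrow> 'a) \<Rightarrow> nat \<Rightarrow> nat \<Rightarrow> 'a set \<Rightarrow> ('a, 'a set) module" where
  "fibre_module A n t e i j U =
     quot_module (left_mod A (proj_ideal A e i)) (W_compl A n t e i j <+>\<^bsub>A\<^esub> U)"

definition fibre_modules ::
  "('k, 'a) module \<Rightarrow> nat \<Rightarrow> nat \<Rightarrow> (nat \<Rightarrow> 'a) \<Rightarrow> nat \<Rightarrow> nat \<Rightarrow> ('a, 'a set) module set" where
  "fibre_modules A n t e i j = {fibre_module A n t e i j U |U.
     submodule U (residue_alg A e j) (V_left A n e i j) \<and>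
     mod_dim (residue_alg A e j) (quot_module (V_left A n e i j) U) = 1}"

text \<open>Isomorphism classes are taken inside the set of the modules \<open>M\<^sub>U\<close>.\<close>
definition fibre_class ::
  "('k, 'a) module \<Rightarrow> nat \<Rightarrow> nat \<Rightarrow> (nat \<Rightarrow> 'a) \<Rightarrow> nat \<Rightarrow> nat \<Rightarrow>
     ('a, 'a set) module \<Rightarrow> ('a, 'a set) module set" where
  "fibre_class A n t e i j M = {N \<in> fibre_modules A n t e i j. mod_isomorphic A M N}"

definition fibre ::
  "('k, 'a) module \<Rightarrow> nat \<Rightarrow> nat \<Rightarrow> (nat \<Rightarrow> 'a) \<Rightarrow> nat \<Rightarrow> nat \<Rightarrow> ('a, 'a set) module set set" where
  "fibre A n t e i j = fibre_class A n t e i j ` fibre_modules A n t e i j"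


section \<open>The projective geometry on a fibre\<close>

definition self_alg :: "'k ring \<Rightarrow> ('k, 'k) module" where
  "self_alg K = left_mod K (carrier K)"

definition V_dual ::
  "'k ring \<Rightarrow> ('k, 'a) module \<Rightarrow> nat \<Rightarrow> (nat \<Rightarrow> 'a) \<Rightarrow> nat \<Rightarrow> nat \<Rightarrow> ('a \<Rightarrow> 'k) set" where
  "V_dual K A n e i j = hom_mod K (A\<lparr>carrier := V_space A n e i j\<rparr>) (self_alg K)"

text \<open>\<open>D\<^sub>i\<^sup>*\<close> as a right \<open>D\<^sub>i\<close>-module, \<open>(\<eta>\<cdot>a)(x) = \<eta>(ax)\<close>\<close>
definition D_dual ::
  "'k ring \<Rightarrow> ('k, 'a) module \<Rightarrow> (nat \<Rightarrow> 'a) \<Rightarrow> nat \<Rightarrow> ('a set, 'a set \<Rightarrow> 'k) module" where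
  "D_dual K A e i = (let D = residue_alg A e i in
     \<lparr>carrier = hom_mod K D (self_alg K), mult = undefined, one = undefined,
      zero = (\<lambda>x\<in>carrier D. \<zero>\<^bsub>K\<^esub>),
      add = (\<lambda>\<eta> \<theta>. \<lambda>x\<in>carrier D. \<eta> x \<oplus>\<^bsub>K\<^esub> \<theta> x),
      smult = (\<lambda>a \<eta>. \<lambda>x\<in>carrier D. \<eta> (a \<otimes>\<^bsub>D\<^esub> x))\<rparr>)"

text \<open>
  \<open>Hom(V\<^sub>i\<^sub>j, D\<^sub>i\<^sup>*)\<close> (right \<open>D\<^sub>i\<close>-linear maps) as a left \<open>D\<^sub>i\<close>-module, via the left structure
  \<open>(a\<cdot>\<eta>)(x) = \<eta>(xa)\<close> of \<open>D\<^sub>i\<^sup>*\<close>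
\<close>
definition coord_space ::
  "'k ring \<Rightarrow> ('k, 'a) module \<Rightarrow> nat \<Rightarrow> (nat \<Rightarrow> 'a) \<Rightarrow> nat \<Rightarrow> nat \<Rightarrow>
     ('a set, 'a \<Rightarrow> 'a set \<Rightarrow> 'k) module" where
  "coord_space K A n e i j = (let D = residue_alg A e i in
     \<lparr>carrier = hom_mod (opp D) (V_right A n e i j) (D_dual K A e i),
      mult = undefined, one = undefined,
      zero = (\<lambda>v\<in>V_space A n e i j. \<lambda>x\<in>carrier D. \<zero>\<^bsub>K\<^esub>),
      add = (\<lambda>f g. \<lambda>v\<in>V_space A n e i j. \<lambda>x\<in>carrier D. f v x \<oplus>\<^bsub>K\<^esub> g v x),
      smult = (\<lambda>a f. \<lambda>v\<in>V_space A n e i j. \<lambda>x\<in>carrier D. f v (x \<otimes>\<^bsub>D\<^esub> a))\<rparr>)"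

text \<open>The point of \<open>\<P>(coord_space)\<close> given by \<open>\<lambda>\<close>: the line through \<open>v \<mapsto> (d \<mapsto> \<lambda>(vd))\<close>\<close>
definition coord_point ::
  "'k ring \<Rightarrow> ('k, 'a) module \<Rightarrow> nat \<Rightarrow> (nat \<Rightarrow> 'a) \<Rightarrow> nat \<Rightarrow> nat \<Rightarrow>
     ('a \<Rightarrow> 'k) \<Rightarrow> ('a \<Rightarrow> 'a set \<Rightarrow> 'k) set" where
  "coord_point K A n e i j l = (let D = residue_alg A e i in
     {a \<odot>\<^bsub>coord_space K A n e i j\<^esub>
        (\<lambda>v\<in>V_space A n e i j. \<lambda>d\<in>carrier D. l (d \<odot>\<^bsub>V_right A n e i j\<^esub> v)) |a. a \<in> carrier D})"

text \<open>
  The projective linear subspaces of the fibre: the images of the sets \<open>\<P>(U)\<close>,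
  \<open>0 \<noteq> U \<subseteq> coord_space\<close>, under the identification that matches the class of
  \<open>M\<^bsub>ker \<lambda>\<^esub>\<close> with the point of \<open>\<lambda>\<close>.
\<close>
definition fibre_subspaces ::
  "'k ring \<Rightarrow> ('k, 'a) module \<Rightarrow> nat \<Rightarrow> nat \<Rightarrow> (nat \<Rightarrow> 'a) \<Rightarrow> nat \<Rightarrow> nat \<Rightarrow>
     ('a, 'a set) module set set set" where
  "fibre_subspaces K A n t e i j = (let D = residue_alg A e i; W = coord_space K A n e i j in
     {{fibre_class A n t e i j (fibre_module A n t e i j {v \<in> V_space A n e i j. l v = \<zero>\<^bsub>K\<^esub>}) |l.
         l \<in> V_dual K A n e i j \<and> (\<exists>v\<in>V_space A n e i j. l v \<noteq> \<zero>\<^bsub>K\<^esub>) \<and>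
         coord_point K A n e i j l \<in> proj_space D (W\<lparr>carrier := U\<rparr>)} |U.
       submodule U D W \<and> U \<noteq> {\<zero>\<^bsub>W\<^esub>}})"

text \<open>Isomorphism of geometries given by their point sets and sets of linear subspaces\<close>
definition geometry_isomorphic :: "'p set \<Rightarrow> 'p set set \<Rightarrow> 'q set \<Rightarrow> 'q set set \<Rightarrow> bool" where
  "geometry_isomorphic F \<S> F' \<S>' \<longleftrightarrow> (\<exists>g. bij_betw g F F' \<and> (\<lambda>S. g ` S) ` \<S> = \<S>')"

definition fibre_families_isomorphic ::
  "'k ring \<Rightarrow> nat \<Rightarrow> nat \<Rightarrow> ('k, 'a) module \<Rightarrow> (nat \<Rightarrow> 'a) \<Rightarrow> ('k, 'b) module \<Rightarrow> (nat \<Rightarrow> 'b) \<Rightarrow> bool" where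
  "fibre_families_isomorphic K n t A e A' e' \<longleftrightarrow> (\<forall>i\<in>{1..t}. \<forall>j\<in>{1..t}.
     (V_space A n e i j \<noteq> {\<zero>\<^bsub>A\<^esub>} \<longleftrightarrow> V_space A' n e' i j \<noteq> {\<zero>\<^bsub>A'\<^esub>}) \<and>
     (V_space A n e i j \<noteq> {\<zero>\<^bsub>A\<^esub>} \<longrightarrow>
        geometry_isomorphic (fibre A n t e i j) (fibre_subspaces K A n t e i j)
          (fibre A' n t e' i j) (fibre_subspaces K A' n t e' i j)))"


section \<open>Recovering the terminal species\<close>

text \<open>The vertices that occur as source or target of a nonzero \<open>V\<^sub>i\<^sub>j\<close>; the fibres carry no
  information about any other residue algebra.\<close>
definition recovered :: "('k, 'a) module \<Rightarrow> nat \<Rightarrow> nat \<Rightarrow> (nat \<Rightarrow> 'a) \<Rightarrow> nat set" where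
  "recovered A n t e = {i \<in> {1..t}. \<exists>j\<in>{1..t}. V_space A n e i j \<noteq> {\<zero>\<^bsub>A\<^esub>} \<or> V_space A n e j i \<noteq> {\<zero>\<^bsub>A\<^esub>}}"

text \<open>
  A projective geometry determines its coordinate division ring only as a ring, and says nothing
  about the embedding of \<open>k\<close>, i.e. about the action of \<open>D\<^sub>j \<cong> k\<close> on \<open>V\<^sub>i\<^sub>j\<close>.  For instance, over
  \<open>k = \<rat>(x)\<close> the quadratic extension \<open>k(\<surd>x)\<close> and the cubic extension \<open>k(x\<^bsup>1/3\<^esup>)\<close> are isomorphic
  rings; the triangular algebras with \<open>D\<^sub>1\<close> one of them, \<open>D\<^sub>2 = k\<close>, \<open>V\<^sub>1\<^sub>2 = D\<^sub>1\<^sup>3\<close> and \<open>n = 2\<close>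
  have isomorphic fibres, but no isomorphism of the species respects both actions on \<open>V\<^sub>1\<^sub>2\<close>.
  So \<open>\<phi> i\<close> is an isomorphism of rings, \<open>k\<close>-linear whenever the two residue algebras are
  isomorphic over \<open>k\<close> at all (in particular if \<open>i\<close> is a target), and \<open>f\<close> respects the left
  actions as well when \<open>\<phi> i\<close> is \<open>k\<close>-linear.
\<close>
definition direct_match ::
  "'k ring \<Rightarrow> nat \<Rightarrow> nat \<Rightarrow> ('k, 'a) module \<Rightarrow> (nat \<Rightarrow> 'a) \<Rightarrow> ('k, 'b) module \<Rightarrow> (nat \<Rightarrow> 'b) \<Rightarrow>
     (nat \<Rightarrow> 'a set \<Rightarrow> 'b set) \<Rightarrow> nat \<Rightarrow> bool" where
  "direct_match K n t A e A' e' \<phi> i \<longleftrightarrow> (let D = residue_alg A e i; D' = residue_alg A' e' i in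
     \<phi> i \<in> ring_iso D D' \<and>
     (alg_isomorphic K D D' \<longrightarrow> k_linear K D D' (\<phi> i)) \<and>
     (\<forall>j\<in>{1..t}. \<exists>f.
        semilinear_iso (opp D) (\<phi> i) (V_right A n e i j) (V_right A' n e' i j) f \<and>
        (V_space A n e i j \<noteq> {\<zero>\<^bsub>A\<^esub>} \<and> k_linear K D D' (\<phi> i) \<longrightarrow>
           (\<forall>d\<in>carrier (residue_alg A e j). \<forall>v\<in>V_space A n e i j.
              f (d \<odot>\<^bsub>V_left A n e i j\<^esub> v) = \<phi> j d \<odot>\<^bsub>V_left A' n e' i j\<^esub> f v))))"

text \<open>
  The same with \<open>D'\<^sub>i\<close> replaced by its opposite.  The right \<open>D\<^sub>i\<close>-module \<open>V\<^sub>i\<^sub>j\<close> then has to be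
  compared with a left \<open>D'\<^sub>i\<close>-module, namely the one whose lines are the points of the
  fibre; \<open>D'\<^sub>j\<close> acts on it by \<open>(g\<cdot>d)(v') = g(dv')\<close>.
\<close>
definition opposite_match ::
  "'k ring \<Rightarrow> nat \<Rightarrow> nat \<Rightarrow> ('k, 'a) module \<Rightarrow> (nat \<Rightarrow> 'a) \<Rightarrow> ('k, 'b) module \<Rightarrow> (nat \<Rightarrow> 'b) \<Rightarrow>
     (nat \<Rightarrow> 'a set \<Rightarrow> 'b set) \<Rightarrow> nat \<Rightarrow> bool" where
  "opposite_match K n t A e A' e' \<phi> i \<longleftrightarrow> (let D = opp (residue_alg A e i); D' = residue_alg A' e' i in
     \<phi> i \<in> ring_iso D D' \<and>
     (alg_isomorphic K D D' \<longrightarrow> k_linear K D D' (\<phi> i)) \<and>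
     (\<forall>j\<in>{1..t}. \<exists>f.
        semilinear_iso D (\<phi> i) (V_right A n e i j) (coord_space K A' n e' i j) f \<and>
        (V_space A n e i j \<noteq> {\<zero>\<^bsub>A\<^esub>} \<and> k_linear K D D' (\<phi> i) \<longrightarrow>
           (\<forall>d\<in>carrier (residue_alg A e j). \<forall>v\<in>V_space A n e i j. \<forall>v'\<in>V_space A' n e' i j.
              f (d \<odot>\<^bsub>V_left A n e i j\<^esub> v) v' = f v (\<phi> j d \<odot>\<^bsub>V_left A' n e' i j\<^esub> v')))))"

definition species_isomorphic_up_to_opposites ::
  "'k ring \<Rightarrow> nat \<Rightarrow> nat \<Rightarrow> ('k, 'a) module \<Rightarrow> (nat \<Rightarrow> 'a) \<Rightarrow> ('k, 'b) module \<Rightarrow> (nat \<Rightarrow> 'b) \<Rightarrow> bool" where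
  "species_isomorphic_up_to_opposites K n t A e A' e' \<longleftrightarrow>
     recovered A n t e = recovered A' n t e' \<and>
     (\<exists>\<phi>. \<forall>i\<in>recovered A n t e.
        direct_match K n t A e A' e' \<phi> i \<or> opposite_match K n t A e A' e' \<phi> i)"

end

theory Submission
  imports Defs
begin

text \<open>
  Write \<open>W\<^sub>i\<^sub>j\<close> for the left \<open>D\<^sub>i\<close>-module \<open>Hom(V\<^sub>i\<^sub>j, D\<^sub>i\<^sup>*)\<close>, which is the \<open>k\<close>-dual of \<open>V\<^sub>i\<^sub>j\<close>.  The fibre over
  \<open>(i, j)\<close>, with its linear subspaces, is the projective space \<open>\<P>(W\<^sub>i\<^sub>j)\<close>, and \<open>\<P>(W\<^sub>i\<^sub>j)\<close> remembers
  two things: the dimension of \<open>W\<^sub>i\<^sub>j\<close>, which is \<open>r\<^sub>i\<^sub>j\<close>, and, if that is at least three, the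
  ring \<open>D\<^sub>i\<close>.  This is enough.  Let two algebras have isomorphic fibres.  At a source \<open>i\<close> some
  \<open>r\<^sub>i\<^sub>j\<close> is at least three, so \<open>D\<^sub>i\<close> and \<open>D'\<^sub>i\<close> are isomorphic as rings; at a target both are \<open>k\<close>.
  For every \<open>j\<close> the modules \<open>V\<^sub>i\<^sub>j\<close> and \<open>V'\<^sub>i\<^sub>j\<close> are then free of the same rank over isomorphic
  division rings, and matching their bases gives a semilinear isomorphism
  (\<open>semilinear_iso_of_bases\<close>).  It is compatible with the left actions as soon as the isomorphism
  \<open>D\<^sub>i \<rightarrow> D'\<^sub>i\<close> is \<open>k\<close>-linear, because \<open>D\<^sub>j = k\<close> acts by scalars, and scalars act on the right as
  well.  Both geometries are built from left modules, so the match is direct at every vertex.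

  The geometric half is the fundamental theorem of projective geometry over division rings, in the
  part that recovers the coordinate ring (\<open>ring_iso_of_plane\<close>).  A bijection of points that
  preserves linear subspaces preserves spans, hence carries bases to bases (\<open>basis_image\<close>).  On a
  plane, the affine coordinate \<open>a\<close> of the point \<open>\<langle>e\<^sub>0 + a e\<^sub>1\<rangle>\<close> is sent to the affine coordinate
  \<open>\<phi>(a)\<close> of the image, and sums and products of coordinates are visible as incidences of points
  with lines.

  The algebraic half identifies the fibre with \<open>\<P>(W\<^sub>i\<^sub>j)\<close> (\<open>point_eq_iff\<close>).  An isomorphism
  \<open>M\<^sub>U \<rightarrow> M\<^bsub>U'\<^esub>\<close> lifts to right multiplication of \<open>P\<^sub>i = \<Lambda>e\<^sub>i\<close> by an element of \<open>e\<^sub>i\<Lambda>e\<^sub>i\<close>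
  (\<open>fibre_modules_isomorphic_iff\<close>), and the corner ring \<open>e\<^sub>i\<Lambda>e\<^sub>i\<close> is local by Fitting's lemma, so that
  this element is a unit once it acts nontrivially on the terminal layer.  Hence isomorphism
  classes are orbits of hyperplanes \<open>ker \<lambda>\<close> under \<open>D\<^sub>i\<^sup>\<times>\<close>, that is, lines \<open>D\<^sub>i\<lambda>\<close>.  That the denominators
  \<open>W\<^sub>j \<oplus> U\<close> are submodules rests on \<open>e\<^sub>j\<Lambda>e\<^sub>h \<subseteq> J\<close> for \<open>h \<noteq> j\<close>, which is what being basic means here
  (\<open>off_diagonal_in_J\<close>).  Finally \<open>dim W\<^sub>i\<^sub>j = r\<^sub>i\<^sub>j\<close> holds because \<open>D\<^sub>i\<^sup>*\<close> is one-dimensional over \<open>D\<^sub>i\<close>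
  (\<open>generating_functional\<close>, \<open>hom_dual_basis\<close>).
\<close>

section \<open>Linear algebra over division rings\<close>

locale left_module = R?: ring R + M?: abelian_group M
  for R :: "('r, 'z) ring_scheme" (structure) and M :: "('r, 'm) module" (structure) +
  assumes smult_closed [simp, intro]:
      "\<lbrakk>a \<in> carrier R; x \<in> carrier M\<rbrakk> \<Longrightarrow> a \<odot>\<^bsub>M\<^esub> x \<in> carrier M"
    and smult_l_distr:
      "\<lbrakk>a \<in> carrier R; b \<in> carrier R; x \<in> carrier M\<rbrakk> \<Longrightarrow>
        (a \<oplus> b) \<odot>\<^bsub>M\<^esub> x = a \<odot>\<^bsub>M\<^esub> x \<oplus>\<^bsub>M\<^esub> b \<odot>\<^bsub>M\<^esub> x"
    and smult_r_distr:
      "\<lbrakk>a \<in> carrier R; x \<in> carrier M; y \<in> carrier M\<rbrakk> \<Longrightarrow>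
        a \<odot>\<^bsub>M\<^esub> (x \<oplus>\<^bsub>M\<^esub> y) = a \<odot>\<^bsub>M\<^esub> x \<oplus>\<^bsub>M\<^esub> a \<odot>\<^bsub>M\<^esub> y"
    and smult_assoc:
      "\<lbrakk>a \<in> carrier R; b \<in> carrier R; x \<in> carrier M\<rbrakk> \<Longrightarrow>
        (a \<otimes> b) \<odot>\<^bsub>M\<^esub> x = a \<odot>\<^bsub>M\<^esub> (b \<odot>\<^bsub>M\<^esub> x)"
    and smult_one [simp]: "x \<in> carrier M \<Longrightarrow> \<one> \<odot>\<^bsub>M\<^esub> x = x"

text \<open>
  The hull of a set under the submodules of \<open>M\<close>: on the points of a projective space this is the
  closure operator that an isomorphism of geometries preserves.
\<close>
definition span :: "('r, 'z) ring_scheme \<Rightarrow> ('r, 'm) module \<Rightarrow> 'm set \<Rightarrow> 'm set" where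
  "span R M S = \<Inter>{U. submodule U R M \<and> S \<subseteq> U}"

definition independent :: "('r, 'z) ring_scheme \<Rightarrow> ('r, 'm) module \<Rightarrow> 'm set \<Rightarrow> bool" where
  "independent R M S \<longleftrightarrow> (\<forall>x\<in>S. x \<notin> span R M (S - {x}))"

definition lincomb :: "('r, 'm) module \<Rightarrow> 'm set \<Rightarrow> ('m \<Rightarrow> 'r) \<Rightarrow> 'm" where
  "lincomb M B a = (\<Oplus>\<^bsub>M\<^esub>b\<in>B. a b \<odot>\<^bsub>M\<^esub> b)"

context left_module
begin

lemma smult_l_null [simp]: "x \<in> carrier M \<Longrightarrow> \<zero> \<odot>\<^bsub>M\<^esub> x = \<zero>\<^bsub>M\<^esub>"
  by (metis M.add.r_cancel_one' R.r_zero R.zero_closed smult_closed smult_l_distr)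

lemma smult_r_null [simp]: "a \<in> carrier R \<Longrightarrow> a \<odot>\<^bsub>M\<^esub> \<zero>\<^bsub>M\<^esub> = \<zero>\<^bsub>M\<^esub>"
  by (metis M.zero_closed R.r_null R.zero_closed smult_assoc smult_l_null)

lemma smult_l_minus:
  "\<lbrakk>a \<in> carrier R; x \<in> carrier M\<rbrakk> \<Longrightarrow> (\<ominus> a) \<odot>\<^bsub>M\<^esub> x = \<ominus>\<^bsub>M\<^esub> (a \<odot>\<^bsub>M\<^esub> x)"
  by (metis M.add.inv_comm M.minus_equality R.add.inv_closed R.r_neg smult_closed smult_l_distr smult_l_null)

lemma smult_r_minus:
  "\<lbrakk>a \<in> carrier R; x \<in> carrier M\<rbrakk> \<Longrightarrow> a \<odot>\<^bsub>M\<^esub> (\<ominus>\<^bsub>M\<^esub> x) = \<ominus>\<^bsub>M\<^esub> (a \<odot>\<^bsub>M\<^esub> x)"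
  by (metis M.add.inv_closed M.add.inv_comm M.minus_equality M.r_neg smult_closed smult_r_distr smult_r_null)

lemma finsum_smult:
  assumes "finite S" "a \<in> carrier R" "f \<in> S \<rightarrow> carrier M"
  shows "a \<odot>\<^bsub>M\<^esub> (\<Oplus>\<^bsub>M\<^esub>i\<in>S. f i) = (\<Oplus>\<^bsub>M\<^esub>i\<in>S. a \<odot>\<^bsub>M\<^esub> f i)"
  using assms by (induct set: finite) (simp_all add: Pi_def smult_r_distr)

lemma submoduleI:
  assumes "H \<subseteq> carrier M" "\<zero>\<^bsub>M\<^esub> \<in> H"
    and "\<And>x y. \<lbrakk>x \<in> H; y \<in> H\<rbrakk> \<Longrightarrow> x \<oplus>\<^bsub>M\<^esub> y \<in> H"
    and "\<And>a x. \<lbrakk>a \<in> carrier R; x \<in> H\<rbrakk> \<Longrightarrow> a \<odot>\<^bsub>M\<^esub> x \<in> H"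
  shows "submodule H R M"
proof -
  have "\<ominus>\<^bsub>M\<^esub> x \<in> H" if "x \<in> H" for x
    using assms(4)[of "\<ominus> \<one>" x] assms(1) that by (simp add: smult_l_minus subsetD)
  then show ?thesis
    using assms unfolding a_inv_def
    by (intro submodule.intro subgroup.intro submodule_axioms.intro) auto
qed

lemma submoduleD:
  assumes "submodule H R M"
  shows "H \<subseteq> carrier M" "\<zero>\<^bsub>M\<^esub> \<in> H"
    and "\<And>x y. \<lbrakk>x \<in> H; y \<in> H\<rbrakk> \<Longrightarrow> x \<oplus>\<^bsub>M\<^esub> y \<in> H"
    and "\<And>a x. \<lbrakk>a \<in> carrier R; x \<in> H\<rbrakk> \<Longrightarrow> a \<odot>\<^bsub>M\<^esub> x \<in> H"
    and "\<And>x. x \<in> H \<Longrightarrow> \<ominus>\<^bsub>M\<^esub> x \<in> H"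
proof -
  interpret submodule H R M by fact
  show "H \<subseteq> carrier M" "\<zero>\<^bsub>M\<^esub> \<in> H" using subset one_closed by auto
  show "\<And>x y. \<lbrakk>x \<in> H; y \<in> H\<rbrakk> \<Longrightarrow> x \<oplus>\<^bsub>M\<^esub> y \<in> H" using m_closed by auto
  show "\<And>a x. \<lbrakk>a \<in> carrier R; x \<in> H\<rbrakk> \<Longrightarrow> a \<odot>\<^bsub>M\<^esub> x \<in> H" by auto
  show "\<And>x. x \<in> H \<Longrightarrow> \<ominus>\<^bsub>M\<^esub> x \<in> H" using m_inv_closed unfolding a_inv_def by auto
qed

lemma carrier_submodule: "submodule (carrier M) R M"
  by (rule submoduleI) auto

lemma zero_submodule: "submodule {\<zero>\<^bsub>M\<^esub>} R M"
  by (rule submoduleI) auto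

lemma restrict_left_module:
  assumes "submodule H R M"
  shows "left_module R (M\<lparr>carrier := H\<rparr>)"
proof -
  note H = submoduleD[OF assms]
  have "abelian_group (M\<lparr>carrier := H\<rparr>)"
  proof (rule abelian_groupI)
    fix x assume x: "x \<in> carrier (M\<lparr>carrier := H\<rparr>)"
    then show "\<exists>y\<in>carrier (M\<lparr>carrier := H\<rparr>). y \<oplus>\<^bsub>M\<lparr>carrier := H\<rparr>\<^esub> x = \<zero>\<^bsub>M\<lparr>carrier := H\<rparr>\<^esub>"
      using H(1,5) M.l_neg by auto
  qed (use H(1,2,3) M.a_assoc M.a_comm in \<open>auto simp: subset_iff\<close>)
  then show ?thesis
    using H(1,4) R.ring_axioms
    by (intro left_module.intro left_module_axioms.intro)
       (auto simp: smult_l_distr smult_r_distr smult_assoc subset_iff)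
qed

lemma submodule_restrict:
  assumes "submodule H R M" "L \<subseteq> H"
  shows "submodule L R (M\<lparr>carrier := H\<rparr>) \<longleftrightarrow> submodule L R M"
proof -
  interpret N: left_module R "M\<lparr>carrier := H\<rparr>" by (rule restrict_left_module[OF assms(1)])
  show ?thesis
  proof
    assume "submodule L R (M\<lparr>carrier := H\<rparr>)"
    then show "submodule L R M"
      using N.submoduleD[of L] submoduleD(1)[OF assms(1)] by (intro submoduleI) auto
  next
    assume L: "submodule L R M"
    show "submodule L R (M\<lparr>carrier := H\<rparr>)"
      using submoduleD[OF L] assms(2) by (intro N.submoduleI) auto
  qed
qed

lemma span_submodule:
  assumes "S \<subseteq> carrier M"
  shows "submodule (span R M S) R M"
proof (rule submoduleI)
  show "span R M S \<subseteq> carrier M"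
    unfolding span_def using assms carrier_submodule by blast
qed (auto simp: span_def submoduleD)

lemma span_superset: "S \<subseteq> span R M S"
  unfolding span_def by blast

lemma span_least: "submodule U R M \<Longrightarrow> S \<subseteq> U \<Longrightarrow> span R M S \<subseteq> U"
  unfolding span_def by blast

lemma span_carrier: "S \<subseteq> carrier M \<Longrightarrow> span R M S \<subseteq> carrier M"
  using carrier_submodule span_least by blast

lemma span_mono: "S \<subseteq> T \<Longrightarrow> span R M S \<subseteq> span R M T"
  unfolding span_def by blast

lemma span_subset_span: "T \<subseteq> carrier M \<Longrightarrow> S \<subseteq> span R M T \<Longrightarrow> span R M S \<subseteq> span R M T"
  by (simp add: span_least span_submodule)

lemma span_empty: "span R M {} = {\<zero>\<^bsub>M\<^esub>}"
  using span_least[OF zero_submodule, of "{}"] submoduleD(2)[OF span_submodule[of "{}"]] by auto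

lemma span_insert:
  assumes "x \<in> carrier M" "S \<subseteq> carrier M"
  shows "span R M (insert x S) = {a \<odot>\<^bsub>M\<^esub> x \<oplus>\<^bsub>M\<^esub> s |a s. a \<in> carrier R \<and> s \<in> span R M S}" (is "_ = ?T")
proof
  note S = submoduleD[OF span_submodule[OF assms(2)]]
  have "submodule ?T R M"
  proof (rule submoduleI)
    show "?T \<subseteq> carrier M" using S(1) assms(1) by auto
    show "\<zero>\<^bsub>M\<^esub> \<in> ?T" using S(2) assms(1) by (force intro!: exI[of _ \<zero>])
  next
    fix u v assume "u \<in> ?T" "v \<in> ?T"
    then obtain a s b r where *: "u = a \<odot>\<^bsub>M\<^esub> x \<oplus>\<^bsub>M\<^esub> s" "a \<in> carrier R" "s \<in> span R M S"
      "v = b \<odot>\<^bsub>M\<^esub> x \<oplus>\<^bsub>M\<^esub> r" "b \<in> carrier R" "r \<in> span R M S" by auto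
    have "u \<oplus>\<^bsub>M\<^esub> v = (a \<oplus> b) \<odot>\<^bsub>M\<^esub> x \<oplus>\<^bsub>M\<^esub> (s \<oplus>\<^bsub>M\<^esub> r)"
      using * S(1) assms(1) by (simp add: smult_l_distr subset_iff M.a_ac)
    then show "u \<oplus>\<^bsub>M\<^esub> v \<in> ?T" using * S(3) by blast
  next
    fix c u assume c: "c \<in> carrier R" "u \<in> ?T"
    then obtain a s where *: "u = a \<odot>\<^bsub>M\<^esub> x \<oplus>\<^bsub>M\<^esub> s" "a \<in> carrier R" "s \<in> span R M S" by auto
    have "c \<odot>\<^bsub>M\<^esub> u = (c \<otimes> a) \<odot>\<^bsub>M\<^esub> x \<oplus>\<^bsub>M\<^esub> c \<odot>\<^bsub>M\<^esub> s"
      using * c S(1) assms(1) by (simp add: smult_r_distr smult_assoc subset_iff)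
    then show "c \<odot>\<^bsub>M\<^esub> u \<in> ?T" using * c S(4) by blast
  qed
  moreover have "x \<in> ?T" using S(2) assms(1) by (force intro!: exI[of _ \<one>])
  moreover have "S \<subseteq> ?T"
  proof
    fix s assume "s \<in> S"
    then show "s \<in> ?T" using assms span_superset by (force intro!: exI[of _ \<zero>] exI[of _ s])
  qed
  ultimately show "span R M (insert x S) \<subseteq> ?T" by (intro span_least) auto
  have "span R M S \<subseteq> span R M (insert x S)" by (intro span_mono) auto
  moreover have "x \<in> span R M (insert x S)" using span_superset[of "insert x S"] by auto
  ultimately show "?T \<subseteq> span R M (insert x S)"
    using submoduleD(3,4)[OF span_submodule[of "insert x S"]] assms by auto
qed

lemma span_singleton:
  assumes "x \<in> carrier M"
  shows "span R M {x} = {a \<odot>\<^bsub>M\<^esub> x |a. a \<in> carrier R}"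
proof -
  have "a \<odot>\<^bsub>M\<^esub> x \<oplus>\<^bsub>M\<^esub> \<zero>\<^bsub>M\<^esub> = a \<odot>\<^bsub>M\<^esub> x" if "a \<in> carrier R" for a using that assms by simp
  then show ?thesis unfolding span_insert[OF assms empty_subsetI] span_empty by force
qed

lemma span_pair:
  assumes "x \<in> carrier M" "y \<in> carrier M"
  shows "span R M {x, y} = {a \<odot>\<^bsub>M\<^esub> x \<oplus>\<^bsub>M\<^esub> b \<odot>\<^bsub>M\<^esub> y |a b. a \<in> carrier R \<and> b \<in> carrier R}"
  using assms span_insert[of x "{y}"] span_singleton by auto

lemma lincomb_closed:
  "B \<subseteq> carrier M \<Longrightarrow> a \<in> B \<rightarrow> carrier R \<Longrightarrow> lincomb M B a \<in> carrier M"
  unfolding lincomb_def by (intro M.finsum_closed) auto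

lemma lincomb_cong:
  assumes "B \<subseteq> carrier M" "a \<in> B \<rightarrow> carrier R" "\<And>b. b \<in> B \<Longrightarrow> c b = a b"
  shows "lincomb M B c = lincomb M B a"
  unfolding lincomb_def using assms by (intro M.finsum_cong') auto

lemma lincomb_insert:
  assumes "finite B" "x \<notin> B" "insert x B \<subseteq> carrier M" "a \<in> insert x B \<rightarrow> carrier R"
  shows "lincomb M (insert x B) a = a x \<odot>\<^bsub>M\<^esub> x \<oplus>\<^bsub>M\<^esub> lincomb M B a"
  unfolding lincomb_def using assms by (intro M.finsum_insert) auto

lemma lincomb_add:
  assumes "B \<subseteq> carrier M" "a \<in> B \<rightarrow> carrier R" "c \<in> B \<rightarrow> carrier R"
  shows "lincomb M B (\<lambda>b. a b \<oplus> c b) = lincomb M B a \<oplus>\<^bsub>M\<^esub> lincomb M B c"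
proof -
  have "lincomb M B (\<lambda>b. a b \<oplus> c b) = (\<Oplus>\<^bsub>M\<^esub>b\<in>B. a b \<odot>\<^bsub>M\<^esub> b \<oplus>\<^bsub>M\<^esub> c b \<odot>\<^bsub>M\<^esub> b)"
    unfolding lincomb_def using assms
    by (intro M.finsum_cong') (auto simp: smult_l_distr subset_iff Pi_iff)
  also have "\<dots> = lincomb M B a \<oplus>\<^bsub>M\<^esub> lincomb M B c"
    unfolding lincomb_def using assms by (intro M.finsum_addf) auto
  finally show ?thesis .
qed

lemma lincomb_smult:
  assumes "finite B" "B \<subseteq> carrier M" "a \<in> B \<rightarrow> carrier R" "r \<in> carrier R"
  shows "lincomb M B (\<lambda>b. r \<otimes> a b) = r \<odot>\<^bsub>M\<^esub> lincomb M B a"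
proof -
  have "lincomb M B (\<lambda>b. r \<otimes> a b) = (\<Oplus>\<^bsub>M\<^esub>b\<in>B. r \<odot>\<^bsub>M\<^esub> (a b \<odot>\<^bsub>M\<^esub> b))"
    unfolding lincomb_def using assms
    by (intro M.finsum_cong') (auto simp: smult_assoc subset_iff Pi_iff)
  also have "\<dots> = r \<odot>\<^bsub>M\<^esub> lincomb M B a"
    unfolding lincomb_def using assms by (intro finsum_smult[symmetric]) auto
  finally show ?thesis .
qed

lemma span_eq_lincombs:
  assumes "finite B" "B \<subseteq> carrier M"
  shows "span R M B = {lincomb M B a |a. a \<in> B \<rightarrow> carrier R}"
  using assms
proof (induct B rule: finite_induct)
  case empty
  then show ?case by (auto simp: span_empty lincomb_def)
next
  case (insert x B)
  have "span R M (insert x B) = {r \<odot>\<^bsub>M\<^esub> x \<oplus>\<^bsub>M\<^esub> s |r s. r \<in> carrier R \<and> s \<in> span R M B}"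
    using insert by (intro span_insert) auto
  also have "\<dots> = {lincomb M (insert x B) a |a. a \<in> insert x B \<rightarrow> carrier R}"
  proof (intro Set.set_eqI iffI)
    fix v assume "v \<in> {r \<odot>\<^bsub>M\<^esub> x \<oplus>\<^bsub>M\<^esub> s |r s. r \<in> carrier R \<and> s \<in> span R M B}"
    then obtain r a where v: "v = r \<odot>\<^bsub>M\<^esub> x \<oplus>\<^bsub>M\<^esub> lincomb M B a" "r \<in> carrier R" "a \<in> B \<rightarrow> carrier R"
      using insert by auto
    have "lincomb M B (a(x := r)) = lincomb M B a"
      using insert v by (intro lincomb_cong) auto
    then have "v = lincomb M (insert x B) (a(x := r))"
      using insert v by (subst lincomb_insert) (auto simp: Pi_iff)
    moreover have "a(x := r) \<in> insert x B \<rightarrow> carrier R" using v by auto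
    ultimately show "v \<in> {lincomb M (insert x B) a |a. a \<in> insert x B \<rightarrow> carrier R}" by blast
  next
    fix v assume "v \<in> {lincomb M (insert x B) a |a. a \<in> insert x B \<rightarrow> carrier R}"
    then obtain a where a: "v = lincomb M (insert x B) a" "a \<in> insert x B \<rightarrow> carrier R" by blast
    then have "v = a x \<odot>\<^bsub>M\<^esub> x \<oplus>\<^bsub>M\<^esub> lincomb M B a"
      using insert by (simp add: lincomb_insert)
    then show "v \<in> {r \<odot>\<^bsub>M\<^esub> x \<oplus>\<^bsub>M\<^esub> s |r s. r \<in> carrier R \<and> s \<in> span R M B}"
      using a insert by (auto intro!: exI[of _ "a x"] exI[of _ "lincomb M B a"])
  qed
  finally show ?case .
qed

lemma independent_nonzero:
  "independent R M S \<Longrightarrow> S \<subseteq> carrier M \<Longrightarrow> x \<in> S \<Longrightarrow> x \<noteq> \<zero>\<^bsub>M\<^esub>"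
  unfolding independent_def using submoduleD(2)[OF span_submodule[of "S - {x}"]] by auto

end

locale left_vector_space = left_module +
  assumes nonzero_Units: "Units R = carrier R - {\<zero>}"
begin

lemma one_neq_zero: "\<one> \<noteq> \<zero>"
  using nonzero_Units R.Units_one_closed by auto

lemma smult_eq_zero_iff:
  assumes "a \<in> carrier R" "x \<in> carrier M"
  shows "a \<odot>\<^bsub>M\<^esub> x = \<zero>\<^bsub>M\<^esub> \<longleftrightarrow> a = \<zero> \<or> x = \<zero>\<^bsub>M\<^esub>"
proof -
  have "x = \<zero>\<^bsub>M\<^esub>" if "a \<odot>\<^bsub>M\<^esub> x = \<zero>\<^bsub>M\<^esub>" "a \<noteq> \<zero>"
  proof -
    have "a \<in> Units R" using that assms nonzero_Units by auto
    then have "x = inv a \<odot>\<^bsub>M\<^esub> (a \<odot>\<^bsub>M\<^esub> x)" using assms by (simp flip: smult_assoc)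
    then show ?thesis using that \<open>a \<in> Units R\<close> by simp
  qed
  then show ?thesis using assms by auto
qed

text \<open>
  The Steinitz exchange property: the coefficient of \<open>x\<close> in an expression for \<open>y\<close> is nonzero,
  hence a unit, and one can solve for \<open>x\<close>.
\<close>
lemma exchange:
  assumes "x \<in> carrier M" "S \<subseteq> carrier M" "y \<in> span R M (insert x S)" "y \<notin> span R M S"
  shows "x \<in> span R M (insert y S)"
proof -
  obtain a s where y: "y = a \<odot>\<^bsub>M\<^esub> x \<oplus>\<^bsub>M\<^esub> s" and a: "a \<in> carrier R" and s: "s \<in> span R M S"
    using assms span_insert by auto
  have sc: "s \<in> carrier M" using s span_carrier assms by auto
  have yc: "y \<in> carrier M" using y a sc assms by auto
  have "a \<noteq> \<zero>" using y s sc assms by auto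
  then have u: "a \<in> Units R" using a nonzero_Units by auto
  have "a \<odot>\<^bsub>M\<^esub> x = y \<oplus>\<^bsub>M\<^esub> \<ominus>\<^bsub>M\<^esub> s" using y a sc assms by (simp add: M.a_assoc M.r_neg)
  then have "x = inv a \<odot>\<^bsub>M\<^esub> (y \<oplus>\<^bsub>M\<^esub> \<ominus>\<^bsub>M\<^esub> s)"
    using u a assms by (metis R.Units_inv_closed R.Units_l_inv smult_assoc smult_one)
  then have "x = inv a \<odot>\<^bsub>M\<^esub> y \<oplus>\<^bsub>M\<^esub> inv a \<odot>\<^bsub>M\<^esub> (\<ominus>\<^bsub>M\<^esub> s)"
    using u yc sc by (simp add: smult_r_distr)
  moreover have "inv a \<odot>\<^bsub>M\<^esub> (\<ominus>\<^bsub>M\<^esub> s) \<in> span R M S"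
    using u s submoduleD[OF span_submodule[OF assms(2)]] by auto
  ultimately show ?thesis using u yc assms span_insert[of y S] by auto
qed

text \<open>
  Induction on the number of elements of \<open>B\<close> outside \<open>G\<close>.  A subset \<open>H\<close> of \<open>G\<close> maximal with
  \<open>b \<notin> span H\<close> singles out an element \<open>g\<close> that can be exchanged for \<open>b\<close>.
\<close>
lemma independent_card_le:
  assumes "finite G" "G \<subseteq> carrier M" "finite B" "B \<subseteq> span R M G" "independent R M B"
  shows "card B \<le> card G"
  using assms
proof (induct "card (B - G)" arbitrary: G)
  case 0
  then show ?case by (auto intro: card_mono)
next
  case (Suc m)
  then obtain b where b: "b \<in> B" "b \<notin> G" by (metis Diff_iff card_eq_SucD insertI1)
  have bc: "b \<in> carrier M" using b Suc.prems span_carrier by blast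
  define P where "P = {H. B \<inter> G \<subseteq> H \<and> H \<subseteq> G \<and> b \<notin> span R M H}"
  have "B \<inter> G \<in> P"
    using Suc.prems(5) b span_mono[of "B \<inter> G" "B - {b}"] unfolding independent_def P_def by auto
  moreover have "finite P" using Suc.prems(1) finite_subset[of P "Pow G"] unfolding P_def by auto
  ultimately obtain H where H: "H \<in> P" "\<And>H'. H' \<in> P \<Longrightarrow> H \<subseteq> H' \<Longrightarrow> H = H'"
    by (metis finite_has_maximal2)
  obtain g where g: "g \<in> G" "g \<notin> H" 
  proof -
    have "H \<noteq> G" "H \<subseteq> G" using H(1) b(1) Suc.prems(4) unfolding P_def by auto
    then show thesis using that by blast
  qed
  have "insert g H \<notin> P" using H(2)[of "insert g H"] g by auto
  then have "b \<in> span R M (insert g H)" using H(1) g unfolding P_def by auto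
  moreover have Hc: "H \<subseteq> carrier M" using H(1) Suc.prems unfolding P_def by auto
  ultimately have "g \<in> span R M (insert b H)"
    using exchange[of g H b] g H(1) Suc.prems(2) unfolding P_def by auto
  moreover define G' where "G' = insert b (G - {g})"
  ultimately have gG': "g \<in> span R M G'"
    using span_mono[of "insert b H" G'] g H(1) unfolding P_def by auto
  have G'c: "G' \<subseteq> carrier M" using bc Suc.prems unfolding G'_def by auto
  have "G \<subseteq> span R M G'" using gG' span_superset[of G'] unfolding G'_def by auto
  then have "B \<subseteq> span R M G'" using span_subset_span[OF G'c] Suc.prems(4) by blast
  moreover have "B - G' = (B - G) - {b}"
    using g H(1) unfolding G'_def P_def by auto
  then have "m = card (B - G')" using Suc(2) b Suc.prems(3) by simp
  moreover have "finite G'" using Suc.prems unfolding G'_def by auto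
  ultimately have "card B \<le> card G'" using Suc(1) Suc.prems G'c by auto
  also have "card G' = card G" using g b Suc.prems(1) unfolding G'_def
    by (simp add: card_gt_0_iff card_insert_if) (metis Suc_pred card_gt_0_iff empty_iff)
  finally show ?case .
qed

text \<open>
  Bases in the sense of unique coordinates are the independent spanning sets, so that dimensions can
  be compared with the exchange property.
\<close>
lemma is_basis_iff:
  "is_basis R M B \<longleftrightarrow> finite B \<and> B \<subseteq> carrier M \<and> independent R M B \<and> span R M B = carrier M"
proof (cases "finite B \<and> B \<subseteq> carrier M")
  case True
  then have B: "finite B" "B \<subseteq> carrier M" by auto
  have split: "lincomb M B a = a b \<odot>\<^bsub>M\<^esub> b \<oplus>\<^bsub>M\<^esub> lincomb M (B - {b}) a"
    if "b \<in> B" "a \<in> B \<rightarrow> carrier R" for a b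
    using lincomb_insert[of "B - {b}" b a] that B by (auto simp: insert_absorb Pi_iff)
  show ?thesis
  proof
    assume bas: "is_basis R M B"
    have "carrier M \<subseteq> span R M B"
      using bas B unfolding is_basis_def span_eq_lincombs[OF B] lincomb_def by (fastforce simp: PiE_def)
    moreover have "independent R M B"
      unfolding independent_def
    proof (intro ballI notI)
      fix b assume b: "b \<in> B" "b \<in> span R M (B - {b})"
      then obtain a where a: "b = lincomb M (B - {b}) a" "a \<in> B - {b} \<rightarrow> carrier R"
        using span_eq_lincombs[of "B - {b}"] B by auto
      let ?a1 = "\<lambda>x\<in>B. if x = b then \<zero> else a x"
      let ?a2 = "\<lambda>x\<in>B. if x = b then \<one> else \<zero>"
      have bc: "b \<in> carrier M" using b B by auto
      have *: "?a1 \<in> B \<rightarrow>\<^sub>E carrier R" "?a2 \<in> B \<rightarrow>\<^sub>E carrier R" using a by auto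
      have "lincomb M (B - {b}) ?a1 = b"
        using a B lincomb_cong[of "B - {b}" a ?a1] by auto
      then have "lincomb M B ?a1 = b" using split[of b ?a1] b bc * by auto
      moreover have "lincomb M (B - {b}) ?a2 = \<zero>\<^bsub>M\<^esub>"
        unfolding lincomb_def using B by (intro M.add.finprod_one_eqI) auto
      then have "lincomb M B ?a2 = b" using split[of b ?a2] b bc * by auto
      moreover have "\<exists>!a. a \<in> B \<rightarrow>\<^sub>E carrier R \<and> b = lincomb M B a"
        using bas bc unfolding is_basis_def lincomb_def by blast
      ultimately have "?a1 = ?a2" using * by metis
      then have "?a1 b = ?a2 b" by metis
      then show False using b one_neq_zero by simp
    qed
    ultimately show "finite B \<and> B \<subseteq> carrier M \<and> independent R M B \<and> span R M B = carrier M"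
      using B span_carrier by blast
  next
    assume bas: "finite B \<and> B \<subseteq> carrier M \<and> independent R M B \<and> span R M B = carrier M"
    have uniq: "a = c" if ac: "a \<in> B \<rightarrow>\<^sub>E carrier R" "c \<in> B \<rightarrow>\<^sub>E carrier R" "lincomb M B a = lincomb M B c" for a c
    proof (rule ccontr)
      assume "a \<noteq> c"
      then obtain b where b: "b \<in> B" "a b \<noteq> c b" using ac(1,2) by (metis PiE_ext)
      have ac': "a \<in> B \<rightarrow> carrier R" "c \<in> B \<rightarrow> carrier R" using ac by auto
      have d: "(\<lambda>x. c x \<oplus> \<ominus> a x) \<in> B \<rightarrow> carrier R" using ac by auto
      have m: "(\<lambda>x. \<ominus> \<one> \<otimes> a x) \<in> B \<rightarrow> carrier R" using ac by auto
      have "lincomb M B (\<lambda>x. c x \<oplus> \<ominus> a x) = lincomb M B (\<lambda>x. c x \<oplus> \<ominus> \<one> \<otimes> a x)"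
        using B m ac' by (intro lincomb_cong) (auto simp: R.l_minus Pi_iff)
      also have "\<dots> = lincomb M B c \<oplus>\<^bsub>M\<^esub> lincomb M B (\<lambda>x. \<ominus> \<one> \<otimes> a x)"
        using B ac' m by (intro lincomb_add) auto
      also have "\<dots> = lincomb M B c \<oplus>\<^bsub>M\<^esub> \<ominus>\<^bsub>M\<^esub> lincomb M B a"
        using B ac' by (subst lincomb_smult) (auto simp: smult_l_minus lincomb_closed)
      also have "\<dots> = \<zero>\<^bsub>M\<^esub>" using ac(3) lincomb_closed[OF B(2) ac'(2)] by (simp add: M.r_neg)
      finally have "(c b \<oplus> \<ominus> a b) \<odot>\<^bsub>M\<^esub> b \<oplus>\<^bsub>M\<^esub> lincomb M (B - {b}) (\<lambda>x. c x \<oplus> \<ominus> a x) = \<zero>\<^bsub>M\<^esub>"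
        using split[OF b(1) d] by simp
      moreover have s: "lincomb M (B - {b}) (\<lambda>x. c x \<oplus> \<ominus> a x) \<in> span R M (B - {b})"
        using span_eq_lincombs[of "B - {b}"] B d by auto
      moreover have bc: "b \<in> carrier M" "c b \<oplus> \<ominus> a b \<in> carrier R" using b B d by auto
      moreover have sub: "submodule (span R M (B - {b})) R M" using B by (intro span_submodule) auto
      ultimately have "(c b \<oplus> \<ominus> a b) \<odot>\<^bsub>M\<^esub> b = \<ominus>\<^bsub>M\<^esub> lincomb M (B - {b}) (\<lambda>x. c x \<oplus> \<ominus> a x)"
        using submoduleD(1)[OF sub] by (intro M.minus_equality[symmetric]) (auto simp: M.a_comm)
      then have *: "(c b \<oplus> \<ominus> a b) \<odot>\<^bsub>M\<^esub> b \<in> span R M (B - {b})"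
        using s submoduleD(5)[OF sub] by auto
      have cb: "c b \<in> carrier R" "a b \<in> carrier R" using b ac' by auto
      have ne: "c b \<oplus> \<ominus> a b \<noteq> \<zero>"
      proof
        assume "c b \<oplus> \<ominus> a b = \<zero>"
        then have "\<ominus> (\<ominus> a b) = c b" using cb by (intro R.minus_equality) auto
        then show False using b cb by simp
      qed
      obtain d where d: "d \<in> carrier R" "d \<otimes> (c b \<oplus> \<ominus> a b) = \<one>"
        using ne bc nonzero_Units unfolding Units_def by blast
      then have "b = d \<odot>\<^bsub>M\<^esub> ((c b \<oplus> \<ominus> a b) \<odot>\<^bsub>M\<^esub> b)"
        using bc smult_assoc[of d "c b \<oplus> \<ominus> a b" b] by simp
      then have "b \<in> span R M (B - {b})"
        using submoduleD(4)[OF sub d(1) *] by simp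
      then show False using bas b unfolding independent_def by blast
    qed
    show "is_basis R M B"
      unfolding is_basis_def
    proof (intro conjI ballI B)
      fix x assume "x \<in> carrier M"
      then obtain a where a: "x = lincomb M B a" "a \<in> B \<rightarrow> carrier R"
        using bas span_eq_lincombs[OF B] by blast
      then have "x = lincomb M B (restrict a B)" "restrict a B \<in> B \<rightarrow>\<^sub>E carrier R"
        using lincomb_cong[OF B(2) a(2), of "restrict a B"] by auto
      then have "\<exists>!a. a \<in> B \<rightarrow>\<^sub>E carrier R \<and> x = lincomb M B a" using uniq by (metis (no_types, lifting))
      then show "\<exists>!a. a \<in> B \<rightarrow>\<^sub>E carrier R \<and> x = (\<Oplus>\<^bsub>M\<^esub>b\<in>B. a b \<odot>\<^bsub>M\<^esub> b)" unfolding lincomb_def .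
    qed
  qed
qed (auto simp: is_basis_def)

lemma basis_card_unique: "is_basis R M B \<Longrightarrow> is_basis R M C \<Longrightarrow> card B = card C"
  unfolding is_basis_iff by (metis antisym independent_card_le order_refl)

lemma mod_dim_eq: "is_basis R M B \<Longrightarrow> mod_dim R M = card B"
  unfolding mod_dim_def using basis_card_unique by blast

lemma independent_insert:
  assumes "B \<subseteq> carrier M" "independent R M B" "x \<in> carrier M" "x \<notin> span R M B"
  shows "independent R M (insert x B)"
  unfolding independent_def
proof (intro ballI)
  fix b assume b: "b \<in> insert x B"
  have xB: "x \<notin> B" using assms span_superset by auto
  show "b \<notin> span R M (insert x B - {b})"
  proof (cases "b = x")
    case True
    then show ?thesis using assms xB by simp
  next
    case False
    then have "insert x B - {b} = insert x (B - {b})" "insert b (B - {b}) = B" using b by auto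
    moreover have "b \<notin> span R M (B - {b})" using assms b False unfolding independent_def by auto
    ultimately show ?thesis using exchange[of x "B - {b}" b] assms by auto
  qed
qed

text \<open>
  An independent set whose cardinality cannot be increased is a basis; so it suffices to bound the
  size of independent sets.
\<close>
lemma extend_to_basis:
  assumes "finite B" "B \<subseteq> carrier M" "independent R M B"
    and "\<And>C. finite C \<Longrightarrow> C \<subseteq> carrier M \<Longrightarrow> independent R M C \<Longrightarrow> card C \<le> d"
  shows "\<exists>C. B \<subseteq> C \<and> is_basis R M C"
proof -
  define P where "P C \<longleftrightarrow> B \<subseteq> C \<and> finite C \<and> C \<subseteq> carrier M \<and> independent R M C" for C
  have "P B" using assms unfolding P_def by auto
  moreover have "\<forall>C. P C \<longrightarrow> card C < Suc d" using assms(4) unfolding P_def by (simp add: le_imp_less_Suc)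
  ultimately obtain C where C: "P C" "\<And>C'. P C' \<Longrightarrow> card C' \<le> card C"
    using ex_has_greatest_nat[of P B card "Suc d"] by blast
  have "x \<in> span R M C" if x: "x \<in> carrier M" for x
  proof (rule ccontr)
    assume n: "x \<notin> span R M C"
    then have "P (insert x C)" using C(1) x independent_insert unfolding P_def by auto
    then have "card (insert x C) \<le> card C" by (rule C(2))
    moreover have "x \<notin> C" using n span_superset by auto
    ultimately show False using C(1) unfolding P_def by simp
  qed
  then have "is_basis R M C" using C(1) span_carrier unfolding is_basis_iff P_def by auto
  then show ?thesis using C(1) unfolding P_def by auto
qed

lemma basis_exists:
  assumes "finite G" "G \<subseteq> carrier M" "carrier M \<subseteq> span R M G"
  shows "\<exists>B. is_basis R M B"
  using extend_to_basis[of "{}" "card G"] independent_card_le[OF assms(1,2)] assms(3)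
  by (auto simp: independent_def)

text \<open>
  In a space spanned by \<open>d\<close> elements, \<open>d\<close> independent elements span.  This replaces rank-nullity
  in the proof that injective maps between spaces of equal dimension are surjective.
\<close>
lemma independent_card_ge_basis:
  assumes "finite G" "G \<subseteq> carrier M" "carrier M \<subseteq> span R M G"
    and B: "finite B" "B \<subseteq> carrier M" "independent R M B" "card G \<le> card B"
  shows "is_basis R M B"
proof -
  have le: "card C \<le> card G" if "finite C" "C \<subseteq> carrier M" "independent R M C" for C
    using independent_card_le[OF assms(1,2)] assms(3) that by auto
  then obtain C where C: "B \<subseteq> C" "is_basis R M C" using extend_to_basis[OF B(1-3)] by blast
  then have "card C \<le> card B" using le B(4) unfolding is_basis_iff by (meson le_trans)
  then have "C = B" using C by (metis card_seteq is_basis_iff)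
  then show ?thesis using C by simp
qed

lemma restrict_left_vector_space:
  "submodule H R M \<Longrightarrow> left_vector_space R (M\<lparr>carrier := H\<rparr>)"
  using restrict_left_module nonzero_Units
  by (intro left_vector_space.intro left_vector_space_axioms.intro) auto

lemma span_restrict:
  assumes "submodule H R M" "S \<subseteq> H"
  shows "span R (M\<lparr>carrier := H\<rparr>) S = span R M S"
proof
  interpret N: left_vector_space R "M\<lparr>carrier := H\<rparr>" by (rule restrict_left_vector_space[OF assms(1)])
  have c: "S \<subseteq> carrier M" using assms submoduleD(1) by blast
  have "span R M S \<subseteq> H" using assms span_least by auto
  then show "span R (M\<lparr>carrier := H\<rparr>) S \<subseteq> span R M S"
    using submodule_restrict[OF assms(1)] span_submodule[OF c] span_superset
    by (intro N.span_least) auto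
  have "span R (M\<lparr>carrier := H\<rparr>) S \<subseteq> H" using N.span_carrier assms(2) by auto
  then show "span R M S \<subseteq> span R (M\<lparr>carrier := H\<rparr>) S"
    using submodule_restrict[OF assms(1)] N.span_submodule[of S] N.span_superset assms(2)
    by (intro span_least) auto
qed

lemma submodule_basis_exists:
  assumes "is_basis R M B" "submodule H R M"
  shows "\<exists>C. is_basis R (M\<lparr>carrier := H\<rparr>) C"
proof -
  interpret N: left_vector_space R "M\<lparr>carrier := H\<rparr>" by (rule restrict_left_vector_space[OF assms(2)])
  have "card C \<le> card B" if "finite C" "C \<subseteq> H" "independent R (M\<lparr>carrier := H\<rparr>) C" for C
  proof -
    have "independent R M C"
      using that span_restrict[OF assms(2), of "C - {x}" for x] unfolding independent_def by (metis Diff_subset order_trans)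
    then show ?thesis
      using independent_card_le[of B C] assms(1) that submoduleD(1)[OF assms(2)]
      unfolding is_basis_iff by auto
  qed
  then show ?thesis using N.extend_to_basis[of "{}" "card B"] by (auto simp: independent_def)
qed

lemma singleton_basis:
  assumes "x \<in> carrier M" "x \<noteq> \<zero>\<^bsub>M\<^esub>" "\<And>y. y \<in> carrier M \<Longrightarrow> \<exists>a\<in>carrier R. y = a \<odot>\<^bsub>M\<^esub> x"
  shows "is_basis R M {x}"
  using assms span_carrier[of "{x}"] unfolding is_basis_iff independent_def
  by (auto simp: span_empty span_singleton)

text \<open>The points of \<open>\<P>\<^sub>R(M)\<close> are the sets \<open>Rx\<close> with \<open>x \<noteq> 0\<close>.\<close>
lemma line_in_proj_space_iff:
  assumes "submodule U R M" "x \<in> carrier M" "x \<noteq> \<zero>\<^bsub>M\<^esub>"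
  shows "{a \<odot>\<^bsub>M\<^esub> x |a. a \<in> carrier R} \<in> proj_space R (M\<lparr>carrier := U\<rparr>) \<longleftrightarrow> x \<in> U"
proof -
  interpret N: left_vector_space R "M\<lparr>carrier := U\<rparr>" by (rule restrict_left_vector_space[OF assms(1)])
  let ?L = "{a \<odot>\<^bsub>M\<^esub> x |a. a \<in> carrier R}"
  have L: "?L = span R M {x}" using span_singleton assms by auto
  show ?thesis
  proof
    assume "?L \<in> proj_space R (M\<lparr>carrier := U\<rparr>)"
    then have "?L \<subseteq> U" using N.submoduleD(1)[of ?L] unfolding proj_space_def by auto
    then show "x \<in> U" using L span_superset[of "{x}"] by auto
  next
    assume x: "x \<in> U"
    have LU: "?L \<subseteq> U" using submoduleD(4)[OF assms(1)] x by auto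
    have sub: "submodule ?L R M" using L span_submodule assms by auto
    interpret P: left_vector_space R "M\<lparr>carrier := ?L\<rparr>" by (rule restrict_left_vector_space[OF sub])
    have "x \<in> ?L" using L span_superset[of "{x}"] by auto
    then have "is_basis R (M\<lparr>carrier := ?L\<rparr>) {x}" using assms(3) by (intro P.singleton_basis) auto
    then have "mod_dim R (M\<lparr>carrier := ?L\<rparr>) = 1" using P.mod_dim_eq by fastforce
    then show "?L \<in> proj_space R (M\<lparr>carrier := U\<rparr>)"
      using submodule_restrict[OF assms(1) LU] sub unfolding proj_space_def by simp
  qed
qed

end

context left_vector_space
begin

text \<open>
  Dimension detects equality of nested subspaces; chains of subspaces therefore stabilize.
\<close>
lemma submodule_dim_le:
  assumes "is_basis R M B" "submodule U R M" "submodule U' R M" "U \<subseteq> U'"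
  shows "mod_dim R (M\<lparr>carrier := U\<rparr>) \<le> mod_dim R (M\<lparr>carrier := U'\<rparr>)"
    and "mod_dim R (M\<lparr>carrier := U\<rparr>) = mod_dim R (M\<lparr>carrier := U'\<rparr>) \<Longrightarrow> U = U'"
    and "mod_dim R (M\<lparr>carrier := U\<rparr>) \<le> card B"
proof -
  interpret N: left_vector_space R "M\<lparr>carrier := U\<rparr>" by (rule restrict_left_vector_space[OF assms(2)])
  interpret N': left_vector_space R "M\<lparr>carrier := U'\<rparr>" by (rule restrict_left_vector_space[OF assms(3)])
  obtain C where C: "is_basis R (M\<lparr>carrier := U\<rparr>) C" using submodule_basis_exists assms by blast
  obtain C' where C': "is_basis R (M\<lparr>carrier := U'\<rparr>) C'" using submodule_basis_exists assms by blast
  have c: "finite C" "C \<subseteq> U" "independent R (M\<lparr>carrier := U\<rparr>) C" "span R (M\<lparr>carrier := U\<rparr>) C = U"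
    using C N.is_basis_iff by auto
  have c': "finite C'" "C' \<subseteq> U'" "span R (M\<lparr>carrier := U'\<rparr>) C' = U'"
    using C' N'.is_basis_iff by auto
  have ind: "independent R M C"
    using c span_restrict[OF assms(2), of "C - {x}" for x] unfolding independent_def by (metis Diff_subset order_trans)
  then have ind': "independent R (M\<lparr>carrier := U'\<rparr>) C"
    using c assms(4) span_restrict[OF assms(3), of "C - {x}" for x] unfolding independent_def
    by (metis Diff_subset order_trans)
  have dims: "mod_dim R (M\<lparr>carrier := U\<rparr>) = card C" "mod_dim R (M\<lparr>carrier := U'\<rparr>) = card C'"
    using N.mod_dim_eq C N'.mod_dim_eq C' by auto
  show "mod_dim R (M\<lparr>carrier := U\<rparr>) \<le> mod_dim R (M\<lparr>carrier := U'\<rparr>)"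
    unfolding dims using N'.independent_card_le[of C' C] c c' ind' assms(4) by auto
  show "mod_dim R (M\<lparr>carrier := U\<rparr>) \<le> card B"
    unfolding dims using independent_card_le[of B C] assms(1) c ind submoduleD(1)[OF assms(2)]
    unfolding is_basis_iff by auto
  show "U = U'" if "mod_dim R (M\<lparr>carrier := U\<rparr>) = mod_dim R (M\<lparr>carrier := U'\<rparr>)"
  proof -
    have "is_basis R (M\<lparr>carrier := U'\<rparr>) C"
      using N'.independent_card_ge_basis[of C' C] c c' ind' assms(4) that dims by auto
    then have "span R (M\<lparr>carrier := U'\<rparr>) C = U'" using N'.is_basis_iff by auto
    then show ?thesis using c(2,4) assms(4) span_restrict[OF assms(2), of C] span_restrict[OF assms(3), of C] by auto
  qed
qed

lemma increasing_chain_stabilizes: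
  assumes B: "is_basis R M B" and sub: "\<And>m::nat. submodule (U m) R M" and mono: "\<And>m. U m \<subseteq> U (Suc m)"
  shows "\<exists>m. \<forall>k\<ge>m. U k = U m"
proof -
  let ?d = "\<lambda>m. mod_dim R (M\<lparr>carrier := U m\<rparr>)"
  have "\<forall>m. True \<longrightarrow> ?d m < Suc (card B)"
    using submodule_dim_le(3)[OF B sub sub order_refl] by (simp add: le_imp_less_Suc)
  then obtain m where m: "\<And>k. ?d k \<le> ?d m" using ex_has_greatest_nat[of "\<lambda>_. True" 0 ?d] by blast
  have "U m = U k" if "k \<ge> m" for k
  proof -
    have "U m \<subseteq> U k" using lift_Suc_mono_le[of U m k] mono that by simp
    then show ?thesis using submodule_dim_le(1,2)[OF B sub sub, of m k] m[of k] by auto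
  qed
  then show ?thesis by metis
qed

lemma decreasing_chain_stabilizes:
  assumes B: "is_basis R M B" and sub: "\<And>m::nat. submodule (U m) R M" and mono: "\<And>m. U (Suc m) \<subseteq> U m"
  shows "\<exists>m. \<forall>k\<ge>m. U k = U m"
proof -
  let ?d = "\<lambda>m. mod_dim R (M\<lparr>carrier := U m\<rparr>)"
  obtain m where m: "\<And>k. ?d m \<le> ?d k" using ex_has_least_nat[of "\<lambda>_. True" 0 ?d] by blast
  have "U k = U m" if "k \<ge> m" for k
  proof -
    have "U k \<subseteq> U m" using lift_Suc_antimono_le[of U m k] mono that by simp
    then show ?thesis using submodule_dim_le(1,2)[OF B sub sub, of k m] m[of k] by auto
  qed
  then show ?thesis by metis
qed

end

section \<open>Coordinates and semilinear isomorphisms\<close>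

definition coords :: "('r, 'z) ring_scheme \<Rightarrow> ('r, 'm) module \<Rightarrow> 'm set \<Rightarrow> 'm \<Rightarrow> 'm \<Rightarrow> 'r" where
  "coords R M B x = (THE a. a \<in> B \<rightarrow>\<^sub>E carrier R \<and> x = lincomb M B a)"

context left_module
begin

lemma coords:
  assumes "is_basis R M B" "x \<in> carrier M"
  shows "coords R M B x \<in> B \<rightarrow>\<^sub>E carrier R" "x = lincomb M B (coords R M B x)"
  using theI'[of "\<lambda>a. a \<in> B \<rightarrow>\<^sub>E carrier R \<and> x = lincomb M B a"] assms
  unfolding is_basis_def coords_def lincomb_def by blast+

lemma coords_closed:
  "is_basis R M B \<Longrightarrow> x \<in> carrier M \<Longrightarrow> b \<in> B \<Longrightarrow> coords R M B x b \<in> carrier R"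
  using coords(1) by (auto simp: PiE_iff)

lemma coords_unique:
  assumes "is_basis R M B" "a \<in> B \<rightarrow> carrier R" "b \<in> B"
  shows "coords R M B (lincomb M B a) b = a b"
proof -
  have B: "B \<subseteq> carrier M" using assms unfolding is_basis_def by auto
  let ?x = "lincomb M B a"
  have x: "?x \<in> carrier M" using lincomb_closed[OF B] assms by auto
  have "?x = lincomb M B (restrict a B)" "restrict a B \<in> B \<rightarrow>\<^sub>E carrier R"
    using lincomb_cong[OF B assms(2), of "restrict a B"] assms by auto
  moreover have "\<exists>!c. c \<in> B \<rightarrow>\<^sub>E carrier R \<and> ?x = lincomb M B c"
    using assms(1) x unfolding is_basis_def lincomb_def by blast
  ultimately have "coords R M B ?x = restrict a B" using coords[OF assms(1) x] by metis
  then show ?thesis using assms by simp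
qed

lemma coords_add:
  assumes "is_basis R M B" "x \<in> carrier M" "y \<in> carrier M" "b \<in> B"
  shows "coords R M B (x \<oplus>\<^bsub>M\<^esub> y) b = coords R M B x b \<oplus> coords R M B y b"
proof -
  have B: "B \<subseteq> carrier M" using assms unfolding is_basis_def by auto
  have a: "coords R M B x \<in> B \<rightarrow> carrier R" "coords R M B y \<in> B \<rightarrow> carrier R"
    using coords(1) assms by (auto simp: PiE_iff)
  have "lincomb M B (\<lambda>b. coords R M B x b \<oplus> coords R M B y b) = x \<oplus>\<^bsub>M\<^esub> y"
    using lincomb_add[OF B a] coords(2)[OF assms(1)] assms(2,3) by simp
  then show ?thesis
    using coords_unique[OF assms(1), of "\<lambda>b. coords R M B x b \<oplus> coords R M B y b" b] a assms(4) by auto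
qed

lemma coords_smult:
  assumes "is_basis R M B" "x \<in> carrier M" "r \<in> carrier R" "b \<in> B"
  shows "coords R M B (r \<odot>\<^bsub>M\<^esub> x) b = r \<otimes> coords R M B x b"
proof -
  have B: "finite B" "B \<subseteq> carrier M" using assms unfolding is_basis_def by auto
  have a: "coords R M B x \<in> B \<rightarrow> carrier R"
    using coords(1) assms by (auto simp: PiE_iff)
  have "lincomb M B (\<lambda>b. r \<otimes> coords R M B x b) = r \<odot>\<^bsub>M\<^esub> x"
    using lincomb_smult[OF B a assms(3)] coords(2)[OF assms(1,2)] by simp
  then show ?thesis
    using coords_unique[OF assms(1), of "\<lambda>b. r \<otimes> coords R M B x b" b] a assms by auto
qed

lemma coords_basis:
  assumes "is_basis R M B" "b \<in> B" "c \<in> B"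
  shows "coords R M B b c = (if c = b then \<one> else \<zero>)"
proof -
  have B: "finite B" "B \<subseteq> carrier M" using assms unfolding is_basis_def by auto
  let ?a = "\<lambda>c. if c = b then \<one> else \<zero>"
  have "lincomb M (B - {b}) ?a = \<zero>\<^bsub>M\<^esub>"
    unfolding lincomb_def using B by (intro M.add.finprod_one_eqI) auto
  moreover have "b \<in> carrier M" using B assms by auto
  ultimately have "lincomb M B ?a = b"
    using lincomb_insert[of "B - {b}" b ?a] B assms by (auto simp: insert_absorb)
  then show ?thesis using coords_unique[OF assms(1), of ?a c] assms by auto
qed

lemma coords_eqI:
  assumes "is_basis R M B" "x \<in> carrier M" "y \<in> carrier M"
    and "\<And>b. b \<in> B \<Longrightarrow> coords R M B x b = coords R M B y b"
  shows "x = y"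
  using coords[OF assms(1)] assms by (metis PiE_ext)

end

text \<open>
  Transport coordinates along \<open>\<phi>\<close> and a bijection between the bases.
\<close>
lemma semilinear_iso_of_bases:
  assumes "left_module R M" "left_module S N" and \<phi>: "\<phi> \<in> ring_iso R S"
    and B: "is_basis R M B" and C: "is_basis S N C" and card: "card B = card C"
  shows "\<exists>f. semilinear_iso R \<phi> M N f"
proof -
  interpret M: left_module R M by fact
  interpret N: left_module S N by fact
  have \<phi>h: "\<phi> \<in> ring_hom R S" and \<phi>b: "bij_betw \<phi> (carrier R) (carrier S)"
    using \<phi> unfolding ring_iso_def by auto
  have fin: "finite B" "B \<subseteq> carrier M" "finite C" "C \<subseteq> carrier N"
    using B C unfolding is_basis_def by auto
  then obtain \<beta> where \<beta>: "bij_betw \<beta> C B" using finite_same_card_bij card by metis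
  have \<beta>B: "\<beta> c \<in> B" if "c \<in> C" for c using \<beta> that bij_betwE by blast
  define f where "f x = lincomb N C (\<lambda>c. \<phi> (coords R M B x (\<beta> c)))" for x
  have \<phi>c: "\<phi> r \<in> carrier S" if "r \<in> carrier R" for r using \<phi>h that ring_hom_closed by metis
  have P: "(\<lambda>c. \<phi> (coords R M B x (\<beta> c))) \<in> C \<rightarrow> carrier S" if "x \<in> carrier M" for x
    using M.coords_closed[OF B that] \<beta>B \<phi>c by auto
  have fcl: "f x \<in> carrier N" if "x \<in> carrier M" for x
    unfolding f_def using P[OF that] fin by (intro N.lincomb_closed) auto
  have fco: "coords S N C (f x) c = \<phi> (coords R M B x (\<beta> c))" if "x \<in> carrier M" "c \<in> C" for x c
    unfolding f_def using N.coords_unique[OF C P[OF that(1)] that(2)] by simp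
  have "inj_on f (carrier M)"
  proof (rule inj_onI)
    fix x y assume xy: "x \<in> carrier M" "y \<in> carrier M" "f x = f y"
    show "x = y"
    proof (rule M.coords_eqI[OF B xy(1,2)])
      fix b assume "b \<in> B"
      then obtain c where c: "c \<in> C" "b = \<beta> c" using \<beta> by (auto simp: bij_betw_def)
      then have "\<phi> (coords R M B x b) = \<phi> (coords R M B y b)" using fco xy by metis
      then show "coords R M B x b = coords R M B y b"
        using M.coords_closed[OF B] xy \<open>b \<in> B\<close> \<phi>b by (metis bij_betw_def inj_on_eq_iff)
    qed
  qed
  moreover have "y \<in> f ` carrier M" if y: "y \<in> carrier N" for y
  proof -
    define a where "a b = inv_into (carrier R) \<phi> (coords S N C y (inv_into C \<beta> b))" for b
    have inv: "inv_into C \<beta> b \<in> C" if "b \<in> B" for b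
      using that \<beta> by (metis bij_betw_def inv_into_into)
    have a: "a b \<in> carrier R" "\<phi> (a b) = coords S N C y (inv_into C \<beta> b)" if "b \<in> B" for b
      using N.coords_closed[OF C y inv[OF that]] \<phi>b unfolding a_def
      by (simp_all add: bij_betw_def inv_into_into f_inv_into_f)
    have x: "lincomb M B a \<in> carrier M" using a fin by (intro M.lincomb_closed) auto
    have "f (lincomb M B a) = y"
    proof (rule N.coords_eqI[OF C fcl[OF x] y])
      fix c assume c: "c \<in> C"
      have "coords R M B (lincomb M B a) (\<beta> c) = a (\<beta> c)"
        using M.coords_unique[OF B, of a] a \<beta>B c by auto
      moreover have "inv_into C \<beta> (\<beta> c) = c" using \<beta> c by (simp add: bij_betw_def)
      ultimately show "coords S N C (f (lincomb M B a)) c = coords S N C y c"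
        using fco[OF x c] a(2)[OF \<beta>B[OF c]] by simp
    qed
    then show ?thesis using x by blast
  qed
  ultimately have "bij_betw f (carrier M) (carrier N)" using fcl by (auto simp: bij_betw_def)
  moreover have "f (x \<oplus>\<^bsub>M\<^esub> y) = f x \<oplus>\<^bsub>N\<^esub> f y" if xy: "x \<in> carrier M" "y \<in> carrier M" for x y
  proof (rule N.coords_eqI[OF C])
    fix c assume c: "c \<in> C"
    show "coords S N C (f (x \<oplus>\<^bsub>M\<^esub> y)) c = coords S N C (f x \<oplus>\<^bsub>N\<^esub> f y) c"
      using xy c \<beta>B fcl
      by (simp add: N.coords_add[OF C] fco M.coords_add[OF B] ring_hom_add[OF \<phi>h] M.coords_closed[OF B])
  qed (use xy fcl in auto)
  moreover have "f (r \<odot>\<^bsub>M\<^esub> x) = \<phi> r \<odot>\<^bsub>N\<^esub> f x" if xr: "x \<in> carrier M" "r \<in> carrier R" for x r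
  proof (rule N.coords_eqI[OF C])
    fix c assume c: "c \<in> C"
    show "coords S N C (f (r \<odot>\<^bsub>M\<^esub> x)) c = coords S N C (\<phi> r \<odot>\<^bsub>N\<^esub> f x) c"
      using xr c \<beta>B fcl \<phi>c
      by (simp add: N.coords_smult[OF C] fco M.coords_smult[OF B] ring_hom_mult[OF \<phi>h] M.coords_closed[OF B])
  qed (use xr fcl \<phi>c in auto)
  ultimately show ?thesis unfolding semilinear_iso_def by blast
qed

section \<open>The fundamental theorem of projective geometry\<close>

text \<open>
  A bijection between the points of two projective spaces is given by a relation \<open>\<rho>\<close> between nonzero
  representing vectors that is stable under scaling on both sides, which avoids choosing
  representatives.  Linear subspaces correspond to each other through membership.
\<close>
locale collineation =
  W: left_vector_space D W + W': left_vector_space D' W'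
  for D :: "('d, 'y) ring_scheme" and W :: "('d, 'v) module"
    and D' :: "('e, 'z) ring_scheme" and W' :: "('e, 'w) module" +
  fixes \<rho> :: "'v \<Rightarrow> 'w \<Rightarrow> bool"
  assumes rel_carrier: "\<rho> x y \<Longrightarrow> x \<in> carrier W - {\<zero>\<^bsub>W\<^esub>} \<and> y \<in> carrier W' - {\<zero>\<^bsub>W'\<^esub>}"
    and rel_total: "x \<in> carrier W - {\<zero>\<^bsub>W\<^esub>} \<Longrightarrow> \<exists>y. \<rho> x y"
    and rel_surj: "y \<in> carrier W' - {\<zero>\<^bsub>W'\<^esub>} \<Longrightarrow> \<exists>x. \<rho> x y"
    and submodule_image: "submodule U D W \<Longrightarrow> \<exists>U'. submodule U' D' W' \<and> (\<forall>x y. \<rho> x y \<longrightarrow> (x \<in> U \<longleftrightarrow> y \<in> U'))"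
    and submodule_preimage: "submodule U' D' W' \<Longrightarrow> \<exists>U. submodule U D W \<and> (\<forall>x y. \<rho> x y \<longrightarrow> (x \<in> U \<longleftrightarrow> y \<in> U'))"
    and rel_smult: "\<rho> x y \<Longrightarrow> c \<in> carrier D' - {\<zero>\<^bsub>D'\<^esub>} \<Longrightarrow> \<rho> x (c \<odot>\<^bsub>W'\<^esub> y)"
    and rel_smult_left: "\<rho> x y \<Longrightarrow> a \<in> carrier D - {\<zero>\<^bsub>D\<^esub>} \<Longrightarrow> \<rho> (a \<odot>\<^bsub>W\<^esub> x) y"
begin

text \<open>
  \<open>span T\<close> is the least submodule containing \<open>T\<close>, a notion that survives a correspondence of
  submodules.
\<close>
lemma rel_span:
  assumes "\<rho> x y"
    and "\<And>u. u \<in> T \<Longrightarrow> \<exists>u'\<in>T'. \<rho> u u'" "\<And>u'. u' \<in> T' \<Longrightarrow> \<exists>u\<in>T. \<rho> u u'"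
  shows "x \<in> span D W T \<longleftrightarrow> y \<in> span D' W' T'"
proof
  have T: "T \<subseteq> carrier W" "T' \<subseteq> carrier W'" using assms rel_carrier by blast+
  {
    assume x: "x \<in> span D W T"
    obtain U where U: "submodule U D W" "\<And>x y. \<rho> x y \<Longrightarrow> x \<in> U \<longleftrightarrow> y \<in> span D' W' T'"
      using submodule_preimage[OF W'.span_submodule[OF T(2)]] by blast
    have "T \<subseteq> U" using U(2) assms(2) W'.span_superset[of T'] by blast
    then show "y \<in> span D' W' T'" using W.span_least[OF U(1)] x U(2)[OF assms(1)] by blast
  next
    assume y: "y \<in> span D' W' T'"
    obtain U where U: "submodule U D' W'" "\<And>x y. \<rho> x y \<Longrightarrow> x \<in> span D W T \<longleftrightarrow> y \<in> U"
      using submodule_image[OF W.span_submodule[OF T(1)]] by blast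
    have "T' \<subseteq> U" using U(2) assms(3) W.span_superset[of T] by blast
    then show "x \<in> span D W T" using W'.span_least[OF U(1)] y U(2)[OF assms(1)] by blast
  }
qed

lemma basis_image:
  assumes "is_basis D W B"
  shows "\<exists>h. inj_on h B \<and> (\<forall>b\<in>B. \<rho> b (h b)) \<and> is_basis D' W' (h ` B)"
proof -
  have B: "finite B" "B \<subseteq> carrier W" "independent D W B" "span D W B = carrier W"
    using assms W.is_basis_iff by auto
  have "\<forall>b\<in>B. \<exists>y. \<rho> b y" using rel_total W.independent_nonzero[OF B(3,2)] B(2) by blast
  then obtain h where h: "\<And>b. b \<in> B \<Longrightarrow> \<rho> b (h b)" by metis
  have inj: "inj_on h B"
  proof (rule inj_onI, rule ccontr)
    fix b c assume bc: "b \<in> B" "c \<in> B" "h b = h c" "b \<noteq> c"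
    have "\<rho> b (h c)" using h[OF bc(1)] bc(3) by simp
    then have "b \<in> span D W {c} \<longleftrightarrow> h c \<in> span D' W' {h c}" using h[OF bc(2)] by (intro rel_span) auto
    then have "b \<in> span D W {c}" using bc W'.span_superset[of "{h c}"] by auto
    then show False using W.span_mono[of "{c}" "B - {b}"] bc B(3) unfolding independent_def by auto
  qed
  have hB: "h ` B \<subseteq> carrier W'" using h rel_carrier by blast
  have "h b \<notin> span D' W' (h ` B - {h b})" if b: "b \<in> B" for b
  proof -
    have "h ` B - {h b} = h ` (B - {b})" using inj b by (auto simp: inj_on_def)
    moreover have "b \<in> span D W (B - {b}) \<longleftrightarrow> h b \<in> span D' W' (h ` (B - {b}))"
      using h b by (intro rel_span) auto
    ultimately show ?thesis using B(3) b unfolding independent_def by simp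
  qed
  then have "independent D' W' (h ` B)" unfolding independent_def by blast
  moreover have "y \<in> span D' W' (h ` B)" if y: "y \<in> carrier W'" for y
  proof (cases "y = \<zero>\<^bsub>W'\<^esub>")
    case True
    then show ?thesis using W'.submoduleD(2)[OF W'.span_submodule[OF hB]] by simp
  next
    case False
    then obtain x where x: "\<rho> x y" using rel_surj y by blast
    have "x \<in> span D W B \<longleftrightarrow> y \<in> span D' W' (h ` B)" using x h by (intro rel_span) auto
    then show ?thesis using rel_carrier[OF x] B(4) by auto
  qed
  ultimately have "is_basis D' W' (h ` B)"
    using W'.is_basis_iff B(1) hB W'.span_carrier[OF hB] by auto
  then show ?thesis using inj h by blast
qed

end

text \<open>
  Three independent vectors, used as a coordinate frame: identities between vectors of the plane
  they span become identities in \<open>R\<close>.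
\<close>
locale framed = left_vector_space +
  fixes e0 e1 e2
  assumes frame_closed [simp, intro]: "e0 \<in> carrier M" "e1 \<in> carrier M" "e2 \<in> carrier M"
    and frame_eq: "\<lbrakk>a \<in> carrier R; b \<in> carrier R; c \<in> carrier R;
        a' \<in> carrier R; b' \<in> carrier R; c' \<in> carrier R;
        a \<odot>\<^bsub>M\<^esub> e0 \<oplus>\<^bsub>M\<^esub> b \<odot>\<^bsub>M\<^esub> e1 \<oplus>\<^bsub>M\<^esub> c \<odot>\<^bsub>M\<^esub> e2 =
        a' \<odot>\<^bsub>M\<^esub> e0 \<oplus>\<^bsub>M\<^esub> b' \<odot>\<^bsub>M\<^esub> e1 \<oplus>\<^bsub>M\<^esub> c' \<odot>\<^bsub>M\<^esub> e2\<rbrakk> \<Longrightarrow> a = a' \<and> b = b' \<and> c = c'"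
begin

definition vec where "vec a b c = a \<odot>\<^bsub>M\<^esub> e0 \<oplus>\<^bsub>M\<^esub> b \<odot>\<^bsub>M\<^esub> e1 \<oplus>\<^bsub>M\<^esub> c \<odot>\<^bsub>M\<^esub> e2"

lemma vec_closed [simp, intro]:
  "\<lbrakk>a \<in> carrier R; b \<in> carrier R; c \<in> carrier R\<rbrakk> \<Longrightarrow> vec a b c \<in> carrier M"
  unfolding vec_def by auto

lemma vec_eq_iff:
  "\<lbrakk>a \<in> carrier R; b \<in> carrier R; c \<in> carrier R; a' \<in> carrier R; b' \<in> carrier R; c' \<in> carrier R\<rbrakk> \<Longrightarrow>
    vec a b c = vec a' b' c' \<longleftrightarrow> a = a' \<and> b = b' \<and> c = c'"
  unfolding vec_def using frame_eq by blast

lemma vec_add: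
  "\<lbrakk>a \<in> carrier R; b \<in> carrier R; c \<in> carrier R; a' \<in> carrier R; b' \<in> carrier R; c' \<in> carrier R\<rbrakk> \<Longrightarrow>
    vec a b c \<oplus>\<^bsub>M\<^esub> vec a' b' c' = vec (a \<oplus> a') (b \<oplus> b') (c \<oplus> c')"
  unfolding vec_def by (simp add: smult_l_distr M.a_ac)

lemma vec_smult:
  "\<lbrakk>r \<in> carrier R; a \<in> carrier R; b \<in> carrier R; c \<in> carrier R\<rbrakk> \<Longrightarrow>
    r \<odot>\<^bsub>M\<^esub> vec a b c = vec (r \<otimes> a) (r \<otimes> b) (r \<otimes> c)"
  unfolding vec_def by (simp add: smult_r_distr smult_assoc)

lemma vec_zero: "vec \<zero> \<zero> \<zero> = \<zero>\<^bsub>M\<^esub>"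
  unfolding vec_def by simp

lemma vec_nonzero:
  "\<lbrakk>a \<in> carrier R; b \<in> carrier R; c \<in> carrier R\<rbrakk> \<Longrightarrow>
    vec a b c \<in> carrier M - {\<zero>\<^bsub>M\<^esub>} \<longleftrightarrow> a \<noteq> \<zero> \<or> b \<noteq> \<zero> \<or> c \<noteq> \<zero>"
  using vec_eq_iff[of a b c \<zero> \<zero> \<zero>] vec_zero by auto

lemma vec_frame: "vec \<one> \<zero> \<zero> = e0" "vec \<zero> \<one> \<zero> = e1" "vec \<zero> \<zero> \<one> = e2"
  unfolding vec_def by auto

lemma vec_in_span_pair:
  assumes "a \<in> carrier R" "b \<in> carrier R" "c \<in> carrier R" "a' \<in> carrier R" "b' \<in> carrier R" "c' \<in> carrier R"
  shows "x \<in> span R M {vec a b c, vec a' b' c'} \<longleftrightarrow>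
    (\<exists>r\<in>carrier R. \<exists>s\<in>carrier R. x = vec (r \<otimes> a \<oplus> s \<otimes> a') (r \<otimes> b \<oplus> s \<otimes> b') (r \<otimes> c \<oplus> s \<otimes> c'))"
  using assms by (force simp: span_pair vec_smult vec_add)

lemma vec_in_span_singleton:
  assumes "a \<in> carrier R" "b \<in> carrier R" "c \<in> carrier R"
  shows "x \<in> span R M {vec a b c} \<longleftrightarrow> (\<exists>r\<in>carrier R. x = vec (r \<otimes> a) (r \<otimes> b) (r \<otimes> c))"
  using assms by (force simp: span_singleton vec_smult)

lemma in_span_frame_pair:
  "x \<in> span R M {e0, e1} \<longleftrightarrow> (\<exists>r\<in>carrier R. \<exists>s\<in>carrier R. x = vec r s \<zero>)"
proof -
  have "vec r s \<zero> = r \<odot>\<^bsub>M\<^esub> e0 \<oplus>\<^bsub>M\<^esub> s \<odot>\<^bsub>M\<^esub> e1" if "r \<in> carrier R" "s \<in> carrier R" for r s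
    using that unfolding vec_def by simp
  then show ?thesis unfolding span_pair[OF frame_closed(1,2)] mem_Collect_eq by metis
qed

lemma in_span_frame_singleton:
  "x \<in> span R M {e1} \<longleftrightarrow> (\<exists>s\<in>carrier R. x = vec \<zero> s \<zero>)"
proof -
  have "vec \<zero> s \<zero> = s \<odot>\<^bsub>M\<^esub> e1" if "s \<in> carrier R" for s
    using that unfolding vec_def by simp
  then show ?thesis unfolding span_singleton[OF frame_closed(2)] mem_Collect_eq by metis
qed

lemma framed_swap: "framed R M e0 e2 e1"
  proof
    fix a b c a' b' c'
    assume *: "a \<in> carrier R" "b \<in> carrier R" "c \<in> carrier R" "a' \<in> carrier R" "b' \<in> carrier R" "c' \<in> carrier R"
      "a \<odot>\<^bsub>M\<^esub> e0 \<oplus>\<^bsub>M\<^esub> b \<odot>\<^bsub>M\<^esub> e2 \<oplus>\<^bsub>M\<^esub> c \<odot>\<^bsub>M\<^esub> e1 = a' \<odot>\<^bsub>M\<^esub> e0 \<oplus>\<^bsub>M\<^esub> b' \<odot>\<^bsub>M\<^esub> e2 \<oplus>\<^bsub>M\<^esub> c' \<odot>\<^bsub>M\<^esub> e1"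
    show "a = a' \<and> b = b' \<and> c = c'"
      using frame_eq[of a c b a' c' b'] * by (simp add: M.a_ac)
  qed auto

lemma vec_swap:
  "\<lbrakk>a \<in> carrier R; b \<in> carrier R; c \<in> carrier R\<rbrakk> \<Longrightarrow> framed.vec M e0 e2 e1 a b c = vec a c b"
  unfolding framed.vec_def[OF framed_swap] vec_def by (simp add: M.a_ac)

end

text \<open>
  The frames correspond, and so do the unit points \<open>e0 + e1\<close> and \<open>e0 + e2\<close>; the latter fixes the
  scaling of \<open>f1\<close> and \<open>f2\<close> relative to \<open>f0\<close>.
\<close>
locale frame_collineation = collineation + E: framed D W e0 e1 e2 + F: framed D' W' f0 f1 f2
  for e0 e1 e2 f0 f1 f2 +
  assumes frame_rel: "\<rho> e0 f0" "\<rho> e1 f1" "\<rho> e2 f2"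
    and unit_rel: "\<rho> (e0 \<oplus>\<^bsub>W\<^esub> e1) (f0 \<oplus>\<^bsub>W'\<^esub> f1)" "\<rho> (e0 \<oplus>\<^bsub>W\<^esub> e2) (f0 \<oplus>\<^bsub>W'\<^esub> f2)"
begin

lemma rel_span_pair:
  "\<rho> x y \<Longrightarrow> \<rho> u u' \<Longrightarrow> \<rho> v v' \<Longrightarrow> x \<in> span D W {u, v} \<longleftrightarrow> y \<in> span D' W' {u', v'}"
  by (rule rel_span) auto

lemma rel_span_singleton:
  "\<rho> x y \<Longrightarrow> \<rho> u u' \<Longrightarrow> x \<in> span D W {u} \<longleftrightarrow> y \<in> span D' W' {u'}"
  by (rule rel_span) auto

lemma rel_normalize:
  assumes "\<rho> x (F.vec r (r \<otimes>\<^bsub>D'\<^esub> b) (r \<otimes>\<^bsub>D'\<^esub> c))" "r \<in> carrier D'" "r \<noteq> \<zero>\<^bsub>D'\<^esub>" "b \<in> carrier D'" "c \<in> carrier D'"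
  shows "\<rho> x (F.vec \<one>\<^bsub>D'\<^esub> b c)"
proof -
  have r: "r \<in> Units D'" using assms W'.nonzero_Units by auto
  then have "inv\<^bsub>D'\<^esub> r \<in> Units D'" by auto
  then have "inv\<^bsub>D'\<^esub> r \<in> carrier D' - {\<zero>\<^bsub>D'\<^esub>}" using W'.nonzero_Units by blast
  then have "\<rho> x (inv\<^bsub>D'\<^esub> r \<odot>\<^bsub>W'\<^esub> F.vec r (r \<otimes>\<^bsub>D'\<^esub> b) (r \<otimes>\<^bsub>D'\<^esub> c))" by (rule rel_smult[OF assms(1)])
  then show ?thesis using assms r by (simp add: F.vec_smult W'.R.m_assoc[symmetric])
qed

text \<open>
  The point \<open>\<langle>e0 + a e1\<rangle>\<close> lies on the line through \<open>e0\<close> and \<open>e1\<close> and differs from \<open>\<langle>e1\<rangle>\<close>, so its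
  image has a representative \<open>f0 + c f1\<close>, and \<open>c\<close> is determined by the point.
\<close>
lemma affine_coordinate:
  assumes a: "a \<in> carrier D"
  shows "\<exists>!c. c \<in> carrier D' \<and> \<rho> (E.vec \<one>\<^bsub>D\<^esub> a \<zero>\<^bsub>D\<^esub>) (F.vec \<one>\<^bsub>D'\<^esub> c \<zero>\<^bsub>D'\<^esub>)"
proof -
  have x: "E.vec \<one>\<^bsub>D\<^esub> a \<zero>\<^bsub>D\<^esub> \<in> carrier W - {\<zero>\<^bsub>W\<^esub>}" using a W.one_neq_zero by (subst E.vec_nonzero) auto
  then obtain y where y: "\<rho> (E.vec \<one>\<^bsub>D\<^esub> a \<zero>\<^bsub>D\<^esub>) y" using rel_total by blast
  have "E.vec \<one>\<^bsub>D\<^esub> a \<zero>\<^bsub>D\<^esub> \<in> span D W {e0, e1}"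
    using a by (auto simp: E.in_span_frame_pair)
  then have "y \<in> span D' W' {f0, f1}" using rel_span_pair[OF y frame_rel(1,2)] by simp
  then obtain r s where rs: "r \<in> carrier D'" "s \<in> carrier D'" "y = F.vec r s \<zero>\<^bsub>D'\<^esub>"
    by (auto simp: F.in_span_frame_pair)
  have r0: "r \<noteq> \<zero>\<^bsub>D'\<^esub>"
  proof
    assume "r = \<zero>\<^bsub>D'\<^esub>"
    then have "y \<in> span D' W' {f1}" using rs by (auto simp: F.in_span_frame_singleton)
    then have "E.vec \<one>\<^bsub>D\<^esub> a \<zero>\<^bsub>D\<^esub> \<in> span D W {e1}" using rel_span_singleton[OF y frame_rel(2)] by simp
    then show False using a W.one_neq_zero
      by (auto simp: E.in_span_frame_singleton E.vec_eq_iff)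
  qed
  then obtain t where t: "t \<in> carrier D'" "r \<otimes>\<^bsub>D'\<^esub> t = s"
    using W'.R.m_assoc[of r "inv\<^bsub>D'\<^esub> r" s] rs W'.nonzero_Units
    by (metis Diff_iff W'.R.Units_inv_closed W'.R.Units_r_inv W'.R.l_one W'.R.m_closed singletonD)
  have "\<rho> (E.vec \<one>\<^bsub>D\<^esub> a \<zero>\<^bsub>D\<^esub>) (F.vec \<one>\<^bsub>D'\<^esub> t \<zero>\<^bsub>D'\<^esub>)"
    using y rs t r0 by (intro rel_normalize[of _ r]) auto
  moreover have "c = d"
    if cd: "c \<in> carrier D'" "d \<in> carrier D'"
      "\<rho> (E.vec \<one>\<^bsub>D\<^esub> a \<zero>\<^bsub>D\<^esub>) (F.vec \<one>\<^bsub>D'\<^esub> c \<zero>\<^bsub>D'\<^esub>)" "\<rho> (E.vec \<one>\<^bsub>D\<^esub> a \<zero>\<^bsub>D\<^esub>) (F.vec \<one>\<^bsub>D'\<^esub> d \<zero>\<^bsub>D'\<^esub>)" for c d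
  proof -
    have "F.vec \<one>\<^bsub>D'\<^esub> c \<zero>\<^bsub>D'\<^esub> \<in> span D' W' {F.vec \<one>\<^bsub>D'\<^esub> d \<zero>\<^bsub>D'\<^esub>}"
      using rel_span_singleton[OF cd(3,4)] W.span_superset by blast
    then show ?thesis using cd(1,2) by (subst (asm) F.vec_in_span_singleton) (auto simp: F.vec_eq_iff)
  qed
  ultimately show ?thesis using t(1) by blast
qed

definition \<phi> where
  "\<phi> a = (THE c. c \<in> carrier D' \<and> \<rho> (E.vec \<one>\<^bsub>D\<^esub> a \<zero>\<^bsub>D\<^esub>) (F.vec \<one>\<^bsub>D'\<^esub> c \<zero>\<^bsub>D'\<^esub>))"

lemma phi:
  assumes "a \<in> carrier D"
  shows "\<phi> a \<in> carrier D'" "\<rho> (E.vec \<one>\<^bsub>D\<^esub> a \<zero>\<^bsub>D\<^esub>) (F.vec \<one>\<^bsub>D'\<^esub> (\<phi> a) \<zero>\<^bsub>D'\<^esub>)"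
  using theI'[OF affine_coordinate[OF assms]] unfolding \<phi>_def by auto

lemma phi_eqI:
  "\<lbrakk>a \<in> carrier D; c \<in> carrier D'; \<rho> (E.vec \<one>\<^bsub>D\<^esub> a \<zero>\<^bsub>D\<^esub>) (F.vec \<one>\<^bsub>D'\<^esub> c \<zero>\<^bsub>D'\<^esub>)\<rbrakk> \<Longrightarrow> \<phi> a = c"
  using affine_coordinate[of a] phi[of a] by blast

lemma phi_one: "\<phi> \<one>\<^bsub>D\<^esub> = \<one>\<^bsub>D'\<^esub>"
  using unit_rel(1) by (intro phi_eqI) (auto simp: E.vec_def F.vec_def)

text \<open>
  The points \<open>\<langle>e0 + a e1\<rangle>\<close> are all the points of their line except \<open>\<langle>e1\<rangle>\<close>, and the same holds for
  the images.
\<close>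
lemma phi_bij: "bij_betw \<phi> (carrier D) (carrier D')"
  unfolding bij_betw_def
proof
  show "inj_on \<phi> (carrier D)"
  proof (rule inj_onI)
    fix a b assume ab: "a \<in> carrier D" "b \<in> carrier D" "\<phi> a = \<phi> b"
    then have "E.vec \<one>\<^bsub>D\<^esub> a \<zero>\<^bsub>D\<^esub> \<in> span D W {E.vec \<one>\<^bsub>D\<^esub> b \<zero>\<^bsub>D\<^esub>}"
      using rel_span_singleton[OF phi(2) phi(2), of a b] W'.span_superset by auto
    then show "a = b" using ab(1,2) by (subst (asm) E.vec_in_span_singleton) (auto simp: E.vec_eq_iff)
  qed
  have "c \<in> \<phi> ` carrier D" if c: "c \<in> carrier D'" for c
  proof -
    have "F.vec \<one>\<^bsub>D'\<^esub> c \<zero>\<^bsub>D'\<^esub> \<in> carrier W' - {\<zero>\<^bsub>W'\<^esub>}" using c W'.one_neq_zero by (subst F.vec_nonzero) auto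
    then obtain x where x: "\<rho> x (F.vec \<one>\<^bsub>D'\<^esub> c \<zero>\<^bsub>D'\<^esub>)" using rel_surj by blast
    have "F.vec \<one>\<^bsub>D'\<^esub> c \<zero>\<^bsub>D'\<^esub> \<in> span D' W' {f0, f1}"
      using c by (auto simp: F.in_span_frame_pair)
    then have "x \<in> span D W {e0, e1}" using rel_span_pair[OF x frame_rel(1,2)] by simp
    then obtain r s where rs: "r \<in> carrier D" "s \<in> carrier D" "x = E.vec r s \<zero>\<^bsub>D\<^esub>"
      by (auto simp: E.in_span_frame_pair)
    have r0: "r \<noteq> \<zero>\<^bsub>D\<^esub>"
    proof
      assume "r = \<zero>\<^bsub>D\<^esub>"
      then have "x \<in> span D W {e1}" using rs by (auto simp: E.in_span_frame_singleton)
      then have "F.vec \<one>\<^bsub>D'\<^esub> c \<zero>\<^bsub>D'\<^esub> \<in> span D' W' {f1}" using rel_span_singleton[OF x frame_rel(2)] by simp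
      then show False using c W'.one_neq_zero
        by (auto simp: F.in_span_frame_singleton F.vec_eq_iff)
    qed
    then have u: "r \<in> Units D" using rs W.nonzero_Units by auto
    then have "inv\<^bsub>D\<^esub> r \<in> Units D" by auto
    then have iu: "inv\<^bsub>D\<^esub> r \<in> carrier D - {\<zero>\<^bsub>D\<^esub>}" using W.nonzero_Units by blast
    have "\<rho> (E.vec \<one>\<^bsub>D\<^esub> (inv\<^bsub>D\<^esub> r \<otimes>\<^bsub>D\<^esub> s) \<zero>\<^bsub>D\<^esub>) (F.vec \<one>\<^bsub>D'\<^esub> c \<zero>\<^bsub>D'\<^esub>)"
      using rel_smult_left[OF x iu] rs u by (simp add: E.vec_smult)
    then have "\<phi> (inv\<^bsub>D\<^esub> r \<otimes>\<^bsub>D\<^esub> s) = c" using u rs c by (intro phi_eqI) auto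
    then show ?thesis using u rs by blast
  qed
  then show "\<phi> ` carrier D = carrier D'" using phi(1) by auto
qed

lemma frame_swap: "frame_collineation D W D' W' \<rho> e0 e2 e1 f0 f2 f1"
  using frame_rel unit_rel collineation_axioms E.framed_swap F.framed_swap
  by (intro frame_collineation.intro frame_collineation_axioms.intro)

text \<open>
  Here \<open>\<psi>\<close> is the coordinate map on the second axis.  The point \<open>\<langle>e0 + a e1 + b e2\<rangle>\<close> is the intersection
  of the lines joining \<open>e0 + a e1\<close> to \<open>e2\<close> and \<open>e0 + b e2\<close> to \<open>e1\<close>; the point \<open>\<langle>a e1 + b e2\<rangle>\<close> at
  infinity is the intersection of the line joining it to \<open>e0\<close> with the line through \<open>e1\<close> and \<open>e2\<close>.
\<close>
lemma plane_and_infinity: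
  obtains \<psi> where "\<And>a. a \<in> carrier D \<Longrightarrow> \<psi> a \<in> carrier D'" "\<psi> \<one>\<^bsub>D\<^esub> = \<one>\<^bsub>D'\<^esub>"
    and "\<And>a b. \<lbrakk>a \<in> carrier D; b \<in> carrier D\<rbrakk> \<Longrightarrow>
          \<rho> (E.vec \<one>\<^bsub>D\<^esub> a b) (F.vec \<one>\<^bsub>D'\<^esub> (\<phi> a) (\<psi> b))"
    and "\<And>a b. \<lbrakk>a \<in> carrier D; b \<in> carrier D; a \<noteq> \<zero>\<^bsub>D\<^esub> \<or> b \<noteq> \<zero>\<^bsub>D\<^esub>\<rbrakk> \<Longrightarrow>
          \<rho> (E.vec \<zero>\<^bsub>D\<^esub> a b) (F.vec \<zero>\<^bsub>D'\<^esub> (\<phi> a) (\<psi> b))"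
proof -
  interpret S: frame_collineation D W D' W' \<rho> e0 e2 e1 f0 f2 f1 by (rule frame_swap)
  have \<psi>: "S.\<phi> b \<in> carrier D'" "\<rho> (E.vec \<one>\<^bsub>D\<^esub> \<zero>\<^bsub>D\<^esub> b) (F.vec \<one>\<^bsub>D'\<^esub> \<zero>\<^bsub>D'\<^esub> (S.\<phi> b))" if "b \<in> carrier D" for b
    using S.phi[OF that] that by (simp_all add: E.vec_swap F.vec_swap)
  have plane: "\<rho> (E.vec \<one>\<^bsub>D\<^esub> a b) (F.vec \<one>\<^bsub>D'\<^esub> (\<phi> a) (S.\<phi> b))"
    if ab: "a \<in> carrier D" "b \<in> carrier D" for a b
  proof -
    have "E.vec \<one>\<^bsub>D\<^esub> a b \<in> carrier W - {\<zero>\<^bsub>W\<^esub>}" using ab W.one_neq_zero by (subst E.vec_nonzero) auto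
    then obtain y where y: "\<rho> (E.vec \<one>\<^bsub>D\<^esub> a b) y" using rel_total by blast
    have "E.vec \<one>\<^bsub>D\<^esub> a b \<in> span D W {E.vec \<one>\<^bsub>D\<^esub> a \<zero>\<^bsub>D\<^esub>, E.vec \<zero>\<^bsub>D\<^esub> \<zero>\<^bsub>D\<^esub> \<one>\<^bsub>D\<^esub>}"
      using ab by (subst E.vec_in_span_pair, simp_all) (rule bexI[of _ "\<one>\<^bsub>D\<^esub>"], rule bexI[of _ b], simp_all)
    then have "y \<in> span D' W' {F.vec \<one>\<^bsub>D'\<^esub> (\<phi> a) \<zero>\<^bsub>D'\<^esub>, F.vec \<zero>\<^bsub>D'\<^esub> \<zero>\<^bsub>D'\<^esub> \<one>\<^bsub>D'\<^esub>}"
      using rel_span_pair[OF y phi(2)[OF ab(1)] frame_rel(3)] by (simp add: E.vec_frame F.vec_frame)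
    then obtain r s where rs: "r \<in> carrier D'" "s \<in> carrier D'" "y = F.vec r (r \<otimes>\<^bsub>D'\<^esub> \<phi> a) s"
      using phi(1)[OF ab(1)] by (subst (asm) F.vec_in_span_pair) auto
    have "E.vec \<one>\<^bsub>D\<^esub> a b \<in> span D W {E.vec \<one>\<^bsub>D\<^esub> \<zero>\<^bsub>D\<^esub> b, E.vec \<zero>\<^bsub>D\<^esub> \<one>\<^bsub>D\<^esub> \<zero>\<^bsub>D\<^esub>}"
      using ab by (subst E.vec_in_span_pair, simp_all) (rule bexI[of _ "\<one>\<^bsub>D\<^esub>"], rule bexI[of _ a], simp_all)
    then have "y \<in> span D' W' {F.vec \<one>\<^bsub>D'\<^esub> \<zero>\<^bsub>D'\<^esub> (S.\<phi> b), F.vec \<zero>\<^bsub>D'\<^esub> \<one>\<^bsub>D'\<^esub> \<zero>\<^bsub>D'\<^esub>}"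
      using rel_span_pair[OF y \<psi>(2)[OF ab(2)] frame_rel(2)] by (simp add: E.vec_frame F.vec_frame)
    then obtain r' s' where rs': "r' \<in> carrier D'" "s' \<in> carrier D'" "y = F.vec r' s' (r' \<otimes>\<^bsub>D'\<^esub> S.\<phi> b)"
      using \<psi>(1)[OF ab(2)] by (subst (asm) F.vec_in_span_pair) auto
    have "r = r'" "s = r \<otimes>\<^bsub>D'\<^esub> S.\<phi> b"
      using rs rs' phi(1)[OF ab(1)] \<psi>(1)[OF ab(2)] F.vec_eq_iff[of r "r \<otimes>\<^bsub>D'\<^esub> \<phi> a" s r' s' "r' \<otimes>\<^bsub>D'\<^esub> S.\<phi> b"] by auto
    then have y': "y = F.vec r (r \<otimes>\<^bsub>D'\<^esub> \<phi> a) (r \<otimes>\<^bsub>D'\<^esub> S.\<phi> b)" using rs by simp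
    have "y \<noteq> \<zero>\<^bsub>W'\<^esub>" using rel_carrier[OF y] by simp
    then have "r \<noteq> \<zero>\<^bsub>D'\<^esub>" using y' phi(1)[OF ab(1)] \<psi>(1)[OF ab(2)] F.vec_zero by auto
    then show ?thesis
      using y y' rs(1) phi(1)[OF ab(1)] \<psi>(1)[OF ab(2)] by (intro rel_normalize[of _ r]) auto
  qed
  have inf: "\<rho> (E.vec \<zero>\<^bsub>D\<^esub> a b) (F.vec \<zero>\<^bsub>D'\<^esub> (\<phi> a) (S.\<phi> b))"
    if ab: "a \<in> carrier D" "b \<in> carrier D" "a \<noteq> \<zero>\<^bsub>D\<^esub> \<or> b \<noteq> \<zero>\<^bsub>D\<^esub>" for a b
  proof -
    note c = phi(1)[OF ab(1)] \<psi>(1)[OF ab(2)]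
    have "E.vec \<zero>\<^bsub>D\<^esub> a b \<in> carrier W - {\<zero>\<^bsub>W\<^esub>}" using ab by (subst E.vec_nonzero) auto
    then obtain y where y: "\<rho> (E.vec \<zero>\<^bsub>D\<^esub> a b) y" using rel_total by blast
    have "E.vec \<zero>\<^bsub>D\<^esub> a b \<in> span D W {E.vec \<one>\<^bsub>D\<^esub> a b, E.vec \<one>\<^bsub>D\<^esub> \<zero>\<^bsub>D\<^esub> \<zero>\<^bsub>D\<^esub>}"
      using ab by (subst E.vec_in_span_pair, simp_all)
        (rule bexI[of _ "\<one>\<^bsub>D\<^esub>"], rule bexI[of _ "\<ominus>\<^bsub>D\<^esub> \<one>\<^bsub>D\<^esub>"], simp_all add: W.R.r_neg)
    then have "y \<in> span D' W' {F.vec \<one>\<^bsub>D'\<^esub> (\<phi> a) (S.\<phi> b), F.vec \<one>\<^bsub>D'\<^esub> \<zero>\<^bsub>D'\<^esub> \<zero>\<^bsub>D'\<^esub>}"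
      using rel_span_pair[OF y plane[OF ab(1,2)] frame_rel(1)] by (simp add: E.vec_frame F.vec_frame)
    then obtain r s where rs: "r \<in> carrier D'" "s \<in> carrier D'"
      "y = F.vec (r \<oplus>\<^bsub>D'\<^esub> s) (r \<otimes>\<^bsub>D'\<^esub> \<phi> a) (r \<otimes>\<^bsub>D'\<^esub> S.\<phi> b)"
      using c by (subst (asm) F.vec_in_span_pair) auto
    have "E.vec \<zero>\<^bsub>D\<^esub> a b \<in> span D W {E.vec \<zero>\<^bsub>D\<^esub> \<one>\<^bsub>D\<^esub> \<zero>\<^bsub>D\<^esub>, E.vec \<zero>\<^bsub>D\<^esub> \<zero>\<^bsub>D\<^esub> \<one>\<^bsub>D\<^esub>}"
      using ab by (subst E.vec_in_span_pair, simp_all) (rule bexI[of _ a], rule bexI[of _ b], simp_all)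
    then have "y \<in> span D' W' {F.vec \<zero>\<^bsub>D'\<^esub> \<one>\<^bsub>D'\<^esub> \<zero>\<^bsub>D'\<^esub>, F.vec \<zero>\<^bsub>D'\<^esub> \<zero>\<^bsub>D'\<^esub> \<one>\<^bsub>D'\<^esub>}"
      using rel_span_pair[OF y frame_rel(2,3)] by (simp add: E.vec_frame F.vec_frame)
    then obtain t u where tu: "t \<in> carrier D'" "u \<in> carrier D'" "y = F.vec \<zero>\<^bsub>D'\<^esub> t u"
      by (subst (asm) F.vec_in_span_pair) auto
    have y': "y = F.vec \<zero>\<^bsub>D'\<^esub> (r \<otimes>\<^bsub>D'\<^esub> \<phi> a) (r \<otimes>\<^bsub>D'\<^esub> S.\<phi> b)"
      using rs tu c F.vec_eq_iff[of "r \<oplus>\<^bsub>D'\<^esub> s" "r \<otimes>\<^bsub>D'\<^esub> \<phi> a" "r \<otimes>\<^bsub>D'\<^esub> S.\<phi> b" "\<zero>\<^bsub>D'\<^esub>" t u] by auto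
    have "y \<noteq> \<zero>\<^bsub>W'\<^esub>" using rel_carrier[OF y] by simp
    then have "r \<noteq> \<zero>\<^bsub>D'\<^esub>" using y' c F.vec_zero by auto
    then have r: "r \<in> Units D'" using rs W'.nonzero_Units by auto
    then have "inv\<^bsub>D'\<^esub> r \<in> Units D'" by auto
    then have "inv\<^bsub>D'\<^esub> r \<in> carrier D' - {\<zero>\<^bsub>D'\<^esub>}" using W'.nonzero_Units by blast
    then have "\<rho> (E.vec \<zero>\<^bsub>D\<^esub> a b) (inv\<^bsub>D'\<^esub> r \<odot>\<^bsub>W'\<^esub> y)" by (rule rel_smult[OF y])
    then show ?thesis using r rs(1) c unfolding y' by (simp add: F.vec_smult W'.R.m_assoc[symmetric])
  qed
  show thesis using that[of S.\<phi>] \<psi>(1) S.phi_one plane inf by blast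
qed

text \<open>
  Addition: \<open>e0 + (a + b) e1 + e2\<close> is collinear with \<open>e0 + a e1\<close> and \<open>b e1 + e2\<close>.
  Multiplication: \<open>e0 + ab e1 + a e2\<close> is collinear with \<open>e0\<close> and \<open>b e1 + e2\<close>; it gives
  \<open>\<phi>(ab) = \<psi>(a) \<phi>(b)\<close>, and \<open>b = 1\<close> shows \<open>\<psi> = \<phi>\<close>.
\<close>
lemma phi_ring_iso: "\<phi> \<in> ring_iso D D'"
proof -
  obtain \<psi> where \<psi>c: "\<And>a. a \<in> carrier D \<Longrightarrow> \<psi> a \<in> carrier D'" and \<psi>1: "\<psi> \<one>\<^bsub>D\<^esub> = \<one>\<^bsub>D'\<^esub>"
    and plane: "\<And>a b. \<lbrakk>a \<in> carrier D; b \<in> carrier D\<rbrakk> \<Longrightarrow>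
          \<rho> (E.vec \<one>\<^bsub>D\<^esub> a b) (F.vec \<one>\<^bsub>D'\<^esub> (\<phi> a) (\<psi> b))"
    and inf: "\<And>a b. \<lbrakk>a \<in> carrier D; b \<in> carrier D; a \<noteq> \<zero>\<^bsub>D\<^esub> \<or> b \<noteq> \<zero>\<^bsub>D\<^esub>\<rbrakk> \<Longrightarrow>
          \<rho> (E.vec \<zero>\<^bsub>D\<^esub> a b) (F.vec \<zero>\<^bsub>D'\<^esub> (\<phi> a) (\<psi> b))"
    using plane_and_infinity by blast
  have inf1: "\<rho> (E.vec \<zero>\<^bsub>D\<^esub> b \<one>\<^bsub>D\<^esub>) (F.vec \<zero>\<^bsub>D'\<^esub> (\<phi> b) \<one>\<^bsub>D'\<^esub>)" if "b \<in> carrier D" for b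
    using inf[OF that, of "\<one>\<^bsub>D\<^esub>"] W.one_neq_zero \<psi>1 by simp
  have add: "\<phi> (a \<oplus>\<^bsub>D\<^esub> b) = \<phi> a \<oplus>\<^bsub>D'\<^esub> \<phi> b" if ab: "a \<in> carrier D" "b \<in> carrier D" for a b
  proof -
    note c = phi(1)[OF ab(1)] phi(1)[OF ab(2)] phi(1)[OF W.R.a_closed[OF ab]]
    have "E.vec \<one>\<^bsub>D\<^esub> (a \<oplus>\<^bsub>D\<^esub> b) \<one>\<^bsub>D\<^esub> \<in> span D W {E.vec \<one>\<^bsub>D\<^esub> a \<zero>\<^bsub>D\<^esub>, E.vec \<zero>\<^bsub>D\<^esub> b \<one>\<^bsub>D\<^esub>}"
      using ab by (subst E.vec_in_span_pair, simp_all)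
        (rule bexI[of _ "\<one>\<^bsub>D\<^esub>"], rule bexI[of _ "\<one>\<^bsub>D\<^esub>"], simp_all)
    moreover have "\<rho> (E.vec \<one>\<^bsub>D\<^esub> (a \<oplus>\<^bsub>D\<^esub> b) \<one>\<^bsub>D\<^esub>) (F.vec \<one>\<^bsub>D'\<^esub> (\<phi> (a \<oplus>\<^bsub>D\<^esub> b)) \<one>\<^bsub>D'\<^esub>)"
      using plane[of "a \<oplus>\<^bsub>D\<^esub> b" "\<one>\<^bsub>D\<^esub>"] ab \<psi>1 by simp
    ultimately have "F.vec \<one>\<^bsub>D'\<^esub> (\<phi> (a \<oplus>\<^bsub>D\<^esub> b)) \<one>\<^bsub>D'\<^esub>
        \<in> span D' W' {F.vec \<one>\<^bsub>D'\<^esub> (\<phi> a) \<zero>\<^bsub>D'\<^esub>, F.vec \<zero>\<^bsub>D'\<^esub> (\<phi> b) \<one>\<^bsub>D'\<^esub>}"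
      using rel_span_pair[OF _ phi(2)[OF ab(1)] inf1[OF ab(2)]] by blast
    then show ?thesis using c by (subst (asm) F.vec_in_span_pair) (auto simp: F.vec_eq_iff)
  qed
  have mult': "\<phi> (a \<otimes>\<^bsub>D\<^esub> b) = \<psi> a \<otimes>\<^bsub>D'\<^esub> \<phi> b" if ab: "a \<in> carrier D" "b \<in> carrier D" for a b
  proof -
    note c = \<psi>c[OF ab(1)] phi(1)[OF ab(2)] phi(1)[OF W.R.m_closed[OF ab]]
    have "E.vec \<one>\<^bsub>D\<^esub> (a \<otimes>\<^bsub>D\<^esub> b) a \<in> span D W {E.vec \<one>\<^bsub>D\<^esub> \<zero>\<^bsub>D\<^esub> \<zero>\<^bsub>D\<^esub>, E.vec \<zero>\<^bsub>D\<^esub> b \<one>\<^bsub>D\<^esub>}"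
      using ab by (subst E.vec_in_span_pair, simp_all)
        (rule bexI[of _ "\<one>\<^bsub>D\<^esub>"], rule bexI[of _ a], simp_all)
    then have "F.vec \<one>\<^bsub>D'\<^esub> (\<phi> (a \<otimes>\<^bsub>D\<^esub> b)) (\<psi> a)
        \<in> span D' W' {F.vec \<one>\<^bsub>D'\<^esub> \<zero>\<^bsub>D'\<^esub> \<zero>\<^bsub>D'\<^esub>, F.vec \<zero>\<^bsub>D'\<^esub> (\<phi> b) \<one>\<^bsub>D'\<^esub>}"
      using rel_span_pair[OF plane[of "a \<otimes>\<^bsub>D\<^esub> b" a] frame_rel(1) inf1[OF ab(2)]] ab
      by (simp add: E.vec_frame F.vec_frame)
    then show ?thesis using c by (subst (asm) F.vec_in_span_pair) (auto simp: F.vec_eq_iff)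
  qed
  have "\<psi> a = \<phi> a" if "a \<in> carrier D" for a
    using mult'[OF that, of "\<one>\<^bsub>D\<^esub>"] that \<psi>c phi_one by simp
  then have "\<phi> \<in> ring_hom D D'" using add mult' phi phi_one by (intro ring_hom_memI) auto
  then show ?thesis using phi_bij unfolding ring_iso_def by blast
qed

end

text \<open>
  Three elements of a basis and their images are frames once the images are rescaled so that
  the unit points correspond.
\<close>
lemma (in collineation) ring_iso_of_plane:
  assumes B: "is_basis D W B" "card B \<ge> 3"
  shows "\<exists>\<phi>. \<phi> \<in> ring_iso D D'"
proof -
  obtain e0 e1 e2 where e: "e0 \<in> B" "e1 \<in> B" "e2 \<in> B" "e0 \<noteq> e1" "e0 \<noteq> e2" "e1 \<noteq> e2"
  proof -
    obtain T where "T \<subseteq> B" "card T = 3" using B(2) by (metis obtain_subset_with_card_n)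
    then show thesis using that by (auto simp: card_3_iff)
  qed
  have Bc: "B \<subseteq> carrier W" using B(1) W.is_basis_iff by auto
  obtain h where h: "inj_on h B" "\<And>b. b \<in> B \<Longrightarrow> \<rho> b (h b)" "is_basis D' W' (h ` B)"
    using basis_image[OF B(1)] by blast
  define g0 g1 g2 where g: "g0 = h e0" "g1 = h e1" "g2 = h e2"
  have gB: "g0 \<in> h ` B" "g1 \<in> h ` B" "g2 \<in> h ` B" "g0 \<noteq> g1" "g0 \<noteq> g2" "g1 \<noteq> g2"
    using e h(1) unfolding g inj_on_def by auto
  have gc: "g0 \<in> carrier W'" "g1 \<in> carrier W'" "g2 \<in> carrier W'"
    using h(3) gB W'.is_basis_iff by auto
  interpret E: framed D W e0 e1 e2
  proof
    fix a b c a' b' c'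
    assume c: "a \<in> carrier D" "b \<in> carrier D" "c \<in> carrier D" "a' \<in> carrier D" "b' \<in> carrier D" "c' \<in> carrier D"
      and eq: "a \<odot>\<^bsub>W\<^esub> e0 \<oplus>\<^bsub>W\<^esub> b \<odot>\<^bsub>W\<^esub> e1 \<oplus>\<^bsub>W\<^esub> c \<odot>\<^bsub>W\<^esub> e2 = a' \<odot>\<^bsub>W\<^esub> e0 \<oplus>\<^bsub>W\<^esub> b' \<odot>\<^bsub>W\<^esub> e1 \<oplus>\<^bsub>W\<^esub> c' \<odot>\<^bsub>W\<^esub> e2"
    show "a = a' \<and> b = b' \<and> c = c'"
      using arg_cong[OF eq, of "\<lambda>x. coords D W B x e0"] arg_cong[OF eq, of "\<lambda>x. coords D W B x e1"]
        arg_cong[OF eq, of "\<lambda>x. coords D W B x e2"] c e Bc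
      by (simp add: W.coords_add[OF B(1)] W.coords_smult[OF B(1)] W.coords_basis[OF B(1)] subset_iff)
  qed (use e Bc in auto)
  interpret G: framed D' W' g0 g1 g2
  proof
    fix a b c a' b' c'
    assume c: "a \<in> carrier D'" "b \<in> carrier D'" "c \<in> carrier D'" "a' \<in> carrier D'" "b' \<in> carrier D'" "c' \<in> carrier D'"
      and eq: "a \<odot>\<^bsub>W'\<^esub> g0 \<oplus>\<^bsub>W'\<^esub> b \<odot>\<^bsub>W'\<^esub> g1 \<oplus>\<^bsub>W'\<^esub> c \<odot>\<^bsub>W'\<^esub> g2 = a' \<odot>\<^bsub>W'\<^esub> g0 \<oplus>\<^bsub>W'\<^esub> b' \<odot>\<^bsub>W'\<^esub> g1 \<oplus>\<^bsub>W'\<^esub> c' \<odot>\<^bsub>W'\<^esub> g2"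
    show "a = a' \<and> b = b' \<and> c = c'"
      using arg_cong[OF eq, of "\<lambda>x. coords D' W' (h ` B) x g0"] arg_cong[OF eq, of "\<lambda>x. coords D' W' (h ` B) x g1"]
        arg_cong[OF eq, of "\<lambda>x. coords D' W' (h ` B) x g2"] c gB gc
      by (simp add: W'.coords_add[OF h(3)] W'.coords_smult[OF h(3)] W'.coords_basis[OF h(3)])
  qed (use gc in auto)
  have unit: "\<exists>s\<in>Units D'. \<rho> (e0 \<oplus>\<^bsub>W\<^esub> x) (g0 \<oplus>\<^bsub>W'\<^esub> s \<odot>\<^bsub>W'\<^esub> y)"
    if xy: "x \<in> B" "y = h x" "e0 \<noteq> x" for x y
  proof -
    have xc: "x \<in> carrier W" and yc: "y \<in> carrier W'" and e0c: "e0 \<in> carrier W"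
      using xy Bc h(2)[OF xy(1)] rel_carrier e by auto
    have ind: "e0 \<notin> span D W {x}" "x \<notin> span D W {e0}"
      using e(1) xy(1,3) B(1) W.span_mono[of "{x}" "B - {e0}"] W.span_mono[of "{e0}" "B - {x}"]
      unfolding W.is_basis_iff independent_def by auto
    have sx: "submodule (span D W {x}) D W" and se: "submodule (span D W {e0}) D W"
      using W.span_submodule xc e0c by auto
    have n1: "e0 \<oplus>\<^bsub>W\<^esub> x \<notin> span D W {x}"
    proof
      assume "e0 \<oplus>\<^bsub>W\<^esub> x \<in> span D W {x}"
      then have "(e0 \<oplus>\<^bsub>W\<^esub> x) \<oplus>\<^bsub>W\<^esub> \<ominus>\<^bsub>W\<^esub> x \<in> span D W {x}"
        using W.submoduleD(3,5)[OF sx] W.span_superset[of "{x}"] by auto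
      then show False using ind e0c xc by (simp add: W.M.a_assoc W.M.r_neg)
    qed
    have n2: "e0 \<oplus>\<^bsub>W\<^esub> x \<notin> span D W {e0}"
    proof
      assume "e0 \<oplus>\<^bsub>W\<^esub> x \<in> span D W {e0}"
      then have "\<ominus>\<^bsub>W\<^esub> e0 \<oplus>\<^bsub>W\<^esub> (e0 \<oplus>\<^bsub>W\<^esub> x) \<in> span D W {e0}"
        using W.submoduleD(3,5)[OF se] W.span_superset[of "{e0}"] by auto
      then show False using ind e0c xc by (simp add: W.M.a_assoc[symmetric] W.M.l_neg)
    qed
    have "e0 \<oplus>\<^bsub>W\<^esub> x \<noteq> \<zero>\<^bsub>W\<^esub>" using n1 W.submoduleD(2)[OF sx] by auto
    then obtain z where z: "\<rho> (e0 \<oplus>\<^bsub>W\<^esub> x) z" using rel_total e0c xc by blast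
    have "e0 \<oplus>\<^bsub>W\<^esub> x \<in> span D W {e0, x}"
      using W.submoduleD(3)[OF W.span_submodule[of "{e0, x}"]] W.span_superset[of "{e0, x}"] e0c xc by auto
    moreover have r: "\<rho> e0 g0" "\<rho> x y" using h(2) e xy g by auto
    then have "e0 \<oplus>\<^bsub>W\<^esub> x \<in> span D W {e0, x} \<longleftrightarrow> z \<in> span D' W' {g0, y}" using z by (intro rel_span) auto
    ultimately obtain r s where rs: "r \<in> carrier D'" "s \<in> carrier D'" "z = r \<odot>\<^bsub>W'\<^esub> g0 \<oplus>\<^bsub>W'\<^esub> s \<odot>\<^bsub>W'\<^esub> y"
      using W'.span_pair[OF gc(1) yc] by auto
    have "e0 \<oplus>\<^bsub>W\<^esub> x \<in> span D W {x} \<longleftrightarrow> z \<in> span D' W' {y}" using z r by (intro rel_span) auto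
    then have r0: "r \<noteq> \<zero>\<^bsub>D'\<^esub>" using n1 rs gc yc W'.span_singleton[OF yc] by auto
    have "e0 \<oplus>\<^bsub>W\<^esub> x \<in> span D W {e0} \<longleftrightarrow> z \<in> span D' W' {g0}" using z r by (intro rel_span) auto
    then have s0: "s \<noteq> \<zero>\<^bsub>D'\<^esub>" using n2 rs gc yc W'.span_singleton[OF gc(1)] by auto
    have u: "r \<in> Units D'" "s \<in> Units D'" using rs r0 s0 W'.nonzero_Units by auto
    then have iu: "inv\<^bsub>D'\<^esub> r \<in> Units D'" by auto
    then have "inv\<^bsub>D'\<^esub> r \<in> carrier D' - {\<zero>\<^bsub>D'\<^esub>}" using W'.nonzero_Units by blast
    then have "\<rho> (e0 \<oplus>\<^bsub>W\<^esub> x) (inv\<^bsub>D'\<^esub> r \<odot>\<^bsub>W'\<^esub> z)" by (rule rel_smult[OF z])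
    moreover have "inv\<^bsub>D'\<^esub> r \<odot>\<^bsub>W'\<^esub> z = g0 \<oplus>\<^bsub>W'\<^esub> (inv\<^bsub>D'\<^esub> r \<otimes>\<^bsub>D'\<^esub> s) \<odot>\<^bsub>W'\<^esub> y"
      using rs u gc yc by (simp add: W'.smult_r_distr W'.smult_assoc[symmetric])
    ultimately show ?thesis using iu u(2) W'.R.Units_m_closed by metis
  qed
  \<comment> \<open>These scalars are the rescaling that makes the unit points correspond.\<close>
  obtain s1 s2 where s: "s1 \<in> Units D'" "s2 \<in> Units D'"
    "\<rho> (e0 \<oplus>\<^bsub>W\<^esub> e1) (g0 \<oplus>\<^bsub>W'\<^esub> s1 \<odot>\<^bsub>W'\<^esub> g1)" "\<rho> (e0 \<oplus>\<^bsub>W\<^esub> e2) (g0 \<oplus>\<^bsub>W'\<^esub> s2 \<odot>\<^bsub>W'\<^esub> g2)"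
    using unit[OF e(2) g(2) e(4)] unit[OF e(3) g(3) e(5)] by blast
  have sc: "s1 \<in> carrier D'" "s2 \<in> carrier D'" using s by auto
  have cancel: "b = b'" if "b \<otimes>\<^bsub>D'\<^esub> s = b' \<otimes>\<^bsub>D'\<^esub> s" "s \<in> Units D'" "b \<in> carrier D'" "b' \<in> carrier D'" for b b' s
    using that by (metis W'.R.Units_closed W'.R.Units_inv_closed W'.R.Units_r_inv W'.R.m_assoc W'.R.r_one)
  interpret F: framed D' W' g0 "s1 \<odot>\<^bsub>W'\<^esub> g1" "s2 \<odot>\<^bsub>W'\<^esub> g2"
  proof
    fix a b c a' b' c'
    assume c: "a \<in> carrier D'" "b \<in> carrier D'" "c \<in> carrier D'" "a' \<in> carrier D'" "b' \<in> carrier D'" "c' \<in> carrier D'"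
      and eq: "a \<odot>\<^bsub>W'\<^esub> g0 \<oplus>\<^bsub>W'\<^esub> b \<odot>\<^bsub>W'\<^esub> (s1 \<odot>\<^bsub>W'\<^esub> g1) \<oplus>\<^bsub>W'\<^esub> c \<odot>\<^bsub>W'\<^esub> (s2 \<odot>\<^bsub>W'\<^esub> g2) =
        a' \<odot>\<^bsub>W'\<^esub> g0 \<oplus>\<^bsub>W'\<^esub> b' \<odot>\<^bsub>W'\<^esub> (s1 \<odot>\<^bsub>W'\<^esub> g1) \<oplus>\<^bsub>W'\<^esub> c' \<odot>\<^bsub>W'\<^esub> (s2 \<odot>\<^bsub>W'\<^esub> g2)"
    then have "a = a' \<and> b \<otimes>\<^bsub>D'\<^esub> s1 = b' \<otimes>\<^bsub>D'\<^esub> s1 \<and> c \<otimes>\<^bsub>D'\<^esub> s2 = c' \<otimes>\<^bsub>D'\<^esub> s2"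
      using sc gc by (intro G.frame_eq) (simp_all add: W'.smult_assoc)
    then show "a = a' \<and> b = b' \<and> c = c'" using cancel s c by blast
  qed (use gc sc in auto)
  have ne: "s \<in> carrier D' - {\<zero>\<^bsub>D'\<^esub>}" if "s \<in> Units D'" for s using that W'.nonzero_Units by blast
  interpret frame_collineation D W D' W' \<rho> e0 e1 e2 g0 "s1 \<odot>\<^bsub>W'\<^esub> g1" "s2 \<odot>\<^bsub>W'\<^esub> g2"
    using h(2) e g s rel_smult[OF _ ne] by unfold_locales auto
  show ?thesis using phi_ring_iso by blast
qed

text \<open>
  The maps \<open>p\<close> and \<open>p'\<close> coordinatize the two point sets by nonzero vectors up to scalars.  The points
  of the first geometry are only known to lie in \<open>F\<close>; that \<open>g\<close> sends them onto the points of the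
  second follows by applying it to the largest subspace.
\<close>
lemma collineation_of_geometry_isomorphism:
  fixes D :: "('d, 'y) ring_scheme" and W :: "('d, 'v) module"
    and D' :: "('e, 'z) ring_scheme" and W' :: "('e, 'w) module"
    and p :: "'v \<Rightarrow> 'p" and p' :: "'w \<Rightarrow> 'q"
  assumes "left_vector_space D W" "left_vector_space D' W'"
    and p: "\<And>x y. \<lbrakk>x \<in> carrier W - {\<zero>\<^bsub>W\<^esub>}; y \<in> carrier W - {\<zero>\<^bsub>W\<^esub>}\<rbrakk> \<Longrightarrow>
        p x = p y \<longleftrightarrow> (\<exists>c\<in>carrier D - {\<zero>\<^bsub>D\<^esub>}. y = c \<odot>\<^bsub>W\<^esub> x)"
    and p': "\<And>x y. \<lbrakk>x \<in> carrier W' - {\<zero>\<^bsub>W'\<^esub>}; y \<in> carrier W' - {\<zero>\<^bsub>W'\<^esub>}\<rbrakk> \<Longrightarrow>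
        p' x = p' y \<longleftrightarrow> (\<exists>c\<in>carrier D' - {\<zero>\<^bsub>D'\<^esub>}. y = c \<odot>\<^bsub>W'\<^esub> x)"
    and pF: "p ` (carrier W - {\<zero>\<^bsub>W\<^esub>}) \<subseteq> F"
    and iso: "geometry_isomorphic F {p ` (U - {\<zero>\<^bsub>W\<^esub>}) |U. submodule U D W \<and> U \<noteq> {\<zero>\<^bsub>W\<^esub>}}
        F' {p' ` (U - {\<zero>\<^bsub>W'\<^esub>}) |U. submodule U D' W' \<and> U \<noteq> {\<zero>\<^bsub>W'\<^esub>}}"
  shows "\<exists>\<rho>. collineation D W D' W' \<rho>"
proof -
  interpret W: left_vector_space D W by fact
  interpret W': left_vector_space D' W' by fact
  define X where "X = carrier W - {\<zero>\<^bsub>W\<^esub>}"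
  define X' where "X' = carrier W' - {\<zero>\<^bsub>W'\<^esub>}"
  obtain g where g: "bij_betw g F F'"
    and gS: "(\<lambda>S. g ` S) ` {p ` (U - {\<zero>\<^bsub>W\<^esub>}) |U. submodule U D W \<and> U \<noteq> {\<zero>\<^bsub>W\<^esub>}} =
        {p' ` (U - {\<zero>\<^bsub>W'\<^esub>}) |U. submodule U D' W' \<and> U \<noteq> {\<zero>\<^bsub>W'\<^esub>}}"
    using iso unfolding geometry_isomorphic_def by (elim exE conjE)
  have ginj: "g (p x) = g (p y) \<longleftrightarrow> p x = p y" if "x \<in> X" "y \<in> X" for x y
  proof (rule inj_on_eq_iff)
    show "inj_on g F" using g by (rule bij_betw_imp_inj_on)
  qed (use pF that in \<open>auto simp: X_def\<close>)
  have fwd: "\<exists>U'. submodule U' D' W' \<and> U' \<noteq> {\<zero>\<^bsub>W'\<^esub>} \<and> g ` p ` (U - {\<zero>\<^bsub>W\<^esub>}) = p' ` (U' - {\<zero>\<^bsub>W'\<^esub>})"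
    if "submodule U D W" "U \<noteq> {\<zero>\<^bsub>W\<^esub>}" for U
  proof -
    have "g ` p ` (U - {\<zero>\<^bsub>W\<^esub>}) \<in> (\<lambda>S. g ` S) ` {p ` (U - {\<zero>\<^bsub>W\<^esub>}) |U. submodule U D W \<and> U \<noteq> {\<zero>\<^bsub>W\<^esub>}}"
      using that by blast
    then show ?thesis unfolding gS by blast
  qed
  have bwd: "\<exists>U. submodule U D W \<and> U \<noteq> {\<zero>\<^bsub>W\<^esub>} \<and> g ` p ` (U - {\<zero>\<^bsub>W\<^esub>}) = p' ` (U' - {\<zero>\<^bsub>W'\<^esub>})"
    if "submodule U' D' W'" "U' \<noteq> {\<zero>\<^bsub>W'\<^esub>}" for U'
  proof -
    have "p' ` (U' - {\<zero>\<^bsub>W'\<^esub>}) \<in> (\<lambda>S. g ` S) ` {p ` (U - {\<zero>\<^bsub>W\<^esub>}) |U. submodule U D W \<and> U \<noteq> {\<zero>\<^bsub>W\<^esub>}}"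
      unfolding gS using that by blast
    then obtain S where S: "p' ` (U' - {\<zero>\<^bsub>W'\<^esub>}) = g ` S"
        "S \<in> {p ` (U - {\<zero>\<^bsub>W\<^esub>}) |U. submodule U D W \<and> U \<noteq> {\<zero>\<^bsub>W\<^esub>}}"
      by (rule imageE)
    from S(2) obtain U where "S = p ` (U - {\<zero>\<^bsub>W\<^esub>})" "submodule U D W \<and> U \<noteq> {\<zero>\<^bsub>W\<^esub>}" by blast
    then show ?thesis using S(1) by auto
  qed
  define \<rho> where "\<rho> x y \<longleftrightarrow> x \<in> X \<and> y \<in> X' \<and> g (p x) = p' y" for x y
  have match: "x \<in> U \<longleftrightarrow> y \<in> U'"
    if U: "submodule U D W" "submodule U' D' W'" and img: "g ` p ` (U - {\<zero>\<^bsub>W\<^esub>}) = p' ` (U' - {\<zero>\<^bsub>W'\<^esub>})"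
      and r: "\<rho> x y" for U U' x y
  proof
    have UX: "U - {\<zero>\<^bsub>W\<^esub>} \<subseteq> X" "U' - {\<zero>\<^bsub>W'\<^esub>} \<subseteq> X'"
      using W.submoduleD(1)[OF U(1)] W'.submoduleD(1)[OF U(2)] unfolding X_def X'_def by auto
    {
      assume "x \<in> U"
      then have "x \<in> U - {\<zero>\<^bsub>W\<^esub>}" using r unfolding \<rho>_def X_def by simp
      then have "g (p x) \<in> g ` p ` (U - {\<zero>\<^bsub>W\<^esub>})" by (intro imageI)
      then have "p' y \<in> p' ` (U' - {\<zero>\<^bsub>W'\<^esub>})" using r unfolding img \<rho>_def by simp
      then obtain z where z: "z \<in> U' - {\<zero>\<^bsub>W'\<^esub>}" "p' y = p' z" by (rule imageE)
      then have z: "z \<in> U'" "z \<in> X'" "p' z = p' y" using UX by auto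
      then obtain c where "c \<in> carrier D'" "y = c \<odot>\<^bsub>W'\<^esub> z"
        using p'[of z y] r unfolding \<rho>_def X'_def by blast
      then show "y \<in> U'" using W'.submoduleD(4)[OF U(2)] z(1) by blast
    next
      assume "y \<in> U'"
      then have "y \<in> U' - {\<zero>\<^bsub>W'\<^esub>}" using r unfolding \<rho>_def X'_def by simp
      then have "p' y \<in> p' ` (U' - {\<zero>\<^bsub>W'\<^esub>})" by (intro imageI)
      then have "g (p x) \<in> g ` p ` (U - {\<zero>\<^bsub>W\<^esub>})" using r unfolding img \<rho>_def by simp
      then obtain z where "z \<in> U - {\<zero>\<^bsub>W\<^esub>}" "g (p x) = g (p z)" unfolding image_image by (rule imageE)
      then have z: "z \<in> U" "z \<in> X" "g (p z) = g (p x)" using UX by auto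
      then have "p z = p x" using ginj r unfolding \<rho>_def by blast
      then obtain c where "c \<in> carrier D" "x = c \<odot>\<^bsub>W\<^esub> z"
        using p[of z x] z(2) r unfolding \<rho>_def X_def by blast
      then show "x \<in> U" using W.submoduleD(4)[OF U(1)] z(1) by blast
    }
  qed
  have "collineation D W D' W' \<rho>"
  proof
    fix x y assume "\<rho> x y"
    then show "x \<in> carrier W - {\<zero>\<^bsub>W\<^esub>} \<and> y \<in> carrier W' - {\<zero>\<^bsub>W'\<^esub>}" unfolding \<rho>_def X_def X'_def by simp
  next
    fix x assume x: "x \<in> carrier W - {\<zero>\<^bsub>W\<^esub>}"
    then have "carrier W \<noteq> {\<zero>\<^bsub>W\<^esub>}" by auto
    then obtain U' where U': "submodule U' D' W'" "g ` p ` (carrier W - {\<zero>\<^bsub>W\<^esub>}) = p' ` (U' - {\<zero>\<^bsub>W'\<^esub>})"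
      using fwd[OF W.carrier_submodule] by blast
    have "g (p x) \<in> g ` p ` (carrier W - {\<zero>\<^bsub>W\<^esub>})" by (intro imageI x)
    then obtain y where "y \<in> U' - {\<zero>\<^bsub>W'\<^esub>}" "g (p x) = p' y" unfolding U'(2) by (rule imageE)
    then show "\<exists>y. \<rho> x y" using x W'.submoduleD(1)[OF U'(1)] unfolding \<rho>_def X_def X'_def by auto
  next
    fix y assume y: "y \<in> carrier W' - {\<zero>\<^bsub>W'\<^esub>}"
    then have "carrier W' \<noteq> {\<zero>\<^bsub>W'\<^esub>}" by auto
    then obtain U where U: "submodule U D W" "g ` p ` (U - {\<zero>\<^bsub>W\<^esub>}) = p' ` (carrier W' - {\<zero>\<^bsub>W'\<^esub>})"
      using bwd[OF W'.carrier_submodule] by blast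
    have "p' y \<in> p' ` (carrier W' - {\<zero>\<^bsub>W'\<^esub>})" by (intro imageI y)
    then obtain x where "x \<in> U - {\<zero>\<^bsub>W\<^esub>}" "p' y = g (p x)"
      unfolding U(2)[symmetric] image_image by (rule imageE)
    then show "\<exists>x. \<rho> x y" using y W.submoduleD(1)[OF U(1)] unfolding \<rho>_def X_def X'_def by auto
  next
    fix U assume U: "submodule U D W"
    show "\<exists>U'. submodule U' D' W' \<and> (\<forall>x y. \<rho> x y \<longrightarrow> (x \<in> U \<longleftrightarrow> y \<in> U'))"
    proof (cases "U = {\<zero>\<^bsub>W\<^esub>}")
      case True
      then show ?thesis using W'.zero_submodule unfolding \<rho>_def X_def X'_def by blast
    next
      case False
      obtain U' where U': "submodule U' D' W'" "g ` p ` (U - {\<zero>\<^bsub>W\<^esub>}) = p' ` (U' - {\<zero>\<^bsub>W'\<^esub>})"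
        using fwd[OF U False] by (elim exE conjE)
      show ?thesis using match[OF U U'] U'(1) by (intro exI[of _ U'] conjI allI impI)
    qed
  next
    fix U' assume U': "submodule U' D' W'"
    show "\<exists>U. submodule U D W \<and> (\<forall>x y. \<rho> x y \<longrightarrow> (x \<in> U \<longleftrightarrow> y \<in> U'))"
    proof (cases "U' = {\<zero>\<^bsub>W'\<^esub>}")
      case True
      then show ?thesis using W.zero_submodule unfolding \<rho>_def X_def X'_def by blast
    next
      case False
      obtain U where U: "submodule U D W" "g ` p ` (U - {\<zero>\<^bsub>W\<^esub>}) = p' ` (U' - {\<zero>\<^bsub>W'\<^esub>})"
        using bwd[OF U' False] by (elim exE conjE)
      show ?thesis using match[OF U(1) U' U(2)] U(1) by (intro exI[of _ U] conjI allI impI)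
    qed
  next
    fix x y c assume r: "\<rho> x y" and c: "c \<in> carrier D' - {\<zero>\<^bsub>D'\<^esub>}"
    have y: "y \<in> X'" using r unfolding \<rho>_def by simp
    then have cy: "c \<odot>\<^bsub>W'\<^esub> y \<in> X'" using c W'.smult_eq_zero_iff unfolding X'_def by auto
    then have "p' y = p' (c \<odot>\<^bsub>W'\<^esub> y)" using y c p'[of y "c \<odot>\<^bsub>W'\<^esub> y"] unfolding X'_def by blast
    then show "\<rho> x (c \<odot>\<^bsub>W'\<^esub> y)" using r cy unfolding \<rho>_def by simp
  next
    fix x y a assume r: "\<rho> x y" and a: "a \<in> carrier D - {\<zero>\<^bsub>D\<^esub>}"
    have x: "x \<in> X" using r unfolding \<rho>_def by simp
    then have ax: "a \<odot>\<^bsub>W\<^esub> x \<in> X" using a W.smult_eq_zero_iff unfolding X_def by auto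
    then have "p x = p (a \<odot>\<^bsub>W\<^esub> x)" using x a p[of x "a \<odot>\<^bsub>W\<^esub> x"] unfolding X_def by blast
    then show "\<rho> (a \<odot>\<^bsub>W\<^esub> x) y" using r ax unfolding \<rho>_def by simp
  qed
  then show ?thesis by blast
qed

section \<open>Quotient modules\<close>

lemma quot_module_simps:
  "carrier (quot_module M N) = a_rcosets\<^bsub>M\<^esub> N"
  "zero (quot_module M N) = N"
  "add (quot_module M N) = set_add M"
  "smult (quot_module M N) = (\<lambda>r X. \<Union>x\<in>X. N +>\<^bsub>M\<^esub> (r \<odot>\<^bsub>M\<^esub> x))"
  "mult (quot_module M N) = rcoset_mult M N"
  "one (quot_module M N) = N +>\<^bsub>M\<^esub> \<one>\<^bsub>M\<^esub>"
  unfolding quot_module_def FactRing_def by (simp_all add: ring.defs module.defs)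

locale quotient = left_module +
  fixes N
  assumes N: "submodule N R M"
begin

sublocale C: abelian_subgroup N M
  using N M.abelian_group_axioms unfolding submodule_def
  by (intro abelian_subgroupI3 additive_subgroup.intro) auto

abbreviation Q where "Q \<equiv> quot_module M N"

lemma quot_carrier: "carrier Q = {N +>\<^bsub>M\<^esub> x |x. x \<in> carrier M}"
  unfolding quot_module_simps A_RCOSETS_def' a_r_coset_def' by auto

lemma coset_closed [simp, intro]: "x \<in> carrier M \<Longrightarrow> N +>\<^bsub>M\<^esub> x \<in> carrier Q"
  unfolding quot_carrier by auto

lemma quot_zero: "\<zero>\<^bsub>Q\<^esub> = N +>\<^bsub>M\<^esub> \<zero>\<^bsub>M\<^esub>"
  using submoduleD(1)[OF N] unfolding quot_module_simps by simp

lemma coset_eq_iff: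
  assumes "x \<in> carrier M" "y \<in> carrier M"
  shows "N +>\<^bsub>M\<^esub> x = N +>\<^bsub>M\<^esub> y \<longleftrightarrow> x \<oplus>\<^bsub>M\<^esub> \<ominus>\<^bsub>M\<^esub> y \<in> N"
  using C.a_rcos_module[of y x] assms C.a_repr_independence'[of x y] C.a_rcos_self[of x]
  by metis

lemma coset_eq_zero_iff: "x \<in> carrier M \<Longrightarrow> N +>\<^bsub>M\<^esub> x = \<zero>\<^bsub>Q\<^esub> \<longleftrightarrow> x \<in> N"
  unfolding quot_zero by (simp add: coset_eq_iff M.minus_equality[of "\<zero>\<^bsub>M\<^esub>" "\<zero>\<^bsub>M\<^esub>"])

lemma coset_add:
  "x \<in> carrier M \<Longrightarrow> y \<in> carrier M \<Longrightarrow> (N +>\<^bsub>M\<^esub> x) \<oplus>\<^bsub>Q\<^esub> (N +>\<^bsub>M\<^esub> y) = N +>\<^bsub>M\<^esub> (x \<oplus>\<^bsub>M\<^esub> y)"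
  unfolding quot_module_simps by (rule C.a_rcos_sum)

lemma coset_smult:
  assumes r: "r \<in> carrier R" and x: "x \<in> carrier M"
  shows "r \<odot>\<^bsub>Q\<^esub> (N +>\<^bsub>M\<^esub> x) = N +>\<^bsub>M\<^esub> (r \<odot>\<^bsub>M\<^esub> x)"
proof -
  have *: "N +>\<^bsub>M\<^esub> (r \<odot>\<^bsub>M\<^esub> y) = N +>\<^bsub>M\<^esub> (r \<odot>\<^bsub>M\<^esub> x)" if "y \<in> N +>\<^bsub>M\<^esub> x" for y
  proof -
    have y: "y \<in> carrier M" using that C.a_elemrcos_carrier x by blast
    have "y \<oplus>\<^bsub>M\<^esub> \<ominus>\<^bsub>M\<^esub> x \<in> N" using that C.a_rcos_module[OF x y] by simp
    then have "r \<odot>\<^bsub>M\<^esub> (y \<oplus>\<^bsub>M\<^esub> \<ominus>\<^bsub>M\<^esub> x) \<in> N" using submoduleD(4)[OF N r] by simp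
    then show ?thesis using r x y by (simp add: coset_eq_iff smult_r_distr smult_r_minus)
  qed
  have "x \<in> N +>\<^bsub>M\<^esub> x" by (rule C.a_rcos_self[OF x])
  then show ?thesis unfolding quot_module_simps using * by blast
qed

lemma left_module_quot: "left_module R Q"
proof -
  have "abelian_group Q"
  proof (rule abelian_groupI)
    fix X assume "X \<in> carrier Q"
    then obtain x where "x \<in> carrier M" "X = N +>\<^bsub>M\<^esub> x" unfolding quot_carrier by auto
    then have "(N +>\<^bsub>M\<^esub> \<ominus>\<^bsub>M\<^esub> x) \<oplus>\<^bsub>Q\<^esub> X = \<zero>\<^bsub>Q\<^esub>" "N +>\<^bsub>M\<^esub> \<ominus>\<^bsub>M\<^esub> x \<in> carrier Q"
      by (simp_all add: coset_add M.l_neg quot_zero)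
    then show "\<exists>Y\<in>carrier Q. Y \<oplus>\<^bsub>Q\<^esub> X = \<zero>\<^bsub>Q\<^esub>" by blast
  next
    fix X Y assume "X \<in> carrier Q" "Y \<in> carrier Q"
    then obtain x y where "x \<in> carrier M" "X = N +>\<^bsub>M\<^esub> x" "y \<in> carrier M" "Y = N +>\<^bsub>M\<^esub> y"
      unfolding quot_carrier by auto
    then show "X \<oplus>\<^bsub>Q\<^esub> Y \<in> carrier Q" "X \<oplus>\<^bsub>Q\<^esub> Y = Y \<oplus>\<^bsub>Q\<^esub> X"
      by (simp_all add: coset_add M.a_comm)
  next
    fix X Y Z assume "X \<in> carrier Q" "Y \<in> carrier Q" "Z \<in> carrier Q"
    then show "X \<oplus>\<^bsub>Q\<^esub> Y \<oplus>\<^bsub>Q\<^esub> Z = X \<oplus>\<^bsub>Q\<^esub> (Y \<oplus>\<^bsub>Q\<^esub> Z)"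
      unfolding quot_carrier by (auto simp: coset_add M.a_assoc)
  next
    fix X assume "X \<in> carrier Q"
    then show "\<zero>\<^bsub>Q\<^esub> \<oplus>\<^bsub>Q\<^esub> X = X" unfolding quot_carrier quot_zero by (auto simp: coset_add)
  qed (simp add: quot_zero)
  then show ?thesis
    using R.ring_axioms
    by (intro left_module.intro left_module_axioms.intro)
       (auto simp: quot_carrier coset_add coset_smult smult_l_distr smult_r_distr smult_assoc)
qed

end

lemma semilinear_iso_refl: "semilinear_iso R (\<lambda>r. r) M M (\<lambda>x. x)"
  unfolding semilinear_iso_def by (auto simp: bij_betw_def)

lemma semilinear_iso_inverse:
  assumes "left_module R M" "semilinear_iso R (\<lambda>r. r) M N f"
  shows "semilinear_iso R (\<lambda>r. r) N M (inv_into (carrier M) f)"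
proof -
  interpret left_module R M by fact
  have bij: "bij_betw f (carrier M) (carrier N)"
    and add: "\<And>x y. x \<in> carrier M \<Longrightarrow> y \<in> carrier M \<Longrightarrow> f (x \<oplus>\<^bsub>M\<^esub> y) = f x \<oplus>\<^bsub>N\<^esub> f y"
    and smult: "\<And>r x. r \<in> carrier R \<Longrightarrow> x \<in> carrier M \<Longrightarrow> f (r \<odot>\<^bsub>M\<^esub> x) = r \<odot>\<^bsub>N\<^esub> f x"
    using assms unfolding semilinear_iso_def by auto
  let ?g = "inv_into (carrier M) f"
  have gf: "?g (f x) = x" if "x \<in> carrier M" for x using bij that by (simp add: bij_betw_def)
  have "?g (x \<oplus>\<^bsub>N\<^esub> y) = ?g x \<oplus>\<^bsub>M\<^esub> ?g y" if xy: "x \<in> carrier N" "y \<in> carrier N" for x y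
  proof -
    obtain u v where "u \<in> carrier M" "x = f u" "v \<in> carrier M" "y = f v"
      using xy bij unfolding bij_betw_def by blast
    then show ?thesis using gf add[of u v, symmetric] by simp
  qed
  moreover have "?g (r \<odot>\<^bsub>N\<^esub> x) = r \<odot>\<^bsub>M\<^esub> ?g x" if rx: "r \<in> carrier R" "x \<in> carrier N" for r x
  proof -
    obtain u where "u \<in> carrier M" "x = f u" using rx bij unfolding bij_betw_def by blast
    then show ?thesis using rx gf smult[of r u, symmetric] by simp
  qed
  ultimately show ?thesis using bij_betw_inv_into[OF bij] unfolding semilinear_iso_def by blast
qed

lemma semilinear_iso_compose:
  assumes "semilinear_iso R (\<lambda>r. r) L M f" "semilinear_iso R (\<lambda>r. r) M N g"
  shows "semilinear_iso R (\<lambda>r. r) L N (g \<circ> f)"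
  using assms bij_betw_trans[of f _ _ g] bij_betwE[of f] unfolding semilinear_iso_def by auto

lemma mod_isomorphic_sym: "left_module R M \<Longrightarrow> mod_isomorphic R M N \<Longrightarrow> mod_isomorphic R N M"
  unfolding mod_isomorphic_def using semilinear_iso_inverse by blast

lemma mod_isomorphic_trans: "mod_isomorphic R L M \<Longrightarrow> mod_isomorphic R M N \<Longrightarrow> mod_isomorphic R L N"
  unfolding mod_isomorphic_def using semilinear_iso_compose by blast

text \<open>Right multiplications on the projective \<open>P\<^sub>i\<close> induce isomorphisms of the modules \<open>M\<^sub>U\<close> in this way.\<close>
lemma quot_module_isomorphic:
  assumes "quotient R M N" "quotient R M' N'"
    and h: "h \<in> carrier M \<rightarrow> carrier M'"
      "\<And>x y. \<lbrakk>x \<in> carrier M; y \<in> carrier M\<rbrakk> \<Longrightarrow> h (x \<oplus>\<^bsub>M\<^esub> y) = h x \<oplus>\<^bsub>M'\<^esub> h y"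
      "\<And>r x. \<lbrakk>r \<in> carrier R; x \<in> carrier M\<rbrakk> \<Longrightarrow> h (r \<odot>\<^bsub>M\<^esub> x) = r \<odot>\<^bsub>M'\<^esub> h x"
    and surj: "carrier M' \<subseteq> h ` carrier M"
    and iff: "\<And>x. x \<in> carrier M \<Longrightarrow> h x \<in> N' \<longleftrightarrow> x \<in> N"
  shows "mod_isomorphic R (quot_module M N) (quot_module M' N')"
proof -
  interpret Q: quotient R M N by fact
  interpret Q': quotient R M' N' by fact
  have hc: "h x \<in> carrier M'" if "x \<in> carrier M" for x using h(1) that by auto
  have hneg: "h (\<ominus>\<^bsub>M\<^esub> x) = \<ominus>\<^bsub>M'\<^esub> h x" if "x \<in> carrier M" for x
    using h(3)[of "\<ominus>\<^bsub>R\<^esub> \<one>\<^bsub>R\<^esub>" x] that hc by (simp add: Q.smult_l_minus Q'.smult_l_minus)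
  have coset: "N' +>\<^bsub>M'\<^esub> h x = N' +>\<^bsub>M'\<^esub> h y \<longleftrightarrow> N +>\<^bsub>M\<^esub> x = N +>\<^bsub>M\<^esub> y"
    if "x \<in> carrier M" "y \<in> carrier M" for x y
    using that hc iff[of "x \<oplus>\<^bsub>M\<^esub> \<ominus>\<^bsub>M\<^esub> y"] by (simp add: Q.coset_eq_iff Q'.coset_eq_iff h(2) hneg)
  define f where "f X = N' +>\<^bsub>M'\<^esub> h (SOME x. x \<in> carrier M \<and> X = N +>\<^bsub>M\<^esub> x)" for X
  have f: "f (N +>\<^bsub>M\<^esub> x) = N' +>\<^bsub>M'\<^esub> h x" if x: "x \<in> carrier M" for x
  proof -
    define y where "y = (SOME y. y \<in> carrier M \<and> N +>\<^bsub>M\<^esub> x = N +>\<^bsub>M\<^esub> y)"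
    have y: "y \<in> carrier M \<and> N +>\<^bsub>M\<^esub> x = N +>\<^bsub>M\<^esub> y"
      unfolding y_def using x by (intro someI[of "\<lambda>y. y \<in> carrier M \<and> N +>\<^bsub>M\<^esub> x = N +>\<^bsub>M\<^esub> y" x]) auto
    then have "N' +>\<^bsub>M'\<^esub> h x = N' +>\<^bsub>M'\<^esub> h y" using coset[of x y] x by simp
    then show ?thesis unfolding f_def y_def by simp
  qed
  have "inj_on f (carrier Q.Q)"
  proof (rule inj_onI)
    fix X Y assume XY: "X \<in> carrier Q.Q" "Y \<in> carrier Q.Q" "f X = f Y"
    then obtain x y where xy: "x \<in> carrier M" "X = N +>\<^bsub>M\<^esub> x" "y \<in> carrier M" "Y = N +>\<^bsub>M\<^esub> y"
      unfolding Q.quot_carrier by blast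
    then show "X = Y" using XY(3) f coset by simp
  qed
  moreover have "f ` carrier Q.Q = carrier Q'.Q"
  proof
    show "f ` carrier Q.Q \<subseteq> carrier Q'.Q" unfolding Q.quot_carrier using hc by (auto simp: f)
    show "carrier Q'.Q \<subseteq> f ` carrier Q.Q"
    proof
      fix Y assume "Y \<in> carrier Q'.Q"
      then obtain y where "y \<in> carrier M'" "Y = N' +>\<^bsub>M'\<^esub> y" unfolding Q'.quot_carrier by auto
      then obtain x where "x \<in> carrier M" "Y = f (N +>\<^bsub>M\<^esub> x)" using surj f by blast
      then show "Y \<in> f ` carrier Q.Q" by blast
    qed
  qed
  ultimately have "bij_betw f (carrier Q.Q) (carrier Q'.Q)" unfolding bij_betw_def by simp
  moreover have "f (X \<oplus>\<^bsub>Q.Q\<^esub> Y) = f X \<oplus>\<^bsub>Q'.Q\<^esub> f Y" if XY: "X \<in> carrier Q.Q" "Y \<in> carrier Q.Q" for X Y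
    using XY hc unfolding Q.quot_carrier by (auto simp: Q.coset_add Q'.coset_add f h(2))
  moreover have "f (r \<odot>\<^bsub>Q.Q\<^esub> X) = r \<odot>\<^bsub>Q'.Q\<^esub> f X" if "r \<in> carrier R" "X \<in> carrier Q.Q" for r X
    using that hc unfolding Q.quot_carrier by (auto simp: Q.coset_smult Q'.coset_smult f h(3))
  ultimately show ?thesis unfolding mod_isomorphic_def semilinear_iso_def by blast
qed

lemma (in quotient) quotient_basis_exists:
  assumes "left_vector_space R M" "is_basis R M B"
  shows "\<exists>C. is_basis R (quot_module M N) C"
proof -
  interpret M': left_vector_space R M by fact
  interpret Q: left_vector_space R Q
    using left_module_quot M'.nonzero_Units
    by (intro left_vector_space.intro left_vector_space_axioms.intro)
  have B: "finite B" "B \<subseteq> carrier M" "span R M B = carrier M" using assms(2) M'.is_basis_iff by auto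
  let ?G = "(\<lambda>x. N +>\<^bsub>M\<^esub> x) ` B"
  have G: "?G \<subseteq> carrier Q" using B by auto
  note S = Q.submoduleD[OF Q.span_submodule[OF G]]
  have "submodule {x \<in> carrier M. N +>\<^bsub>M\<^esub> x \<in> span R Q ?G} R M"
    using S(2,3,4) by (intro submoduleI) (auto simp: quot_zero coset_add[symmetric] coset_smult[symmetric])
  moreover have "B \<subseteq> {x \<in> carrier M. N +>\<^bsub>M\<^esub> x \<in> span R Q ?G}" using B Q.span_superset[of ?G] by auto
  ultimately have "span R M B \<subseteq> {x \<in> carrier M. N +>\<^bsub>M\<^esub> x \<in> span R Q ?G}" by (rule span_least)
  then have "carrier Q \<subseteq> span R Q ?G" unfolding B(3) quot_carrier by auto
  then show ?thesis using Q.basis_exists[of ?G] B(1) G by blast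
qed

section \<open>Duality\<close>

definition fun_module :: "'k ring \<Rightarrow> 'b set \<Rightarrow> ('k, 'b \<Rightarrow> 'k) module" where
  "fun_module K B = \<lparr>carrier = B \<rightarrow>\<^sub>E carrier K, mult = undefined, one = undefined,
     zero = (\<lambda>b\<in>B. \<zero>\<^bsub>K\<^esub>), add = (\<lambda>f g. \<lambda>b\<in>B. f b \<oplus>\<^bsub>K\<^esub> g b), smult = (\<lambda>c f. \<lambda>b\<in>B. c \<otimes>\<^bsub>K\<^esub> f b)\<rparr>"

lemma field_Units_eq: "field K \<Longrightarrow> Units K = carrier K - {\<zero>\<^bsub>K\<^esub>}"
  by (simp add: field.field_Units)

lemma fun_module_vector_space:
  assumes "field K"
  shows "left_vector_space K (fun_module K B)"
proof -
  interpret field K by fact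
  have "abelian_group (fun_module K B)"
  proof (rule abelian_groupI)
    fix f assume f: "f \<in> carrier (fun_module K B)"
    show "\<exists>g\<in>carrier (fun_module K B). g \<oplus>\<^bsub>fun_module K B\<^esub> f = \<zero>\<^bsub>fun_module K B\<^esub>"
      using f by (intro bexI[of _ "\<lambda>b\<in>B. \<ominus>\<^bsub>K\<^esub> f b"]) (auto simp: fun_module_def fun_eq_iff l_neg PiE_iff)
  qed (auto simp: fun_module_def fun_eq_iff PiE_iff a_ac extensional_def)
  then show ?thesis
    using field_Units_eq[OF assms] ring_axioms
    by (intro left_vector_space.intro left_module.intro left_module_axioms.intro left_vector_space_axioms.intro)
       (auto simp: fun_module_def fun_eq_iff PiE_iff l_distr r_distr m_assoc extensional_def)
qed

lemma fun_module_spanned: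
  assumes "field K" "finite B"
  shows "\<exists>G. finite G \<and> card G \<le> card B \<and> G \<subseteq> carrier (fun_module K B) \<and>
    carrier (fun_module K B) \<subseteq> span K (fun_module K B) G"
proof -
  interpret field K by fact
  let ?F = "fun_module K B"
  interpret F: left_vector_space K ?F by (rule fun_module_vector_space[OF assms(1)])
  define \<delta> where "\<delta> s = (\<lambda>b\<in>B. if b = s then \<one>\<^bsub>K\<^esub> else \<zero>\<^bsub>K\<^esub>)" for s
  have \<delta>: "\<delta> s \<in> carrier ?F" for s unfolding \<delta>_def fun_module_def by auto
  have "f \<in> span K ?F (\<delta> ` S)" if "finite S" "S \<subseteq> B" "f \<in> carrier ?F" "\<forall>b\<in>B - S. f b = \<zero>\<^bsub>K\<^esub>" for f S
    using that
  proof (induct S arbitrary: f rule: finite_induct)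
    case empty
    then have "f = \<zero>\<^bsub>?F\<^esub>" by (auto simp: fun_module_def PiE_iff extensional_def fun_eq_iff)
    then show ?case by (simp add: F.span_empty)
  next
    case (insert s S)
    let ?g = "\<lambda>b\<in>B. if b = s then \<zero>\<^bsub>K\<^esub> else f b"
    have sub: "submodule (span K ?F (\<delta> ` insert s S)) K ?F" using \<delta> by (intro F.span_submodule) auto
    have "?g \<in> span K ?F (\<delta> ` S)"
      using insert by (intro insert(3)) (auto simp: fun_module_def)
    then have "?g \<in> span K ?F (\<delta> ` insert s S)" using F.span_mono[of "\<delta> ` S" "\<delta> ` insert s S"] by auto
    moreover have "f s \<in> carrier K" using insert by (auto simp: fun_module_def)
    moreover have "\<delta> s \<in> span K ?F (\<delta> ` insert s S)" using F.span_superset[of "\<delta> ` insert s S"] by auto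
    ultimately have "f s \<odot>\<^bsub>?F\<^esub> \<delta> s \<oplus>\<^bsub>?F\<^esub> ?g \<in> span K ?F (\<delta> ` insert s S)"
      using F.submoduleD(3,4)[OF sub] by blast
    moreover have "f s \<odot>\<^bsub>?F\<^esub> \<delta> s \<oplus>\<^bsub>?F\<^esub> ?g = f"
      using insert by (auto simp: fun_module_def \<delta>_def fun_eq_iff PiE_iff extensional_def)
    ultimately show ?case by simp
  qed
  then have "carrier ?F \<subseteq> span K ?F (\<delta> ` B)" using assms(2) by blast
  then show ?thesis using \<delta> card_image_le[OF assms(2), of \<delta>] assms(2) by blast
qed

text \<open>
  The evaluation \<open>x \<mapsto> (\<beta> x b)\<^sub>b\<close> is an injective linear map from \<open>M\<close> to \<open>K\<^sup>B\<close>, and both sides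
  have dimension \<open>card B\<close>.
\<close>
lemma injective_evaluation_surjective:
  fixes K :: "'k ring" and M :: "('k, 'm) module"
  assumes "field K" "left_vector_space K M" and B: "is_basis K M B"
    and closed: "\<And>x b. \<lbrakk>x \<in> carrier M; b \<in> B\<rbrakk> \<Longrightarrow> \<beta> x b \<in> carrier K"
    and add: "\<And>x y b. \<lbrakk>x \<in> carrier M; y \<in> carrier M; b \<in> B\<rbrakk> \<Longrightarrow> \<beta> (x \<oplus>\<^bsub>M\<^esub> y) b = \<beta> x b \<oplus>\<^bsub>K\<^esub> \<beta> y b"
    and smult: "\<And>c x b. \<lbrakk>c \<in> carrier K; x \<in> carrier M; b \<in> B\<rbrakk> \<Longrightarrow> \<beta> (c \<odot>\<^bsub>M\<^esub> x) b = c \<otimes>\<^bsub>K\<^esub> \<beta> x b"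
    and inj: "\<And>x. \<lbrakk>x \<in> carrier M; \<forall>b\<in>B. \<beta> x b = \<zero>\<^bsub>K\<^esub>\<rbrakk> \<Longrightarrow> x = \<zero>\<^bsub>M\<^esub>"
    and t: "\<And>b. b \<in> B \<Longrightarrow> t b \<in> carrier K"
  shows "\<exists>x\<in>carrier M. \<forall>b\<in>B. \<beta> x b = t b"
proof -
  interpret K: field K by fact
  interpret M: left_vector_space K M by fact
  let ?F = "fun_module K B"
  interpret F: left_vector_space K ?F by (rule fun_module_vector_space[OF assms(1)])
  have Bf: "finite B" "B \<subseteq> carrier M" "independent K M B" using B M.is_basis_iff by auto
  define T where "T x = (\<lambda>b\<in>B. \<beta> x b)" for x
  have Tc: "T x \<in> carrier ?F" if "x \<in> carrier M" for x
    using closed that unfolding T_def fun_module_def by auto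
  have Tadd: "T (x \<oplus>\<^bsub>M\<^esub> y) = T x \<oplus>\<^bsub>?F\<^esub> T y" if "x \<in> carrier M" "y \<in> carrier M" for x y
    using add that unfolding T_def fun_module_def by (auto simp: fun_eq_iff)
  have Tsm: "T (c \<odot>\<^bsub>M\<^esub> x) = c \<odot>\<^bsub>?F\<^esub> T x" if "c \<in> carrier K" "x \<in> carrier M" for x c
    using smult that unfolding T_def fun_module_def by (auto simp: fun_eq_iff)
  have T0: "x = \<zero>\<^bsub>M\<^esub>" if "x \<in> carrier M" "T x = \<zero>\<^bsub>?F\<^esub>" for x
  proof (rule inj[OF that(1)], rule ballI)
    fix b assume "b \<in> B"
    then show "\<beta> x b = \<zero>\<^bsub>K\<^esub>" using fun_cong[OF that(2), of b] by (simp add: T_def fun_module_def)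
  qed
  have Tneg: "T (\<ominus>\<^bsub>M\<^esub> x) = \<ominus>\<^bsub>?F\<^esub> T x" if "x \<in> carrier M" for x
    using Tsm[of "\<ominus>\<^bsub>K\<^esub> \<one>\<^bsub>K\<^esub>" x] that Tc by (simp add: M.smult_l_minus F.smult_l_minus)
  have Tinj: "x = y" if xy: "x \<in> carrier M" "y \<in> carrier M" "T x = T y" for x y
  proof -
    have "T (x \<oplus>\<^bsub>M\<^esub> \<ominus>\<^bsub>M\<^esub> y) = \<zero>\<^bsub>?F\<^esub>" using xy Tc by (simp add: Tadd Tneg F.M.r_neg)
    then have "x \<oplus>\<^bsub>M\<^esub> \<ominus>\<^bsub>M\<^esub> y = \<zero>\<^bsub>M\<^esub>" using xy by (intro T0) auto
    then have "\<ominus>\<^bsub>M\<^esub> (\<ominus>\<^bsub>M\<^esub> y) = x" using xy by (intro M.M.minus_equality) auto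
    then show ?thesis using xy by simp
  qed
  have T0': "T \<zero>\<^bsub>M\<^esub> = \<zero>\<^bsub>?F\<^esub>" using Tsm[of "\<zero>\<^bsub>K\<^esub>" "\<zero>\<^bsub>M\<^esub>"] Tc by simp
  have image: "submodule (T ` H) K ?F" if "submodule H K M" for H
  proof (rule F.submoduleI)
    note H = M.submoduleD[OF that]
    show "T ` H \<subseteq> carrier ?F" using H(1) Tc by auto
    show "\<zero>\<^bsub>?F\<^esub> \<in> T ` H" using H(2) T0' by (metis imageI)
    show "u \<oplus>\<^bsub>?F\<^esub> v \<in> T ` H" if uv: "u \<in> T ` H" "v \<in> T ` H" for u v
    proof -
      obtain x y where "x \<in> H" "y \<in> H" "u = T x" "v = T y" using uv by blast
      then have "u \<oplus>\<^bsub>?F\<^esub> v = T (x \<oplus>\<^bsub>M\<^esub> y)" "x \<oplus>\<^bsub>M\<^esub> y \<in> H" using H(1,3) Tadd by (auto simp: subset_iff)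
      then show ?thesis by blast
    qed
    show "c \<odot>\<^bsub>?F\<^esub> u \<in> T ` H" if cu: "c \<in> carrier K" "u \<in> T ` H" for c u
    proof -
      obtain x where "x \<in> H" "u = T x" using cu(2) by blast
      then have "c \<odot>\<^bsub>?F\<^esub> u = T (c \<odot>\<^bsub>M\<^esub> x)" "c \<odot>\<^bsub>M\<^esub> x \<in> H" using cu H(1,4) Tsm by (auto simp: subset_iff)
      then show ?thesis by blast
    qed
  qed
  have "independent K ?F (T ` B)"
    unfolding independent_def
  proof (intro ballI notI)
    fix u assume u: "u \<in> T ` B" "u \<in> span K ?F (T ` B - {u})"
    then obtain b where b: "b \<in> B" "u = T b" by blast
    have "T ` B - {u} \<subseteq> T ` (B - {b})" using b by auto
    also have "\<dots> \<subseteq> T ` span K M (B - {b})" using M.span_superset[of "B - {b}"] by auto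
    finally have "span K ?F (T ` B - {u}) \<subseteq> T ` span K M (B - {b})"
      using Bf by (intro F.span_least image M.span_submodule) auto
    then obtain x where x: "x \<in> span K M (B - {b})" "T x = T b" using u b by auto
    then have "x \<in> carrier M" using M.span_carrier[of "B - {b}"] Bf by auto
    then have "x = b" using Tinj x b Bf by auto
    then show False using x b Bf(3) unfolding independent_def by auto
  qed
  moreover have "inj_on T B" using Tinj Bf by (auto intro!: inj_onI)
  then have "card (T ` B) = card B" by (rule card_image)
  moreover obtain G where "finite G" "card G \<le> card B" "G \<subseteq> carrier ?F" "carrier ?F \<subseteq> span K ?F G"
    using fun_module_spanned[OF assms(1) Bf(1)] by blast
  ultimately have "is_basis K ?F (T ` B)"
    using Bf Tc by (intro F.independent_card_ge_basis[of G]) auto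
  then have "carrier ?F = span K ?F (T ` B)" using F.is_basis_iff by auto
  also have "\<dots> \<subseteq> T ` carrier M" using Bf by (intro F.span_least image M.carrier_submodule) auto
  finally have "(\<lambda>b\<in>B. t b) \<in> T ` carrier M" using t by (auto simp: fun_module_def)
  then obtain x where "x \<in> carrier M" "(\<lambda>b\<in>B. t b) = T x" by blast
  then show ?thesis unfolding T_def by (metis restrict_apply')
qed

lemma opp_simps [simp]:
  "carrier (opp R) = carrier R" "mult (opp R) = (\<lambda>x y. y \<otimes>\<^bsub>R\<^esub> x)" "one (opp R) = \<one>\<^bsub>R\<^esub>"
  "zero (opp R) = \<zero>\<^bsub>R\<^esub>" "add (opp R) = add R"
  unfolding opp_def by simp_all

lemma Units_opp [simp]: "Units (opp R) = Units R"
  unfolding Units_def by auto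

lemma ring_opp: "ring R \<Longrightarrow> ring (opp R)"
proof -
  assume "ring R"
  then interpret ring R .
  show "ring (opp R)"
  proof (rule ringI)
    show "abelian_group (opp R)"
      by (rule abelian_groupI) (auto simp: a_ac intro: l_neg)
    show "monoid (opp R)" by (rule monoidI) (auto simp: m_assoc)
  qed (auto simp: l_distr r_distr)
qed

definition dual_module :: "'k ring \<Rightarrow> ('k, 'd) module \<Rightarrow> ('d, 'd \<Rightarrow> 'k) module" where
  "dual_module K D =
     \<lparr>carrier = hom_mod K D (self_alg K), mult = undefined, one = undefined,
      zero = (\<lambda>x\<in>carrier D. \<zero>\<^bsub>K\<^esub>),
      add = (\<lambda>\<eta> \<theta>. \<lambda>x\<in>carrier D. \<eta> x \<oplus>\<^bsub>K\<^esub> \<theta> x),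
      smult = (\<lambda>a \<eta>. \<lambda>x\<in>carrier D. \<eta> (a \<otimes>\<^bsub>D\<^esub> x))\<rparr>"

text \<open>
  Right \<open>D\<close>-modules are modules over \<open>opp D\<close>; for such a module \<open>V\<close> the left \<open>D\<close>-module \<open>hom_dual K D V\<close> is
  \<open>Hom(V, D\<^sup>*)\<close>.  It is the coordinate space of a fibre, with no reference to the algebra \<open>\<Lambda>\<close>.
\<close>
definition hom_dual :: "'k ring \<Rightarrow> ('k, 'd) module \<Rightarrow> ('d, 'v) module \<Rightarrow> ('d, 'v \<Rightarrow> 'd \<Rightarrow> 'k) module" where
  "hom_dual K D V =
     \<lparr>carrier = hom_mod (opp D) V (dual_module K D),
      mult = undefined, one = undefined,
      zero = (\<lambda>v\<in>carrier V. \<lambda>x\<in>carrier D. \<zero>\<^bsub>K\<^esub>),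
      add = (\<lambda>f g. \<lambda>v\<in>carrier V. \<lambda>x\<in>carrier D. f v x \<oplus>\<^bsub>K\<^esub> g v x),
      smult = (\<lambda>a f. \<lambda>v\<in>carrier V. \<lambda>x\<in>carrier D. f v (x \<otimes>\<^bsub>D\<^esub> a))\<rparr>"

lemma self_alg_simps [simp]:
  "carrier (self_alg K) = carrier K" "mult (self_alg K) = mult K" "one (self_alg K) = \<one>\<^bsub>K\<^esub>"
  "zero (self_alg K) = \<zero>\<^bsub>K\<^esub>" "add (self_alg K) = add K" "smult (self_alg K) = mult K"
  unfolding self_alg_def left_mod_def by simp_all

locale division_algebra =
  K: field K + D: ring D + KD: left_vector_space K D
  for K :: "'k ring" and D :: "('k, 'd) module" +
  assumes division: "Units D = carrier D - {\<zero>\<^bsub>D\<^esub>}"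
    and alg_smult: "\<And>c x y. \<lbrakk>c \<in> carrier K; x \<in> carrier D; y \<in> carrier D\<rbrakk> \<Longrightarrow>
          (c \<odot>\<^bsub>D\<^esub> x) \<otimes>\<^bsub>D\<^esub> y = c \<odot>\<^bsub>D\<^esub> (x \<otimes>\<^bsub>D\<^esub> y) \<and> x \<otimes>\<^bsub>D\<^esub> (c \<odot>\<^bsub>D\<^esub> y) = c \<odot>\<^bsub>D\<^esub> (x \<otimes>\<^bsub>D\<^esub> y)"
    and finite_dim: "\<exists>B. is_basis K D B"
begin

text \<open>
  A nonzero functional \<open>\<eta>\<^sub>0\<close> generates the dual: \<open>a \<mapsto> \<eta>\<^sub>0(x a)\<close> is injective because \<open>Da = D\<close>
  for \<open>a \<noteq> 0\<close>, hence surjective for dimension reasons.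
\<close>
lemma generating_functional:
  "\<exists>\<eta>0. (\<forall>x\<in>carrier D. \<eta>0 x \<in> carrier K) \<and>
     (\<forall>x\<in>carrier D. \<forall>y\<in>carrier D. \<eta>0 (x \<oplus>\<^bsub>D\<^esub> y) = \<eta>0 x \<oplus>\<^bsub>K\<^esub> \<eta>0 y) \<and>
     (\<forall>c\<in>carrier K. \<forall>x\<in>carrier D. \<eta>0 (c \<odot>\<^bsub>D\<^esub> x) = c \<otimes>\<^bsub>K\<^esub> \<eta>0 x) \<and>
     (\<exists>x0\<in>carrier D. \<eta>0 x0 \<noteq> \<zero>\<^bsub>K\<^esub>) \<and>
     (\<forall>\<eta>\<in>hom_mod K D (self_alg K). \<exists>a\<in>carrier D. \<forall>y\<in>carrier D. \<eta> y = \<eta>0 (y \<otimes>\<^bsub>D\<^esub> a))"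
proof -
  obtain B where B: "is_basis K D B" using finite_dim by blast
  have Bc: "B \<subseteq> carrier D" "span K D B = carrier D" using B KD.is_basis_iff by auto
  have "B \<noteq> {}"
  proof
    assume "B = {}"
    then have "carrier D = {\<zero>\<^bsub>D\<^esub>}" using Bc KD.span_empty by simp
    then show False using division D.Units_one_closed by auto
  qed
  then obtain b0 where b0: "b0 \<in> B" by blast
  have bc: "b \<in> carrier D" if "b \<in> B" for b using that Bc(1) by blast
  define \<eta>0 where "\<eta>0 x = coords K D B x b0" for x
  have cl: "\<eta>0 x \<in> carrier K" if "x \<in> carrier D" for x
    unfolding \<eta>0_def using KD.coords_closed[OF B that b0] .
  have add: "\<eta>0 (x \<oplus>\<^bsub>D\<^esub> y) = \<eta>0 x \<oplus>\<^bsub>K\<^esub> \<eta>0 y" if "x \<in> carrier D" "y \<in> carrier D" for x y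
    unfolding \<eta>0_def using KD.coords_add[OF B that b0] .
  have smult: "\<eta>0 (c \<odot>\<^bsub>D\<^esub> x) = c \<otimes>\<^bsub>K\<^esub> \<eta>0 x" if "c \<in> carrier K" "x \<in> carrier D" for c x
    unfolding \<eta>0_def using KD.coords_smult[OF B that(2,1) b0] .
  have nz: "b0 \<in> carrier D" "\<eta>0 b0 \<noteq> \<zero>\<^bsub>K\<^esub>"
    using b0 Bc KD.coords_basis[OF B b0 b0] unfolding \<eta>0_def by auto
  have determined: "\<eta> y = \<theta> y"
    if "\<And>x y. \<lbrakk>x \<in> carrier D; y \<in> carrier D\<rbrakk> \<Longrightarrow> \<eta> (x \<oplus>\<^bsub>D\<^esub> y) = \<eta> x \<oplus>\<^bsub>K\<^esub> \<eta> y"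
      "\<And>c x. \<lbrakk>c \<in> carrier K; x \<in> carrier D\<rbrakk> \<Longrightarrow> \<eta> (c \<odot>\<^bsub>D\<^esub> x) = c \<otimes>\<^bsub>K\<^esub> \<eta> x"
      "\<And>x y. \<lbrakk>x \<in> carrier D; y \<in> carrier D\<rbrakk> \<Longrightarrow> \<theta> (x \<oplus>\<^bsub>D\<^esub> y) = \<theta> x \<oplus>\<^bsub>K\<^esub> \<theta> y"
      "\<And>c x. \<lbrakk>c \<in> carrier K; x \<in> carrier D\<rbrakk> \<Longrightarrow> \<theta> (c \<odot>\<^bsub>D\<^esub> x) = c \<otimes>\<^bsub>K\<^esub> \<theta> x"
      "\<And>b. b \<in> B \<Longrightarrow> \<eta> b = \<theta> b" "\<eta> \<zero>\<^bsub>D\<^esub> = \<theta> \<zero>\<^bsub>D\<^esub>" "y \<in> carrier D"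
    for \<eta> \<theta> :: "'d \<Rightarrow> 'k" and y
  proof -
    have "submodule {x \<in> carrier D. \<eta> x = \<theta> x} K D" using that by (intro KD.submoduleI) auto
    then have "span K D B \<subseteq> {x \<in> carrier D. \<eta> x = \<theta> x}" using that Bc by (intro KD.span_least) auto
    then show ?thesis using Bc that by auto
  qed
  have gen: "\<exists>a\<in>carrier D. \<forall>y\<in>carrier D. \<eta> y = \<eta>0 (y \<otimes>\<^bsub>D\<^esub> a)" if \<eta>: "\<eta> \<in> hom_mod K D (self_alg K)" for \<eta>
  proof -
    have \<eta>cl: "\<eta> x \<in> carrier K" if "x \<in> carrier D" for x
      using \<eta> that unfolding hom_mod_def by auto
    have \<eta>0: "\<eta> \<zero>\<^bsub>D\<^esub> = \<zero>\<^bsub>K\<^esub>" and \<eta>00: "\<eta>0 \<zero>\<^bsub>D\<^esub> = \<zero>\<^bsub>K\<^esub>"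
    proof -
      have "\<eta> (c \<odot>\<^bsub>D\<^esub> x) = c \<otimes>\<^bsub>K\<^esub> \<eta> x" if "c \<in> carrier K" "x \<in> carrier D" for c x
        using \<eta> that unfolding hom_mod_def by auto
      from this[of "\<zero>\<^bsub>K\<^esub>" "\<zero>\<^bsub>D\<^esub>"] show "\<eta> \<zero>\<^bsub>D\<^esub> = \<zero>\<^bsub>K\<^esub>" using \<eta>cl by simp
      show "\<eta>0 \<zero>\<^bsub>D\<^esub> = \<zero>\<^bsub>K\<^esub>" using smult[of "\<zero>\<^bsub>K\<^esub>" "\<zero>\<^bsub>D\<^esub>"] cl by simp
    qed
    have "\<exists>a\<in>carrier D. \<forall>b\<in>B. \<eta>0 (b \<otimes>\<^bsub>D\<^esub> a) = \<eta> b"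
    proof (rule injective_evaluation_surjective[OF K.field_axioms KD.left_vector_space_axioms B])
      fix a assume a: "a \<in> carrier D" "\<forall>b\<in>B. \<eta>0 (b \<otimes>\<^bsub>D\<^esub> a) = \<zero>\<^bsub>K\<^esub>"
      have z: "\<eta>0 (y \<otimes>\<^bsub>D\<^esub> a) = \<zero>\<^bsub>K\<^esub>" if "y \<in> carrier D" for y
      proof (rule determined[of "\<lambda>y. \<eta>0 (y \<otimes>\<^bsub>D\<^esub> a)" "\<lambda>_. \<zero>\<^bsub>K\<^esub>", OF _ _ _ _ _ _ that])
        show "\<eta>0 (b \<otimes>\<^bsub>D\<^esub> a) = \<zero>\<^bsub>K\<^esub>" if "b \<in> B" for b using a(2) that by simp
      qed (use a(1) in \<open>simp_all add: D.l_distr add alg_smult smult \<eta>00\<close>)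
      show "a = \<zero>\<^bsub>D\<^esub>"
      proof (rule ccontr)
        assume "a \<noteq> \<zero>\<^bsub>D\<^esub>"
        then have u: "a \<in> Units D" using a division by auto
        then have "b0 \<otimes>\<^bsub>D\<^esub> inv\<^bsub>D\<^esub> a \<otimes>\<^bsub>D\<^esub> a = b0" using nz a by (simp add: D.m_assoc)
        then show False using z[of "b0 \<otimes>\<^bsub>D\<^esub> inv\<^bsub>D\<^esub> a"] nz u by simp
      qed
    qed (simp_all add: bc cl \<eta>cl D.r_distr add alg_smult smult)
    then obtain a where a: "a \<in> carrier D" "\<forall>b\<in>B. \<eta>0 (b \<otimes>\<^bsub>D\<^esub> a) = \<eta> b" by blast
    have "\<eta> y = \<eta>0 (y \<otimes>\<^bsub>D\<^esub> a)" if "y \<in> carrier D" for y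
    proof (rule determined[of \<eta> "\<lambda>y. \<eta>0 (y \<otimes>\<^bsub>D\<^esub> a)", OF _ _ _ _ _ _ that])
      show "\<eta> (x \<oplus>\<^bsub>D\<^esub> y) = \<eta> x \<oplus>\<^bsub>K\<^esub> \<eta> y" if "x \<in> carrier D" "y \<in> carrier D" for x y
        using \<eta> that unfolding hom_mod_def by auto
      show "\<eta> (c \<odot>\<^bsub>D\<^esub> x) = c \<otimes>\<^bsub>K\<^esub> \<eta> x" if "c \<in> carrier K" "x \<in> carrier D" for c x
        using \<eta> that unfolding hom_mod_def by auto
      show "\<eta> b = \<eta>0 (b \<otimes>\<^bsub>D\<^esub> a)" if "b \<in> B" for b using a(2) that by simp
    qed (use a(1) in \<open>simp_all add: D.l_distr add alg_smult smult \<eta>0 \<eta>00\<close>)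
    then show ?thesis using a by blast
  qed
  show ?thesis by (intro exI[of _ \<eta>0] conjI ballI bexI[of _ b0] gen cl add smult nz)
qed

end

locale dual_setup = division_algebra + V: left_vector_space "opp D" V
  for V :: "('b, 'v) module"
begin

abbreviation W where "W \<equiv> hom_dual K D V"

lemma hom_dual_iff:
  "F \<in> carrier W \<longleftrightarrow> F \<in> carrier V \<rightarrow>\<^sub>E (carrier D \<rightarrow>\<^sub>E carrier K) \<and>
    (\<forall>v\<in>carrier V. \<forall>x\<in>carrier D. \<forall>y\<in>carrier D. F v (x \<oplus>\<^bsub>D\<^esub> y) = F v x \<oplus>\<^bsub>K\<^esub> F v y) \<and>
    (\<forall>v\<in>carrier V. \<forall>c\<in>carrier K. \<forall>x\<in>carrier D. F v (c \<odot>\<^bsub>D\<^esub> x) = c \<otimes>\<^bsub>K\<^esub> F v x) \<and>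
    (\<forall>v\<in>carrier V. \<forall>w\<in>carrier V. \<forall>x\<in>carrier D. F (v \<oplus>\<^bsub>V\<^esub> w) x = F v x \<oplus>\<^bsub>K\<^esub> F w x) \<and>
    (\<forall>d\<in>carrier D. \<forall>v\<in>carrier V. \<forall>x\<in>carrier D. F (d \<odot>\<^bsub>V\<^esub> v) x = F v (d \<otimes>\<^bsub>D\<^esub> x))" (is "?L \<longleftrightarrow> ?R")
proof -
  have ext: "f = (\<lambda>x\<in>carrier D. g x) \<longleftrightarrow> (\<forall>x\<in>carrier D. f x = g x)"
    if "f \<in> carrier D \<rightarrow>\<^sub>E carrier K" for f g
    using that by (auto simp: PiE_iff extensional_def fun_eq_iff)
  show ?thesis
  proof
    assume L: ?L
    then have h: "F v \<in> hom_mod K D (self_alg K)" if "v \<in> carrier V" for v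
      using that unfolding hom_dual_def dual_module_def hom_mod_def[of "opp D"] by auto
    then have c: "F v \<in> carrier D \<rightarrow>\<^sub>E carrier K" if "v \<in> carrier V" for v
      using that unfolding hom_mod_def by auto
    have "\<forall>v\<in>carrier V. \<forall>x\<in>carrier D. \<forall>y\<in>carrier D. F v (x \<oplus>\<^bsub>D\<^esub> y) = F v x \<oplus>\<^bsub>K\<^esub> F v y"
      "\<forall>v\<in>carrier V. \<forall>c\<in>carrier K. \<forall>x\<in>carrier D. F v (c \<odot>\<^bsub>D\<^esub> x) = c \<otimes>\<^bsub>K\<^esub> F v x"
      using h unfolding hom_mod_def by auto
    moreover have "F \<in> extensional (carrier V)"
      using L unfolding hom_dual_def hom_mod_def by (auto simp: PiE_iff)
    ultimately show ?R using L c unfolding hom_dual_def dual_module_def hom_mod_def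
      by (auto simp: ext PiE_iff)
  next
    assume R: ?R
    then have c: "F v \<in> carrier D \<rightarrow>\<^sub>E carrier K" if "v \<in> carrier V" for v
      using that by auto
    from R show ?L unfolding hom_dual_def dual_module_def hom_mod_def using c by (auto simp: ext PiE_iff)
  qed
qed

lemma W_simps:
  "v \<in> carrier V \<Longrightarrow> x \<in> carrier D \<Longrightarrow> (F \<oplus>\<^bsub>W\<^esub> G) v x = F v x \<oplus>\<^bsub>K\<^esub> G v x"
  "v \<in> carrier V \<Longrightarrow> x \<in> carrier D \<Longrightarrow> \<zero>\<^bsub>W\<^esub> v x = \<zero>\<^bsub>K\<^esub>"
  "v \<in> carrier V \<Longrightarrow> x \<in> carrier D \<Longrightarrow> (a \<odot>\<^bsub>W\<^esub> F) v x = F v (x \<otimes>\<^bsub>D\<^esub> a)"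
  unfolding hom_dual_def by simp_all

lemma W_eqI:
  assumes "F \<in> carrier V \<rightarrow>\<^sub>E (carrier D \<rightarrow>\<^sub>E carrier K)" "G \<in> carrier V \<rightarrow>\<^sub>E (carrier D \<rightarrow>\<^sub>E carrier K)"
    and "\<And>v x. \<lbrakk>v \<in> carrier V; x \<in> carrier D\<rbrakk> \<Longrightarrow> F v x = G v x"
  shows "F = G"
proof (rule PiE_ext[OF assms(1,2)])
  fix v assume v: "v \<in> carrier V"
  show "F v = G v"
    by (rule PiE_ext[of _ "carrier D" "\<lambda>_. carrier K"]) (use assms v in auto)
qed

lemma W_D:
  assumes "F \<in> carrier W"
  shows "F \<in> carrier V \<rightarrow>\<^sub>E (carrier D \<rightarrow>\<^sub>E carrier K)"
    and "\<And>v x. \<lbrakk>v \<in> carrier V; x \<in> carrier D\<rbrakk> \<Longrightarrow> F v x \<in> carrier K"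
    and "\<And>v x y. \<lbrakk>v \<in> carrier V; x \<in> carrier D; y \<in> carrier D\<rbrakk> \<Longrightarrow> F v (x \<oplus>\<^bsub>D\<^esub> y) = F v x \<oplus>\<^bsub>K\<^esub> F v y"
    and "\<And>v c x. \<lbrakk>v \<in> carrier V; c \<in> carrier K; x \<in> carrier D\<rbrakk> \<Longrightarrow> F v (c \<odot>\<^bsub>D\<^esub> x) = c \<otimes>\<^bsub>K\<^esub> F v x"
    and "\<And>v w x. \<lbrakk>v \<in> carrier V; w \<in> carrier V; x \<in> carrier D\<rbrakk> \<Longrightarrow> F (v \<oplus>\<^bsub>V\<^esub> w) x = F v x \<oplus>\<^bsub>K\<^esub> F w x"
    and "\<And>d v x. \<lbrakk>d \<in> carrier D; v \<in> carrier V; x \<in> carrier D\<rbrakk> \<Longrightarrow> F (d \<odot>\<^bsub>V\<^esub> v) x = F v (d \<otimes>\<^bsub>D\<^esub> x)"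
  using assms unfolding hom_dual_iff by (auto simp: PiE_iff)

lemma V_smult_closed [simp]: "d \<in> carrier D \<Longrightarrow> v \<in> carrier V \<Longrightarrow> d \<odot>\<^bsub>V\<^esub> v \<in> carrier V"
  using V.smult_closed by simp

lemma W_closed:
  shows "\<lbrakk>F \<in> carrier W; G \<in> carrier W\<rbrakk> \<Longrightarrow> F \<oplus>\<^bsub>W\<^esub> G \<in> carrier W"
    and "\<zero>\<^bsub>W\<^esub> \<in> carrier W"
    and "\<lbrakk>a \<in> carrier D; F \<in> carrier W\<rbrakk> \<Longrightarrow> a \<odot>\<^bsub>W\<^esub> F \<in> carrier W"
proof -
  assume F: "F \<in> carrier W" and G: "G \<in> carrier W"
  have "F \<oplus>\<^bsub>W\<^esub> G \<in> carrier V \<rightarrow>\<^sub>E (carrier D \<rightarrow>\<^sub>E carrier K)"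
    using W_D(2)[OF F] W_D(2)[OF G] unfolding hom_dual_def by auto
  then show "F \<oplus>\<^bsub>W\<^esub> G \<in> carrier W"
    unfolding hom_dual_iff
    using W_D(2-6)[OF F] W_D(2-6)[OF G] by (simp add: W_simps K.a_ac K.r_distr)
next
  have "\<zero>\<^bsub>W\<^esub> \<in> carrier V \<rightarrow>\<^sub>E (carrier D \<rightarrow>\<^sub>E carrier K)"
    unfolding hom_dual_def by auto
  then show "\<zero>\<^bsub>W\<^esub> \<in> carrier W" unfolding hom_dual_iff by (simp add: W_simps)
next
  assume a: "a \<in> carrier D" and F: "F \<in> carrier W"
  have "a \<odot>\<^bsub>W\<^esub> F \<in> carrier V \<rightarrow>\<^sub>E (carrier D \<rightarrow>\<^sub>E carrier K)"
    using W_D(2)[OF F] a unfolding hom_dual_def by auto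
  then show "a \<odot>\<^bsub>W\<^esub> F \<in> carrier W"
    unfolding hom_dual_iff
    using W_D(2-6)[OF F] a by (simp add: W_simps D.l_distr alg_smult D.m_assoc)
qed

sublocale W: left_vector_space D W
proof -
  note ext = W_eqI[OF W_D(1) W_D(1)]
  have "abelian_group W"
  proof (rule abelian_groupI)
    fix F assume F: "F \<in> carrier W"
    have m: "\<ominus>\<^bsub>D\<^esub> \<one>\<^bsub>D\<^esub> \<in> carrier D" by simp
    have neg: "F v x \<oplus>\<^bsub>K\<^esub> F v (\<ominus>\<^bsub>D\<^esub> x) = \<zero>\<^bsub>K\<^esub>" if "v \<in> carrier V" "x \<in> carrier D" for v x
    proof -
      have "F v \<zero>\<^bsub>D\<^esub> = \<zero>\<^bsub>K\<^esub>"
        using W_D(4)[OF F that(1), of "\<zero>\<^bsub>K\<^esub>" "\<zero>\<^bsub>D\<^esub>"] W_D(2)[OF F that(1)] by simp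
      then show ?thesis using W_D(3)[OF F that(1) that(2), of "\<ominus>\<^bsub>D\<^esub> x"] that(2) by (simp add: D.r_neg)
    qed
    have "(\<ominus>\<^bsub>D\<^esub> \<one>\<^bsub>D\<^esub>) \<odot>\<^bsub>W\<^esub> F \<oplus>\<^bsub>W\<^esub> F = \<zero>\<^bsub>W\<^esub>"
    proof (rule ext)
      fix v x assume vx: "v \<in> carrier V" "x \<in> carrier D"
      then have "F v (\<ominus>\<^bsub>D\<^esub> x) \<oplus>\<^bsub>K\<^esub> F v x = \<zero>\<^bsub>K\<^esub>"
        using neg[OF vx] W_D(2)[OF F] by (simp add: K.a_comm)
      then show "((\<ominus>\<^bsub>D\<^esub> \<one>\<^bsub>D\<^esub>) \<odot>\<^bsub>W\<^esub> F \<oplus>\<^bsub>W\<^esub> F) v x = \<zero>\<^bsub>W\<^esub> v x"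
        using vx by (simp add: W_simps D.r_minus)
    qed (use F m W_closed in auto)
    then show "\<exists>G\<in>carrier W. G \<oplus>\<^bsub>W\<^esub> F = \<zero>\<^bsub>W\<^esub>" using W_closed(3)[OF m F] by blast
  next
    fix F G assume "F \<in> carrier W" "G \<in> carrier W"
    then show "F \<oplus>\<^bsub>W\<^esub> G = G \<oplus>\<^bsub>W\<^esub> F"
      by (intro ext W_closed) (simp_all add: W_simps K.a_comm W_D(2))
  next
    fix F G H assume "F \<in> carrier W" "G \<in> carrier W" "H \<in> carrier W"
    then show "F \<oplus>\<^bsub>W\<^esub> G \<oplus>\<^bsub>W\<^esub> H = F \<oplus>\<^bsub>W\<^esub> (G \<oplus>\<^bsub>W\<^esub> H)"
      by (intro ext W_closed) (simp_all add: W_simps K.a_assoc W_D(2))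
  next
    fix F assume "F \<in> carrier W"
    then show "\<zero>\<^bsub>W\<^esub> \<oplus>\<^bsub>W\<^esub> F = F"
      by (intro ext W_closed) (simp_all add: W_simps W_D(2))
  qed (auto intro: W_closed)
  moreover have "left_module_axioms D W"
  proof
    fix a b F assume "a \<in> carrier D" "b \<in> carrier D" "F \<in> carrier W"
    then show "(a \<oplus>\<^bsub>D\<^esub> b) \<odot>\<^bsub>W\<^esub> F = a \<odot>\<^bsub>W\<^esub> F \<oplus>\<^bsub>W\<^esub> b \<odot>\<^bsub>W\<^esub> F"
      and "(a \<otimes>\<^bsub>D\<^esub> b) \<odot>\<^bsub>W\<^esub> F = a \<odot>\<^bsub>W\<^esub> (b \<odot>\<^bsub>W\<^esub> F)"
      by (intro ext W_closed D.a_closed D.m_closed; simp add: W_simps W_D(3) D.r_distr D.m_assoc)+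
  next
    fix a F G assume "a \<in> carrier D" "F \<in> carrier W" "G \<in> carrier W"
    then show "a \<odot>\<^bsub>W\<^esub> (F \<oplus>\<^bsub>W\<^esub> G) = a \<odot>\<^bsub>W\<^esub> F \<oplus>\<^bsub>W\<^esub> a \<odot>\<^bsub>W\<^esub> G"
      by (intro ext W_closed; simp add: W_simps)
  next
    fix F assume "F \<in> carrier W"
    then show "\<one>\<^bsub>D\<^esub> \<odot>\<^bsub>W\<^esub> F = F" by (intro ext W_closed D.one_closed; simp add: W_simps)
  qed (rule W_closed)
  ultimately show "left_vector_space D W"
    using division D.ring_axioms
    by (intro left_vector_space.intro left_module.intro left_vector_space_axioms.intro) auto
qed

text \<open>
  The dual basis: for a basis element \<open>b\<close> with coordinate function \<open>c\<^sub>b\<close>, take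
  \<open>v \<mapsto> (x \<mapsto> \<eta>\<^sub>0(c\<^sub>b(v) x))\<close>, where \<open>\<eta>\<^sub>0\<close> generates \<open>D\<^sup>*\<close>.  A map \<open>F\<close> is determined by its values \<open>F(b)\<close>,
  and \<open>F(b) = \<eta>\<^sub>0(x a)\<close> for some \<open>a\<close>, so subtracting \<open>a\<close> times the dual vector of \<open>b\<close> removes one basis
  element at a time.
\<close>
lemma hom_dual_basis:
  assumes B: "is_basis (opp D) V B"
  shows "\<exists>C. is_basis D W C \<and> card C = card B"
proof -
  obtain \<eta>0 where "\<forall>x\<in>carrier D. \<eta>0 x \<in> carrier K"
    and "\<forall>x\<in>carrier D. \<forall>y\<in>carrier D. \<eta>0 (x \<oplus>\<^bsub>D\<^esub> y) = \<eta>0 x \<oplus>\<^bsub>K\<^esub> \<eta>0 y"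
    and "\<forall>c\<in>carrier K. \<forall>x\<in>carrier D. \<eta>0 (c \<odot>\<^bsub>D\<^esub> x) = c \<otimes>\<^bsub>K\<^esub> \<eta>0 x"
    and "\<exists>x0\<in>carrier D. \<eta>0 x0 \<noteq> \<zero>\<^bsub>K\<^esub>"
    and gen: "\<forall>\<eta>\<in>hom_mod K D (self_alg K). \<exists>a\<in>carrier D. \<forall>y\<in>carrier D. \<eta> y = \<eta>0 (y \<otimes>\<^bsub>D\<^esub> a)"
    using generating_functional by (elim exE conjE)
  then obtain x0 where cl: "\<And>x. x \<in> carrier D \<Longrightarrow> \<eta>0 x \<in> carrier K"
    and add: "\<And>x y. \<lbrakk>x \<in> carrier D; y \<in> carrier D\<rbrakk> \<Longrightarrow> \<eta>0 (x \<oplus>\<^bsub>D\<^esub> y) = \<eta>0 x \<oplus>\<^bsub>K\<^esub> \<eta>0 y"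
    and smult: "\<And>c x. \<lbrakk>c \<in> carrier K; x \<in> carrier D\<rbrakk> \<Longrightarrow> \<eta>0 (c \<odot>\<^bsub>D\<^esub> x) = c \<otimes>\<^bsub>K\<^esub> \<eta>0 x"
    and nz: "x0 \<in> carrier D" "\<eta>0 x0 \<noteq> \<zero>\<^bsub>K\<^esub>"
    by auto
  have \<eta>00: "\<eta>0 \<zero>\<^bsub>D\<^esub> = \<zero>\<^bsub>K\<^esub>" using smult[of "\<zero>\<^bsub>K\<^esub>" "\<zero>\<^bsub>D\<^esub>"] cl by simp
  have Bf: "finite B" "B \<subseteq> carrier V" "span (opp D) V B = carrier V" using B V.is_basis_iff by auto
  let ?c = "coords (opp D) V B"
  have cc: "?c v b \<in> carrier D" if "v \<in> carrier V" "b \<in> B" for v b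
    using V.coords_closed[OF B that] by simp
  define G where "G b = (\<lambda>v\<in>carrier V. \<lambda>x\<in>carrier D. \<eta>0 (?c v b \<otimes>\<^bsub>D\<^esub> x))" for b
  have Gap: "G b v x = \<eta>0 (?c v b \<otimes>\<^bsub>D\<^esub> x)" if "v \<in> carrier V" "x \<in> carrier D" for b v x
    using that unfolding G_def by simp
  have GW: "G b \<in> carrier W" if b: "b \<in> B" for b
  proof -
    have "G b \<in> carrier V \<rightarrow>\<^sub>E (carrier D \<rightarrow>\<^sub>E carrier K)"
      using cc b cl unfolding G_def by auto
    then show ?thesis
      unfolding hom_dual_iff
      using cc[OF _ b] V.coords_add[OF B _ _ b] V.coords_smult[OF B _ _ b]
      by (simp add: Gap D.r_distr D.l_distr add alg_smult smult D.m_assoc)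
  qed
  have Gb: "G b b' x = (if b' = b then \<eta>0 x else \<zero>\<^bsub>K\<^esub>)" if "b \<in> B" "b' \<in> B" "x \<in> carrier D" for b b' x
    using V.coords_basis[OF B that(2,1)] that Bf by (auto simp: Gap \<eta>00)
  have spanning: "F \<in> span D W (G ` S)"
    if "finite S" "S \<subseteq> B" "F \<in> carrier W" "\<And>b x. \<lbrakk>b \<in> B - S; x \<in> carrier D\<rbrakk> \<Longrightarrow> F b x = \<zero>\<^bsub>K\<^esub>" for F S
    using that
  proof (induct S arbitrary: F rule: finite_induct)
    case empty
    note F = W_D[OF empty(2)]
    have F0: "F v \<zero>\<^bsub>D\<^esub> = \<zero>\<^bsub>K\<^esub>" if "v \<in> carrier V" for v
      using F(4)[OF that, of "\<zero>\<^bsub>K\<^esub>" "\<zero>\<^bsub>D\<^esub>"] F(2)[OF that] by simp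
    have "submodule {v \<in> carrier V. \<forall>x\<in>carrier D. F v x = \<zero>\<^bsub>K\<^esub>} (opp D) V"
    proof (rule V.submoduleI)
      have "F (\<zero>\<^bsub>D\<^esub> \<odot>\<^bsub>V\<^esub> \<zero>\<^bsub>V\<^esub>) x = \<zero>\<^bsub>K\<^esub>" if "x \<in> carrier D" for x
        using F(6)[of "\<zero>\<^bsub>D\<^esub>" "\<zero>\<^bsub>V\<^esub>" x] F0 that by simp
      then show "\<zero>\<^bsub>V\<^esub> \<in> {v \<in> carrier V. \<forall>x\<in>carrier D. F v x = \<zero>\<^bsub>K\<^esub>}" using V.smult_r_null[of "\<zero>\<^bsub>D\<^esub>"] by simp
    qed (use F in auto)
    then have "span (opp D) V B \<subseteq> {v \<in> carrier V. \<forall>x\<in>carrier D. F v x = \<zero>\<^bsub>K\<^esub>}"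
      using Bf empty(3) by (intro V.span_least) auto
    then have "F = \<zero>\<^bsub>W\<^esub>" using Bf by (intro W_eqI[OF F(1) W_D(1)[OF W_closed(2)]]) (auto simp: W_simps)
    then show ?case by (simp add: W.span_empty)
  next
    case (insert s S)
    note F = W_D[OF insert.prems(2)]
    have s: "s \<in> B" "s \<in> carrier V" using insert Bf by auto
    have "F s \<in> hom_mod K D (self_alg K)" using F(1,3,4) s unfolding hom_mod_def by auto
    then obtain a where a: "a \<in> carrier D" "\<And>y. y \<in> carrier D \<Longrightarrow> F s y = \<eta>0 (y \<otimes>\<^bsub>D\<^esub> a)" using gen by blast
    have sub: "submodule (span D W (G ` insert s S)) D W" using GW insert by (intro W.span_submodule) auto
    let ?H = "F \<oplus>\<^bsub>W\<^esub> \<ominus>\<^bsub>D\<^esub> a \<odot>\<^bsub>W\<^esub> G s"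
    have HW: "?H \<in> carrier W" using insert.prems(2) a GW[OF s(1)] by simp
    have neg: "\<eta>0 (\<ominus>\<^bsub>D\<^esub> y) \<oplus>\<^bsub>K\<^esub> \<eta>0 y = \<zero>\<^bsub>K\<^esub>" if "y \<in> carrier D" for y
      using add[of "\<ominus>\<^bsub>D\<^esub> y" y] that \<eta>00 by (simp add: D.l_neg)
    have "?H b x = \<zero>\<^bsub>K\<^esub>" if "b \<in> B - S" "x \<in> carrier D" for b x
    proof (cases "b = s")
      case True
      have y: "x \<otimes>\<^bsub>D\<^esub> a \<in> carrier D" using that a by simp
      have "?H b x = \<eta>0 (x \<otimes>\<^bsub>D\<^esub> a) \<oplus>\<^bsub>K\<^esub> \<eta>0 (\<ominus>\<^bsub>D\<^esub> (x \<otimes>\<^bsub>D\<^esub> a))"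
        using True s that a Gb[OF s(1) s(1)] by (simp add: W_simps D.r_minus)
      then show ?thesis using neg[OF y] cl[OF y] cl[of "\<ominus>\<^bsub>D\<^esub> (x \<otimes>\<^bsub>D\<^esub> a)"] y by (simp add: K.a_comm)
    next
      case False
      then have "F b x = \<zero>\<^bsub>K\<^esub>" "b \<in> carrier V" "b \<in> B" using that insert.prems(3) Bf by auto
      then show ?thesis using False that a Gb[OF s(1), of b] by (simp add: W_simps)
    qed
    then have "?H \<in> span D W (G ` S)" using HW insert by auto
    then have H: "?H \<in> span D W (G ` insert s S)" using W.span_mono[of "G ` S" "G ` insert s S"] by auto
    have Gs: "G s \<in> span D W (G ` insert s S)" using W.span_superset[of "G ` insert s S"] by auto
    have "?H \<oplus>\<^bsub>W\<^esub> a \<odot>\<^bsub>W\<^esub> G s \<in> span D W (G ` insert s S)"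
      using W.submoduleD(3,4)[OF sub] H Gs a by blast
    moreover have "?H \<oplus>\<^bsub>W\<^esub> a \<odot>\<^bsub>W\<^esub> G s = F"
      using insert.prems(2) a GW[OF s(1)] by (simp add: W.M.a_assoc W.smult_l_minus W.M.l_neg)
    ultimately show ?case by simp
  qed
  have Gsub: "G ` B \<subseteq> carrier W" using GW by auto
  have ne: "G b \<notin> span D W (G ` (B - {b}))" if b: "b \<in> B" for b
  proof
    assume *: "G b \<in> span D W (G ` (B - {b}))"
    have bc: "b \<in> carrier V" using b Bf by auto
    have "submodule {F \<in> carrier W. \<forall>x\<in>carrier D. F b x = \<zero>\<^bsub>K\<^esub>} D W"
      using bc by (intro W.submoduleI) (auto simp: W_simps)
    then have "span D W (G ` (B - {b})) \<subseteq> {F \<in> carrier W. \<forall>x\<in>carrier D. F b x = \<zero>\<^bsub>K\<^esub>}"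
      using Gb b GW by (intro W.span_least) auto
    then have "G b b x0 = \<zero>\<^bsub>K\<^esub>" using * nz by blast
    then show False using Gb[OF b b nz(1)] nz(2) by simp
  qed
  have inj: "inj_on G B"
  proof (rule inj_onI, rule ccontr)
    fix b c assume bc: "b \<in> B" "c \<in> B" "G b = G c" "b \<noteq> c"
    then show False using ne[of b] W.span_superset[of "G ` (B - {b})"] by auto
  qed
  have "independent D W (G ` B)"
    unfolding independent_def
  proof (rule ballI)
    fix u assume "u \<in> G ` B"
    then obtain b where b: "b \<in> B" "u = G b" by blast
    then have "G ` B - {u} \<subseteq> G ` (B - {b})" by auto
    then show "u \<notin> span D W (G ` B - {u})" using ne b W.span_mono by blast
  qed
  moreover have "carrier W \<subseteq> span D W (G ` B)" using spanning[OF Bf(1)] by blast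
  ultimately have "is_basis D W (G ` B)"
    using W.is_basis_iff Bf(1) Gsub W.span_carrier[OF Gsub] by auto
  then show ?thesis using card_image[OF inj] by blast
qed

end

lemma left_mod_simps [simp]:
  "carrier (left_mod R N) = N" "zero (left_mod R N) = \<zero>\<^bsub>R\<^esub>" "add (left_mod R N) = add R"
  "smult (left_mod R N) = mult R" "mult (left_mod R N) = mult R" "one (left_mod R N) = \<one>\<^bsub>R\<^esub>"
  unfolding left_mod_def by simp_all

lemma left_mod_left_module:
  assumes "ring R"
  shows "left_module R (left_mod R (carrier R))"
proof -
  interpret ring R by fact
  have "abelian_group (left_mod R (carrier R))"
    by (rule abelian_groupI) (auto simp: a_ac intro: l_neg)
  then show ?thesis
    using ring_axioms
    by (intro left_module.intro left_module_axioms.intro) (auto simp: l_distr r_distr m_assoc)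
qed

section \<open>The Jacobson radical\<close>

context basic_fd_algebra
begin

sublocale A: ring A by (rule ring)
sublocale K: field K by (rule field)
sublocale KA: left_vector_space K A
proof -
  interpret module K A by (rule vector_space)
  show "left_vector_space K A"
    using field_Units_eq[OF field] K.ring_axioms A.abelian_group_axioms
      smult_closed smult_l_distr smult_r_distr smult_assoc1 smult_one
    by (intro left_vector_space.intro left_vector_space_axioms.intro left_module.intro left_module_axioms.intro) auto
qed

sublocale R: left_module A "left_mod A (carrier A)"
  by (rule left_mod_left_module[OF ring])

abbreviation J where "J \<equiv> jacobson_radical A"

lemma left_ideal_iff:
  "left_ideal A L \<longleftrightarrow> L \<subseteq> carrier A \<and> \<zero>\<^bsub>A\<^esub> \<in> L \<and> (\<forall>x\<in>L. \<forall>y\<in>L. x \<oplus>\<^bsub>A\<^esub> y \<in> L) \<and>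
     (\<forall>a\<in>carrier A. \<forall>x\<in>L. a \<otimes>\<^bsub>A\<^esub> x \<in> L)"
proof
  assume "left_ideal A L"
  then have L: "submodule L A (left_mod A (carrier A))" unfolding left_ideal_def .
  show "L \<subseteq> carrier A \<and> \<zero>\<^bsub>A\<^esub> \<in> L \<and> (\<forall>x\<in>L. \<forall>y\<in>L. x \<oplus>\<^bsub>A\<^esub> y \<in> L) \<and>
     (\<forall>a\<in>carrier A. \<forall>x\<in>L. a \<otimes>\<^bsub>A\<^esub> x \<in> L)"
    using R.submoduleD(1-4)[OF L] by simp
next
  assume "L \<subseteq> carrier A \<and> \<zero>\<^bsub>A\<^esub> \<in> L \<and> (\<forall>x\<in>L. \<forall>y\<in>L. x \<oplus>\<^bsub>A\<^esub> y \<in> L) \<and>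
     (\<forall>a\<in>carrier A. \<forall>x\<in>L. a \<otimes>\<^bsub>A\<^esub> x \<in> L)"
  then show "left_ideal A L" unfolding left_ideal_def by (intro R.submoduleI) auto
qed

lemma left_ideal_neg: "left_ideal A L \<Longrightarrow> x \<in> L \<Longrightarrow> \<ominus>\<^bsub>A\<^esub> x \<in> L"
proof -
  assume L: "left_ideal A L" and x: "x \<in> L"
  then have "\<ominus>\<^bsub>A\<^esub> \<one>\<^bsub>A\<^esub> \<otimes>\<^bsub>A\<^esub> x \<in> L" "x \<in> carrier A" unfolding left_ideal_iff by auto
  then show ?thesis by (simp add: A.l_minus)
qed

lemma left_ideal_eq_carrier: "left_ideal A L \<Longrightarrow> \<one>\<^bsub>A\<^esub> \<in> L \<Longrightarrow> L = carrier A"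
proof -
  assume L: "left_ideal A L" and o: "\<one>\<^bsub>A\<^esub> \<in> L"
  have "a \<in> L" if "a \<in> carrier A" for a
  proof -
    have "a \<otimes>\<^bsub>A\<^esub> \<one>\<^bsub>A\<^esub> \<in> L" using L o that unfolding left_ideal_iff by blast
    then show ?thesis using that by simp
  qed
  then show ?thesis using L unfolding left_ideal_iff by blast
qed

text \<open>
  For \<open>x \<notin> L\<close> the left ideal \<open>L + \<Lambda>x\<close> is everything.
\<close>
lemma maximal_left_ideal_complement:
  assumes L: "maximal_left_ideal A L" and x: "x \<in> carrier A" "x \<notin> L" and a: "a \<in> carrier A"
  shows "\<exists>y\<in>carrier A. a \<oplus>\<^bsub>A\<^esub> \<ominus>\<^bsub>A\<^esub> (y \<otimes>\<^bsub>A\<^esub> x) \<in> L"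
proof -
  have Li: "left_ideal A L" and Lmax: "\<And>L'. left_ideal A L' \<Longrightarrow> L \<subseteq> L' \<Longrightarrow> L' = L \<or> L' = carrier A"
    using L unfolding maximal_left_ideal_def by auto
  have Lc: "L \<subseteq> carrier A" "\<zero>\<^bsub>A\<^esub> \<in> L" using Li unfolding left_ideal_iff by auto
  let ?L = "span A (left_mod A (carrier A)) (insert x L)"
  have eq: "?L = {b \<otimes>\<^bsub>A\<^esub> x \<oplus>\<^bsub>A\<^esub> s |b s. b \<in> carrier A \<and> s \<in> L}"
  proof -
    have "span A (left_mod A (carrier A)) L = L"
      using R.span_least[of L L] R.span_superset[of L] Li unfolding left_ideal_def by auto
    then show ?thesis using R.span_insert[of x L] x Lc by simp
  qed
  have "left_ideal A ?L" unfolding left_ideal_def using x Lc by (intro R.span_submodule) auto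
  moreover have "insert x L \<subseteq> ?L" by (rule R.span_superset)
  ultimately have "?L = carrier A" using Lmax[of ?L] x by auto
  then obtain b s where bs: "b \<in> carrier A" "s \<in> L" "a = b \<otimes>\<^bsub>A\<^esub> x \<oplus>\<^bsub>A\<^esub> s" using a unfolding eq by blast
  have sc: "s \<in> carrier A" using bs Lc by auto
  have "a \<oplus>\<^bsub>A\<^esub> \<ominus>\<^bsub>A\<^esub> (b \<otimes>\<^bsub>A\<^esub> x) = s"
    unfolding bs(3) using bs(1) x sc by (simp add: A.a_ac A.r_neg A.r_neg1 A.r_neg2)
  then show ?thesis using bs(1,2) by (intro bexI[of _ b]) auto
qed

lemma left_ideal_J: "left_ideal A J"
  unfolding left_ideal_iff jacobson_radical_def maximal_left_ideal_def by auto

text \<open>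
  If \<open>xa \<notin> L\<close> for a maximal left ideal \<open>L\<close>, then \<open>{z. za \<in> L}\<close> is again a maximal left ideal, and it
  misses \<open>x\<close>.
\<close>
lemma J_right_mult:
  assumes x: "x \<in> J" and a: "a \<in> carrier A"
  shows "x \<otimes>\<^bsub>A\<^esub> a \<in> J"
proof -
  have xc: "x \<in> carrier A" using x unfolding jacobson_radical_def by simp
  have "x \<otimes>\<^bsub>A\<^esub> a \<in> L" if L: "maximal_left_ideal A L" for L
  proof (rule ccontr)
    assume n: "x \<otimes>\<^bsub>A\<^esub> a \<notin> L"
    have Li: "left_ideal A L" using L unfolding maximal_left_ideal_def by auto
    note Lc = Li[unfolded left_ideal_iff]
    define N where "N = {z \<in> carrier A. z \<otimes>\<^bsub>A\<^esub> a \<in> L}"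
    have Ni: "left_ideal A N"
      unfolding left_ideal_iff N_def using Lc a by (auto simp: A.l_distr A.m_assoc)
    have "x \<notin> N" using n unfolding N_def by simp
    moreover have "maximal_left_ideal A N"
      unfolding maximal_left_ideal_def
    proof (intro conjI allI impI Ni)
      show "N \<noteq> carrier A" using n xc unfolding N_def by auto
    next
      fix N' assume N': "left_ideal A N' \<and> N \<subseteq> N'"
      note N'c = conjunct1[OF N', unfolded left_ideal_iff]
      show "N' = N \<or> N' = carrier A"
      proof (cases "N' = N")
        case False
        then obtain z where z: "z \<in> N'" "z \<notin> N" using N' by blast
        then have zc: "z \<in> carrier A" "z \<otimes>\<^bsub>A\<^esub> a \<notin> L" using N'c unfolding N_def by auto
        obtain b where b: "b \<in> carrier A" "a \<oplus>\<^bsub>A\<^esub> \<ominus>\<^bsub>A\<^esub> (b \<otimes>\<^bsub>A\<^esub> (z \<otimes>\<^bsub>A\<^esub> a)) \<in> L"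
          using maximal_left_ideal_complement[OF L _ zc(2) a] zc a by auto
        have "(\<one>\<^bsub>A\<^esub> \<oplus>\<^bsub>A\<^esub> \<ominus>\<^bsub>A\<^esub> (b \<otimes>\<^bsub>A\<^esub> z)) \<otimes>\<^bsub>A\<^esub> a = a \<oplus>\<^bsub>A\<^esub> \<ominus>\<^bsub>A\<^esub> (b \<otimes>\<^bsub>A\<^esub> (z \<otimes>\<^bsub>A\<^esub> a))"
          using b(1) zc a by (simp add: A.l_distr A.l_minus A.m_assoc)
        then have "\<one>\<^bsub>A\<^esub> \<oplus>\<^bsub>A\<^esub> \<ominus>\<^bsub>A\<^esub> (b \<otimes>\<^bsub>A\<^esub> z) \<in> N" using b zc unfolding N_def by simp
        then have "\<one>\<^bsub>A\<^esub> \<oplus>\<^bsub>A\<^esub> \<ominus>\<^bsub>A\<^esub> (b \<otimes>\<^bsub>A\<^esub> z) \<in> N'" using N' by blast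
        moreover have "b \<otimes>\<^bsub>A\<^esub> z \<in> N'" using N'c b z by blast
        ultimately have "(\<one>\<^bsub>A\<^esub> \<oplus>\<^bsub>A\<^esub> \<ominus>\<^bsub>A\<^esub> (b \<otimes>\<^bsub>A\<^esub> z)) \<oplus>\<^bsub>A\<^esub> b \<otimes>\<^bsub>A\<^esub> z \<in> N'" using N'c by blast
        then have "\<one>\<^bsub>A\<^esub> \<in> N'" using b zc by (simp add: A.a_assoc A.l_neg)
        then show ?thesis using left_ideal_eq_carrier N' by blast
      qed simp
    qed
    ultimately show False using x unfolding jacobson_radical_def by blast
  qed
  then show ?thesis using xc a unfolding jacobson_radical_def by auto
qed

lemma J_ideal: "ideal J A"
proof (rule idealI[OF ring])
  show "subgroup J (add_monoid A)"
    using left_ideal_J left_ideal_neg[OF left_ideal_J] unfolding left_ideal_iff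
    by (intro subgroup.intro) (auto simp: a_inv_def)
  show "x \<otimes>\<^bsub>A\<^esub> a \<in> J" if "a \<in> J" "x \<in> carrier A" for a x
    using left_ideal_J[unfolded left_ideal_iff] that by simp
qed (rule J_right_mult)

lemma J_carrier: "x \<in> J \<Longrightarrow> x \<in> carrier A"
  unfolding jacobson_radical_def by simp

lemma rad_pow_ideal: "ideal (rad_pow A m) A"
  by (induct m) (auto intro: A.ideal_prod_is_ideal J_ideal A.oneideal)

lemma rad_pow_carrier: "x \<in> rad_pow A m \<Longrightarrow> x \<in> carrier A"
  using ideal.Icarr[OF rad_pow_ideal] .

lemma J_rad_pow: "x \<in> J \<Longrightarrow> y \<in> rad_pow A m \<Longrightarrow> x \<otimes>\<^bsub>A\<^esub> y \<in> rad_pow A (Suc m)"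
  by (auto intro: ideal_prod.prod)

text \<open>
  The powers of \<open>J\<close> are built up by left multiplication; this is the statement on the other side, which
  makes \<open>J\<^bsup>n-1\<^esup>\<close> a right module over \<open>\<Lambda>/J\<close> as well.
\<close>
lemma rad_pow_J: "y \<in> rad_pow A m \<Longrightarrow> x \<in> J \<Longrightarrow> y \<otimes>\<^bsub>A\<^esub> x \<in> rad_pow A (Suc m)"
proof (induct m arbitrary: y)
  case 0
  have "(y \<otimes>\<^bsub>A\<^esub> x) \<otimes>\<^bsub>A\<^esub> \<one>\<^bsub>A\<^esub> \<in> rad_pow A (Suc 0)"
    using 0 ideal.I_l_closed[OF J_ideal] by (intro J_rad_pow) auto
  then show ?case using 0 J_carrier by simp
next
  case (Suc m)
  have xc: "x \<in> carrier A" using Suc J_carrier by simp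
  have "y \<in> ideal_prod A J (rad_pow A m)" using Suc by simp
  then show ?case
  proof (induct y rule: ideal_prod.induct)
    case (prod i j)
    have "i \<otimes>\<^bsub>A\<^esub> (j \<otimes>\<^bsub>A\<^esub> x) \<in> rad_pow A (Suc (Suc m))"
      using J_rad_pow[OF prod(1) Suc.hyps[OF prod(2) Suc.prems(2)]] .
    then show ?case using prod xc J_carrier rad_pow_carrier by (simp add: A.m_assoc)
  next
    case (sum s1 s2)
    have c: "s1 \<in> carrier A" "s2 \<in> carrier A"
      using sum(1,3) rad_pow_carrier[of _ "Suc m"] by auto
    have "s1 \<otimes>\<^bsub>A\<^esub> x \<oplus>\<^bsub>A\<^esub> s2 \<otimes>\<^bsub>A\<^esub> x \<in> rad_pow A (Suc (Suc m))"
      using sum(2,4) additive_subgroup.a_closed[OF ideal.axioms(1)[OF rad_pow_ideal]] by blast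
    then show ?case using c xc by (simp add: A.l_distr)
  qed
qed

lemma Suc_n: "Suc (n - 1) = n"
  using n_pos by simp

lemma J_annihilates:
  assumes "x \<in> J" "y \<in> rad_pow A (n - 1)"
  shows "x \<otimes>\<^bsub>A\<^esub> y = \<zero>\<^bsub>A\<^esub>" "y \<otimes>\<^bsub>A\<^esub> x = \<zero>\<^bsub>A\<^esub>"
  using J_rad_pow[OF assms] rad_pow_J[OF assms(2,1)] rad_nilpotent unfolding Suc_n by auto

lemma idempotent_in_J:
  assumes "f \<in> J" "f \<otimes>\<^bsub>A\<^esub> f = f"
  shows "f = \<zero>\<^bsub>A\<^esub>"
proof -
  have "f \<in> rad_pow A m" for m
  proof (induct m)
    case 0
    then show ?case using assms J_carrier by simp
  next
    case (Suc m)
    then show ?case using J_rad_pow[OF assms(1), of f m] assms(2) by simp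
  qed
  then show ?thesis using rad_nilpotent by blast
qed

text \<open>
  If \<open>x \<notin> L\<close>, then \<open>1 - yx \<in> L\<close> for some \<open>y\<close>, hence \<open>1 - (yx)\<^sup>m \<in> L\<close> for all \<open>m\<close>, and \<open>1 \<in> L\<close>.
\<close>
lemma nilpotents_in_J:
  assumes x: "x \<in> carrier A" and nil: "\<And>y. y \<in> carrier A \<Longrightarrow> \<exists>m. (y \<otimes>\<^bsub>A\<^esub> x) [^]\<^bsub>A\<^esub> (m::nat) = \<zero>\<^bsub>A\<^esub>"
  shows "x \<in> J"
  unfolding jacobson_radical_def
proof (intro CollectI conjI x allI impI)
  fix L assume L: "maximal_left_ideal A L"
  show "x \<in> L"
  proof (rule ccontr)
    assume n: "x \<notin> L"
    have Li: "left_ideal A L" using L unfolding maximal_left_ideal_def by auto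
    note Lc = Li[unfolded left_ideal_iff]
    obtain y where y: "y \<in> carrier A" "\<one>\<^bsub>A\<^esub> \<oplus>\<^bsub>A\<^esub> \<ominus>\<^bsub>A\<^esub> (y \<otimes>\<^bsub>A\<^esub> x) \<in> L"
      using maximal_left_ideal_complement[OF L x n, of "\<one>\<^bsub>A\<^esub>"] by auto
    define z where "z = y \<otimes>\<^bsub>A\<^esub> x"
    have z: "z \<in> carrier A" "\<one>\<^bsub>A\<^esub> \<oplus>\<^bsub>A\<^esub> \<ominus>\<^bsub>A\<^esub> z \<in> L" using y x unfolding z_def by auto
    have "\<one>\<^bsub>A\<^esub> \<oplus>\<^bsub>A\<^esub> \<ominus>\<^bsub>A\<^esub> (z [^]\<^bsub>A\<^esub> m) \<in> L" for m :: nat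
    proof (induct m)
      case 0
      then show ?case using Lc by (simp add: A.r_neg)
    next
      case (Suc m)
      have p: "z [^]\<^bsub>A\<^esub> m \<in> carrier A" using z by simp
      have "z [^]\<^bsub>A\<^esub> m \<otimes>\<^bsub>A\<^esub> (\<one>\<^bsub>A\<^esub> \<oplus>\<^bsub>A\<^esub> \<ominus>\<^bsub>A\<^esub> z) \<in> L" using Lc z p by blast
      then have "(\<one>\<^bsub>A\<^esub> \<oplus>\<^bsub>A\<^esub> \<ominus>\<^bsub>A\<^esub> (z [^]\<^bsub>A\<^esub> m)) \<oplus>\<^bsub>A\<^esub> z [^]\<^bsub>A\<^esub> m \<otimes>\<^bsub>A\<^esub> (\<one>\<^bsub>A\<^esub> \<oplus>\<^bsub>A\<^esub> \<ominus>\<^bsub>A\<^esub> z) \<in> L"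
        using Lc Suc by blast
      moreover have "(\<one>\<^bsub>A\<^esub> \<oplus>\<^bsub>A\<^esub> \<ominus>\<^bsub>A\<^esub> (z [^]\<^bsub>A\<^esub> m)) \<oplus>\<^bsub>A\<^esub> z [^]\<^bsub>A\<^esub> m \<otimes>\<^bsub>A\<^esub> (\<one>\<^bsub>A\<^esub> \<oplus>\<^bsub>A\<^esub> \<ominus>\<^bsub>A\<^esub> z)
          = \<one>\<^bsub>A\<^esub> \<oplus>\<^bsub>A\<^esub> \<ominus>\<^bsub>A\<^esub> (z [^]\<^bsub>A\<^esub> Suc m)"
        using p z by (simp add: A.r_distr A.r_minus A.a_assoc A.r_neg1)
      ultimately show ?case by simp
    qed
    moreover obtain m where "z [^]\<^bsub>A\<^esub> (m::nat) = \<zero>\<^bsub>A\<^esub>" using nil[OF y(1)] unfolding z_def by blast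
    ultimately have "\<one>\<^bsub>A\<^esub> \<oplus>\<^bsub>A\<^esub> \<ominus>\<^bsub>A\<^esub> \<zero>\<^bsub>A\<^esub> \<in> L" by metis
    then have "\<one>\<^bsub>A\<^esub> \<in> L" by (simp add: A.minus_equality[of "\<zero>\<^bsub>A\<^esub>" "\<zero>\<^bsub>A\<^esub>"])
    then show False using left_ideal_eq_carrier[OF Li] L unfolding maximal_left_ideal_def by blast
  qed
qed

section \<open>Corner rings of primitive idempotents\<close>

text \<open>
  \<open>corner j i\<close> is \<open>e\<^sub>j\<Lambda>e\<^sub>i\<close>, described by the equations that its elements satisfy.
\<close>
definition corner :: "nat \<Rightarrow> nat \<Rightarrow> 'a set" where
  "corner j i = {x \<in> carrier A. e j \<otimes>\<^bsub>A\<^esub> x = x \<and> x \<otimes>\<^bsub>A\<^esub> e i = x}"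

lemma e_idem: "i \<in> {1..t} \<Longrightarrow> e i \<in> carrier A" "i \<in> {1..t} \<Longrightarrow> e i \<otimes>\<^bsub>A\<^esub> e i = e i" "i \<in> {1..t} \<Longrightarrow> e i \<noteq> \<zero>\<^bsub>A\<^esub>"
  using primitive unfolding primitive_idempotent_def by auto

lemma corner_carrier: "x \<in> corner j i \<Longrightarrow> x \<in> carrier A"
  unfolding corner_def by simp

lemma corner_fix: "x \<in> corner j i \<Longrightarrow> e j \<otimes>\<^bsub>A\<^esub> x = x" "x \<in> corner j i \<Longrightarrow> x \<otimes>\<^bsub>A\<^esub> e i = x"
  unfolding corner_def by simp_all

lemma corner_sandwich:
  assumes "i \<in> {1..t}" "j \<in> {1..t}" "x \<in> carrier A"
  shows "e j \<otimes>\<^bsub>A\<^esub> x \<otimes>\<^bsub>A\<^esub> e i \<in> corner j i"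
proof -
  have "e j \<otimes>\<^bsub>A\<^esub> (e j \<otimes>\<^bsub>A\<^esub> x \<otimes>\<^bsub>A\<^esub> e i) = (e j \<otimes>\<^bsub>A\<^esub> e j) \<otimes>\<^bsub>A\<^esub> x \<otimes>\<^bsub>A\<^esub> e i"
    using assms e_idem(1) by (simp add: A.m_assoc del: e_idem)
  moreover have "e j \<otimes>\<^bsub>A\<^esub> x \<otimes>\<^bsub>A\<^esub> e i \<otimes>\<^bsub>A\<^esub> e i = e j \<otimes>\<^bsub>A\<^esub> x \<otimes>\<^bsub>A\<^esub> e i"
    using assms e_idem(1,2) by (simp add: A.m_assoc)
  ultimately show ?thesis using assms e_idem(1,2) unfolding corner_def by simp
qed

lemma corner_eq:
  assumes "i \<in> {1..t}" "j \<in> {1..t}"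
  shows "{e j \<otimes>\<^bsub>A\<^esub> x \<otimes>\<^bsub>A\<^esub> e i |x. x \<in> carrier A} = corner j i"
proof
  show "{e j \<otimes>\<^bsub>A\<^esub> x \<otimes>\<^bsub>A\<^esub> e i |x. x \<in> carrier A} \<subseteq> corner j i" using corner_sandwich[OF assms] by auto
  show "corner j i \<subseteq> {e j \<otimes>\<^bsub>A\<^esub> x \<otimes>\<^bsub>A\<^esub> e i |x. x \<in> carrier A}"
  proof
    fix x assume x: "x \<in> corner j i"
    then have "x = e j \<otimes>\<^bsub>A\<^esub> x \<otimes>\<^bsub>A\<^esub> e i" unfolding corner_def by simp
    then show "x \<in> {e j \<otimes>\<^bsub>A\<^esub> x \<otimes>\<^bsub>A\<^esub> e i |x. x \<in> carrier A}" using corner_carrier[OF x] by blast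
  qed
qed

lemma corner_mult:
  assumes "i \<in> {1..t}" "x \<in> corner j h" "y \<in> corner h' i" "j \<in> {1..t}"
  shows "x \<otimes>\<^bsub>A\<^esub> y \<in> corner j i"
proof -
  have c: "x \<in> carrier A" "y \<in> carrier A" "e i \<in> carrier A" "e j \<in> carrier A"
    using assms corner_carrier e_idem(1) by blast+
  have "e j \<otimes>\<^bsub>A\<^esub> (x \<otimes>\<^bsub>A\<^esub> y) = (e j \<otimes>\<^bsub>A\<^esub> x) \<otimes>\<^bsub>A\<^esub> y"
    using c by (simp add: A.m_assoc)
  then have "e j \<otimes>\<^bsub>A\<^esub> (x \<otimes>\<^bsub>A\<^esub> y) = x \<otimes>\<^bsub>A\<^esub> y" unfolding corner_fix(1)[OF assms(2)] .
  moreover have "x \<otimes>\<^bsub>A\<^esub> y \<otimes>\<^bsub>A\<^esub> e i = x \<otimes>\<^bsub>A\<^esub> (y \<otimes>\<^bsub>A\<^esub> e i)"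
    using c by (simp add: A.m_assoc)
  then have "x \<otimes>\<^bsub>A\<^esub> y \<otimes>\<^bsub>A\<^esub> e i = x \<otimes>\<^bsub>A\<^esub> y" unfolding corner_fix(2)[OF assms(3)] .
  ultimately show ?thesis using c unfolding corner_def by simp
qed

lemma corner_idem: "i \<in> {1..t} \<Longrightarrow> e i \<in> corner i i"
  using e_idem unfolding corner_def by auto

lemma corner_add: "x \<in> corner j i \<Longrightarrow> y \<in> corner j i \<Longrightarrow> i \<in> {1..t} \<Longrightarrow> j \<in> {1..t} \<Longrightarrow> x \<oplus>\<^bsub>A\<^esub> y \<in> corner j i"
  using e_idem(1) unfolding corner_def by (simp add: A.l_distr A.r_distr)

lemma corner_neg: "x \<in> corner j i \<Longrightarrow> i \<in> {1..t} \<Longrightarrow> j \<in> {1..t} \<Longrightarrow> \<ominus>\<^bsub>A\<^esub> x \<in> corner j i"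
  using e_idem(1) unfolding corner_def by (simp add: A.l_minus A.r_minus)

lemma corner_zero: "i \<in> {1..t} \<Longrightarrow> j \<in> {1..t} \<Longrightarrow> \<zero>\<^bsub>A\<^esub> \<in> corner j i"
  using e_idem(1) unfolding corner_def by simp

lemma corner_smult: "c \<in> carrier K \<Longrightarrow> x \<in> corner j i \<Longrightarrow> i \<in> {1..t} \<Longrightarrow> j \<in> {1..t} \<Longrightarrow> c \<odot>\<^bsub>A\<^esub> x \<in> corner j i"
  using e_idem(1) smult_mult unfolding corner_def by simp

text \<open>Powers inside a corner ring, with \<open>e i\<close> as the zeroth power\<close>
fun cpow :: "nat \<Rightarrow> 'a \<Rightarrow> nat \<Rightarrow> 'a" where
  "cpow i x 0 = e i"
| "cpow i x (Suc m) = cpow i x m \<otimes>\<^bsub>A\<^esub> x"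

lemma cpow_corner: "i \<in> {1..t} \<Longrightarrow> x \<in> corner i i \<Longrightarrow> cpow i x m \<in> corner i i"
  by (induct m) (auto intro: corner_idem corner_mult)

lemma cpow_add:
  assumes "i \<in> {1..t}" "x \<in> corner i i"
  shows "cpow i x (k + m) = cpow i x k \<otimes>\<^bsub>A\<^esub> cpow i x m"
proof (induct m)
  case 0
  show ?case using corner_fix(2)[OF cpow_corner[OF assms, of k]] by simp
next
  case (Suc m)
  then show ?case using corner_carrier[OF cpow_corner[OF assms]] corner_carrier[OF assms(2)]
    by (simp add: A.m_assoc)
qed

lemma cpow_commute:
  assumes "i \<in> {1..t}" "x \<in> corner i i"
  shows "x \<otimes>\<^bsub>A\<^esub> cpow i x m = cpow i x (Suc m)"
  using cpow_add[OF assms, of 1 m] corner_fix(1)[OF assms(2)] by simp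

lemma corner_submodule: "i \<in> {1..t} \<Longrightarrow> j \<in> {1..t} \<Longrightarrow> submodule (corner j i) K A"
  by (intro KA.submoduleI) (auto intro: corner_zero corner_add corner_smult corner_carrier)

lemma cpow_image_submodule:
  assumes i: "i \<in> {1..t}" and x: "x \<in> corner i i"
  shows "submodule {z \<otimes>\<^bsub>A\<^esub> cpow i x m |z. z \<in> corner i i} K A"
proof (rule KA.submoduleI)
  let ?p = "cpow i x m"
  have p: "?p \<in> carrier A" using corner_carrier[OF cpow_corner[OF i x]] .
  show "{z \<otimes>\<^bsub>A\<^esub> ?p |z. z \<in> corner i i} \<subseteq> carrier A" using p corner_carrier by auto
  show "\<zero>\<^bsub>A\<^esub> \<in> {z \<otimes>\<^bsub>A\<^esub> ?p |z. z \<in> corner i i}"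
    using corner_zero[OF i i] p by (intro CollectI exI[of _ "\<zero>\<^bsub>A\<^esub>"]) simp
  show "u \<oplus>\<^bsub>A\<^esub> v \<in> {z \<otimes>\<^bsub>A\<^esub> ?p |z. z \<in> corner i i}"
    if uv: "u \<in> {z \<otimes>\<^bsub>A\<^esub> ?p |z. z \<in> corner i i}" "v \<in> {z \<otimes>\<^bsub>A\<^esub> ?p |z. z \<in> corner i i}" for u v
  proof -
    obtain y z where "y \<in> corner i i" "z \<in> corner i i" "u = y \<otimes>\<^bsub>A\<^esub> ?p" "v = z \<otimes>\<^bsub>A\<^esub> ?p" using uv by blast
    then show ?thesis using corner_add[OF _ _ i i, of y z] p corner_carrier
      by (intro CollectI exI[of _ "y \<oplus>\<^bsub>A\<^esub> z"]) (simp add: A.l_distr)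
  qed
  show "c \<odot>\<^bsub>A\<^esub> u \<in> {z \<otimes>\<^bsub>A\<^esub> ?p |z. z \<in> corner i i}"
    if cu: "c \<in> carrier K" "u \<in> {z \<otimes>\<^bsub>A\<^esub> ?p |z. z \<in> corner i i}" for c u
  proof -
    obtain y where "y \<in> corner i i" "u = y \<otimes>\<^bsub>A\<^esub> ?p" using cu by blast
    then show ?thesis using cu(1) corner_smult[OF cu(1) _ i i, of y] p corner_carrier smult_mult[of c y ?p]
      by (intro CollectI exI[of _ "c \<odot>\<^bsub>A\<^esub> y"]) simp
  qed
qed

lemma cpow_kernel_submodule:
  assumes i: "i \<in> {1..t}" and x: "x \<in> corner i i"
  shows "submodule {z \<in> corner i i. z \<otimes>\<^bsub>A\<^esub> cpow i x m = \<zero>\<^bsub>A\<^esub>} K A"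
  using corner_carrier[OF cpow_corner[OF i x, of m]] i
  by (intro KA.submoduleI)
     (auto intro: corner_zero corner_add corner_smult corner_carrier simp: A.l_distr smult_mult corner_carrier)

text \<open>
  Fitting: for large \<open>m\<close> the corner \<open>E\<close> is the direct sum of the left ideals \<open>E x\<^sup>m\<close> and
  \<open>{z. z x\<^sup>m = 0}\<close>, so the components of its identity are orthogonal idempotents.
\<close>
lemma nilpotent_or_left_invertible:
  assumes i: "i \<in> {1..t}" and x: "x \<in> corner i i"
  shows "(\<exists>m. cpow i x m = \<zero>\<^bsub>A\<^esub>) \<or> (\<exists>y\<in>corner i i. y \<otimes>\<^bsub>A\<^esub> x = e i)"
proof -
  obtain B where B: "is_basis K A B" using finite_dimensional by blast
  have pc: "cpow i x m \<in> corner i i" "cpow i x m \<in> carrier A" for m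
    using cpow_corner[OF i x] corner_carrier by auto
  have xc: "x \<in> carrier A" using x corner_carrier by auto
  define I where "I m = {z \<otimes>\<^bsub>A\<^esub> cpow i x m |z. z \<in> corner i i}" for m
  define N where "N m = {z \<in> corner i i. z \<otimes>\<^bsub>A\<^esub> cpow i x m = \<zero>\<^bsub>A\<^esub>}" for m
  have "I (Suc m) \<subseteq> I m" for m
  proof
    fix u assume "u \<in> I (Suc m)"
    then obtain z where z: "z \<in> corner i i" "u = z \<otimes>\<^bsub>A\<^esub> cpow i x (Suc m)" unfolding I_def by blast
    then have "u = (z \<otimes>\<^bsub>A\<^esub> x) \<otimes>\<^bsub>A\<^esub> cpow i x m"
      using pc[of m] corner_carrier[OF z(1)] xc unfolding cpow_commute[OF i x, symmetric] by (simp add: A.m_assoc)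
    then show "u \<in> I m" using corner_mult[OF i z(1) x i] unfolding I_def by blast
  qed
  then obtain m1 where m1: "\<And>k. k \<ge> m1 \<Longrightarrow> I k = I m1"
    using KA.decreasing_chain_stabilizes[OF B, of I] cpow_image_submodule[OF i x] unfolding I_def by blast
  have "N m \<subseteq> N (Suc m)" for m
  proof
    fix z assume "z \<in> N m"
    then have z: "z \<in> corner i i" "z \<otimes>\<^bsub>A\<^esub> cpow i x m = \<zero>\<^bsub>A\<^esub>" unfolding N_def by auto
    then have "z \<otimes>\<^bsub>A\<^esub> cpow i x (Suc m) = \<zero>\<^bsub>A\<^esub>"
      using A.m_assoc[of z "cpow i x m" x] pc[of m] xc corner_carrier[of z] by simp
    then show "z \<in> N (Suc m)" using z(1) unfolding N_def by blast
  qed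
  then obtain m2 where m2: "\<And>k. k \<ge> m2 \<Longrightarrow> N k = N m2"
    using KA.increasing_chain_stabilizes[OF B, of N] cpow_kernel_submodule[OF i x] unfolding N_def by blast
  define m where "m = Suc (m1 + m2)"
  let ?p = "cpow i x m"
  have pp: "cpow i x (m + m) = ?p \<otimes>\<^bsub>A\<^esub> ?p" by (rule cpow_add[OF i x])
  have "I (m + m) = I m" using m1[of m] m1[of "m + m"] unfolding m_def by simp
  moreover have "e i \<otimes>\<^bsub>A\<^esub> ?p \<in> I m" using corner_idem[OF i] unfolding I_def by blast
  then have "?p \<in> I m" using corner_fix(1)[OF pc(1)] by simp
  ultimately obtain y where y: "y \<in> corner i i" "?p = y \<otimes>\<^bsub>A\<^esub> (?p \<otimes>\<^bsub>A\<^esub> ?p)"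
    unfolding I_def pp by blast
  have yc: "y \<in> carrier A" using y corner_carrier by auto
  have inter: "z = \<zero>\<^bsub>A\<^esub>" if z: "z = w \<otimes>\<^bsub>A\<^esub> ?p" "w \<in> corner i i" "z \<otimes>\<^bsub>A\<^esub> ?p = \<zero>\<^bsub>A\<^esub>" for w z
  proof -
    have "w \<in> N (m + m)" using z pc corner_carrier[OF z(2)] unfolding N_def pp by (simp add: A.m_assoc)
    also have "N (m + m) = N m" using m2[of m] m2[of "m + m"] unfolding m_def by simp
    finally show ?thesis using z(1) unfolding N_def by simp
  qed
  define f where "f = y \<otimes>\<^bsub>A\<^esub> ?p"
  define g where "g = e i \<oplus>\<^bsub>A\<^esub> \<ominus>\<^bsub>A\<^esub> f"
  have f: "f \<in> corner i i" unfolding f_def using corner_mult[OF i y(1) pc(1) i] .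
  have g: "g \<in> corner i i" unfolding g_def using corner_add corner_neg[OF f] corner_idem i by auto
  have fc: "f \<in> carrier A" and gc: "g \<in> carrier A" and ec: "e i \<in> carrier A" using f g corner_carrier e_idem(1)[OF i] by auto
  have fp: "f \<otimes>\<^bsub>A\<^esub> ?p = ?p" unfolding f_def using y pc yc by (simp add: A.m_assoc)
  have gp: "g \<otimes>\<^bsub>A\<^esub> ?p = \<zero>\<^bsub>A\<^esub>"
    unfolding g_def using fp corner_fix(1)[OF pc(1)[of m]] pc[of m] fc ec by (simp add: A.l_distr A.l_minus A.r_neg)
  have fg_sum: "e i = f \<oplus>\<^bsub>A\<^esub> g" 
  proof -
    have "f \<oplus>\<^bsub>A\<^esub> (e i \<oplus>\<^bsub>A\<^esub> \<ominus>\<^bsub>A\<^esub> f) = e i \<oplus>\<^bsub>A\<^esub> (f \<oplus>\<^bsub>A\<^esub> \<ominus>\<^bsub>A\<^esub> f)"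
      by (rule A.a_lcomm) (use fc ec in auto)
    then show ?thesis unfolding g_def using fc ec by (simp add: A.r_neg)
  qed
  have fg: "f \<otimes>\<^bsub>A\<^esub> g = \<zero>\<^bsub>A\<^esub>"
  proof -
    have "f \<otimes>\<^bsub>A\<^esub> g = f \<oplus>\<^bsub>A\<^esub> \<ominus>\<^bsub>A\<^esub> (f \<otimes>\<^bsub>A\<^esub> f)"
      unfolding g_def using fc ec corner_fix(2)[OF f] by (simp add: A.r_distr A.r_minus)
    also have "\<dots> = (y \<oplus>\<^bsub>A\<^esub> \<ominus>\<^bsub>A\<^esub> (f \<otimes>\<^bsub>A\<^esub> y)) \<otimes>\<^bsub>A\<^esub> ?p"
      using yc pc fc unfolding f_def by (simp add: A.l_distr A.l_minus A.m_assoc)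
    finally have *: "f \<otimes>\<^bsub>A\<^esub> g = (y \<oplus>\<^bsub>A\<^esub> \<ominus>\<^bsub>A\<^esub> (f \<otimes>\<^bsub>A\<^esub> y)) \<otimes>\<^bsub>A\<^esub> ?p" .
    have w: "y \<oplus>\<^bsub>A\<^esub> \<ominus>\<^bsub>A\<^esub> (f \<otimes>\<^bsub>A\<^esub> y) \<in> corner i i"
      using corner_add[OF y(1) corner_neg[OF corner_mult[OF i f y(1) i] i i] i i] .
    have "f \<otimes>\<^bsub>A\<^esub> g \<otimes>\<^bsub>A\<^esub> ?p = \<zero>\<^bsub>A\<^esub>" using gp fc gc pc by (simp add: A.m_assoc)
    then show ?thesis by (rule inter[OF * w])
  qed
  have ff: "f \<otimes>\<^bsub>A\<^esub> f = f"
  proof -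
    have "f = f \<otimes>\<^bsub>A\<^esub> (f \<oplus>\<^bsub>A\<^esub> g)" using corner_fix(2)[OF f] fg_sum by simp
    also have "\<dots> = f \<otimes>\<^bsub>A\<^esub> f" using fg fc gc by (simp add: A.r_distr)
    finally show ?thesis by simp
  qed
  have gf: "g \<otimes>\<^bsub>A\<^esub> f = \<zero>\<^bsub>A\<^esub>"
    unfolding g_def using fc ec ff corner_fix(1)[OF f] by (simp add: A.l_distr A.l_minus A.r_neg)
  have gg: "g \<otimes>\<^bsub>A\<^esub> g = g"
  proof -
    have "g = g \<otimes>\<^bsub>A\<^esub> (f \<oplus>\<^bsub>A\<^esub> g)" using corner_fix(2)[OF g] fg_sum by simp
    also have "\<dots> = g \<otimes>\<^bsub>A\<^esub> g" using gf fc gc by (simp add: A.r_distr)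
    finally show ?thesis by simp
  qed
  have "f = \<zero>\<^bsub>A\<^esub> \<or> g = \<zero>\<^bsub>A\<^esub>"
    using primitive[OF i] fc gc ff gg fg gf fg_sum unfolding primitive_idempotent_def by blast
  then show ?thesis
  proof
    assume "f = \<zero>\<^bsub>A\<^esub>"
    then have "?p = \<zero>\<^bsub>A\<^esub>" using fp pc by simp
    then show ?thesis by blast
  next
    assume "g = \<zero>\<^bsub>A\<^esub>"
    then have "e i = y \<otimes>\<^bsub>A\<^esub> cpow i x (m1 + m2) \<otimes>\<^bsub>A\<^esub> x"
      using fg_sum fc xc pc yc unfolding f_def m_def by (simp add: A.m_assoc)
    then show ?thesis using corner_mult[OF i y(1) pc(1) i] by metis
  qed
qed

lemma left_invertible_not_nilpotent:
  assumes i: "i \<in> {1..t}" and x: "x \<in> corner i i" and y: "y \<in> corner i i" "y \<otimes>\<^bsub>A\<^esub> x = e i"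
  shows "cpow i x m \<noteq> \<zero>\<^bsub>A\<^esub>" "cpow i y m \<noteq> \<zero>\<^bsub>A\<^esub>"
proof -
  have c: "x \<in> carrier A" "y \<in> carrier A" using x y corner_carrier by auto
  have pc: "cpow i x m \<in> carrier A" "cpow i y m \<in> carrier A" "cpow i x m \<in> corner i i" for m
    using cpow_corner[OF i x] corner_carrier[OF cpow_corner[OF i x]] corner_carrier[OF cpow_corner[OF i y(1)]]
    by auto
  have "cpow i y m \<otimes>\<^bsub>A\<^esub> cpow i x m = e i"
  proof (induct m)
    case 0
    then show ?case using e_idem(2)[OF i] by simp
  next
    case (Suc m)
    have "cpow i y (Suc m) \<otimes>\<^bsub>A\<^esub> cpow i x (Suc m) = cpow i y m \<otimes>\<^bsub>A\<^esub> ((y \<otimes>\<^bsub>A\<^esub> x) \<otimes>\<^bsub>A\<^esub> cpow i x m)"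
      using pc c unfolding cpow_commute[OF i x, symmetric] by (simp add: A.m_assoc)
    then show ?case using Suc corner_fix(1)[OF pc(3)] by (simp add: y(2))
  qed
  then show "cpow i x m \<noteq> \<zero>\<^bsub>A\<^esub>" "cpow i y m \<noteq> \<zero>\<^bsub>A\<^esub>" using e_idem(3)[OF i] pc by auto
qed

text \<open>
  A left inverse of a left inverse: it agrees with \<open>x\<close>, so one-sided inverses are two-sided.
\<close>
lemma nilpotent_or_unit:
  assumes i: "i \<in> {1..t}" and x: "x \<in> corner i i"
  shows "(\<exists>m. cpow i x m = \<zero>\<^bsub>A\<^esub>) \<or> (\<exists>y\<in>corner i i. y \<otimes>\<^bsub>A\<^esub> x = e i \<and> x \<otimes>\<^bsub>A\<^esub> y = e i)"
proof (cases "\<exists>m. cpow i x m = \<zero>\<^bsub>A\<^esub>")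
  case False
  then obtain y where y: "y \<in> corner i i" "y \<otimes>\<^bsub>A\<^esub> x = e i"
    using nilpotent_or_left_invertible[OF i x] by blast
  then obtain z where z: "z \<in> corner i i" "z \<otimes>\<^bsub>A\<^esub> y = e i"
    using nilpotent_or_left_invertible[OF i y(1)] left_invertible_not_nilpotent(2)[OF i x y] by blast
  have "z = z \<otimes>\<^bsub>A\<^esub> (y \<otimes>\<^bsub>A\<^esub> x)" using y(2) corner_fix(2)[OF z(1)] by simp
  also have "\<dots> = (z \<otimes>\<^bsub>A\<^esub> y) \<otimes>\<^bsub>A\<^esub> x"
    by (rule A.m_assoc[symmetric]) (use x y z corner_carrier in blast)+
  also have "\<dots> = x" using z(2) corner_fix(1)[OF x] by simp
  finally show ?thesis using y z by blast
qed simp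

text \<open>
  The powers of \<open>yx\<close> and of \<open>e\<^sub>hyx\<close> agree after multiplication by \<open>x\<close> from the left, so
  nilpotency may be tested in the corner ring.
\<close>
lemma corner_in_J:
  assumes h: "h \<in> {1..t}" and x: "x \<in> carrier A" "x \<otimes>\<^bsub>A\<^esub> e h = x"
    and nil: "\<And>y. y \<in> carrier A \<Longrightarrow> \<exists>m. cpow h (e h \<otimes>\<^bsub>A\<^esub> y \<otimes>\<^bsub>A\<^esub> x) m = \<zero>\<^bsub>A\<^esub>"
  shows "x \<in> J"
proof (rule nilpotents_in_J[OF x(1)])
  fix y assume y: "y \<in> carrier A"
  have eh: "e h \<in> carrier A" using e_idem h by auto
  let ?w = "e h \<otimes>\<^bsub>A\<^esub> y \<otimes>\<^bsub>A\<^esub> x"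
  have wc: "?w \<in> corner h h"
    using corner_sandwich[OF h h, of "y \<otimes>\<^bsub>A\<^esub> x"] x y eh by (simp add: A.m_assoc)
  then have pc: "cpow h ?w m \<in> carrier A" for m using cpow_corner[OF h] corner_carrier by blast
  obtain m where m: "cpow h ?w m = \<zero>\<^bsub>A\<^esub>" using nil[OF y] by blast
  have *: "x \<otimes>\<^bsub>A\<^esub> (y \<otimes>\<^bsub>A\<^esub> x) [^]\<^bsub>A\<^esub> k = x \<otimes>\<^bsub>A\<^esub> cpow h ?w k" for k :: nat
  proof (induct k)
    case 0
    then show ?case using x by simp
  next
    case (Suc k)
    have fix_: "(x \<otimes>\<^bsub>A\<^esub> cpow h ?w k) \<otimes>\<^bsub>A\<^esub> e h = x \<otimes>\<^bsub>A\<^esub> cpow h ?w k"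
      using x(1) pc eh corner_fix(2)[OF cpow_corner[OF h wc]] by (simp add: A.m_assoc)
    have "x \<otimes>\<^bsub>A\<^esub> (y \<otimes>\<^bsub>A\<^esub> x) [^]\<^bsub>A\<^esub> Suc k = (x \<otimes>\<^bsub>A\<^esub> (y \<otimes>\<^bsub>A\<^esub> x) [^]\<^bsub>A\<^esub> k) \<otimes>\<^bsub>A\<^esub> (y \<otimes>\<^bsub>A\<^esub> x)"
      using x y by (simp add: A.m_assoc)
    also have "\<dots> = ((x \<otimes>\<^bsub>A\<^esub> cpow h ?w k) \<otimes>\<^bsub>A\<^esub> e h) \<otimes>\<^bsub>A\<^esub> (y \<otimes>\<^bsub>A\<^esub> x)" unfolding Suc fix_ ..
    also have "\<dots> = x \<otimes>\<^bsub>A\<^esub> cpow h ?w (Suc k)" using x(1) y pc eh by (simp add: A.m_assoc)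
    finally show ?case .
  qed
  have "(y \<otimes>\<^bsub>A\<^esub> x) [^]\<^bsub>A\<^esub> Suc m = y \<otimes>\<^bsub>A\<^esub> (x \<otimes>\<^bsub>A\<^esub> (y \<otimes>\<^bsub>A\<^esub> x) [^]\<^bsub>A\<^esub> m)"
    using A.nat_pow_mult[of "y \<otimes>\<^bsub>A\<^esub> x" 1 m] x y by (simp add: A.m_assoc)
  also have "\<dots> = \<zero>\<^bsub>A\<^esub>" unfolding * m using x y by simp
  finally show "\<exists>k. (y \<otimes>\<^bsub>A\<^esub> x) [^]\<^bsub>A\<^esub> (k::nat) = \<zero>\<^bsub>A\<^esub>" by blast
qed

lemma e_notin_J: "i \<in> {1..t} \<Longrightarrow> e i \<notin> J"
  using idempotent_in_J e_idem by blast

text \<open>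
  Corner rings of primitive idempotents are local, with the radical part as the set of nonunits.
  For a nilpotent \<open>x\<close>, no \<open>e\<^sub>iyx\<close> can be a unit, since \<open>x\<close> would then have a left inverse.
\<close>
lemma corner_unit_iff:
  assumes i: "i \<in> {1..t}" and x: "x \<in> corner i i"
  shows "x \<notin> J \<longleftrightarrow> (\<exists>y\<in>corner i i. y \<otimes>\<^bsub>A\<^esub> x = e i \<and> x \<otimes>\<^bsub>A\<^esub> y = e i)"
proof
  assume "\<exists>y\<in>corner i i. y \<otimes>\<^bsub>A\<^esub> x = e i \<and> x \<otimes>\<^bsub>A\<^esub> y = e i"
  then show "x \<notin> J" using ideal.I_l_closed[OF J_ideal] e_notin_J[OF i] corner_carrier by metis
next
  assume n: "x \<notin> J"
  show "\<exists>y\<in>corner i i. y \<otimes>\<^bsub>A\<^esub> x = e i \<and> x \<otimes>\<^bsub>A\<^esub> y = e i"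
  proof (rule ccontr)
    assume nu: "\<not> (\<exists>y\<in>corner i i. y \<otimes>\<^bsub>A\<^esub> x = e i \<and> x \<otimes>\<^bsub>A\<^esub> y = e i)"
    then obtain k where k: "cpow i x k = \<zero>\<^bsub>A\<^esub>" using nilpotent_or_unit[OF i x] by blast
    have "\<exists>m. cpow i (e i \<otimes>\<^bsub>A\<^esub> y \<otimes>\<^bsub>A\<^esub> x) m = \<zero>\<^bsub>A\<^esub>" if y: "y \<in> carrier A" for y
    proof (rule ccontr)
      assume nn: "\<not> (\<exists>m. cpow i (e i \<otimes>\<^bsub>A\<^esub> y \<otimes>\<^bsub>A\<^esub> x) m = \<zero>\<^bsub>A\<^esub>)"
      have xc: "x \<in> carrier A" and ec: "e i \<in> carrier A" using x corner_carrier e_idem(1)[OF i] by auto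
      have "e i \<otimes>\<^bsub>A\<^esub> (y \<otimes>\<^bsub>A\<^esub> x) \<otimes>\<^bsub>A\<^esub> e i \<in> corner i i" using xc y by (intro corner_sandwich[OF i i]) auto
      then have w: "e i \<otimes>\<^bsub>A\<^esub> y \<otimes>\<^bsub>A\<^esub> x \<in> corner i i"
        using xc y ec corner_fix(2)[OF x] by (simp add: A.m_assoc)
      then obtain u where u: "u \<in> corner i i" "u \<otimes>\<^bsub>A\<^esub> (e i \<otimes>\<^bsub>A\<^esub> y \<otimes>\<^bsub>A\<^esub> x) = e i"
        using nilpotent_or_left_invertible[OF i w] nn by blast
      have uc: "u \<in> carrier A" using u corner_carrier by auto
      have v: "u \<otimes>\<^bsub>A\<^esub> (e i \<otimes>\<^bsub>A\<^esub> y \<otimes>\<^bsub>A\<^esub> e i) \<in> corner i i"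
        using corner_mult[OF i u(1) corner_sandwich[OF i i y] i] .
      have "u \<otimes>\<^bsub>A\<^esub> (e i \<otimes>\<^bsub>A\<^esub> y \<otimes>\<^bsub>A\<^esub> e i) \<otimes>\<^bsub>A\<^esub> x = u \<otimes>\<^bsub>A\<^esub> (e i \<otimes>\<^bsub>A\<^esub> y \<otimes>\<^bsub>A\<^esub> (e i \<otimes>\<^bsub>A\<^esub> x))"
        using uc y xc ec by (simp add: A.m_assoc)
      also have "\<dots> = e i" using u(2) corner_fix(1)[OF x] by simp
      finally show False using left_invertible_not_nilpotent(1)[OF i x v] k by blast
    qed
    then show False using corner_in_J[OF i corner_carrier[OF x] corner_fix(2)[OF x]] n by blast
  qed
qed

text \<open>This is where the algebra being basic enters: a map between distinct projectives that is not
  radical would be an isomorphism.\<close>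
lemma off_diagonal_in_J:
  assumes j: "j \<in> {1..t}" and h: "h \<in> {1..t}" and "h \<noteq> j" and x: "x \<in> corner j h"
  shows "x \<in> J"
proof (rule ccontr)
  assume n: "x \<notin> J"
  have xc: "x \<in> carrier A" and ej: "e j \<in> carrier A" and eh: "e h \<in> carrier A"
    using x corner_carrier e_idem(1) j h by auto
  obtain y where y: "y \<in> carrier A" "\<And>m. cpow h (e h \<otimes>\<^bsub>A\<^esub> y \<otimes>\<^bsub>A\<^esub> x) m \<noteq> \<zero>\<^bsub>A\<^esub>"
    using corner_in_J[OF h xc corner_fix(2)[OF x]] n by blast
  have "e h \<otimes>\<^bsub>A\<^esub> (y \<otimes>\<^bsub>A\<^esub> x) \<otimes>\<^bsub>A\<^esub> e h \<in> corner h h" using xc y by (intro corner_sandwich[OF h h]) auto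
  then have w: "e h \<otimes>\<^bsub>A\<^esub> y \<otimes>\<^bsub>A\<^esub> x \<in> corner h h"
    using xc y eh corner_fix(2)[OF x] by (simp add: A.m_assoc)
  then obtain u where u: "u \<in> corner h h" "u \<otimes>\<^bsub>A\<^esub> (e h \<otimes>\<^bsub>A\<^esub> y \<otimes>\<^bsub>A\<^esub> x) = e h"
    using nilpotent_or_left_invertible[OF h w] y(2) by blast
  have uc: "u \<in> carrier A" using u corner_carrier by auto
  define z where "z = u \<otimes>\<^bsub>A\<^esub> (e h \<otimes>\<^bsub>A\<^esub> y \<otimes>\<^bsub>A\<^esub> e j)"
  have z: "z \<in> corner h j" unfolding z_def using corner_mult[OF j u(1) corner_sandwich[OF j h y(1)] h] .
  have zc: "z \<in> carrier A" using z corner_carrier by auto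
  have "z \<otimes>\<^bsub>A\<^esub> x = u \<otimes>\<^bsub>A\<^esub> (e h \<otimes>\<^bsub>A\<^esub> y \<otimes>\<^bsub>A\<^esub> (e j \<otimes>\<^bsub>A\<^esub> x))"
    unfolding z_def using uc y xc eh ej by (simp add: A.m_assoc)
  then have zx: "z \<otimes>\<^bsub>A\<^esub> x = e h" using u(2) corner_fix(1)[OF x] by simp
  define f where "f = x \<otimes>\<^bsub>A\<^esub> z"
  have f: "f \<in> corner j j" unfolding f_def using corner_mult[OF j x z j] .
  have fc: "f \<in> carrier A" using f corner_carrier by auto
  have "f \<otimes>\<^bsub>A\<^esub> f = x \<otimes>\<^bsub>A\<^esub> (z \<otimes>\<^bsub>A\<^esub> x) \<otimes>\<^bsub>A\<^esub> z" unfolding f_def using xc zc by (simp add: A.m_assoc)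
  then have ff: "f \<otimes>\<^bsub>A\<^esub> f = f" unfolding zx f_def using corner_fix(2)[OF x] by simp
  have f0: "f \<noteq> \<zero>\<^bsub>A\<^esub>"
  proof
    assume f0: "f = \<zero>\<^bsub>A\<^esub>"
    have "e h = (z \<otimes>\<^bsub>A\<^esub> x) \<otimes>\<^bsub>A\<^esub> (z \<otimes>\<^bsub>A\<^esub> x)" using zx e_idem(2)[OF h] by simp
    also have "\<dots> = z \<otimes>\<^bsub>A\<^esub> f \<otimes>\<^bsub>A\<^esub> x" unfolding f_def using xc zc by (simp add: A.m_assoc)
    also have "\<dots> = \<zero>\<^bsub>A\<^esub>" using f0 zc xc by simp
    finally show False using e_idem(3)[OF h] by simp
  qed
  then have "f \<notin> J" using idempotent_in_J ff by blast
  then obtain v where v: "v \<in> corner j j" "f \<otimes>\<^bsub>A\<^esub> v = e j" using corner_unit_iff[OF j f] by blast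
  have vc: "v \<in> carrier A" using v corner_carrier by auto
  have "f = f \<otimes>\<^bsub>A\<^esub> e j" using corner_fix(2)[OF f] by simp
  also have "\<dots> = f \<otimes>\<^bsub>A\<^esub> f \<otimes>\<^bsub>A\<^esub> v" using v(2) fc vc by (simp add: A.m_assoc)
  also have "\<dots> = e j" using ff v(2) by simp
  finally have xz: "x \<otimes>\<^bsub>A\<^esub> z = e j" unfolding f_def .
  have pc: "p \<in> carrier A" if "p \<in> proj_ideal A e k" "k \<in> {1..t}" for p k
    using that e_idem(1) unfolding proj_ideal_def by auto
  have pf: "p \<otimes>\<^bsub>A\<^esub> e k = p" if "p \<in> proj_ideal A e k" "k \<in> {1..t}" for p k
    using that e_idem(1,2) unfolding proj_ideal_def by (auto simp: A.m_assoc)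
  have pI: "q \<in> proj_ideal A e k" if "q \<in> carrier A" "q \<otimes>\<^bsub>A\<^esub> e k = q" for q k
    using that unfolding proj_ideal_def by (intro CollectI exI[of _ q]) simp
  have "bij_betw (\<lambda>p. p \<otimes>\<^bsub>A\<^esub> x) (proj_ideal A e j) (proj_ideal A e h)"
  proof (rule bij_betw_byWitness[of _ "\<lambda>p. p \<otimes>\<^bsub>A\<^esub> z"])
    show "\<forall>p\<in>proj_ideal A e j. p \<otimes>\<^bsub>A\<^esub> x \<otimes>\<^bsub>A\<^esub> z = p"
      using pc[OF _ j] pf[OF _ j] xc zc xz by (simp add: A.m_assoc)
    show "\<forall>p\<in>proj_ideal A e h. p \<otimes>\<^bsub>A\<^esub> z \<otimes>\<^bsub>A\<^esub> x = p"
      using pc[OF _ h] pf[OF _ h] xc zc zx by (simp add: A.m_assoc)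
    show "(\<lambda>p. p \<otimes>\<^bsub>A\<^esub> x) ` proj_ideal A e j \<subseteq> proj_ideal A e h"
      using pc[OF _ j] xc eh corner_fix(2)[OF x] by (auto intro!: pI simp: A.m_assoc)
    show "(\<lambda>p. p \<otimes>\<^bsub>A\<^esub> z) ` proj_ideal A e h \<subseteq> proj_ideal A e j"
      using pc[OF _ h] zc ej corner_fix(2)[OF z] by (auto intro!: pI simp: A.m_assoc)
  qed
  then have "semilinear_iso A (\<lambda>r. r) (left_mod A (proj_ideal A e j)) (left_mod A (proj_ideal A e h)) (\<lambda>p. p \<otimes>\<^bsub>A\<^esub> x)"
    unfolding semilinear_iso_def using pc[OF _ j] xc by (simp add: A.l_distr A.m_assoc)
  then show False using basic[OF j h] \<open>h \<noteq> j\<close> unfolding mod_isomorphic_def by metis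
qed

section \<open>Residue algebras and the terminal bimodules\<close>

abbreviation E where "E i \<equiv> A\<lparr>carrier := corner i i, one := e i\<rparr>"
abbreviation rad where "rad i \<equiv> corner i i \<inter> J"
abbreviation D where "D i \<equiv> residue_alg A e i"
abbreviation V where "V i j \<equiv> V_space A n e i j"

definition residue_class :: "nat \<Rightarrow> 'a \<Rightarrow> 'a set" where
  "residue_class i x = rad i +>\<^bsub>E i\<^esub> x"

lemma minus_eq_zeroD:
  "\<lbrakk>x \<oplus>\<^bsub>A\<^esub> \<ominus>\<^bsub>A\<^esub> y = \<zero>\<^bsub>A\<^esub>; x \<in> carrier A; y \<in> carrier A\<rbrakk> \<Longrightarrow> x = y"
  using A.minus_equality[of x "\<ominus>\<^bsub>A\<^esub> y"] by simp

lemma rad_pow_closed: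
  "\<zero>\<^bsub>A\<^esub> \<in> rad_pow A m" "x \<in> rad_pow A m \<Longrightarrow> y \<in> rad_pow A m \<Longrightarrow> x \<oplus>\<^bsub>A\<^esub> y \<in> rad_pow A m"
  "x \<in> rad_pow A m \<Longrightarrow> \<ominus>\<^bsub>A\<^esub> x \<in> rad_pow A m"
  "a \<in> carrier A \<Longrightarrow> x \<in> rad_pow A m \<Longrightarrow> a \<otimes>\<^bsub>A\<^esub> x \<in> rad_pow A m"
  "a \<in> carrier A \<Longrightarrow> x \<in> rad_pow A m \<Longrightarrow> x \<otimes>\<^bsub>A\<^esub> a \<in> rad_pow A m"
proof -
  interpret P: ideal "rad_pow A m" A by (rule rad_pow_ideal)
  show "\<zero>\<^bsub>A\<^esub> \<in> rad_pow A m" "x \<in> rad_pow A m \<Longrightarrow> y \<in> rad_pow A m \<Longrightarrow> x \<oplus>\<^bsub>A\<^esub> y \<in> rad_pow A m"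
    "x \<in> rad_pow A m \<Longrightarrow> \<ominus>\<^bsub>A\<^esub> x \<in> rad_pow A m"
    "a \<in> carrier A \<Longrightarrow> x \<in> rad_pow A m \<Longrightarrow> a \<otimes>\<^bsub>A\<^esub> x \<in> rad_pow A m"
    "a \<in> carrier A \<Longrightarrow> x \<in> rad_pow A m \<Longrightarrow> x \<otimes>\<^bsub>A\<^esub> a \<in> rad_pow A m"
    using P.I_l_closed P.I_r_closed by auto
qed

lemma J_closed:
  "\<zero>\<^bsub>A\<^esub> \<in> J" "x \<in> J \<Longrightarrow> y \<in> J \<Longrightarrow> x \<oplus>\<^bsub>A\<^esub> y \<in> J" "x \<in> J \<Longrightarrow> \<ominus>\<^bsub>A\<^esub> x \<in> J"
  "a \<in> carrier A \<Longrightarrow> x \<in> J \<Longrightarrow> a \<otimes>\<^bsub>A\<^esub> x \<in> J" "a \<in> carrier A \<Longrightarrow> x \<in> J \<Longrightarrow> x \<otimes>\<^bsub>A\<^esub> a \<in> J"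
proof -
  interpret J: ideal J A by (rule J_ideal)
  show "\<zero>\<^bsub>A\<^esub> \<in> J" "x \<in> J \<Longrightarrow> y \<in> J \<Longrightarrow> x \<oplus>\<^bsub>A\<^esub> y \<in> J" "x \<in> J \<Longrightarrow> \<ominus>\<^bsub>A\<^esub> x \<in> J"
    "a \<in> carrier A \<Longrightarrow> x \<in> J \<Longrightarrow> a \<otimes>\<^bsub>A\<^esub> x \<in> J" "a \<in> carrier A \<Longrightarrow> x \<in> J \<Longrightarrow> x \<otimes>\<^bsub>A\<^esub> a \<in> J"
    using J.I_l_closed J.I_r_closed by auto
qed

lemma smult_as_mult: "c \<in> carrier K \<Longrightarrow> x \<in> carrier A \<Longrightarrow> c \<odot>\<^bsub>A\<^esub> x = (c \<odot>\<^bsub>A\<^esub> \<one>\<^bsub>A\<^esub>) \<otimes>\<^bsub>A\<^esub> x"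
  using smult_mult[of c "\<one>\<^bsub>A\<^esub>" x] by simp

lemma J_smult: "c \<in> carrier K \<Longrightarrow> x \<in> J \<Longrightarrow> c \<odot>\<^bsub>A\<^esub> x \<in> J"
  using J_closed(4)[of "c \<odot>\<^bsub>A\<^esub> \<one>\<^bsub>A\<^esub>" x] smult_as_mult[of c x] J_carrier by simp

lemma rad_eq:
  assumes "i \<in> {1..t}"
  shows "{e i \<otimes>\<^bsub>A\<^esub> x \<otimes>\<^bsub>A\<^esub> e i |x. x \<in> J} = rad i"
proof
  show "{e i \<otimes>\<^bsub>A\<^esub> x \<otimes>\<^bsub>A\<^esub> e i |x. x \<in> J} \<subseteq> rad i"
    using corner_sandwich[OF assms assms J_carrier] J_closed(4,5) e_idem(1)[OF assms] J_carrier by auto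
  show "rad i \<subseteq> {e i \<otimes>\<^bsub>A\<^esub> x \<otimes>\<^bsub>A\<^esub> e i |x. x \<in> J}"
  proof
    fix x assume x: "x \<in> rad i"
    then have "x = e i \<otimes>\<^bsub>A\<^esub> x \<otimes>\<^bsub>A\<^esub> e i" unfolding corner_def by simp
    then show "x \<in> {e i \<otimes>\<^bsub>A\<^esub> x \<otimes>\<^bsub>A\<^esub> e i |x. x \<in> J}" using x by blast
  qed
qed

lemma residue_eq: "i \<in> {1..t} \<Longrightarrow> D i = quot_module (E i) (rad i)"
  unfolding residue_alg_def by (simp add: rad_eq corner_eq)

lemma E_left_module:
  assumes i: "i \<in> {1..t}"
  shows "left_module K (E i)"
proof -
  have "abelian_group (E i)"
  proof (rule abelian_groupI)
    fix x assume x: "x \<in> carrier (E i)"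
    show "\<exists>y\<in>carrier (E i). y \<oplus>\<^bsub>E i\<^esub> x = \<zero>\<^bsub>E i\<^esub>"
      using x corner_neg[OF _ i i, of x] corner_carrier[of x i i] by (intro bexI[of _ "\<ominus>\<^bsub>A\<^esub> x"]) (simp_all add: A.l_neg)
  qed (use i corner_add corner_zero corner_carrier in \<open>auto simp: A.a_ac\<close>)
  then show ?thesis
    using i K.ring_axioms corner_smult corner_carrier
    by (intro left_module.intro left_module_axioms.intro)
       (auto simp: KA.smult_l_distr KA.smult_r_distr KA.smult_assoc)
qed

lemma E_ring:
  assumes i: "i \<in> {1..t}"
  shows "ring (E i)"
proof (rule ringI)
  show "abelian_group (E i)" using left_module.axioms(2)[OF E_left_module[OF i]] .
  show "monoid (E i)"
    using corner_mult[OF i _ _ i] corner_idem[OF i] corner_fix[of _ i i] corner_carrier[of _ i i]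
    by (intro monoidI) (auto simp: A.m_assoc)
qed (use corner_carrier[of _ i i] in \<open>simp_all add: A.l_distr A.r_distr\<close>)

lemma rad_submodule:
  assumes i: "i \<in> {1..t}"
  shows "submodule (rad i) K (E i)"
proof -
  interpret left_module K "E i" by (rule E_left_module[OF i])
  show ?thesis
    using i corner_zero corner_add corner_smult J_closed J_smult by (intro submoduleI) auto
qed

lemma rad_ideal:
  assumes i: "i \<in> {1..t}"
  shows "ideal (rad i) (E i)"
proof (rule idealI[OF E_ring[OF i]])
  show "subgroup (rad i) (add_monoid (E i))"
    using rad_submodule[OF i] unfolding submodule_def by simp
qed (use corner_mult[OF i _ _ i] J_closed(4,5) corner_carrier in auto)

lemma quotient_E: "i \<in> {1..t} \<Longrightarrow> quotient K (E i) (rad i)"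
  using E_left_module rad_submodule by (intro quotient.intro quotient_axioms.intro)

lemma D_carrier: "i \<in> {1..t} \<Longrightarrow> carrier (D i) = residue_class i ` corner i i"
  using quotient.quot_carrier[OF quotient_E, of i] unfolding residue_eq residue_class_def by auto

lemma D_one: "i \<in> {1..t} \<Longrightarrow> \<one>\<^bsub>D i\<^esub> = residue_class i (e i)"
  unfolding residue_eq residue_class_def quot_module_simps by simp

lemma D_add: "i \<in> {1..t} \<Longrightarrow> x \<in> corner i i \<Longrightarrow> y \<in> corner i i \<Longrightarrow> residue_class i x \<oplus>\<^bsub>D i\<^esub> residue_class i y = residue_class i (x \<oplus>\<^bsub>A\<^esub> y)"
  using quotient.coset_add[OF quotient_E, of i x y] unfolding residue_eq residue_class_def by simp

lemma D_mult: "i \<in> {1..t} \<Longrightarrow> x \<in> corner i i \<Longrightarrow> y \<in> corner i i \<Longrightarrow> residue_class i x \<otimes>\<^bsub>D i\<^esub> residue_class i y = residue_class i (x \<otimes>\<^bsub>A\<^esub> y)"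
  using ideal.rcoset_mult_add[OF rad_ideal, of i x y] unfolding residue_eq residue_class_def quot_module_simps by simp

lemma D_smult: "i \<in> {1..t} \<Longrightarrow> c \<in> carrier K \<Longrightarrow> x \<in> corner i i \<Longrightarrow> c \<odot>\<^bsub>D i\<^esub> residue_class i x = residue_class i (c \<odot>\<^bsub>A\<^esub> x)"
  using quotient.coset_smult[OF quotient_E, of i c x] unfolding residue_eq residue_class_def by simp

lemma residue_class_eq_iff:
  assumes i: "i \<in> {1..t}" and x: "x \<in> corner i i" and y: "y \<in> corner i i"
  shows "residue_class i x = residue_class i y \<longleftrightarrow> x \<oplus>\<^bsub>A\<^esub> \<ominus>\<^bsub>A\<^esub> y \<in> J"
proof -
  interpret left_module K "E i" by (rule E_left_module[OF i])
  have neg: "\<ominus>\<^bsub>E i\<^esub> y = \<ominus>\<^bsub>A\<^esub> y"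
    using corner_neg[OF y i i] y corner_carrier[OF y] by (intro M.minus_equality) (auto simp: A.l_neg)
  show ?thesis
    using quotient.coset_eq_iff[OF quotient_E[OF i], of x y] x y corner_add[OF x corner_neg[OF y i i] i i]
    unfolding residue_class_def neg by simp
qed

lemma residue_class_eq_zero_iff: "i \<in> {1..t} \<Longrightarrow> x \<in> corner i i \<Longrightarrow> residue_class i x = \<zero>\<^bsub>D i\<^esub> \<longleftrightarrow> x \<in> J"
  using quotient.coset_eq_zero_iff[OF quotient_E, of i x] unfolding residue_eq residue_class_def by auto

lemma D_cases:
  assumes "i \<in> {1..t}" "X \<in> carrier (D i)"
  obtains x where "x \<in> corner i i" "X = residue_class i x"
  using assms D_carrier by blast

lemma residue_class_closed: "i \<in> {1..t} \<Longrightarrow> x \<in> corner i i \<Longrightarrow> residue_class i x \<in> carrier (D i)"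
  using D_carrier by blast

text \<open>The actions on \<open>V\<^sub>i\<^sub>j\<close> go through an unspecified representative, which is controlled here.\<close>
lemma residue_class_rep:
  assumes i: "i \<in> {1..t}" and x: "x \<in> corner i i"
  shows "(SOME y. y \<in> residue_class i x) \<in> corner i i" "(SOME y. y \<in> residue_class i x) \<oplus>\<^bsub>A\<^esub> \<ominus>\<^bsub>A\<^esub> x \<in> J"
proof -
  interpret quotient K "E i" "rad i" by (rule quotient_E[OF i])
  let ?y = "SOME y. y \<in> residue_class i x"
  have "x \<in> residue_class i x" unfolding residue_class_def using C.a_rcos_self[of x] x by simp
  then have y: "?y \<in> residue_class i x" by (rule someI)
  then show c: "?y \<in> corner i i" using C.a_elemrcos_carrier[of x ?y] x unfolding residue_class_def by simp
  have "residue_class i x = residue_class i ?y" using C.a_repr_independence'[of ?y x] y x unfolding residue_class_def by simp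
  then show "?y \<oplus>\<^bsub>A\<^esub> \<ominus>\<^bsub>A\<^esub> x \<in> J" using residue_class_eq_iff[OF i c x] by simp
qed

lemma D_ring:
  assumes i: "i \<in> {1..t}"
  shows "ring (D i)"
proof (rule ringI)
  show "abelian_group (D i)"
    unfolding residue_eq[OF i]
    using left_module.axioms(2)[OF quotient.left_module_quot[OF quotient_E[OF i]]] .
  have m: "x \<otimes>\<^bsub>A\<^esub> y \<in> corner i i" if "x \<in> corner i i" "y \<in> corner i i" for x y
    using corner_mult[OF i that i] .
  show "monoid (D i)"
    using m corner_idem[OF i] corner_fix[of _ i i] corner_carrier[of _ i i]
    by (intro monoidI) (auto simp: D_carrier[OF i] D_one[OF i] D_mult[OF i] A.m_assoc)
  have a: "x \<oplus>\<^bsub>A\<^esub> y \<in> corner i i" if "x \<in> corner i i" "y \<in> corner i i" for x y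
    using corner_add[OF that i i] .
  show "(X \<oplus>\<^bsub>D i\<^esub> Y) \<otimes>\<^bsub>D i\<^esub> Z = X \<otimes>\<^bsub>D i\<^esub> Z \<oplus>\<^bsub>D i\<^esub> Y \<otimes>\<^bsub>D i\<^esub> Z"
    if XYZ: "X \<in> carrier (D i)" "Y \<in> carrier (D i)" "Z \<in> carrier (D i)" for X Y Z
    using XYZ a m corner_carrier[of _ i i] unfolding D_carrier[OF i] by (auto simp: D_mult[OF i] D_add[OF i] A.l_distr)
  show "Z \<otimes>\<^bsub>D i\<^esub> (X \<oplus>\<^bsub>D i\<^esub> Y) = Z \<otimes>\<^bsub>D i\<^esub> X \<oplus>\<^bsub>D i\<^esub> Z \<otimes>\<^bsub>D i\<^esub> Y"
    if XYZ: "X \<in> carrier (D i)" "Y \<in> carrier (D i)" "Z \<in> carrier (D i)" for X Y Z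
    using XYZ a m corner_carrier[of _ i i] unfolding D_carrier[OF i] by (auto simp: D_mult[OF i] D_add[OF i] A.r_distr)
qed

lemma D_vector_space: "i \<in> {1..t} \<Longrightarrow> left_vector_space K (D i)"
  unfolding residue_eq
  using quotient.left_module_quot[OF quotient_E] KA.nonzero_Units
  by (intro left_vector_space.intro left_vector_space_axioms.intro)

lemma D_Units:
  assumes i: "i \<in> {1..t}"
  shows "Units (D i) = carrier (D i) - {\<zero>\<^bsub>D i\<^esub>}"
proof -
  interpret R: ring "D i" by (rule D_ring[OF i])
  have one: "\<one>\<^bsub>D i\<^esub> \<noteq> \<zero>\<^bsub>D i\<^esub>"
    unfolding D_one[OF i] using residue_class_eq_zero_iff[OF i corner_idem[OF i]] e_notin_J[OF i] by simp
  show ?thesis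
  proof
    show "Units (D i) \<subseteq> carrier (D i) - {\<zero>\<^bsub>D i\<^esub>}"
    proof
      fix X assume X: "X \<in> Units (D i)"
      then obtain Y where Y: "Y \<in> carrier (D i)" "X \<otimes>\<^bsub>D i\<^esub> Y = \<one>\<^bsub>D i\<^esub>" unfolding Units_def by blast
      have "X \<noteq> \<zero>\<^bsub>D i\<^esub>"
      proof
        assume X0: "X = \<zero>\<^bsub>D i\<^esub>"
        from Y(2) have "\<one>\<^bsub>D i\<^esub> = \<zero>\<^bsub>D i\<^esub>" unfolding X0 R.l_null[OF Y(1)] by (rule sym)
        with one show False ..
      qed
      then show "X \<in> carrier (D i) - {\<zero>\<^bsub>D i\<^esub>}" using R.Units_closed[OF X] by blast
    qed
    show "carrier (D i) - {\<zero>\<^bsub>D i\<^esub>} \<subseteq> Units (D i)"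
    proof
      fix X assume X: "X \<in> carrier (D i) - {\<zero>\<^bsub>D i\<^esub>}"
      then obtain x where x: "x \<in> corner i i" "X = residue_class i x" using D_cases[OF i] by blast
      then have "x \<notin> J" using X residue_class_eq_zero_iff[OF i x(1)] by simp
      then obtain y where y: "y \<in> corner i i" "y \<otimes>\<^bsub>A\<^esub> x = e i" "x \<otimes>\<^bsub>A\<^esub> y = e i"
        using corner_unit_iff[OF i x(1)] by blast
      then have "residue_class i y \<otimes>\<^bsub>D i\<^esub> X = \<one>\<^bsub>D i\<^esub>" "X \<otimes>\<^bsub>D i\<^esub> residue_class i y = \<one>\<^bsub>D i\<^esub>"
        using x by (simp_all add: D_mult[OF i] D_one[OF i])
      then show "X \<in> Units (D i)" using X residue_class_closed[OF i y(1)] unfolding Units_def by blast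
    qed
  qed
qed

lemma D_division_algebra:
  assumes i: "i \<in> {1..t}"
  shows "division_algebra K (D i)"
proof -
  interpret KD: left_vector_space K "D i" by (rule D_vector_space[OF i])
  have m: "x \<otimes>\<^bsub>A\<^esub> y \<in> corner i i" if "x \<in> corner i i" "y \<in> corner i i" for x y
    using corner_mult[OF i that i] .
  have s: "c \<odot>\<^bsub>A\<^esub> x \<in> corner i i" if "c \<in> carrier K" "x \<in> corner i i" for c x
    using corner_smult[OF that i i] .
  obtain B where B: "is_basis K (A\<lparr>carrier := corner i i\<rparr>) B"
    using finite_dimensional KA.submodule_basis_exists[OF _ corner_submodule[OF i i]] by blast
  have "is_basis K (E i) B"
  proof -
    have "(\<Oplus>\<^bsub>E i\<^esub>b\<in>B. a b \<odot>\<^bsub>E i\<^esub> b) = (\<Oplus>\<^bsub>A\<lparr>carrier := corner i i\<rparr>\<^esub>b\<in>B. a b \<odot>\<^bsub>A\<lparr>carrier := corner i i\<rparr>\<^esub> b)" for a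
      unfolding finsum_def by simp
    then show ?thesis using B unfolding is_basis_def by simp
  qed
  moreover have "left_vector_space K (E i)"
    using E_left_module[OF i] KA.nonzero_Units by (intro left_vector_space.intro left_vector_space_axioms.intro)
  ultimately have fin: "\<exists>B. is_basis K (D i) B"
    unfolding residue_eq[OF i] using quotient.quotient_basis_exists[OF quotient_E[OF i]] by blast
  show ?thesis
  proof (intro division_algebra.intro division_algebra_axioms.intro field D_ring[OF i] D_vector_space[OF i] D_Units[OF i] fin)
    fix c X Y assume c: "c \<in> carrier K" and XY: "X \<in> carrier (D i)" "Y \<in> carrier (D i)"
    obtain x y where xy: "x \<in> corner i i" "X = residue_class i x" "y \<in> corner i i" "Y = residue_class i y"
      using D_cases[OF i] XY by metis
    show "(c \<odot>\<^bsub>D i\<^esub> X) \<otimes>\<^bsub>D i\<^esub> Y = c \<odot>\<^bsub>D i\<^esub> (X \<otimes>\<^bsub>D i\<^esub> Y) \<and> X \<otimes>\<^bsub>D i\<^esub> (c \<odot>\<^bsub>D i\<^esub> Y) = c \<odot>\<^bsub>D i\<^esub> (X \<otimes>\<^bsub>D i\<^esub> Y)"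
      using c xy m s smult_mult[OF c corner_carrier[OF xy(1)] corner_carrier[OF xy(3)]]
      by (simp add: D_smult[OF i] D_mult[OF i])
  qed
qed

lemma V_eq:
  assumes i: "i \<in> {1..t}" and j: "j \<in> {1..t}"
  shows "V i j = corner j i \<inter> rad_pow A (n - 1)"
proof
  show "V i j \<subseteq> corner j i \<inter> rad_pow A (n - 1)"
  proof
    fix v assume "v \<in> V i j"
    then obtain x where x: "v = e j \<otimes>\<^bsub>A\<^esub> x \<otimes>\<^bsub>A\<^esub> e i" "x \<in> rad_pow A (n - 1)" unfolding V_space_def by blast
    show "v \<in> corner j i \<inter> rad_pow A (n - 1)"
      using corner_sandwich[OF i j rad_pow_carrier[OF x(2)]]
        rad_pow_closed(5)[OF e_idem(1)[OF i] rad_pow_closed(4)[OF e_idem(1)[OF j] x(2)]] x(1) by blast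
  qed
  show "corner j i \<inter> rad_pow A (n - 1) \<subseteq> V i j"
  proof
    fix v assume v: "v \<in> corner j i \<inter> rad_pow A (n - 1)"
    then have "v = e j \<otimes>\<^bsub>A\<^esub> v \<otimes>\<^bsub>A\<^esub> e i" unfolding corner_def by simp
    then show "v \<in> V i j" unfolding V_space_def using v by blast
  qed
qed

lemma V_closed:
  assumes i: "i \<in> {1..t}" and j: "j \<in> {1..t}"
  shows "v \<in> V i j \<Longrightarrow> v \<in> carrier A" "v \<in> V i j \<Longrightarrow> v \<in> corner j i" "v \<in> V i j \<Longrightarrow> v \<in> rad_pow A (n - 1)"
    "\<zero>\<^bsub>A\<^esub> \<in> V i j" "v \<in> V i j \<Longrightarrow> w \<in> V i j \<Longrightarrow> v \<oplus>\<^bsub>A\<^esub> w \<in> V i j" "v \<in> V i j \<Longrightarrow> \<ominus>\<^bsub>A\<^esub> v \<in> V i j"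
    "c \<in> carrier K \<Longrightarrow> v \<in> V i j \<Longrightarrow> c \<odot>\<^bsub>A\<^esub> v \<in> V i j"
    "x \<in> corner i i \<Longrightarrow> v \<in> V i j \<Longrightarrow> v \<otimes>\<^bsub>A\<^esub> x \<in> V i j" "x \<in> corner j j \<Longrightarrow> v \<in> V i j \<Longrightarrow> x \<otimes>\<^bsub>A\<^esub> v \<in> V i j"
proof -
  note V = V_eq[OF i j]
  show "v \<in> V i j \<Longrightarrow> v \<in> carrier A" "v \<in> V i j \<Longrightarrow> v \<in> corner j i" "v \<in> V i j \<Longrightarrow> v \<in> rad_pow A (n - 1)"
    using V corner_carrier by auto
  show "\<zero>\<^bsub>A\<^esub> \<in> V i j" "v \<in> V i j \<Longrightarrow> w \<in> V i j \<Longrightarrow> v \<oplus>\<^bsub>A\<^esub> w \<in> V i j" "v \<in> V i j \<Longrightarrow> \<ominus>\<^bsub>A\<^esub> v \<in> V i j"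
    using corner_zero[OF i j] corner_add[OF _ _ i j] corner_neg[OF _ i j] rad_pow_closed(1-3)
    unfolding V by auto
  show "c \<odot>\<^bsub>A\<^esub> v \<in> V i j" if c: "c \<in> carrier K" and v: "v \<in> V i j"
  proof -
    have "(c \<odot>\<^bsub>A\<^esub> \<one>\<^bsub>A\<^esub>) \<otimes>\<^bsub>A\<^esub> v \<in> rad_pow A (n - 1)" using c v unfolding V by (intro rad_pow_closed(4)) auto
    then show ?thesis using c v smult_as_mult[OF c, of v] corner_smult[OF c _ i j, of v] corner_carrier unfolding V by auto
  qed
  show "v \<otimes>\<^bsub>A\<^esub> x \<in> V i j" if x: "x \<in> corner i i" and v: "v \<in> V i j"
    using corner_mult[OF i _ x j, of v] rad_pow_closed(5)[OF corner_carrier[OF x]] v unfolding V by blast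
  show "x \<otimes>\<^bsub>A\<^esub> v \<in> V i j" if x: "x \<in> corner j j" and v: "v \<in> V i j"
    using corner_mult[OF i x _ j, of v] rad_pow_closed(4)[OF corner_carrier[OF x]] v unfolding V by blast
qed

lemma V_right_simps [simp]:
  "carrier (V_right A n e i j) = V i j" "zero (V_right A n e i j) = \<zero>\<^bsub>A\<^esub>" "add (V_right A n e i j) = add A"
  unfolding V_right_def by simp_all

lemma V_left_simps [simp]:
  "carrier (V_left A n e i j) = V i j" "zero (V_left A n e i j) = \<zero>\<^bsub>A\<^esub>" "add (V_left A n e i j) = add A"
  unfolding V_left_def by simp_all

text \<open>
  The module structure uses an arbitrary representative of the residue class, and \<open>J\<^bsup>n-1\<^esup>J = 0\<close>
  makes the choice irrelevant.
\<close>
lemma V_right_smult: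
  assumes i: "i \<in> {1..t}" and j: "j \<in> {1..t}" and x: "x \<in> corner i i" and v: "v \<in> V i j"
  shows "residue_class i x \<odot>\<^bsub>V_right A n e i j\<^esub> v = v \<otimes>\<^bsub>A\<^esub> x"
proof -
  let ?y = "SOME y. y \<in> residue_class i x"
  note y = residue_class_rep[OF i x]
  have c: "?y \<in> carrier A" "x \<in> carrier A" "v \<in> carrier A"
    using y x v corner_carrier V_closed[OF i j] by blast+
  have "v \<otimes>\<^bsub>A\<^esub> (?y \<oplus>\<^bsub>A\<^esub> \<ominus>\<^bsub>A\<^esub> x) = \<zero>\<^bsub>A\<^esub>"
    using J_annihilates(2)[OF y(2)] V_closed(3)[OF i j v] by simp
  then have "v \<otimes>\<^bsub>A\<^esub> ?y \<oplus>\<^bsub>A\<^esub> \<ominus>\<^bsub>A\<^esub> (v \<otimes>\<^bsub>A\<^esub> x) = \<zero>\<^bsub>A\<^esub>"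
    using c by (simp add: A.r_distr A.r_minus)
  then have "v \<otimes>\<^bsub>A\<^esub> ?y = v \<otimes>\<^bsub>A\<^esub> x" by (rule minus_eq_zeroD) (use c in auto)
  then show ?thesis unfolding V_right_def by simp
qed

lemma V_left_smult:
  assumes i: "i \<in> {1..t}" and j: "j \<in> {1..t}" and x: "x \<in> corner j j" and v: "v \<in> V i j"
  shows "residue_class j x \<odot>\<^bsub>V_left A n e i j\<^esub> v = x \<otimes>\<^bsub>A\<^esub> v"
proof -
  let ?y = "SOME y. y \<in> residue_class j x"
  note y = residue_class_rep[OF j x]
  have c: "?y \<in> carrier A" "x \<in> carrier A" "v \<in> carrier A"
    using y x v corner_carrier V_closed[OF i j] by blast+
  have "(?y \<oplus>\<^bsub>A\<^esub> \<ominus>\<^bsub>A\<^esub> x) \<otimes>\<^bsub>A\<^esub> v = \<zero>\<^bsub>A\<^esub>"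
    using J_annihilates(1)[OF y(2)] V_closed(3)[OF i j v] by simp
  then have "?y \<otimes>\<^bsub>A\<^esub> v \<oplus>\<^bsub>A\<^esub> \<ominus>\<^bsub>A\<^esub> (x \<otimes>\<^bsub>A\<^esub> v) = \<zero>\<^bsub>A\<^esub>"
    using c by (simp add: A.l_distr A.l_minus)
  then have "?y \<otimes>\<^bsub>A\<^esub> v = x \<otimes>\<^bsub>A\<^esub> v" by (rule minus_eq_zeroD) (use c in auto)
  then show ?thesis unfolding V_left_def by simp
qed

lemma V_right_vector_space:
  assumes i: "i \<in> {1..t}" and j: "j \<in> {1..t}"
  shows "left_vector_space (opp (D i)) (V_right A n e i j)"
proof -
  note Vc = V_closed[OF i j]
  have ab: "abelian_group (V_right A n e i j)"
  proof (rule abelian_groupI)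
    fix v assume v: "v \<in> carrier (V_right A n e i j)"
    then show "\<exists>w\<in>carrier (V_right A n e i j). w \<oplus>\<^bsub>V_right A n e i j\<^esub> v = \<zero>\<^bsub>V_right A n e i j\<^esub>"
      using Vc(1,6) by (intro bexI[of _ "\<ominus>\<^bsub>A\<^esub> v"]) (simp_all add: A.l_neg)
  qed (use Vc(1,4,5) in \<open>auto simp: A.a_ac\<close>)
  have "left_module_axioms (opp (D i)) (V_right A n e i j)"
  proof
    fix X v assume X: "X \<in> carrier (opp (D i))" and v: "v \<in> carrier (V_right A n e i j)"
    obtain x where x: "x \<in> corner i i" "X = residue_class i x" using D_cases[OF i] X by auto
    show "X \<odot>\<^bsub>V_right A n e i j\<^esub> v \<in> carrier (V_right A n e i j)"
      using x v V_right_smult[OF i j x(1)] Vc(8) by simp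
  next
    fix X Y v assume X: "X \<in> carrier (opp (D i))" and Y: "Y \<in> carrier (opp (D i))" and v: "v \<in> carrier (V_right A n e i j)"
    obtain x where x: "x \<in> corner i i" "X = residue_class i x" using D_cases[OF i] X by auto
    obtain y where y: "y \<in> corner i i" "Y = residue_class i y" using D_cases[OF i] Y by auto
    have c: "x \<in> carrier A" "y \<in> carrier A" "v \<in> carrier A" using x y v corner_carrier Vc by auto
    show "(X \<oplus>\<^bsub>opp (D i)\<^esub> Y) \<odot>\<^bsub>V_right A n e i j\<^esub> v
        = X \<odot>\<^bsub>V_right A n e i j\<^esub> v \<oplus>\<^bsub>V_right A n e i j\<^esub> Y \<odot>\<^bsub>V_right A n e i j\<^esub> v"
      using x y v c corner_add[OF x(1) y(1) i i] by (simp add: D_add[OF i] V_right_smult[OF i j] A.r_distr)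
    show "(X \<otimes>\<^bsub>opp (D i)\<^esub> Y) \<odot>\<^bsub>V_right A n e i j\<^esub> v = X \<odot>\<^bsub>V_right A n e i j\<^esub> (Y \<odot>\<^bsub>V_right A n e i j\<^esub> v)"
      using x y v c corner_mult[OF i y(1) x(1) i] Vc(8)[OF y(1)]
      by (simp add: D_mult[OF i] V_right_smult[OF i j] A.m_assoc)
  next
    fix X v w assume X: "X \<in> carrier (opp (D i))" and vw: "v \<in> carrier (V_right A n e i j)" "w \<in> carrier (V_right A n e i j)"
    obtain x where x: "x \<in> corner i i" "X = residue_class i x" using D_cases[OF i] X by auto
    have c: "x \<in> carrier A" "v \<in> carrier A" "w \<in> carrier A" using x vw corner_carrier Vc by auto
    show "X \<odot>\<^bsub>V_right A n e i j\<^esub> (v \<oplus>\<^bsub>V_right A n e i j\<^esub> w)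
        = X \<odot>\<^bsub>V_right A n e i j\<^esub> v \<oplus>\<^bsub>V_right A n e i j\<^esub> X \<odot>\<^bsub>V_right A n e i j\<^esub> w"
      using x vw c Vc(5)[of v w] by (simp add: V_right_smult[OF i j] A.l_distr)
  next
    fix v assume v: "v \<in> carrier (V_right A n e i j)"
    then show "\<one>\<^bsub>opp (D i)\<^esub> \<odot>\<^bsub>V_right A n e i j\<^esub> v = v"
      using V_right_smult[OF i j corner_idem[OF i], of v] corner_fix(2)[OF Vc(2)] by (simp add: D_one[OF i])
  qed
  then show ?thesis
    using ab ring_opp[OF D_ring[OF i]] D_Units[OF i]
    by (intro left_vector_space.intro left_vector_space_axioms.intro left_module.intro) auto
qed

lemma V_submodule:
  assumes i: "i \<in> {1..t}" and j: "j \<in> {1..t}"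
  shows "submodule (V i j) K A"
  using V_closed[OF i j] by (intro KA.submoduleI) auto

text \<open>
  Scalars of \<open>k\<close> act through \<open>D\<^sub>i\<close>, so a \<open>k\<close>-basis spans over \<open>D\<^sub>i\<close>.
\<close>
lemma V_right_basis_exists:
  assumes i: "i \<in> {1..t}" and j: "j \<in> {1..t}"
  shows "\<exists>B. is_basis (opp (D i)) (V_right A n e i j) B"
proof -
  interpret R: left_vector_space "opp (D i)" "V_right A n e i j" by (rule V_right_vector_space[OF i j])
  interpret VK: left_vector_space K "A\<lparr>carrier := V i j\<rparr>"
    by (rule KA.restrict_left_vector_space[OF V_submodule[OF i j]])
  obtain B where "is_basis K (A\<lparr>carrier := V i j\<rparr>) B"
    using finite_dimensional KA.submodule_basis_exists[OF _ V_submodule[OF i j]] by blast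
  then have B: "finite B" "B \<subseteq> V i j" "span K (A\<lparr>carrier := V i j\<rparr>) B = V i j" using VK.is_basis_iff by auto
  let ?S = "span (opp (D i)) (V_right A n e i j) B"
  have S: "submodule ?S (opp (D i)) (V_right A n e i j)" using B by (intro R.span_submodule) simp
  note Sd = R.submoduleD[OF S]
  have "c \<odot>\<^bsub>A\<^esub> v \<in> ?S" if c: "c \<in> carrier K" and v: "v \<in> ?S" for c v
  proof -
    have vV: "v \<in> V i j" using v Sd(1) by auto
    have ce: "c \<odot>\<^bsub>A\<^esub> e i \<in> corner i i" using corner_smult[OF c corner_idem[OF i] i i] .
    have "v \<otimes>\<^bsub>A\<^esub> (c \<odot>\<^bsub>A\<^esub> e i) \<in> ?S"
      using Sd(4)[of "residue_class i (c \<odot>\<^bsub>A\<^esub> e i)" v] v residue_class_closed[OF i ce] V_right_smult[OF i j ce vV] by simp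
    then show ?thesis
      using smult_mult[OF c V_closed(1)[OF i j vV] e_idem(1)[OF i]] corner_fix(2)[OF V_closed(2)[OF i j vV]] by simp
  qed
  then have "submodule ?S K (A\<lparr>carrier := V i j\<rparr>)"
    using Sd(1-3) by (intro VK.submoduleI) auto
  then have "V i j \<subseteq> ?S" using VK.span_least[of ?S B] B(3) R.span_superset[of B] by simp
  then show ?thesis using R.basis_exists[of B] B by simp
qed

text \<open>
  If \<open>\<psi>\<close> is an isomorphism onto \<open>k\<close>, then \<open>X\<close> and \<open>\<psi>(X) 1\<close> have the same image.  Through this, \<open>D\<^sub>j\<close>
  acts on \<open>V\<^sub>i\<^sub>j\<close> by scalars.
\<close>
lemma residue_scalars:
  assumes j: "j \<in> {1..t}" and iso: "alg_isomorphic K (D j) (self_alg K)" and X: "X \<in> carrier (D j)"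
  shows "\<exists>c\<in>carrier K. X = c \<odot>\<^bsub>D j\<^esub> \<one>\<^bsub>D j\<^esub> \<and> X = residue_class j (c \<odot>\<^bsub>A\<^esub> e j)"
proof -
  interpret KD: left_vector_space K "D j" by (rule D_vector_space[OF j])
  interpret R: ring "D j" by (rule D_ring[OF j])
  obtain \<psi> where \<psi>: "\<psi> \<in> ring_iso (D j) (self_alg K)" "k_linear K (D j) (self_alg K) \<psi>"
    using iso unfolding alg_isomorphic_def by blast
  have h: "\<psi> \<in> ring_hom (D j) (self_alg K)" and b: "inj_on \<psi> (carrier (D j))"
    using \<psi>(1) unfolding ring_iso_def bij_betw_def by auto
  have c: "\<psi> X \<in> carrier K" using ring_hom_closed[OF h X] by simp
  have "\<psi> (\<psi> X \<odot>\<^bsub>D j\<^esub> \<one>\<^bsub>D j\<^esub>) = \<psi> X"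
    using \<psi>(2) c ring_hom_one[OF h] unfolding k_linear_def by simp
  then have "X = \<psi> X \<odot>\<^bsub>D j\<^esub> \<one>\<^bsub>D j\<^esub>"
    using inj_onD[OF b, of X "\<psi> X \<odot>\<^bsub>D j\<^esub> \<one>\<^bsub>D j\<^esub>"] X c by simp
  then show ?thesis
    using c D_smult[OF j c corner_idem[OF j]] D_one[OF j] by (intro bexI[of _ "\<psi> X"]) auto
qed

lemma V_left_scalar:
  assumes i: "i \<in> {1..t}" and j: "j \<in> {1..t}" and c: "c \<in> carrier K" and v: "v \<in> V i j"
  shows "residue_class j (c \<odot>\<^bsub>A\<^esub> e j) \<odot>\<^bsub>V_left A n e i j\<^esub> v = c \<odot>\<^bsub>A\<^esub> v"
  using V_left_smult[OF i j corner_smult[OF c corner_idem[OF j] j j] v]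
    smult_mult[OF c e_idem(1)[OF j] V_closed(1)[OF i j v]] corner_fix(1)[OF V_closed(2)[OF i j v]] by simp

lemma V_right_scalar:
  assumes i: "i \<in> {1..t}" and j: "j \<in> {1..t}" and c: "c \<in> carrier K" and v: "v \<in> V i j"
  shows "(c \<odot>\<^bsub>D i\<^esub> \<one>\<^bsub>D i\<^esub>) \<odot>\<^bsub>V_right A n e i j\<^esub> v = c \<odot>\<^bsub>A\<^esub> v"
  using V_right_smult[OF i j corner_smult[OF c corner_idem[OF i] i i] v] D_smult[OF i c corner_idem[OF i]]
    smult_mult[OF c V_closed(1)[OF i j v] e_idem(1)[OF i]] corner_fix(2)[OF V_closed(2)[OF i j v]]
  by (simp add: D_one[OF i])

lemma dual_setup_V:
  assumes i: "i \<in> {1..t}" and j: "j \<in> {1..t}"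
  shows "dual_setup K (D i) (V_right A n e i j)"
  using D_division_algebra[OF i] V_right_vector_space[OF i j] by (rule dual_setup.intro)

lemma coord_space_eq: "coord_space K A n e i j = hom_dual K (D i) (V_right A n e i j)"
  unfolding coord_space_def hom_dual_def D_dual_def dual_module_def Let_def by simp

section \<open>The modules \<open>M\<^sub>U\<close>\<close>

lemma V_left_vector_space:
  assumes i: "i \<in> {1..t}" and j: "j \<in> {1..t}"
  shows "left_vector_space (D j) (V_left A n e i j)"
proof -
  note Vc = V_closed[OF i j]
  have ab: "abelian_group (V_left A n e i j)"
  proof (rule abelian_groupI)
    fix v assume v: "v \<in> carrier (V_left A n e i j)"
    then show "\<exists>w\<in>carrier (V_left A n e i j). w \<oplus>\<^bsub>V_left A n e i j\<^esub> v = \<zero>\<^bsub>V_left A n e i j\<^esub>"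
      using Vc(1,6) by (intro bexI[of _ "\<ominus>\<^bsub>A\<^esub> v"]) (simp_all add: A.l_neg)
  qed (use Vc(1,4,5) in \<open>auto simp: A.a_ac\<close>)
  have "left_module_axioms (D j) (V_left A n e i j)"
  proof
    fix X v assume X: "X \<in> carrier (D j)" and v: "v \<in> carrier (V_left A n e i j)"
    obtain x where x: "x \<in> corner j j" "X = residue_class j x" using D_cases[OF j] X by auto
    show "X \<odot>\<^bsub>V_left A n e i j\<^esub> v \<in> carrier (V_left A n e i j)"
      using x v V_left_smult[OF i j x(1)] Vc(9) by simp
  next
    fix X Y v assume X: "X \<in> carrier (D j)" and Y: "Y \<in> carrier (D j)" and v: "v \<in> carrier (V_left A n e i j)"
    obtain x where x: "x \<in> corner j j" "X = residue_class j x" using D_cases[OF j] X by auto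
    obtain y where y: "y \<in> corner j j" "Y = residue_class j y" using D_cases[OF j] Y by auto
    have c: "x \<in> carrier A" "y \<in> carrier A" "v \<in> carrier A" using x y v corner_carrier Vc by auto
    show "(X \<oplus>\<^bsub>D j\<^esub> Y) \<odot>\<^bsub>V_left A n e i j\<^esub> v
        = X \<odot>\<^bsub>V_left A n e i j\<^esub> v \<oplus>\<^bsub>V_left A n e i j\<^esub> Y \<odot>\<^bsub>V_left A n e i j\<^esub> v"
      using x y v c corner_add[OF x(1) y(1) j j] by (simp add: D_add[OF j] V_left_smult[OF i j] A.l_distr)
    show "(X \<otimes>\<^bsub>D j\<^esub> Y) \<odot>\<^bsub>V_left A n e i j\<^esub> v = X \<odot>\<^bsub>V_left A n e i j\<^esub> (Y \<odot>\<^bsub>V_left A n e i j\<^esub> v)"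
      using x y v c corner_mult[OF j x(1) y(1) j] Vc(9)[OF y(1)]
      by (simp add: D_mult[OF j] V_left_smult[OF i j] A.m_assoc)
  next
    fix X v w assume X: "X \<in> carrier (D j)" and vw: "v \<in> carrier (V_left A n e i j)" "w \<in> carrier (V_left A n e i j)"
    obtain x where x: "x \<in> corner j j" "X = residue_class j x" using D_cases[OF j] X by auto
    have c: "x \<in> carrier A" "v \<in> carrier A" "w \<in> carrier A" using x vw corner_carrier Vc by auto
    show "X \<odot>\<^bsub>V_left A n e i j\<^esub> (v \<oplus>\<^bsub>V_left A n e i j\<^esub> w)
        = X \<odot>\<^bsub>V_left A n e i j\<^esub> v \<oplus>\<^bsub>V_left A n e i j\<^esub> X \<odot>\<^bsub>V_left A n e i j\<^esub> w"
      using x vw c Vc(5)[of v w] by (simp add: V_left_smult[OF i j] A.r_distr)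
  next
    fix v assume v: "v \<in> carrier (V_left A n e i j)"
    then show "\<one>\<^bsub>D j\<^esub> \<odot>\<^bsub>V_left A n e i j\<^esub> v = v"
      using V_left_smult[OF i j corner_idem[OF j], of v] corner_fix(1)[OF Vc(2)] by (simp add: D_one[OF j])
  qed
  then show ?thesis
    using ab D_ring[OF j] D_Units[OF j]
    by (intro left_vector_space.intro left_vector_space_axioms.intro left_module.intro) auto
qed

abbreviation P where "P i \<equiv> left_mod A (proj_ideal A e i)"

lemma proj_ideal_iff:
  assumes i: "i \<in> {1..t}"
  shows "p \<in> proj_ideal A e i \<longleftrightarrow> p \<in> carrier A \<and> p \<otimes>\<^bsub>A\<^esub> e i = p"
proof
  assume "p \<in> proj_ideal A e i"
  then show "p \<in> carrier A \<and> p \<otimes>\<^bsub>A\<^esub> e i = p"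
    using e_idem(1,2)[OF i] unfolding proj_ideal_def by (auto simp: A.m_assoc)
next
  assume "p \<in> carrier A \<and> p \<otimes>\<^bsub>A\<^esub> e i = p"
  then show "p \<in> proj_ideal A e i" unfolding proj_ideal_def by (intro CollectI exI[of _ p]) simp
qed

lemma P_left_module:
  assumes i: "i \<in> {1..t}"
  shows "left_module A (P i)"
proof -
  have "submodule (proj_ideal A e i) A (left_mod A (carrier A))"
    using e_idem(1)[OF i] by (intro R.submoduleI) (auto simp: proj_ideal_iff[OF i] A.l_distr A.m_assoc)
  moreover have "left_mod A (carrier A)\<lparr>carrier := proj_ideal A e i\<rparr> = P i"
    unfolding left_mod_def by simp
  ultimately show ?thesis using R.restrict_left_module by metis
qed

lemma last_layer_iff:
  assumes i: "i \<in> {1..t}"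
  shows "w \<in> last_layer A n e i \<longleftrightarrow> w \<in> rad_pow A (n - 1) \<and> w \<otimes>\<^bsub>A\<^esub> e i = w"
proof
  assume "w \<in> last_layer A n e i"
  then have "w \<in> ideal_prod A (rad_pow A (n - 1)) (proj_ideal A e i)" unfolding last_layer_def .
  then show "w \<in> rad_pow A (n - 1) \<and> w \<otimes>\<^bsub>A\<^esub> e i = w"
  proof (induct w rule: ideal_prod.induct)
    case (prod x y)
    then have "y \<in> carrier A" "y \<otimes>\<^bsub>A\<^esub> e i = y" using proj_ideal_iff[OF i] by auto
    then show ?case
      using prod(1) rad_pow_closed(5)[of y x] rad_pow_carrier[OF prod(1)] e_idem(1)[OF i] by (simp add: A.m_assoc)
  next
    case (sum x y)
    then have "x \<in> carrier A" "y \<in> carrier A" using rad_pow_carrier by blast+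
    then show ?case
      using sum rad_pow_closed(2) e_idem(1)[OF i] by (simp add: A.l_distr)
  qed
next
  assume w: "w \<in> rad_pow A (n - 1) \<and> w \<otimes>\<^bsub>A\<^esub> e i = w"
  have "w \<otimes>\<^bsub>A\<^esub> e i \<in> ideal_prod A (rad_pow A (n - 1)) (proj_ideal A e i)"
    using w e_idem(1,2)[OF i] proj_ideal_iff[OF i] by (intro ideal_prod.prod) auto
  then show "w \<in> last_layer A n e i" unfolding last_layer_def using w by simp
qed

lemma sum_e_mult:
  assumes "w \<in> carrier A"
  shows "(\<Oplus>\<^bsub>A\<^esub>h\<in>{1..t}. e h \<otimes>\<^bsub>A\<^esub> w) = w"
proof -
  have "(\<Oplus>\<^bsub>A\<^esub>h\<in>{1..t}. e h) \<otimes>\<^bsub>A\<^esub> w = (\<Oplus>\<^bsub>A\<^esub>h\<in>{1..t}. e h \<otimes>\<^bsub>A\<^esub> w)"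
    using assms e_idem(1) by (intro A.finsum_ldistr) auto
  then show ?thesis using complete assms by simp
qed

lemma W_compl_iff:
  assumes i: "i \<in> {1..t}" and j: "j \<in> {1..t}"
  shows "w \<in> W_compl A n t e i j \<longleftrightarrow> w \<in> last_layer A n e i \<and> e j \<otimes>\<^bsub>A\<^esub> w = \<zero>\<^bsub>A\<^esub>"
proof
  assume "w \<in> W_compl A n t e i j"
  then obtain f where w: "w = (\<Oplus>\<^bsub>A\<^esub>h\<in>{1..t} - {j}. f h)"
    and f: "\<And>h. h \<in> {1..t} - {j} \<Longrightarrow> f h \<in> {e h \<otimes>\<^bsub>A\<^esub> x |x. x \<in> last_layer A n e i}"
    unfolding W_compl_def by blast
  have f': "f h \<in> carrier A \<and> f h \<in> rad_pow A (n - 1) \<and> f h \<otimes>\<^bsub>A\<^esub> e i = f h \<and> e j \<otimes>\<^bsub>A\<^esub> f h = \<zero>\<^bsub>A\<^esub>"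
    if h: "h \<in> {1..t} - {j}" for h
  proof -
    obtain x where x: "f h = e h \<otimes>\<^bsub>A\<^esub> x" "x \<in> rad_pow A (n - 1)" "x \<otimes>\<^bsub>A\<^esub> e i = x"
      using f[OF h] last_layer_iff[OF i] by blast
    have c: "x \<in> carrier A" "e h \<in> carrier A" "e j \<in> carrier A" "e i \<in> carrier A"
      using rad_pow_carrier[OF x(2)] e_idem(1) h i j by auto
    have "e j \<otimes>\<^bsub>A\<^esub> e h = \<zero>\<^bsub>A\<^esub>" using orthogonal[of j h] h j by auto
    then have "e j \<otimes>\<^bsub>A\<^esub> (e h \<otimes>\<^bsub>A\<^esub> x) = \<zero>\<^bsub>A\<^esub>" using c by (simp add: A.m_assoc[symmetric])
    then show ?thesis using x c rad_pow_closed(4)[OF c(2) x(2)] by (simp add: A.m_assoc)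
  qed
  have "(\<Oplus>\<^bsub>A\<^esub>h\<in>S. f h) \<in> rad_pow A (n - 1) \<and> (\<Oplus>\<^bsub>A\<^esub>h\<in>S. f h) \<otimes>\<^bsub>A\<^esub> e i = (\<Oplus>\<^bsub>A\<^esub>h\<in>S. f h)
      \<and> e j \<otimes>\<^bsub>A\<^esub> (\<Oplus>\<^bsub>A\<^esub>h\<in>S. f h) = \<zero>\<^bsub>A\<^esub>"
    if "finite S" "S \<subseteq> {1..t} - {j}" for S
    using that
  proof (induct S rule: finite_induct)
    case empty
    then show ?case using rad_pow_closed(1) e_idem(1) i j by simp
  next
    case (insert h S)
    have h: "h \<in> {1..t} - {j}" "S \<subseteq> {1..t} - {j}" using insert.prems by auto
    have fc: "f \<in> S \<rightarrow> carrier A" using f' h(2) by blast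
    have IH: "(\<Oplus>\<^bsub>A\<^esub>h\<in>S. f h) \<in> rad_pow A (n - 1)" "(\<Oplus>\<^bsub>A\<^esub>h\<in>S. f h) \<otimes>\<^bsub>A\<^esub> e i = (\<Oplus>\<^bsub>A\<^esub>h\<in>S. f h)"
      "e j \<otimes>\<^bsub>A\<^esub> (\<Oplus>\<^bsub>A\<^esub>h\<in>S. f h) = \<zero>\<^bsub>A\<^esub>" using insert.hyps(3)[OF h(2)] by auto
    have "(\<Oplus>\<^bsub>A\<^esub>h\<in>insert h S. f h) = f h \<oplus>\<^bsub>A\<^esub> (\<Oplus>\<^bsub>A\<^esub>h\<in>S. f h)"
      using insert.hyps fc f'[OF h(1)] by (intro A.finsum_insert) auto
    then show ?case
      using IH f'[OF h(1)] rad_pow_closed(2)[of "f h" "n - 1"] A.finsum_closed[OF fc] e_idem(1)[OF i] e_idem(1)[OF j]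
      by (simp add: A.l_distr A.r_distr)
  qed
  then show "w \<in> last_layer A n e i \<and> e j \<otimes>\<^bsub>A\<^esub> w = \<zero>\<^bsub>A\<^esub>" unfolding w last_layer_iff[OF i] by simp
next
  assume w: "w \<in> last_layer A n e i \<and> e j \<otimes>\<^bsub>A\<^esub> w = \<zero>\<^bsub>A\<^esub>"
  then have wc: "w \<in> carrier A" using last_layer_iff[OF i] rad_pow_carrier by blast
  have "(\<Oplus>\<^bsub>A\<^esub>h\<in>insert j ({1..t} - {j}). e h \<otimes>\<^bsub>A\<^esub> w)
      = e j \<otimes>\<^bsub>A\<^esub> w \<oplus>\<^bsub>A\<^esub> (\<Oplus>\<^bsub>A\<^esub>h\<in>{1..t} - {j}. e h \<otimes>\<^bsub>A\<^esub> w)"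
    using wc e_idem(1) j by (intro A.finsum_insert) auto
  moreover have "insert j ({1..t} - {j}) = {1..t}" using j by auto
  moreover have "(\<Oplus>\<^bsub>A\<^esub>h\<in>{1..t} - {j}. e h \<otimes>\<^bsub>A\<^esub> w) \<in> carrier A" using wc e_idem(1) by (intro A.finsum_closed) auto
  ultimately have "w = (\<Oplus>\<^bsub>A\<^esub>h\<in>{1..t} - {j}. e h \<otimes>\<^bsub>A\<^esub> w)" using sum_e_mult[OF wc] w by simp
  then show "w \<in> W_compl A n t e i j" unfolding W_compl_def using w by blast
qed

text \<open>The denominator \<open>W\<^sub>j \<oplus> U\<close> of \<open>M\<^sub>U\<close>, by a condition on \<open>j\<close>-components (see \<open>denom_eq\<close>)\<close>
definition denom :: "nat \<Rightarrow> nat \<Rightarrow> 'a set \<Rightarrow> 'a set" where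
  "denom i j U = {w \<in> rad_pow A (n - 1). w \<otimes>\<^bsub>A\<^esub> e i = w \<and> e j \<otimes>\<^bsub>A\<^esub> w \<in> U}"

lemma denom_eq:
  assumes i: "i \<in> {1..t}" and j: "j \<in> {1..t}" and U: "U \<subseteq> V i j"
  shows "W_compl A n t e i j <+>\<^bsub>A\<^esub> U = denom i j U"
proof
  show "W_compl A n t e i j <+>\<^bsub>A\<^esub> U \<subseteq> denom i j U"
  proof
    fix w assume "w \<in> W_compl A n t e i j <+>\<^bsub>A\<^esub> U"
    then obtain x u where w: "w = x \<oplus>\<^bsub>A\<^esub> u" "x \<in> W_compl A n t e i j" "u \<in> U" unfolding set_add_def' by blast
    have x: "x \<in> rad_pow A (n - 1)" "x \<otimes>\<^bsub>A\<^esub> e i = x" "e j \<otimes>\<^bsub>A\<^esub> x = \<zero>\<^bsub>A\<^esub>"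
      using w(2) W_compl_iff[OF i j] last_layer_iff[OF i] by auto
    have u: "u \<in> rad_pow A (n - 1)" "u \<otimes>\<^bsub>A\<^esub> e i = u" "e j \<otimes>\<^bsub>A\<^esub> u = u"
      using w(3) U V_closed(2,3)[OF i j] corner_fix by blast+
    show "w \<in> denom i j U"
      using x u w(1,3) rad_pow_closed(2)[OF x(1) u(1)] rad_pow_carrier[OF x(1)] rad_pow_carrier[OF u(1)]
        e_idem(1)[OF i] e_idem(1)[OF j]
      unfolding denom_def by (simp add: A.l_distr A.r_distr)
  qed
  show "denom i j U \<subseteq> W_compl A n t e i j <+>\<^bsub>A\<^esub> U"
  proof
    fix w assume "w \<in> denom i j U"
    then have w: "w \<in> rad_pow A (n - 1)" "w \<otimes>\<^bsub>A\<^esub> e i = w" "e j \<otimes>\<^bsub>A\<^esub> w \<in> U" unfolding denom_def by auto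
    let ?u = "e j \<otimes>\<^bsub>A\<^esub> w"
    have c: "w \<in> carrier A" "?u \<in> carrier A" "e i \<in> carrier A" "e j \<in> carrier A"
      using rad_pow_carrier[OF w(1)] e_idem(1) i j by auto
    have ur: "?u \<in> rad_pow A (n - 1)" using rad_pow_closed(4)[OF c(4) w(1)] .
    have ui: "?u \<otimes>\<^bsub>A\<^esub> e i = ?u" using c w(2) by (simp add: A.m_assoc)
    have uj: "e j \<otimes>\<^bsub>A\<^esub> ?u = ?u" using c e_idem(2)[OF j] by (simp add: A.m_assoc[symmetric])
    have "w \<oplus>\<^bsub>A\<^esub> \<ominus>\<^bsub>A\<^esub> ?u \<in> W_compl A n t e i j"
      unfolding W_compl_iff[OF i j] last_layer_iff[OF i]
      using c w ur ui uj rad_pow_closed(2)[OF w(1) rad_pow_closed(3)[OF ur]]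
      by (simp add: A.l_distr A.r_distr A.l_minus A.r_minus A.r_neg)
    moreover have "w = (w \<oplus>\<^bsub>A\<^esub> \<ominus>\<^bsub>A\<^esub> ?u) \<oplus>\<^bsub>A\<^esub> ?u" using c by (simp add: A.a_assoc A.l_neg)
    ultimately show "w \<in> W_compl A n t e i j <+>\<^bsub>A\<^esub> U" unfolding set_add_def' using w(3) by blast
  qed
qed

text \<open>
  For \<open>r \<in> \<Lambda>\<close> the \<open>j\<close>-component of \<open>rw\<close> is \<open>\<Sum>\<^sub>h (e\<^sub>jre\<^sub>h)(e\<^sub>hw)\<close>.  The terms with \<open>h \<noteq> j\<close> vanish, because
  \<open>e\<^sub>jre\<^sub>h\<close> is radical and \<open>w\<close> lies in the last layer; the remaining one is in \<open>U\<close>.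
\<close>
lemma denom_submodule:
  assumes i: "i \<in> {1..t}" and j: "j \<in> {1..t}" and U: "submodule U (D j) (V_left A n e i j)"
  shows "submodule (denom i j U) A (P i)"
proof -
  interpret VL: left_vector_space "D j" "V_left A n e i j" by (rule V_left_vector_space[OF i j])
  interpret Pi: left_module A "P i" by (rule P_left_module[OF i])
  note Ud = VL.submoduleD[OF U, simplified]
  have c: "e i \<in> carrier A" "e j \<in> carrier A" using e_idem(1) i j by auto
  show ?thesis
  proof (rule Pi.submoduleI)
    show "denom i j U \<subseteq> carrier (P i)"
      using rad_pow_carrier unfolding denom_def by (auto simp: proj_ideal_iff[OF i])
    show "\<zero>\<^bsub>P i\<^esub> \<in> denom i j U" using c Ud(2) rad_pow_closed(1) unfolding denom_def by simp
    show "x \<oplus>\<^bsub>P i\<^esub> y \<in> denom i j U" if xy: "x \<in> denom i j U" "y \<in> denom i j U" for x y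
    proof -
      have "x \<in> carrier A" "y \<in> carrier A" using xy rad_pow_carrier unfolding denom_def by blast+
      then show ?thesis
        using xy c rad_pow_closed(2)[of x _ y] Ud(3) unfolding denom_def by (simp add: A.l_distr A.r_distr)
    qed
    show "r \<odot>\<^bsub>P i\<^esub> w \<in> denom i j U" if r: "r \<in> carrier A" and wd: "w \<in> denom i j U" for r w
    proof -
      have w: "w \<in> rad_pow A (n - 1)" "w \<otimes>\<^bsub>A\<^esub> e i = w" "e j \<otimes>\<^bsub>A\<^esub> w \<in> U" using wd unfolding denom_def by auto
      have wc: "w \<in> carrier A" using rad_pow_carrier[OF w(1)] .
      have zero: "(e j \<otimes>\<^bsub>A\<^esub> r) \<otimes>\<^bsub>A\<^esub> (e h \<otimes>\<^bsub>A\<^esub> w) = \<zero>\<^bsub>A\<^esub>" if h: "h \<in> {1..t} - {j}" for h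
      proof -
        have "e j \<otimes>\<^bsub>A\<^esub> r \<otimes>\<^bsub>A\<^esub> e h \<in> J"
          using h by (intro off_diagonal_in_J[OF j _ _ corner_sandwich[OF _ j r]]) auto
        then have "(e j \<otimes>\<^bsub>A\<^esub> r \<otimes>\<^bsub>A\<^esub> e h) \<otimes>\<^bsub>A\<^esub> w = \<zero>\<^bsub>A\<^esub>" using J_annihilates(1) w(1) by blast
        then show ?thesis using c r wc e_idem(1)[of h] h by (simp add: A.m_assoc)
      qed
      have "(e j \<otimes>\<^bsub>A\<^esub> r) \<otimes>\<^bsub>A\<^esub> w = (e j \<otimes>\<^bsub>A\<^esub> r) \<otimes>\<^bsub>A\<^esub> (\<Oplus>\<^bsub>A\<^esub>h\<in>{1..t}. e h \<otimes>\<^bsub>A\<^esub> w)"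
        using sum_e_mult[OF wc] by simp
      also have "\<dots> = (\<Oplus>\<^bsub>A\<^esub>h\<in>{1..t}. (e j \<otimes>\<^bsub>A\<^esub> r) \<otimes>\<^bsub>A\<^esub> (e h \<otimes>\<^bsub>A\<^esub> w))"
        using c r wc e_idem(1) by (intro A.finsum_rdistr) auto
      also have "\<dots> = (\<Oplus>\<^bsub>A\<^esub>h\<in>insert j ({1..t} - {j}). (e j \<otimes>\<^bsub>A\<^esub> r) \<otimes>\<^bsub>A\<^esub> (e h \<otimes>\<^bsub>A\<^esub> w))"
        using j by (simp add: insert_absorb)
      also have "\<dots> = (e j \<otimes>\<^bsub>A\<^esub> r) \<otimes>\<^bsub>A\<^esub> (e j \<otimes>\<^bsub>A\<^esub> w)
          \<oplus>\<^bsub>A\<^esub> (\<Oplus>\<^bsub>A\<^esub>h\<in>{1..t} - {j}. (e j \<otimes>\<^bsub>A\<^esub> r) \<otimes>\<^bsub>A\<^esub> (e h \<otimes>\<^bsub>A\<^esub> w))"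
        using c r wc e_idem(1) by (intro A.finsum_insert) auto
      also have "(\<Oplus>\<^bsub>A\<^esub>h\<in>{1..t} - {j}. (e j \<otimes>\<^bsub>A\<^esub> r) \<otimes>\<^bsub>A\<^esub> (e h \<otimes>\<^bsub>A\<^esub> w)) = \<zero>\<^bsub>A\<^esub>"
        using zero by (intro A.add.finprod_one_eqI) auto
      also have "(e j \<otimes>\<^bsub>A\<^esub> r) \<otimes>\<^bsub>A\<^esub> (e j \<otimes>\<^bsub>A\<^esub> w) \<oplus>\<^bsub>A\<^esub> \<zero>\<^bsub>A\<^esub> = (e j \<otimes>\<^bsub>A\<^esub> r \<otimes>\<^bsub>A\<^esub> e j) \<otimes>\<^bsub>A\<^esub> (e j \<otimes>\<^bsub>A\<^esub> w)"
        using c r wc e_idem(2)[OF j] by (simp add: A.m_assoc) (simp add: A.m_assoc[symmetric])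
      finally have eq: "(e j \<otimes>\<^bsub>A\<^esub> r) \<otimes>\<^bsub>A\<^esub> w = (e j \<otimes>\<^bsub>A\<^esub> r \<otimes>\<^bsub>A\<^esub> e j) \<otimes>\<^bsub>A\<^esub> (e j \<otimes>\<^bsub>A\<^esub> w)" .
      have co: "e j \<otimes>\<^bsub>A\<^esub> r \<otimes>\<^bsub>A\<^esub> e j \<in> corner j j" using corner_sandwich[OF j j r] .
      have "e j \<otimes>\<^bsub>A\<^esub> w \<in> V i j" using w(3) Ud(1) by auto
      then have "(e j \<otimes>\<^bsub>A\<^esub> r \<otimes>\<^bsub>A\<^esub> e j) \<otimes>\<^bsub>A\<^esub> (e j \<otimes>\<^bsub>A\<^esub> w) \<in> U"
        using Ud(4)[OF residue_class_closed[OF j co] w(3)] V_left_smult[OF i j co] by simp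
      then have "e j \<otimes>\<^bsub>A\<^esub> (r \<otimes>\<^bsub>A\<^esub> w) \<in> U" using eq c r wc by (simp add: A.m_assoc)
      then show ?thesis
        using rad_pow_closed(4)[OF r w(1)] w(2) r wc c unfolding denom_def by (simp add: A.m_assoc)
    qed
  qed
qed

lemma fibre_module_eq:
  assumes i: "i \<in> {1..t}" and j: "j \<in> {1..t}" and U: "submodule U (D j) (V_left A n e i j)"
  shows "fibre_module A n t e i j U = quot_module (P i) (denom i j U)"
proof -
  interpret VL: left_vector_space "D j" "V_left A n e i j" by (rule V_left_vector_space[OF i j])
  show ?thesis unfolding fibre_module_def using denom_eq[OF i j] VL.submoduleD(1)[OF U] by simp
qed

lemma quotient_P:
  assumes "i \<in> {1..t}" "j \<in> {1..t}" "submodule U (D j) (V_left A n e i j)"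
  shows "quotient A (P i) (denom i j U)"
  using P_left_module denom_submodule assms by (intro quotient.intro quotient_axioms.intro)

text \<open>
  Isomorphisms \<open>M\<^sub>U \<rightarrow> M\<^bsub>U'\<^esub>\<close> lift to right multiplications on the projective \<open>P\<^sub>i\<close>, so that the
  fibre is the set of orbits under the units of \<open>D\<^sub>i\<close>.
\<close>
lemma fibre_modules_isomorphic_iff:
  assumes i: "i \<in> {1..t}" and j: "j \<in> {1..t}"
    and U: "submodule U (D j) (V_left A n e i j)" and U': "submodule U' (D j) (V_left A n e i j)"
    and proper: "U \<noteq> V i j"
  shows "mod_isomorphic A (fibre_module A n t e i j U) (fibre_module A n t e i j U') \<longleftrightarrow>
    (\<exists>a\<in>corner i i - J. \<forall>v\<in>V i j. v \<in> U \<longleftrightarrow> v \<otimes>\<^bsub>A\<^esub> a \<in> U')" (is "?iso \<longleftrightarrow> ?unit")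
proof -
  interpret VL: left_vector_space "D j" "V_left A n e i j" by (rule V_left_vector_space[OF i j])
  interpret Q: quotient A "P i" "denom i j U" by (rule quotient_P[OF i j U])
  interpret Q': quotient A "P i" "denom i j U'" by (rule quotient_P[OF i j U'])
  have c: "e i \<in> carrier A" "e j \<in> carrier A" using e_idem(1) i j by auto
  have UV: "U \<subseteq> V i j" "U' \<subseteq> V i j" using VL.submoduleD(1)[OF U] VL.submoduleD(1)[OF U'] by auto
  have zU': "\<zero>\<^bsub>A\<^esub> \<in> U'" using VL.submoduleD(2)[OF U'] by simp
  note P = proj_ideal_iff[OF i]
  have eiP: "e i \<in> proj_ideal A e i" using P e_idem(1,2)[OF i] by simp
  have Vd: "v \<in> denom i j X \<longleftrightarrow> v \<in> X" if "v \<in> V i j" for v X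
    using that V_closed(2,3)[OF i j that] corner_fix unfolding denom_def by auto
  have VP: "v \<in> proj_ideal A e i" if "v \<in> V i j" for v
    using V_closed(1,2)[OF i j that] corner_fix(2) P by auto
  show ?thesis
  proof
    assume ?iso
    then obtain f where f: "semilinear_iso A (\<lambda>r. r) Q.Q Q'.Q f"
      unfolding mod_isomorphic_def fibre_module_eq[OF i j U] fibre_module_eq[OF i j U'] by blast
    have fb: "bij_betw f (carrier Q.Q) (carrier Q'.Q)"
      and fs: "\<And>r X. r \<in> carrier A \<Longrightarrow> X \<in> carrier Q.Q \<Longrightarrow> f (r \<odot>\<^bsub>Q.Q\<^esub> X) = r \<odot>\<^bsub>Q'.Q\<^esub> f X"
      using f unfolding semilinear_iso_def by auto
    let ?o = "denom i j U +>\<^bsub>P i\<^esub> e i"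
    have o: "?o \<in> carrier Q.Q" using Q.coset_closed[of "e i"] eiP by simp
    then have "f ?o \<in> carrier Q'.Q" using fb bij_betwE by blast
    then obtain b where b: "b \<in> proj_ideal A e i" "f ?o = denom i j U' +>\<^bsub>P i\<^esub> b"
      unfolding Q'.quot_carrier by auto
    have bc: "b \<in> carrier A" "b \<otimes>\<^bsub>A\<^esub> e i = b" using b P by auto
    \<comment> \<open>\<open>P\<^sub>i\<close> is generated by \<open>e\<^sub>i\<close>, so \<open>f\<close> is right multiplication by a lift of the image of \<open>e\<^sub>i\<close>.\<close>
    define a where "a = e i \<otimes>\<^bsub>A\<^esub> b"
    have a: "a \<in> corner i i" using corner_sandwich[OF i i bc(1)] bc c unfolding a_def by (simp add: A.m_assoc)
    have fp: "f (denom i j U +>\<^bsub>P i\<^esub> p) = denom i j U' +>\<^bsub>P i\<^esub> (p \<otimes>\<^bsub>A\<^esub> a)" if p: "p \<in> proj_ideal A e i" for p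
    proof -
      have pc: "p \<in> carrier A" "p \<otimes>\<^bsub>A\<^esub> e i = p" using p P by auto
      have "p \<otimes>\<^bsub>A\<^esub> a = p \<otimes>\<^bsub>A\<^esub> e i \<otimes>\<^bsub>A\<^esub> b" unfolding a_def using pc(1) bc c by (simp add: A.m_assoc)
      then have pa: "p \<otimes>\<^bsub>A\<^esub> a = p \<otimes>\<^bsub>A\<^esub> b" using pc by simp
      have "denom i j U +>\<^bsub>P i\<^esub> p = p \<odot>\<^bsub>Q.Q\<^esub> ?o" using Q.coset_smult[of p "e i"] pc eiP by simp
      then have "f (denom i j U +>\<^bsub>P i\<^esub> p) = p \<odot>\<^bsub>Q'.Q\<^esub> (denom i j U' +>\<^bsub>P i\<^esub> b)" using fs[OF pc(1) o] b(2) by simp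
      also have "\<dots> = denom i j U' +>\<^bsub>P i\<^esub> (p \<otimes>\<^bsub>A\<^esub> a)" using Q'.coset_smult[of p b] pc b(1) pa by simp
      finally show ?thesis .
    qed
    have ac: "a \<in> carrier A" using a corner_carrier by blast
    have paP: "p \<otimes>\<^bsub>A\<^esub> a \<in> proj_ideal A e i" if "p \<in> carrier A" for p
      using that a ac corner_fix(2)[OF a] c P by (simp add: A.m_assoc)
    have zP: "\<zero>\<^bsub>A\<^esub> \<in> proj_ideal A e i" using P c by simp
    have iff: "v \<in> U \<longleftrightarrow> v \<otimes>\<^bsub>A\<^esub> a \<in> U'" if v: "v \<in> V i j" for v
    proof -
      have vP: "v \<in> proj_ideal A e i" and vc: "v \<in> carrier A" using VP[OF v] V_closed(1)[OF i j v] by auto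
      have "v \<in> U \<longleftrightarrow> v \<in> denom i j U" using Vd[OF v] by simp
      also have "\<dots> \<longleftrightarrow> denom i j U +>\<^bsub>P i\<^esub> v = denom i j U +>\<^bsub>P i\<^esub> \<zero>\<^bsub>A\<^esub>"
        using Q.coset_eq_zero_iff[of v] Q.quot_zero vP by simp
      also have "\<dots> \<longleftrightarrow> f (denom i j U +>\<^bsub>P i\<^esub> v) = f (denom i j U +>\<^bsub>P i\<^esub> \<zero>\<^bsub>A\<^esub>)"
        using Q.coset_closed[of v] Q.coset_closed[of "\<zero>\<^bsub>A\<^esub>"] vP zP bij_betw_imp_inj_on[OF fb]
        by (simp add: inj_on_eq_iff)
      also have "\<dots> \<longleftrightarrow> denom i j U' +>\<^bsub>P i\<^esub> (v \<otimes>\<^bsub>A\<^esub> a) = denom i j U' +>\<^bsub>P i\<^esub> \<zero>\<^bsub>A\<^esub>"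
        using fp[OF vP] fp[OF zP] ac by simp
      also have "\<dots> \<longleftrightarrow> v \<otimes>\<^bsub>A\<^esub> a \<in> denom i j U'"
        using Q'.coset_eq_zero_iff[of "v \<otimes>\<^bsub>A\<^esub> a"] Q'.quot_zero paP[OF vc] by simp
      also have "\<dots> \<longleftrightarrow> v \<otimes>\<^bsub>A\<^esub> a \<in> U'" using Vd[OF V_closed(8)[OF i j a v]] .
      finally show ?thesis .
    qed
    have "a \<notin> J"
    proof
      assume aJ: "a \<in> J"
      have "v \<in> U" if v: "v \<in> V i j" for v
        using iff[OF v] J_annihilates(2)[OF aJ V_closed(3)[OF i j v]] zU' by simp
      then show False using proper UV by blast
    qed
    then show ?unit using a iff by blast
  next
    assume ?unit
    then obtain a where a: "a \<in> corner i i" "a \<notin> J" and iff: "\<And>v. v \<in> V i j \<Longrightarrow> v \<in> U \<longleftrightarrow> v \<otimes>\<^bsub>A\<^esub> a \<in> U'"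
      by blast
    then obtain b where b: "b \<in> corner i i" "b \<otimes>\<^bsub>A\<^esub> a = e i" "a \<otimes>\<^bsub>A\<^esub> b = e i"
      using corner_unit_iff[OF i a(1)] by blast
    have ac: "a \<in> carrier A" "b \<in> carrier A" using a b corner_carrier by auto
    have closed: "p \<otimes>\<^bsub>A\<^esub> x \<in> proj_ideal A e i" if "p \<in> carrier A" "x \<in> corner i i" for p x
      using that corner_fix(2)[OF that(2)] corner_carrier[OF that(2)] c P by (simp add: A.m_assoc)
    have iffP: "p \<otimes>\<^bsub>A\<^esub> a \<in> denom i j U' \<longleftrightarrow> p \<in> denom i j U" if p: "p \<in> proj_ideal A e i" for p
    proof -
      have pc: "p \<in> carrier A" "p \<otimes>\<^bsub>A\<^esub> e i = p" using p P by auto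
      have "p \<otimes>\<^bsub>A\<^esub> a \<otimes>\<^bsub>A\<^esub> b = p" using pc ac b by (simp add: A.m_assoc)
      then have r: "p \<otimes>\<^bsub>A\<^esub> a \<in> rad_pow A (n - 1) \<longleftrightarrow> p \<in> rad_pow A (n - 1)"
        using rad_pow_closed(5)[OF ac(1), of p] rad_pow_closed(5)[OF ac(2), of "p \<otimes>\<^bsub>A\<^esub> a"] by auto
      have "e j \<otimes>\<^bsub>A\<^esub> p \<in> V i j" if "p \<in> rad_pow A (n - 1)"
      proof -
        have "e j \<otimes>\<^bsub>A\<^esub> p \<otimes>\<^bsub>A\<^esub> e i \<in> corner j i" using corner_sandwich[OF i j pc(1)] .
        then show ?thesis
          using rad_pow_closed(4)[OF c(2) that] pc c V_eq[OF i j] by (simp add: A.m_assoc)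
      qed
      then have "e j \<otimes>\<^bsub>A\<^esub> p \<in> U \<longleftrightarrow> e j \<otimes>\<^bsub>A\<^esub> (p \<otimes>\<^bsub>A\<^esub> a) \<in> U'" if "p \<in> rad_pow A (n - 1)"
        using iff[of "e j \<otimes>\<^bsub>A\<^esub> p"] that pc ac c by (simp add: A.m_assoc)
      then show ?thesis using r pc closed[OF pc(1) a(1)] P unfolding denom_def by auto
    qed
    show ?iso
      unfolding fibre_module_eq[OF i j U] fibre_module_eq[OF i j U']
    proof (rule quot_module_isomorphic[where h = "\<lambda>p. p \<otimes>\<^bsub>A\<^esub> a"])
      show "quotient A (P i) (denom i j U)" "quotient A (P i) (denom i j U')"
        by (rule Q.quotient_axioms, rule Q'.quotient_axioms)
      show "(\<lambda>p. p \<otimes>\<^bsub>A\<^esub> a) \<in> carrier (P i) \<rightarrow> carrier (P i)" using closed a P by auto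
      show "carrier (P i) \<subseteq> (\<lambda>p. p \<otimes>\<^bsub>A\<^esub> a) ` carrier (P i)"
      proof
        fix p assume "p \<in> carrier (P i)"
        then have p: "p \<in> carrier A" "p \<otimes>\<^bsub>A\<^esub> e i = p" using P by auto
        then have "p = (p \<otimes>\<^bsub>A\<^esub> b) \<otimes>\<^bsub>A\<^esub> a" using ac b by (simp add: A.m_assoc)
        then show "p \<in> (\<lambda>p. p \<otimes>\<^bsub>A\<^esub> a) ` carrier (P i)" using closed[OF p(1) b(1)] by auto
      qed
    qed (use iffP P ac in \<open>auto simp: A.l_distr A.m_assoc\<close>)
  qed
qed

end

section \<open>The geometry of a fibre\<close>

locale scalar_fibre = basic_fd_algebra K A n t e
  for K :: "'k ring" and A :: "('k, 'a) module" and n t :: nat and e :: "nat \<Rightarrow> 'a" +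
  fixes i j :: nat
  assumes i: "i \<in> {1..t}" and j: "j \<in> {1..t}" and scalar: "alg_isomorphic K (residue_alg A e j) (self_alg K)"
begin

sublocale S: dual_setup K "D i" "V_right A n e i j" by (rule dual_setup_V[OF i j])
sublocale VL: left_vector_space "D j" "V_left A n e i j" by (rule V_left_vector_space[OF i j])

lemma W_eq: "S.W = coord_space K A n e i j"
  by (simp add: coord_space_eq)

text \<open>
  \<open>functional_of\<close> and \<open>hom_of\<close> identify \<open>W\<^sub>i\<^sub>j\<close> with the \<open>k\<close>-dual of \<open>V\<^sub>i\<^sub>j\<close>.
\<close>
definition functional_of :: "('a \<Rightarrow> 'a set \<Rightarrow> 'k) \<Rightarrow> 'a \<Rightarrow> 'k" where
  "functional_of F = (\<lambda>v\<in>V i j. F v \<one>\<^bsub>D i\<^esub>)"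

definition hom_of :: "('a \<Rightarrow> 'k) \<Rightarrow> 'a \<Rightarrow> 'a set \<Rightarrow> 'k" where
  "hom_of l = (\<lambda>v\<in>V i j. \<lambda>d\<in>carrier (D i). l (d \<odot>\<^bsub>V_right A n e i j\<^esub> v))"

abbreviation zeros :: "('a \<Rightarrow> 'k) \<Rightarrow> 'a set" where
  "zeros l \<equiv> {v \<in> V i j. l v = \<zero>\<^bsub>K\<^esub>}"

definition point :: "('a \<Rightarrow> 'a set \<Rightarrow> 'k) \<Rightarrow> ('a, 'a set) module set" where
  "point F = fibre_class A n t e i j (fibre_module A n t e i j (zeros (functional_of F)))"

lemma V_dual_iff:
  "l \<in> V_dual K A n e i j \<longleftrightarrow> l \<in> V i j \<rightarrow>\<^sub>E carrier K \<and>
    (\<forall>v\<in>V i j. \<forall>w\<in>V i j. l (v \<oplus>\<^bsub>A\<^esub> w) = l v \<oplus>\<^bsub>K\<^esub> l w) \<and>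
    (\<forall>c\<in>carrier K. \<forall>v\<in>V i j. l (c \<odot>\<^bsub>A\<^esub> v) = c \<otimes>\<^bsub>K\<^esub> l v)"
  unfolding V_dual_def hom_mod_def by simp

lemma V_dualD:
  assumes "l \<in> V_dual K A n e i j"
  shows "v \<in> V i j \<Longrightarrow> l v \<in> carrier K"
    "v \<in> V i j \<Longrightarrow> w \<in> V i j \<Longrightarrow> l (v \<oplus>\<^bsub>A\<^esub> w) = l v \<oplus>\<^bsub>K\<^esub> l w"
    "c \<in> carrier K \<Longrightarrow> v \<in> V i j \<Longrightarrow> l (c \<odot>\<^bsub>A\<^esub> v) = c \<otimes>\<^bsub>K\<^esub> l v"
    "l \<zero>\<^bsub>A\<^esub> = \<zero>\<^bsub>K\<^esub>"
    "v \<in> V i j \<Longrightarrow> l (\<ominus>\<^bsub>A\<^esub> v) = \<ominus>\<^bsub>K\<^esub> l v"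
proof -
  note l = assms[unfolded V_dual_iff]
  show lc: "v \<in> V i j \<Longrightarrow> l v \<in> carrier K" for v using l by auto
  show "v \<in> V i j \<Longrightarrow> w \<in> V i j \<Longrightarrow> l (v \<oplus>\<^bsub>A\<^esub> w) = l v \<oplus>\<^bsub>K\<^esub> l w" using l by auto
  have sm: "c \<in> carrier K \<Longrightarrow> v \<in> V i j \<Longrightarrow> l (c \<odot>\<^bsub>A\<^esub> v) = c \<otimes>\<^bsub>K\<^esub> l v" for c v using l by auto
  then show "c \<in> carrier K \<Longrightarrow> v \<in> V i j \<Longrightarrow> l (c \<odot>\<^bsub>A\<^esub> v) = c \<otimes>\<^bsub>K\<^esub> l v" .
  show "l \<zero>\<^bsub>A\<^esub> = \<zero>\<^bsub>K\<^esub>" using sm[of "\<zero>\<^bsub>K\<^esub>" "\<zero>\<^bsub>A\<^esub>"] V_closed(4)[OF i j] lc by simp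
  show "l (\<ominus>\<^bsub>A\<^esub> v) = \<ominus>\<^bsub>K\<^esub> l v" if v: "v \<in> V i j"
    using sm[of "\<ominus>\<^bsub>K\<^esub> \<one>\<^bsub>K\<^esub>" v] v lc[OF v] V_closed(1)[OF i j v] by (simp add: KA.smult_l_minus K.l_minus)
qed

lemma V_act_closed: "d \<in> carrier (D i) \<Longrightarrow> v \<in> V i j \<Longrightarrow> d \<odot>\<^bsub>V_right A n e i j\<^esub> v \<in> V i j"
  using S.V_smult_closed by simp

lemma hom_of_in_W:
  assumes l: "l \<in> V_dual K A n e i j"
  shows "hom_of l \<in> carrier S.W"
proof -
  note ld = V_dualD[OF l]
  have ap: "hom_of l v d = l (d \<odot>\<^bsub>V_right A n e i j\<^esub> v)" if "v \<in> V i j" "d \<in> carrier (D i)" for v d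
    using that unfolding hom_of_def by simp
  have cs: "(c \<odot>\<^bsub>D i\<^esub> X) \<odot>\<^bsub>V_right A n e i j\<^esub> v = c \<odot>\<^bsub>A\<^esub> (X \<odot>\<^bsub>V_right A n e i j\<^esub> v)"
    if cXv: "c \<in> carrier K" "X \<in> carrier (D i)" "v \<in> V i j" for c X v
  proof -
    obtain x where x: "x \<in> corner i i" "X = residue_class i x" using D_cases[OF i cXv(2)] .
    then show ?thesis
      using cXv corner_smult[OF cXv(1) x(1) i i] smult_mult[OF cXv(1) V_closed(1)[OF i j cXv(3)] corner_carrier[OF x(1)]]
      by (simp add: D_smult[OF i] V_right_smult[OF i j])
  qed
  have "hom_of l \<in> V i j \<rightarrow>\<^sub>E (carrier (D i) \<rightarrow>\<^sub>E carrier K)"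
    using ld(1) V_act_closed unfolding hom_of_def by auto
  then show ?thesis
    unfolding S.hom_dual_iff
    using S.V.smult_l_distr S.V.smult_r_distr S.V.smult_assoc V_act_closed ld V_closed(5)[OF i j]
      S.D.m_closed S.D.a_closed S.KD.smult_closed
    by (simp add: ap cs)
qed

lemma functional_of_in_V_dual:
  assumes F: "F \<in> carrier S.W"
  shows "functional_of F \<in> V_dual K A n e i j"
proof -
  note Fd = S.W_D[OF F, simplified]
  have ap: "functional_of F v = F v \<one>\<^bsub>D i\<^esub>" if "v \<in> V i j" for v using that unfolding functional_of_def by simp
  have "F (c \<odot>\<^bsub>A\<^esub> v) \<one>\<^bsub>D i\<^esub> = c \<otimes>\<^bsub>K\<^esub> F v \<one>\<^bsub>D i\<^esub>" if cv: "c \<in> carrier K" "v \<in> V i j" for c v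
    using Fd(6)[of "c \<odot>\<^bsub>D i\<^esub> \<one>\<^bsub>D i\<^esub>" v "\<one>\<^bsub>D i\<^esub>"] Fd(4)[of v c "\<one>\<^bsub>D i\<^esub>"] cv V_right_scalar[OF i j cv]
    by simp
  moreover have "functional_of F \<in> V i j \<rightarrow>\<^sub>E carrier K" using Fd(2) unfolding functional_of_def by auto
  ultimately show ?thesis
    unfolding V_dual_iff using Fd(5) V_closed(5,7)[OF i j] by (simp add: ap)
qed

lemma hom_of_functional_of:
  assumes F: "F \<in> carrier S.W"
  shows "hom_of (functional_of F) = F"
proof (rule S.W_eqI[OF S.W_D(1)[OF hom_of_in_W[OF functional_of_in_V_dual[OF F]]] S.W_D(1)[OF F]])
  fix v x assume "v \<in> carrier (V_right A n e i j)" "x \<in> carrier (D i)"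
  then show "hom_of (functional_of F) v x = F v x"
    using V_act_closed[of x v] S.W_D(6)[OF F, of x v "\<one>\<^bsub>D i\<^esub>"] unfolding hom_of_def functional_of_def by simp
qed

lemma functional_of_hom_of:
  assumes l: "l \<in> V_dual K A n e i j"
  shows "functional_of (hom_of l) = l"
proof (rule extensionalityI)
  show "functional_of (hom_of l) \<in> extensional (V i j)" unfolding functional_of_def by simp
  show "l \<in> extensional (V i j)" using l unfolding V_dual_iff by (simp add: PiE_iff)
  show "functional_of (hom_of l) v = l v" if "v \<in> V i j" for v
    using that S.V.smult_one[of v] unfolding functional_of_def hom_of_def by simp
qed

lemma functional_of_inj: "F \<in> carrier S.W \<Longrightarrow> G \<in> carrier S.W \<Longrightarrow> functional_of F = functional_of G \<Longrightarrow> F = G"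
  using hom_of_functional_of by metis

lemma functional_of_zero_iff:
  assumes F: "F \<in> carrier S.W"
  shows "F = \<zero>\<^bsub>S.W\<^esub> \<longleftrightarrow> (\<forall>v\<in>V i j. functional_of F v = \<zero>\<^bsub>K\<^esub>)"
proof
  assume "F = \<zero>\<^bsub>S.W\<^esub>"
  then show "\<forall>v\<in>V i j. functional_of F v = \<zero>\<^bsub>K\<^esub>" unfolding functional_of_def using S.W_simps(2) by simp
next
  assume z: "\<forall>v\<in>V i j. functional_of F v = \<zero>\<^bsub>K\<^esub>"
  have "functional_of F = functional_of \<zero>\<^bsub>S.W\<^esub>"
    using z S.W_simps(2) unfolding functional_of_def by (auto simp: fun_eq_iff)
  then show "F = \<zero>\<^bsub>S.W\<^esub>" using functional_of_inj F S.W_closed(2) by blast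
qed

lemma functional_of_smult:
  assumes F: "F \<in> carrier S.W" and a: "a \<in> corner i i" and v: "v \<in> V i j"
  shows "functional_of (residue_class i a \<odot>\<^bsub>S.W\<^esub> F) v = functional_of F (v \<otimes>\<^bsub>A\<^esub> a)"
proof -
  have d: "residue_class i a \<in> carrier (D i)" using residue_class_closed[OF i a] .
  have "functional_of (residue_class i a \<odot>\<^bsub>S.W\<^esub> F) v = F v (residue_class i a)" using v d unfolding functional_of_def by (simp add: S.W_simps)
  also have "\<dots> = F (residue_class i a \<odot>\<^bsub>V_right A n e i j\<^esub> v) \<one>\<^bsub>D i\<^esub>" using S.W_D(6)[OF F, of "residue_class i a" v "\<one>\<^bsub>D i\<^esub>"] d v by simp
  finally show ?thesis using V_right_smult[OF i j a v] V_closed(8)[OF i j a v] unfolding functional_of_def by simp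
qed

lemma functional_of_scalar:
  assumes F: "F \<in> carrier S.W" and c: "c \<in> carrier K" and v: "v \<in> V i j"
  shows "functional_of ((c \<odot>\<^bsub>D i\<^esub> \<one>\<^bsub>D i\<^esub>) \<odot>\<^bsub>S.W\<^esub> F) v = c \<otimes>\<^bsub>K\<^esub> functional_of F v"
  using S.W_D(4)[OF F, of v c "\<one>\<^bsub>D i\<^esub>"] v c unfolding functional_of_def by (simp add: S.W_simps)

lemma zeros_submodule:
  assumes l: "l \<in> V_dual K A n e i j"
  shows "submodule (zeros l) (D j) (V_left A n e i j)"
proof (rule VL.submoduleI)
  note ld = V_dualD[OF l]
  show "zeros l \<subseteq> carrier (V_left A n e i j)" by auto
  show "\<zero>\<^bsub>V_left A n e i j\<^esub> \<in> zeros l" using ld(4) V_closed(4)[OF i j] by simp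
  show "x \<oplus>\<^bsub>V_left A n e i j\<^esub> y \<in> zeros l" if "x \<in> zeros l" "y \<in> zeros l" for x y
    using that ld(2) V_closed(5)[OF i j] by simp
  show "X \<odot>\<^bsub>V_left A n e i j\<^esub> v \<in> zeros l" if X: "X \<in> carrier (D j)" and v: "v \<in> zeros l" for X v
  proof -
    obtain c where c: "c \<in> carrier K" "X = residue_class j (c \<odot>\<^bsub>A\<^esub> e j)" using residue_scalars[OF j scalar X] by blast
    have vV: "v \<in> V i j" "l v = \<zero>\<^bsub>K\<^esub>" using v by auto
    then show ?thesis using c ld(3)[OF c(1) vV(1)] V_left_scalar[OF i j c(1) vV(1)] V_closed(7)[OF i j c(1) vV(1)] by simp
  qed
qed

text \<open>
  The kernel of a nonzero functional has codimension one: the class of any \<open>v\<^sub>0\<close> outside is a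
  basis of the quotient.
\<close>
lemma fibre_module_in_fibre:
  assumes l: "l \<in> V_dual K A n e i j" and nz: "\<exists>v\<in>V i j. l v \<noteq> \<zero>\<^bsub>K\<^esub>"
  shows "fibre_module A n t e i j (zeros l) \<in> fibre_modules A n t e i j"
proof -
  note ld = V_dualD[OF l]
  note sub = zeros_submodule[OF l]
  interpret Q: quotient "D j" "V_left A n e i j" "zeros l"
    using sub VL.left_module_axioms by (intro quotient.intro quotient_axioms.intro)
  interpret QV: left_vector_space "D j" Q.Q
    using Q.left_module_quot VL.nonzero_Units by (intro left_vector_space.intro left_vector_space_axioms.intro)
  obtain v0 where v0: "v0 \<in> V i j" "l v0 \<noteq> \<zero>\<^bsub>K\<^esub>" using nz by blast
  let ?X = "zeros l +>\<^bsub>V_left A n e i j\<^esub> v0"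
  have X: "?X \<in> carrier Q.Q" "?X \<noteq> \<zero>\<^bsub>Q.Q\<^esub>"
    using Q.coset_closed[of v0] Q.coset_eq_zero_iff[of v0] v0 by auto
  have "is_basis (D j) Q.Q {?X}"
  proof (rule QV.singleton_basis[OF X])
    fix Y assume "Y \<in> carrier Q.Q"
    then obtain v where v: "v \<in> V i j" "Y = zeros l +>\<^bsub>V_left A n e i j\<^esub> v" unfolding Q.quot_carrier by auto
    have u: "l v0 \<in> Units K" using field_Units_eq[OF field] ld(1)[OF v0(1)] v0(2) by auto
    define c where "c = l v \<otimes>\<^bsub>K\<^esub> inv\<^bsub>K\<^esub> (l v0)"
    have c: "c \<in> carrier K" unfolding c_def using ld(1)[OF v(1)] u by simp
    have cl0: "c \<otimes>\<^bsub>K\<^esub> l v0 = l v" unfolding c_def using ld(1)[OF v(1)] ld(1)[OF v0(1)] u by (simp add: K.m_assoc)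
    have cv: "c \<odot>\<^bsub>A\<^esub> v0 \<in> V i j" using V_closed(7)[OF i j c v0(1)] .
    have d: "residue_class j (c \<odot>\<^bsub>A\<^esub> e j) \<in> carrier (D j)" using residue_class_closed[OF j corner_smult[OF c corner_idem[OF j] j j]] .
    have neg: "\<ominus>\<^bsub>V_left A n e i j\<^esub> w = \<ominus>\<^bsub>A\<^esub> w" if "w \<in> V i j" for w
      using that V_closed(1,6)[OF i j that] by (intro VL.M.minus_equality) (auto simp: A.l_neg)
    have "v \<oplus>\<^bsub>A\<^esub> \<ominus>\<^bsub>A\<^esub> (c \<odot>\<^bsub>A\<^esub> v0) \<in> zeros l"
      using ld(2)[OF v(1) V_closed(6)[OF i j cv]] ld(5)[OF cv] ld(3)[OF c v0(1)] cl0 ld(1)[OF v(1)]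
        V_closed(5)[OF i j v(1) V_closed(6)[OF i j cv]] by (simp add: K.r_neg)
    then have "Y = zeros l +>\<^bsub>V_left A n e i j\<^esub> (c \<odot>\<^bsub>A\<^esub> v0)"
      unfolding v(2) using Q.coset_eq_iff[of v "c \<odot>\<^bsub>A\<^esub> v0"] v(1) cv neg[OF cv] by simp
    also have "\<dots> = residue_class j (c \<odot>\<^bsub>A\<^esub> e j) \<odot>\<^bsub>Q.Q\<^esub> ?X"
      using Q.coset_smult[OF d, of v0] v0(1) V_left_scalar[OF i j c v0(1)] by simp
    finally show "\<exists>a\<in>carrier (D j). Y = a \<odot>\<^bsub>Q.Q\<^esub> ?X" using d by blast
  qed
  then have "mod_dim (D j) Q.Q = 1" using QV.mod_dim_eq by fastforce
  then show ?thesis using sub unfolding fibre_modules_def by blast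
qed

lemma fibre_class_eq_iff:
  assumes M: "M \<in> fibre_modules A n t e i j" and N: "N \<in> fibre_modules A n t e i j"
  shows "fibre_class A n t e i j M = fibre_class A n t e i j N \<longleftrightarrow> mod_isomorphic A M N"
proof -
  have lm: "left_module A M" if fm: "M \<in> fibre_modules A n t e i j" for M
  proof -
    obtain U where "submodule U (D j) (V_left A n e i j)" "M = fibre_module A n t e i j U"
      using fm unfolding fibre_modules_def by blast
    then show ?thesis using quotient.left_module_quot[OF quotient_P[OF i j]] fibre_module_eq[OF i j] by simp
  qed
  have "N \<in> fibre_class A n t e i j N"
    using N semilinear_iso_refl unfolding fibre_class_def mod_isomorphic_def by blast
  then show ?thesis
    using mod_isomorphic_trans mod_isomorphic_sym lm[OF M] lm[OF N]
    unfolding fibre_class_def by blast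
qed

text \<open>
  With \<open>r = F(v)/F(v\<^sub>0)\<close> the vector \<open>v - r v\<^sub>0\<close> lies in the kernel of the functional of \<open>F\<close>, hence in
  that of \<open>G\<close>.
\<close>
lemma proportional:
  assumes F: "F \<in> carrier S.W" and G: "G \<in> carrier S.W" "G \<noteq> \<zero>\<^bsub>S.W\<^esub>" and eq: "zeros (functional_of F) = zeros (functional_of G)"
  shows "\<exists>c\<in>carrier K. G = (c \<odot>\<^bsub>D i\<^esub> \<one>\<^bsub>D i\<^esub>) \<odot>\<^bsub>S.W\<^esub> F"
proof -
  note f = V_dualD[OF functional_of_in_V_dual[OF F]] and g = V_dualD[OF functional_of_in_V_dual[OF G(1)]]
  obtain v0 where v0: "v0 \<in> V i j" "functional_of G v0 \<noteq> \<zero>\<^bsub>K\<^esub>" using functional_of_zero_iff[OF G(1)] G(2) by blast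
  then have f0: "functional_of F v0 \<noteq> \<zero>\<^bsub>K\<^esub>" using eq by blast
  then have u: "functional_of F v0 \<in> Units K" using field_Units_eq[OF field] f(1)[OF v0(1)] by auto
  define c where "c = inv\<^bsub>K\<^esub> (functional_of F v0) \<otimes>\<^bsub>K\<^esub> functional_of G v0"
  have c: "c \<in> carrier K" unfolding c_def using u g(1)[OF v0(1)] by simp
  have "functional_of G v = c \<otimes>\<^bsub>K\<^esub> functional_of F v" if v: "v \<in> V i j" for v
  proof -
    define r where "r = functional_of F v \<otimes>\<^bsub>K\<^esub> inv\<^bsub>K\<^esub> (functional_of F v0)"
    have r: "r \<in> carrier K" unfolding r_def using u f(1)[OF v] by simp
    have r0: "r \<otimes>\<^bsub>K\<^esub> functional_of F v0 = functional_of F v" unfolding r_def using u f(1)[OF v] f(1)[OF v0(1)] by (simp add: K.m_assoc)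
    have rv: "r \<odot>\<^bsub>A\<^esub> v0 \<in> V i j" using V_closed(7)[OF i j r v0(1)] .
    let ?w = "v \<oplus>\<^bsub>A\<^esub> \<ominus>\<^bsub>A\<^esub> (r \<odot>\<^bsub>A\<^esub> v0)"
    have w: "?w \<in> V i j" using V_closed(5)[OF i j v V_closed(6)[OF i j rv]] .
    have "functional_of F ?w = \<zero>\<^bsub>K\<^esub>"
      using f(2)[OF v V_closed(6)[OF i j rv]] f(5)[OF rv] f(3)[OF r v0(1)] r0 f(1)[OF v] by (simp add: K.r_neg)
    then have "functional_of G ?w = \<zero>\<^bsub>K\<^esub>" using eq w by blast
    then have z: "functional_of G v \<oplus>\<^bsub>K\<^esub> \<ominus>\<^bsub>K\<^esub> (r \<otimes>\<^bsub>K\<^esub> functional_of G v0) = \<zero>\<^bsub>K\<^esub>"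
      using g(2)[OF v V_closed(6)[OF i j rv]] g(5)[OF rv] g(3)[OF r v0(1)] by simp
    have gc: "functional_of G v \<in> carrier K" "r \<otimes>\<^bsub>K\<^esub> functional_of G v0 \<in> carrier K" using g(1)[OF v] g(1)[OF v0(1)] r by auto
    have "\<ominus>\<^bsub>K\<^esub> (\<ominus>\<^bsub>K\<^esub> (r \<otimes>\<^bsub>K\<^esub> functional_of G v0)) = functional_of G v" by (rule K.minus_equality[OF z]) (use gc in auto)
    then have "functional_of G v = r \<otimes>\<^bsub>K\<^esub> functional_of G v0" using gc by simp
    also have "\<dots> = c \<otimes>\<^bsub>K\<^esub> functional_of F v" unfolding r_def c_def using u f(1)[OF v] g(1)[OF v0(1)] by (simp add: K.m_ac)
    finally show ?thesis .
  qed
  moreover have d: "c \<odot>\<^bsub>D i\<^esub> \<one>\<^bsub>D i\<^esub> \<in> carrier (D i)" using c by simp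
  ultimately have "functional_of G = functional_of ((c \<odot>\<^bsub>D i\<^esub> \<one>\<^bsub>D i\<^esub>) \<odot>\<^bsub>S.W\<^esub> F)"
    using functional_of_scalar[OF F c] unfolding functional_of_def by (auto simp: fun_eq_iff)
  then have "G = (c \<odot>\<^bsub>D i\<^esub> \<one>\<^bsub>D i\<^esub>) \<odot>\<^bsub>S.W\<^esub> F" using functional_of_inj[OF G(1) S.W_closed(3)[OF d F]] by blast
  then show ?thesis using c by blast
qed

text \<open>
  If \<open>\<lambda>\<close> is the functional of \<open>F\<close>, that of \<open>aF\<close> is \<open>v \<mapsto> \<lambda>(va)\<close>.  So the modules are isomorphic exactly if
  some unit multiple of \<open>F\<close> has the same kernel as \<open>G\<close>, and then the two differ by a scalar of
  \<open>k \<subseteq> D\<^sub>i\<close>.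
\<close>
lemma point_eq_iff:
  assumes F: "F \<in> carrier S.W - {\<zero>\<^bsub>S.W\<^esub>}" and G: "G \<in> carrier S.W - {\<zero>\<^bsub>S.W\<^esub>}"
  shows "point F = point G \<longleftrightarrow> (\<exists>X\<in>carrier (D i) - {\<zero>\<^bsub>D i\<^esub>}. G = X \<odot>\<^bsub>S.W\<^esub> F)"
proof -
  have Fc: "F \<in> carrier S.W" "F \<noteq> \<zero>\<^bsub>S.W\<^esub>" and Gc: "G \<in> carrier S.W" "G \<noteq> \<zero>\<^bsub>S.W\<^esub>" using F G by auto
  note f = functional_of_in_V_dual[OF Fc(1)] and g = functional_of_in_V_dual[OF Gc(1)]
  have fz: "\<exists>v\<in>V i j. functional_of F v \<noteq> \<zero>\<^bsub>K\<^esub>" and gz: "\<exists>v\<in>V i j. functional_of G v \<noteq> \<zero>\<^bsub>K\<^esub>"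
    using functional_of_zero_iff[OF Fc(1)] functional_of_zero_iff[OF Gc(1)] Fc(2) Gc(2) by auto
  have "point F = point G \<longleftrightarrow>
      mod_isomorphic A (fibre_module A n t e i j (zeros (functional_of G))) (fibre_module A n t e i j (zeros (functional_of F)))"
    unfolding point_def
    using fibre_class_eq_iff[OF fibre_module_in_fibre[OF g gz] fibre_module_in_fibre[OF f fz]] by auto
  also have "\<dots> \<longleftrightarrow> (\<exists>a\<in>corner i i - J. \<forall>v\<in>V i j. v \<in> zeros (functional_of G) \<longleftrightarrow> v \<otimes>\<^bsub>A\<^esub> a \<in> zeros (functional_of F))"
    using fibre_modules_isomorphic_iff[OF i j zeros_submodule[OF g] zeros_submodule[OF f]] gz by blast
  also have "\<dots> \<longleftrightarrow> (\<exists>a\<in>corner i i - J. zeros (functional_of (residue_class i a \<odot>\<^bsub>S.W\<^esub> F)) = zeros (functional_of G))"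
  proof (intro bex_cong refl)
    fix a assume "a \<in> corner i i - J"
    then have a: "a \<in> corner i i" by blast
    have "zeros (functional_of (residue_class i a \<odot>\<^bsub>S.W\<^esub> F)) = {v \<in> V i j. functional_of F (v \<otimes>\<^bsub>A\<^esub> a) = \<zero>\<^bsub>K\<^esub>}"
      using functional_of_smult[OF Fc(1) a] by auto
    then show "(\<forall>v\<in>V i j. v \<in> zeros (functional_of G) \<longleftrightarrow> v \<otimes>\<^bsub>A\<^esub> a \<in> zeros (functional_of F)) \<longleftrightarrow>
        zeros (functional_of (residue_class i a \<odot>\<^bsub>S.W\<^esub> F)) = zeros (functional_of G)"
      using V_closed(8)[OF i j a] by auto
  qed
  also have "\<dots> \<longleftrightarrow> (\<exists>X\<in>carrier (D i) - {\<zero>\<^bsub>D i\<^esub>}. G = X \<odot>\<^bsub>S.W\<^esub> F)"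
  proof
    assume "\<exists>a\<in>corner i i - J. zeros (functional_of (residue_class i a \<odot>\<^bsub>S.W\<^esub> F)) = zeros (functional_of G)"
    then obtain a where a: "a \<in> corner i i" "zeros (functional_of (residue_class i a \<odot>\<^bsub>S.W\<^esub> F)) = zeros (functional_of G)" by blast
    have d: "residue_class i a \<in> carrier (D i)" using residue_class_closed[OF i a(1)] .
    obtain c where c: "c \<in> carrier K" "G = (c \<odot>\<^bsub>D i\<^esub> \<one>\<^bsub>D i\<^esub>) \<odot>\<^bsub>S.W\<^esub> (residue_class i a \<odot>\<^bsub>S.W\<^esub> F)"
      using proportional[OF S.W_closed(3)[OF d Fc(1)] Gc a(2)] by blast
    let ?X = "(c \<odot>\<^bsub>D i\<^esub> \<one>\<^bsub>D i\<^esub>) \<otimes>\<^bsub>D i\<^esub> residue_class i a"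
    have X: "?X \<in> carrier (D i)" using c d by simp
    have GX: "G = ?X \<odot>\<^bsub>S.W\<^esub> F" using c d Fc(1) by (simp add: S.W.smult_assoc)
    then have "?X \<noteq> \<zero>\<^bsub>D i\<^esub>" using Gc(2) Fc(1) by auto
    then show "\<exists>X\<in>carrier (D i) - {\<zero>\<^bsub>D i\<^esub>}. G = X \<odot>\<^bsub>S.W\<^esub> F" using X GX by blast
  next
    assume "\<exists>X\<in>carrier (D i) - {\<zero>\<^bsub>D i\<^esub>}. G = X \<odot>\<^bsub>S.W\<^esub> F"
    then obtain X where X: "X \<in> carrier (D i)" "X \<noteq> \<zero>\<^bsub>D i\<^esub>" "G = X \<odot>\<^bsub>S.W\<^esub> F" by blast
    obtain a where a: "a \<in> corner i i" "X = residue_class i a" using D_cases[OF i X(1)] .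
    then have "a \<notin> J" using residue_class_eq_zero_iff[OF i a(1)] X(2) by simp
    then show "\<exists>a\<in>corner i i - J. zeros (functional_of (residue_class i a \<odot>\<^bsub>S.W\<^esub> F)) = zeros (functional_of G)" using a X(3) by blast
  qed
  finally show ?thesis .
qed

lemma points_in_fibre: "point ` (carrier S.W - {\<zero>\<^bsub>S.W\<^esub>}) \<subseteq> fibre A n t e i j"
proof
  fix p assume "p \<in> point ` (carrier S.W - {\<zero>\<^bsub>S.W\<^esub>})"
  then obtain F where F: "F \<in> carrier S.W" "F \<noteq> \<zero>\<^bsub>S.W\<^esub>" "p = point F" by blast
  then have "\<exists>v\<in>V i j. functional_of F v \<noteq> \<zero>\<^bsub>K\<^esub>" using functional_of_zero_iff by blast
  then show "p \<in> fibre A n t e i j"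
    unfolding F(3) point_def fibre_def using fibre_module_in_fibre[OF functional_of_in_V_dual[OF F(1)]] by blast
qed

lemma coord_point_eq: "coord_point K A n e i j l = {a \<odot>\<^bsub>S.W\<^esub> hom_of l |a. a \<in> carrier (D i)}"
  unfolding coord_point_def hom_of_def Let_def W_eq ..

text \<open>
  The line through a nonzero coordinate vector is a point of \<open>\<P>(U)\<close> exactly if the vector lies in \<open>U\<close>.
\<close>
lemma fibre_subspaces_eq:
  "fibre_subspaces K A n t e i j = {point ` (U - {\<zero>\<^bsub>S.W\<^esub>}) |U. submodule U (D i) S.W \<and> U \<noteq> {\<zero>\<^bsub>S.W\<^esub>}}"
proof -
  have "{fibre_class A n t e i j (fibre_module A n t e i j (zeros l)) |l.
         l \<in> V_dual K A n e i j \<and> (\<exists>v\<in>V i j. l v \<noteq> \<zero>\<^bsub>K\<^esub>) \<and>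
         coord_point K A n e i j l \<in> proj_space (D i) (S.W\<lparr>carrier := U\<rparr>)} = point ` (U - {\<zero>\<^bsub>S.W\<^esub>})"
    (is "?L = _") if U: "submodule U (D i) S.W" for U
  proof
    have Uc: "U \<subseteq> carrier S.W" using S.W.submoduleD(1)[OF U] .
    have mem: "coord_point K A n e i j l \<in> proj_space (D i) (S.W\<lparr>carrier := U\<rparr>) \<longleftrightarrow> hom_of l \<in> U - {\<zero>\<^bsub>S.W\<^esub>}"
      if "l \<in> V_dual K A n e i j" "\<exists>v\<in>V i j. l v \<noteq> \<zero>\<^bsub>K\<^esub>" for l
    proof -
      have "hom_of l \<noteq> \<zero>\<^bsub>S.W\<^esub>" using functional_of_zero_iff[OF hom_of_in_W[OF that(1)]] functional_of_hom_of[OF that(1)] that(2) by auto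
      then show ?thesis using S.W.line_in_proj_space_iff[OF U hom_of_in_W[OF that(1)]] unfolding coord_point_eq by blast
    qed
    show "?L \<subseteq> point ` (U - {\<zero>\<^bsub>S.W\<^esub>})"
    proof
      fix p assume "p \<in> ?L"
      then obtain l where l: "p = fibre_class A n t e i j (fibre_module A n t e i j (zeros l))"
        "l \<in> V_dual K A n e i j" "\<exists>v\<in>V i j. l v \<noteq> \<zero>\<^bsub>K\<^esub>"
        "coord_point K A n e i j l \<in> proj_space (D i) (S.W\<lparr>carrier := U\<rparr>)" by blast
      then have "p = point (hom_of l)" unfolding point_def functional_of_hom_of[OF l(2)] by simp
      then show "p \<in> point ` (U - {\<zero>\<^bsub>S.W\<^esub>})" using mem[OF l(2,3)] l(4) by blast
    qed
    show "point ` (U - {\<zero>\<^bsub>S.W\<^esub>}) \<subseteq> ?L"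
    proof
      fix p assume "p \<in> point ` (U - {\<zero>\<^bsub>S.W\<^esub>})"
      then obtain F where F: "F \<in> U" "F \<noteq> \<zero>\<^bsub>S.W\<^esub>" "p = point F" by blast
      have Fc: "F \<in> carrier S.W" using F Uc by blast
      have l: "functional_of F \<in> V_dual K A n e i j" "\<exists>v\<in>V i j. functional_of F v \<noteq> \<zero>\<^bsub>K\<^esub>"
        using functional_of_in_V_dual[OF Fc] functional_of_zero_iff[OF Fc] F(2) by auto
      have "coord_point K A n e i j (functional_of F) \<in> proj_space (D i) (S.W\<lparr>carrier := U\<rparr>)"
        unfolding mem[OF l] hom_of_functional_of[OF Fc] using F by blast
      then show "p \<in> ?L" unfolding F(3) point_def using l by blast
    qed
  qed
  then show ?thesis unfolding fibre_subspaces_def Let_def W_eq by (metis (no_types, lifting))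
qed

end

section \<open>Recovering the species\<close>

lemma ring_iso_opp: "\<phi> \<in> ring_iso R S \<Longrightarrow> \<phi> \<in> ring_iso (opp R) (opp S)"
  unfolding ring_iso_def ring_hom_def by auto

lemma alg_isomorphic_via:
  assumes "ring D" "ring D'" and c: "\<And>c x. c \<in> carrier K \<Longrightarrow> x \<in> carrier D' \<Longrightarrow> c \<odot>\<^bsub>D'\<^esub> x \<in> carrier D'"
    and "alg_isomorphic K D L" "alg_isomorphic K D' L"
  shows "alg_isomorphic K D D'"
proof -
  interpret D': ring D' by fact
  obtain \<psi> \<psi>' where \<psi>: "\<psi> \<in> ring_iso D L" "k_linear K D L \<psi>" and \<psi>': "\<psi>' \<in> ring_iso D' L" "k_linear K D' L \<psi>'"
    using assms unfolding alg_isomorphic_def by blast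
  let ?g = "inv_into (carrier D') \<psi>'"
  have b: "bij_betw \<psi>' (carrier D') (carrier L)" using \<psi>'(1) unfolding ring_iso_def by auto
  have residue_class: "\<psi> x \<in> carrier L" if "x \<in> carrier D" for x
    using \<psi>(1) that ring_hom_closed unfolding ring_iso_def by fastforce
  have "?g \<in> ring_iso L D'" using ring_iso_set_sym[OF assms(2) \<psi>'(1)] .
  then have "?g \<circ> \<psi> \<in> ring_iso D D'" using ring_iso_set_trans[OF \<psi>(1)] by blast
  moreover have "?g (\<psi> (c \<odot>\<^bsub>D\<^esub> x)) = c \<odot>\<^bsub>D'\<^esub> ?g (\<psi> x)" if cx: "c \<in> carrier K" "x \<in> carrier D" for c x
  proof -
    have y: "?g (\<psi> x) \<in> carrier D'" "\<psi>' (?g (\<psi> x)) = \<psi> x"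
      using b residue_class[OF cx(2)] by (auto simp: bij_betw_def inv_into_into f_inv_into_f)
    have "\<psi> (c \<odot>\<^bsub>D\<^esub> x) = c \<odot>\<^bsub>L\<^esub> \<psi> x" using \<psi>(2) cx unfolding k_linear_def by blast
    also have "\<dots> = \<psi>' (c \<odot>\<^bsub>D'\<^esub> ?g (\<psi> x))" using \<psi>'(2) cx(1) y unfolding k_linear_def by simp
    finally show ?thesis using b c[OF cx(1) y(1)] by (simp add: bij_betw_def)
  qed
  ultimately show ?thesis unfolding alg_isomorphic_def k_linear_def by (intro bexI[of _ "?g \<circ> \<psi>"]) auto
qed

locale two_algebras =
  A: basic_fd_algebra K A n t e + A': basic_fd_algebra K A' n t e'
  for K :: "'k ring" and n t :: nat
    and A :: "('k, 'a) module" and e :: "nat \<Rightarrow> 'a"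
    and A' :: "('k, 'b) module" and e' :: "nat \<Rightarrow> 'b" +
  assumes scalar: "\<And>i j. i \<in> {1..t} \<Longrightarrow> j \<in> {1..t} \<Longrightarrow> V_space A n e i j \<noteq> {\<zero>\<^bsub>A\<^esub>} \<Longrightarrow>
           alg_isomorphic K (residue_alg A e j) (self_alg K)"
    and scalar': "\<And>i j. i \<in> {1..t} \<Longrightarrow> j \<in> {1..t} \<Longrightarrow> V_space A' n e' i j \<noteq> {\<zero>\<^bsub>A'\<^esub>} \<Longrightarrow>
           alg_isomorphic K (residue_alg A' e' j) (self_alg K)"
    and fibres: "fibre_families_isomorphic K n t A e A' e'"
begin

abbreviation V' where "V' \<equiv> V_space A' n e'"
abbreviation D' where "D' \<equiv> residue_alg A' e'"

lemma V_nonzero_iff: "i \<in> {1..t} \<Longrightarrow> j \<in> {1..t} \<Longrightarrow> A.V i j \<noteq> {\<zero>\<^bsub>A\<^esub>} \<longleftrightarrow> V' i j \<noteq> {\<zero>\<^bsub>A'\<^esub>}"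
  using fibres unfolding fibre_families_isomorphic_def by blast

lemma fibre_collineation:
  assumes i: "i \<in> {1..t}" and j: "j \<in> {1..t}" and nz: "A.V i j \<noteq> {\<zero>\<^bsub>A\<^esub>}"
  shows "\<exists>\<rho>. collineation (A.D i) (coord_space K A n e i j) (D' i) (coord_space K A' n e' i j) \<rho>"
proof -
  have nz': "V' i j \<noteq> {\<zero>\<^bsub>A'\<^esub>}" using V_nonzero_iff[OF i j] nz by simp
  interpret F: scalar_fibre K A n t e i j
    using i j scalar[OF i j nz] by unfold_locales
  interpret F': scalar_fibre K A' n t e' i j
    using i j scalar'[OF i j nz'] by unfold_locales
  have "geometry_isomorphic (fibre A n t e i j) (fibre_subspaces K A n t e i j)
          (fibre A' n t e' i j) (fibre_subspaces K A' n t e' i j)"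
    using fibres i j nz unfolding fibre_families_isomorphic_def by blast
  then have "\<exists>\<rho>. collineation (A.D i) F.S.W (D' i) F'.S.W \<rho>"
    unfolding F.fibre_subspaces_eq F'.fibre_subspaces_eq
    using collineation_of_geometry_isomorphism[OF F.S.W.left_vector_space_axioms F'.S.W.left_vector_space_axioms
        F.point_eq_iff F'.point_eq_iff F.points_in_fibre] by blast
  then show ?thesis unfolding F.W_eq F'.W_eq .
qed

text \<open>
  The rank of \<open>V\<^sub>i\<^sub>j\<close> is the dimension of its coordinate space, which the geometry determines.
\<close>
lemma bases_same_card:
  assumes i: "i \<in> {1..t}" and j: "j \<in> {1..t}"
    and B: "is_basis (opp (A.D i)) (V_right A n e i j) B" and B': "is_basis (opp (D' i)) (V_right A' n e' i j) B'"
  shows "card B = card B'"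
proof (cases "A.V i j = {\<zero>\<^bsub>A\<^esub>}")
  case True
  interpret R: left_vector_space "opp (A.D i)" "V_right A n e i j" by (rule A.V_right_vector_space[OF i j])
  interpret R': left_vector_space "opp (D' i)" "V_right A' n e' i j" by (rule A'.V_right_vector_space[OF i j])
  have "V' i j = {\<zero>\<^bsub>A'\<^esub>}" using V_nonzero_iff[OF i j] True by simp
  then have "B' = {}" using B' R'.independent_nonzero[of B'] unfolding R'.is_basis_iff by auto
  moreover have "B = {}" using B True R.independent_nonzero[of B] unfolding R.is_basis_iff by auto
  ultimately show ?thesis by simp
next
  case False
  then obtain \<rho> where \<rho>: "collineation (A.D i) (coord_space K A n e i j) (D' i) (coord_space K A' n e' i j) \<rho>"
    using fibre_collineation[OF i j] by blast
  interpret collineation "A.D i" "coord_space K A n e i j" "D' i" "coord_space K A' n e' i j" \<rho> by (rule \<rho>)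
  obtain C where C: "is_basis (A.D i) (coord_space K A n e i j) C" "card C = card B"
    using dual_setup.hom_dual_basis[OF A.dual_setup_V[OF i j] B] unfolding A.coord_space_eq by blast
  obtain C' where C': "is_basis (D' i) (coord_space K A' n e' i j) C'" "card C' = card B'"
    using dual_setup.hom_dual_basis[OF A'.dual_setup_V[OF i j] B'] unfolding A'.coord_space_eq by blast
  obtain h where "inj_on h C" "is_basis (D' i) (coord_space K A' n e' i j) (h ` C)"
    using basis_image[OF C(1)] by blast
  then have "card C = card C'" using W'.basis_card_unique[OF _ C'(1)] card_image by metis
  then show ?thesis using C C' by simp
qed

lemma ring_iso_of_rank:
  assumes i: "i \<in> {1..t}" and j: "j \<in> {1..t}" and rank: "right_rank A n e i j \<ge> 3"
  shows "\<exists>\<phi>. \<phi> \<in> ring_iso (A.D i) (D' i)"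
proof -
  interpret R: left_vector_space "opp (A.D i)" "V_right A n e i j" by (rule A.V_right_vector_space[OF i j])
  obtain B where B: "is_basis (opp (A.D i)) (V_right A n e i j) B" using A.V_right_basis_exists[OF i j] by blast
  then have card: "card B \<ge> 3" using rank R.mod_dim_eq[OF B] unfolding right_rank_def by simp
  have nz: "A.V i j \<noteq> {\<zero>\<^bsub>A\<^esub>}"
  proof
    assume "A.V i j = {\<zero>\<^bsub>A\<^esub>}"
    then have "B = {}" using B R.independent_nonzero[of B] unfolding R.is_basis_iff by auto
    then show False using card by simp
  qed
  obtain \<rho> where \<rho>: "collineation (A.D i) (coord_space K A n e i j) (D' i) (coord_space K A' n e' i j) \<rho>"
    using fibre_collineation[OF i j nz] by blast
  obtain C where "is_basis (A.D i) (coord_space K A n e i j) C" "card C = card B"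
    using dual_setup.hom_dual_basis[OF A.dual_setup_V[OF i j] B] unfolding A.coord_space_eq by blast
  then show ?thesis using collineation.ring_iso_of_plane[OF \<rho>] card by simp
qed

lemma target_isomorphic:
  assumes i: "i \<in> {1..t}" and j: "j \<in> {1..t}" and nz: "A.V i j \<noteq> {\<zero>\<^bsub>A\<^esub>}"
  shows "alg_isomorphic K (A.D j) (D' j)"
proof -
  have nz': "V' i j \<noteq> {\<zero>\<^bsub>A'\<^esub>}" using V_nonzero_iff[OF i j] nz by simp
  interpret KD': left_vector_space K "D' j" by (rule A'.D_vector_space[OF j])
  show ?thesis
    by (rule alg_isomorphic_via[OF A.D_ring[OF j] A'.D_ring[OF j] KD'.smult_closed scalar[OF i j nz] scalar'[OF i j nz']])
qed

text \<open>
  At a target both residue algebras are \<open>k\<close>.  A source has a nonzero last layer, hence some fibre of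
  rank at least three, and the geometry of that fibre gives the isomorphism.
\<close>
lemma residue_rings_isomorphic:
  assumes rank: "\<And>i. i \<in> {1..t} \<Longrightarrow> last_layer A n e i \<noteq> {\<zero>\<^bsub>A\<^esub>} \<Longrightarrow> \<exists>j\<in>{1..t}. right_rank A n e i j \<ge> 3"
    and i: "i \<in> recovered A n t e"
  shows "\<exists>\<phi>. \<phi> \<in> ring_iso (A.D i) (D' i)"
proof -
  have it: "i \<in> {1..t}" using i unfolding recovered_def by simp
  obtain j where j: "j \<in> {1..t}" "A.V i j \<noteq> {\<zero>\<^bsub>A\<^esub>} \<or> A.V j i \<noteq> {\<zero>\<^bsub>A\<^esub>}" using i unfolding recovered_def by blast
  show ?thesis
  proof (cases "A.V j i \<noteq> {\<zero>\<^bsub>A\<^esub>}")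
    case True
    then show ?thesis using target_isomorphic[OF j(1) it] unfolding alg_isomorphic_def by blast
  next
    case False
    then obtain v where v: "v \<in> A.V i j" "v \<noteq> \<zero>\<^bsub>A\<^esub>" using j(2) A.V_closed(4)[OF it j(1)] by blast
    then have "v \<in> last_layer A n e i"
      unfolding A.last_layer_iff[OF it] using A.V_closed(2,3)[OF it j(1) v(1)] A.corner_fix(2) by blast
    then show ?thesis using rank[OF it] v(2) ring_iso_of_rank[OF it] by blast
  qed
qed

lemma recovered_eq: "recovered A n t e = recovered A' n t e'"
  unfolding recovered_def using V_nonzero_iff by blast

text \<open>
  The semilinear maps come from bases alone.  For the left actions, \<open>d \<in> D\<^sub>j\<close> is a scalar \<open>c \<in> k\<close>, and
  \<open>cv\<close> is also the right action of \<open>c \<in> D\<^sub>i\<close>, with which \<open>f\<close> is compatible if \<open>\<phi> i\<close> is \<open>k\<close>-linear.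
\<close>
lemma direct_match_of_ring_iso:
  assumes i: "i \<in> {1..t}" and iso: "\<phi> i \<in> ring_iso (A.D i) (D' i)"
    and lin: "\<And>h. alg_isomorphic K (A.D h) (D' h) \<Longrightarrow> \<phi> h \<in> ring_iso (A.D h) (D' h) \<and> k_linear K (A.D h) (D' h) (\<phi> h)"
  shows "direct_match K n t A e A' e' \<phi> i"
  unfolding direct_match_def Let_def
proof (intro conjI ballI impI iso)
  show "k_linear K (A.D i) (D' i) (\<phi> i)" if "alg_isomorphic K (A.D i) (D' i)" using lin[OF that] by simp
next
  fix j assume j: "j \<in> {1..t}"
  interpret R: left_vector_space "opp (A.D i)" "V_right A n e i j" by (rule A.V_right_vector_space[OF i j])
  interpret R': left_vector_space "opp (D' i)" "V_right A' n e' i j" by (rule A'.V_right_vector_space[OF i j])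
  interpret KDi: left_vector_space K "A.D i" by (rule A.D_vector_space[OF i])
  interpret KDj: left_vector_space K "A.D j" by (rule A.D_vector_space[OF j])
  interpret Di: ring "A.D i" by (rule A.D_ring[OF i])
  interpret Dj: ring "A.D j" by (rule A.D_ring[OF j])
  obtain B where B: "is_basis (opp (A.D i)) (V_right A n e i j) B" using A.V_right_basis_exists[OF i j] by blast
  obtain B' where B': "is_basis (opp (D' i)) (V_right A' n e' i j) B'" using A'.V_right_basis_exists[OF i j] by blast
  obtain f where f: "semilinear_iso (opp (A.D i)) (\<phi> i) (V_right A n e i j) (V_right A' n e' i j) f"
    using semilinear_iso_of_bases[OF R.left_module_axioms R'.left_module_axioms ring_iso_opp[OF iso] B B'
        bases_same_card[OF i j B B']] by blast
  have fV: "f v \<in> V' i j" if "v \<in> A.V i j" for v using f that bij_betwE unfolding semilinear_iso_def by fastforce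
  have fs: "f (X \<odot>\<^bsub>V_right A n e i j\<^esub> v) = \<phi> i X \<odot>\<^bsub>V_right A' n e' i j\<^esub> f v" if "X \<in> carrier (A.D i)" "v \<in> A.V i j" for X v
    using f that unfolding semilinear_iso_def by simp
  have left: "f (d \<odot>\<^bsub>V_left A n e i j\<^esub> v) = \<phi> j d \<odot>\<^bsub>V_left A' n e' i j\<^esub> f v"
    if nz: "A.V i j \<noteq> {\<zero>\<^bsub>A\<^esub>}" and k: "k_linear K (A.D i) (D' i) (\<phi> i)" and d: "d \<in> carrier (A.D j)" and v: "v \<in> A.V i j"
    for d v
  proof -
    obtain c where c: "c \<in> carrier K" "d = c \<odot>\<^bsub>A.D j\<^esub> \<one>\<^bsub>A.D j\<^esub>" "d = A.residue_class j (c \<odot>\<^bsub>A\<^esub> e j)"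
      using A.residue_scalars[OF j scalar[OF i j nz] d] by blast
    have "f (d \<odot>\<^bsub>V_left A n e i j\<^esub> v) = f ((c \<odot>\<^bsub>A.D i\<^esub> \<one>\<^bsub>A.D i\<^esub>) \<odot>\<^bsub>V_right A n e i j\<^esub> v)"
      using A.V_left_scalar[OF i j c(1) v] A.V_right_scalar[OF i j c(1) v] c(3) by simp
    also have "\<dots> = \<phi> i (c \<odot>\<^bsub>A.D i\<^esub> \<one>\<^bsub>A.D i\<^esub>) \<odot>\<^bsub>V_right A' n e' i j\<^esub> f v" using fs v c(1) by simp
    also have "\<phi> i (c \<odot>\<^bsub>A.D i\<^esub> \<one>\<^bsub>A.D i\<^esub>) = c \<odot>\<^bsub>D' i\<^esub> \<one>\<^bsub>D' i\<^esub>"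
      using k c(1) iso ring_hom_one[of "\<phi> i" "A.D i" "D' i"] unfolding k_linear_def ring_iso_def by simp
    also have "(c \<odot>\<^bsub>D' i\<^esub> \<one>\<^bsub>D' i\<^esub>) \<odot>\<^bsub>V_right A' n e' i j\<^esub> f v = c \<odot>\<^bsub>A'\<^esub> f v"
      by (rule A'.V_right_scalar[OF i j c(1) fV[OF v]])
    also have "\<dots> = A'.residue_class j (c \<odot>\<^bsub>A'\<^esub> e' j) \<odot>\<^bsub>V_left A' n e' i j\<^esub> f v"
      using A'.V_left_scalar[OF i j c(1) fV[OF v]] by simp
    also have "A'.residue_class j (c \<odot>\<^bsub>A'\<^esub> e' j) = \<phi> j d"
    proof -
      have \<phi>j: "\<phi> j \<in> ring_iso (A.D j) (D' j)" "k_linear K (A.D j) (D' j) (\<phi> j)"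
        using lin[OF target_isomorphic[OF i j nz]] by auto
      have "\<phi> j d = c \<odot>\<^bsub>D' j\<^esub> \<one>\<^bsub>D' j\<^esub>"
        unfolding c(2) using \<phi>j c(1) ring_hom_one[of "\<phi> j" "A.D j" "D' j"]
        unfolding k_linear_def ring_iso_def by simp
      then show ?thesis using A'.D_smult[OF j c(1) A'.corner_idem[OF j]] A'.D_one[OF j] by simp
    qed
    finally show ?thesis .
  qed
  show "\<exists>f. semilinear_iso (opp (A.D i)) (\<phi> i) (V_right A n e i j) (V_right A' n e' i j) f \<and>
        (A.V i j \<noteq> {\<zero>\<^bsub>A\<^esub>} \<and> k_linear K (A.D i) (D' i) (\<phi> i) \<longrightarrow>
           (\<forall>d\<in>carrier (A.D j). \<forall>v\<in>A.V i j.
              f (d \<odot>\<^bsub>V_left A n e i j\<^esub> v) = \<phi> j d \<odot>\<^bsub>V_left A' n e' i j\<^esub> f v))"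
    using f left by blast
qed

end

theorem theorem8p2:
  fixes K :: "'k ring" and n t :: nat
    and A :: "('k, 'a) module" and e :: "nat \<Rightarrow> 'a"
    and A' :: "('k, 'b) module" and e' :: "nat \<Rightarrow> 'b"
  assumes "basic_fd_algebra K A n t e"
    and "\<And>i j. i \<in> {1..t} \<Longrightarrow> j \<in> {1..t} \<Longrightarrow> V_space A n e i j \<noteq> {\<zero>\<^bsub>A\<^esub>} \<Longrightarrow>
           alg_isomorphic K (residue_alg A e j) (self_alg K)"
    and "\<And>i. i \<in> {1..t} \<Longrightarrow> last_layer A n e i \<noteq> {\<zero>\<^bsub>A\<^esub>} \<Longrightarrow> \<exists>j\<in>{1..t}. right_rank A n e i j \<ge> 3"
    and "basic_fd_algebra K A' n t e'"
    and "\<And>i j. i \<in> {1..t} \<Longrightarrow> j \<in> {1..t} \<Longrightarrow> V_space A' n e' i j \<noteq> {\<zero>\<^bsub>A'\<^esub>} \<Longrightarrow>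
           alg_isomorphic K (residue_alg A' e' j) (self_alg K)"
    and "\<And>i. i \<in> {1..t} \<Longrightarrow> last_layer A' n e' i \<noteq> {\<zero>\<^bsub>A'\<^esub>} \<Longrightarrow> \<exists>j\<in>{1..t}. right_rank A' n e' i j \<ge> 3"
    and "fibre_families_isomorphic K n t A e A' e'"
  shows "species_isomorphic_up_to_opposites K n t A e A' e'"
proof -
  interpret two_algebras K n t A e A' e'
    using assms(1,2,4,5,7) by (intro two_algebras.intro two_algebras_axioms.intro)
  \<comment> \<open>A \<open>k\<close>-linear isomorphism is chosen whenever there is one, as the targets need it.\<close>
  define good where "good i \<phi> \<longleftrightarrow> \<phi> \<in> ring_iso (residue_alg A e i) (residue_alg A' e' i) \<and>
    (alg_isomorphic K (residue_alg A e i) (residue_alg A' e' i) \<longrightarrow>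
       k_linear K (residue_alg A e i) (residue_alg A' e' i) \<phi>)" for i \<phi>
  define \<phi> where "\<phi> i = (SOME f. good i f)" for i
  have lin: "\<phi> h \<in> ring_iso (residue_alg A e h) (residue_alg A' e' h) \<and>
      k_linear K (residue_alg A e h) (residue_alg A' e' h) (\<phi> h)"
    if "alg_isomorphic K (residue_alg A e h) (residue_alg A' e' h)" for h
  proof -
    have "\<exists>f. good h f" using that unfolding good_def alg_isomorphic_def by blast
    then have "good h (\<phi> h)" unfolding \<phi>_def by (rule someI_ex)
    then show ?thesis using that unfolding good_def by blast
  qed
  have "direct_match K n t A e A' e' \<phi> i" if i: "i \<in> recovered A n t e" for i
  proof (rule direct_match_of_ring_iso)
    show "i \<in> {1..t}" using i unfolding recovered_def by simp
    show "\<phi> i \<in> ring_iso (residue_alg A e i) (residue_alg A' e' i)"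
    proof (cases "alg_isomorphic K (residue_alg A e i) (residue_alg A' e' i)")
      case True
      then show ?thesis using lin by blast
    next
      case False
      then have "\<exists>f. good i f" using residue_rings_isomorphic[OF assms(3) i] unfolding good_def by blast
      then have "good i (\<phi> i)" unfolding \<phi>_def by (rule someI_ex)
      then show ?thesis unfolding good_def by blast
    qed
  qed (rule lin)
  then show ?thesis unfolding species_isomorphic_up_to_opposites_def using recovered_eq by blast
qed

end
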